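(* Let $d\in\mathbb{N}$, $m\in\mathbb{N}_0$ and $p\in[1,\infty)$. Let $\rho,\pi$ be probability measures on $[-1,1]^d$ with $\mu$-densities $f_\rho,f_\pi$ satisfying Assumption (A) for some constants $0<M\le L<\infty$, $\boldsymbol\delta\in(0,\infty)^d$ and with $C_6=C_6(M,L)$, where $C_6(M,L),C_7(M,L)$ are the regularity constants described in the context. For $j\in\{1,\dots,d\}$ set $\varrho_j:=1+C_7\delta_j$; for $k\in\{1,\dots,d\}$ and $\varepsilon>0$ let $$\Lambda_{k,\varepsilon}:=\Big\{\boldsymbol\nu\in\mathbb{N}_0^k:\ \varrho_k^{-\max\{1,\nu_k\}}\prod_{j=1}^{k-1}\varrho_j^{-\nu_j}\ge\varepsilon\Big\},\quad N_\varepsilon:=\sum_{k=1}^d|\Lambda_{k,\varepsilon}|,\quad \beta:=\Big((d-1)!\prod_{j=1}^d\log(\varrho_j)\Big)^{1/d}.$$ Let $T$ be the Knothe--Rosenblatt transport from $\rho$ to $\pi$. Then for every $\tilde\beta<\beta$ there exists $C>0$, and for every $\varepsilon\in(0,1)$ there exist polynomials $p_{k,\varepsilon}\in\mathbb{P}_{\Lambda_{k,\varepsilon}}$, $k\in\{1,\dots,d\}$, such that with $$\tilde T_{k,\varepsilon}(\boldsymbol x):=-1+\frac{2}{c_{k,\varepsilon}(\boldsymbol x_{[k-1]})}\int_{-1}^{x_k}(1+p_{k,\varepsilon}(\boldsymbol x_{[k-1]},t))^2\,dt,\qquad c_{k,\varepsilon}(\boldsymbol x_{[k-1]}):=\int_{-1}^1(1+p_{k,\varepsilon}(\boldsymbol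 x_{[k-1]},t))^2\,dt,$$ the map $\tilde T_\varepsilon:=(\tilde T_{k,\varepsilon})_{k=1}^d:[-1,1]^d\to[-1,1]^d$ is a monotone triangular bijection, $\|T-\tilde T_\varepsilon\|_{W^{m,\infty}([-1,1]^d)}\le C\exp(-\tilde\beta N_\varepsilon^{1/d})$, and for each $\mathrm{dist}\in\{\mathrm{H},\mathrm{TV},\mathrm{KL},W_p\}$ $$\mathrm{dist}((\tilde T_\varepsilon)_\sharp\rho,\pi)\le C\exp(-\tilde\beta N_\varepsilon^{1/d}).$$
   Context: $\mu$ is the product measure $\bigotimes_j\lambda/2$ on $[-1,1]^k$ ($\lambda$ Lebesgue measure on $[-1,1]$). A probability density on $[-1,1]^d$ is a measurable positive function $f$ with $\int f\,d\mu=1$. $\boldsymbol x_{[k]}=(x_1,\dots,x_k)$. For $\delta>0$, $S\subseteq\mathbb{C}$: $\mathcal{B}_\delta(S)=\{z\in\mathbb{C}:\exists y\in S,|z-y|<\delta\}$; for $\boldsymbol\delta\in(0,\infty)^d$: $\mathcal{B}_{\boldsymbol\delta}(S)=\prod_i\mathcal{B}_{\delta_i}(S)$, $\mathcal{B}_{\boldsymbol\delta}=\prod_i\mathcal{B}_{\delta_i}(0)$. $C^1(O;B)$ for open $O\subseteq\mathbb{C}^n$ means holomorphic functions on $O$ with values in $B$; for a function given on $[-1,1]^n$ it means that a holomorphic extension (denoted by the same symbol) exists. Assumption (A) with constants $M,L,\boldsymbol\delta,C_6$: for $*\in\{\rho,\pi\}$: (a) $f_*:[-1,1]^d\to(0,\infty)$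 is a probability density and $f_*\in C^1(\mathcal{B}_{\boldsymbol\delta}([-1,1]);\mathbb{C})$; (b) $M\le|f_*(\boldsymbol x)|\le L$ for $\boldsymbol x\in\mathcal{B}_{\boldsymbol\delta}([-1,1])$; (c) $\sup_{\boldsymbol y\in\mathcal{B}_{\boldsymbol\delta}}|f_*(\boldsymbol x+\boldsymbol y)-f_*(\boldsymbol x)|\le C_6$ for $\boldsymbol x\in[-1,1]^d$; (d) $\sup_{\boldsymbol y\in\mathcal{B}_{\boldsymbol\delta_{[k]}}\times\{0\}^{d-k}}|f_*(\boldsymbol x+\boldsymbol y)-f_*(\boldsymbol x)|\le C_6\delta_{k+1}$ for $\boldsymbol x\in[-1,1]^d$, $k\in\{1,\dots,d-1\}$. Knothe--Rosenblatt transport: for a density $f$ put $\hat f_0:=1$, $\hat f_k(\boldsymbol x_{[k]}):=\int_{[-1,1]^{d-k}}f(\boldsymbol x_{[k]},\boldsymbol t)\,d\mu(\boldsymbol t)$, $f_k(\boldsymbol x_{[k]}):=\hat f_k(\boldsymbol x_{[k]})/\hat f_{k-1}(\boldsymbol x_{[k-1]})$; with $f=f_*$ put $F_{*;k}(\boldsymbol x_{[k]}):=\int_{-1}^{x_k}f_{*;k}(\boldsymbol x_{[k-1]},t)\,dt$. Then $T_1:=(F_{\pi;1})^{-1}\circ F_{\rho;1}$ and $T_k(\boldsymbol x_{[k-1]},\cdot):=F_{\pi;k}(T_1(x_1),\dots,T_{k-1}(\boldsymbol x_{[k-1]}),\cdot)^{-1}\circ F_{\rho;k}(\boldsymbol x_{[k-1]},\cdot)$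 (inverse in the last variable); $T=(T_k)_{k=1}^d$. Regularity constants: for $0<M\le L<\infty$, $C_6,C_7,C_8>0$ are constants depending only on $M,L$ such that, for all $d$ and $\boldsymbol\delta$, whenever $f_\rho,f_\pi$ satisfy Assumption (A) with $M,L,\boldsymbol\delta,C_6$, then with $\zeta_j=C_7\delta_j$ and $R_k=\partial_{x_k}T_k$, for all $k\in\{1,\dots,d\}$: $R_k\in C^1(\mathcal{B}_{\boldsymbol\zeta_{[k]}}([-1,1]);\mathcal{B}_{C_8}(1))$, $\Re R_k\ge1/C_8$ on $\mathcal{B}_{\boldsymbol\zeta_{[k]}}([-1,1])$, and if $k\ge2$, $R_k$ maps $\mathcal{B}_{\boldsymbol\zeta_{[k-1]}}([-1,1])\times[-1,1]$ to $\mathcal{B}_{C_8/\max\{1,\delta_k\}}(1)$. (Such constants exist; fix one choice.) $\mathbb{P}_\Lambda:=\operatorname{span}_{\mathbb{R}}\{\boldsymbol x^{\boldsymbol\nu}:\boldsymbol\nu\in\Lambda\}$, $\mathbb{P}_\emptyset=\{0\}$. A map $(T_j)_{j=1}^d$ on $[-1,1]^d$ is triangular if each $T_j$ depends only on $\boldsymbol x_{[j]}$, and monotone if $x_j\mapsto T_j(\boldsymbol x_{[j-1]},x_j)$ is monotonically increasing for all $\boldsymbol x_{[j-1]}$ and all $j$. $\|f\|_{W^{m,\infty}}=\sum_{j=0}^m\operatorname{ess\,sup}\|d^jf\|$ (weak derivatives, Euclidean norm); sum over components for vector-valued maps. $T_\sharp\rho(A)=\rho(T^{-1}(A))$. For probability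 measures $\nu_1,\nu_2\ll\mu$: $\mathrm{H}(\nu_1,\nu_2)=\big(\frac12\int(\sqrt{d\nu_1/d\mu}-\sqrt{d\nu_2/d\mu})^2d\mu\big)^{1/2}$; $\mathrm{TV}(\nu_1,\nu_2)=\sup_A|\nu_1(A)-\nu_2(A)|$; $\mathrm{KL}(\nu_1,\nu_2)=\mathrm{KL}(\nu_1\|\nu_2)=\int\log(d\nu_1/d\nu_2)\,d\nu_1$ if $\nu_1\ll\nu_2$, $\infty$ otherwise; $W_p(\nu_1,\nu_2)=\inf_\gamma(\int\|\boldsymbol x-\boldsymbol y\|^pd\gamma(\boldsymbol x,\boldsymbol y))^{1/p}$ over couplings $\gamma$ of $\nu_1,\nu_2$. *)

theory Defs
  imports "HOL-Probability.Probability" "HOL-Probability.Essential_Supremum"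
begin

text \<open>
  The dimension varies inside the statement, so vectors with coordinates in a finite index set
  \<open>I\<close> are functions on \<open>nat\<close> that are \<open>undefined\<close> outside \<open>I\<close>, i.e. elements of \<open>Pi\<^sub>E I _\<close>;
  a vector in dimension \<open>d\<close> has index set \<open>{1..d}\<close>.
\<close>

definition cube :: "nat \<Rightarrow> (nat \<Rightarrow> real) set" where
  "cube d = (\<Pi>\<^sub>E i\<in>{1..d}. {-1..1})"

definition open_cube :: "nat \<Rightarrow> (nat \<Rightarrow> real) set" where
  "open_cube d = (\<Pi>\<^sub>E i\<in>{1..d}. {-1<..<1})"

definition half_lebesgue :: "real measure" where
  "half_lebesgue = scale_measure (ennreal (1/2)) (restrict_space lborel {-1..1})"

definition cube_measure :: "nat set \<Rightarrow> (nat \<Rightarrow> real) measure" where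
  "cube_measure I = (\<Pi>\<^sub>M i\<in>I. half_lebesgue)"

definition prob_density :: "nat \<Rightarrow> ((nat \<Rightarrow> real) \<Rightarrow> real) \<Rightarrow> bool" where
  "prob_density d f \<longleftrightarrow>
     f \<in> borel_measurable (cube_measure {1..d}) \<and>
     (\<forall>x\<in>cube d. 0 < f x) \<and>
     (\<integral>\<^sup>+ x. ennreal (f x) \<partial>cube_measure {1..d}) = 1"

definition complex_nbhd :: "real \<Rightarrow> complex set \<Rightarrow> complex set" where
  "complex_nbhd r S = {z. \<exists>y\<in>S. cmod (z - y) < r}"

definition complex_interval :: "complex set" where
  "complex_interval = complex_of_real ` {-1..1}"

definition poly_nbhd :: "nat \<Rightarrow> (nat \<Rightarrow> real) \<Rightarrow> complex set \<Rightarrow> (nat \<Rightarrow> complex) set" where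
  "poly_nbhd n \<delta> S = (\<Pi>\<^sub>E i\<in>{1..n}. complex_nbhd (\<delta> i) S)"

definition complexify :: "nat \<Rightarrow> (nat \<Rightarrow> real) \<Rightarrow> nat \<Rightarrow> complex" where
  "complexify n x = (\<lambda>i\<in>{1..n}. complex_of_real (x i))"

definition vec_add :: "nat \<Rightarrow> (nat \<Rightarrow> complex) \<Rightarrow> (nat \<Rightarrow> complex) \<Rightarrow> nat \<Rightarrow> complex" where
  "vec_add n x y = (\<lambda>i\<in>{1..n}. x i + y i)"

text \<open>
  Complex Frechet differentiability at every point of the open set \<open>U\<close>; the \<open>a i\<close> are the
  coefficients of the complex-linear derivative.
\<close>

definition multi_holomorphic_on ::
    "nat \<Rightarrow> ((nat \<Rightarrow> complex) \<Rightarrow> complex) \<Rightarrow> (nat \<Rightarrow> complex) set \<Rightarrow> bool" where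
  "multi_holomorphic_on n f U \<longleftrightarrow>
     (\<forall>z\<in>U. \<exists>a :: nat \<Rightarrow> complex. \<forall>e>0. \<exists>r>0. \<forall>w\<in>U.
        L2_set (\<lambda>i. cmod (w i - z i)) {1..n} < r \<longrightarrow>
        cmod (f w - f z - (\<Sum>i=1..n. a i * (w i - z i)))
          \<le> e * L2_set (\<lambda>i. cmod (w i - z i)) {1..n})"

text \<open>
  The function \<open>g\<close> is the holomorphic extension of \<open>f\<close>; it is unique, since the cube is a totally
  real subset of full dimension in a connected domain.
\<close>

definition assumption_A ::
    "nat \<Rightarrow> real \<Rightarrow> real \<Rightarrow> (nat \<Rightarrow> real) \<Rightarrow> real \<Rightarrow> ((nat \<Rightarrow> real) \<Rightarrow> real) \<Rightarrow> bool" where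
  "assumption_A d M L \<delta> C6 f \<longleftrightarrow>
     prob_density d f \<and>
     (\<exists>g. multi_holomorphic_on d g (poly_nbhd d \<delta> complex_interval) \<and>
        (\<forall>x\<in>cube d. g (complexify d x) = complex_of_real (f x)) \<and>
        (\<forall>z\<in>poly_nbhd d \<delta> complex_interval. M \<le> cmod (g z) \<and> cmod (g z) \<le> L) \<and>
        (\<forall>x\<in>cube d. \<forall>y\<in>poly_nbhd d \<delta> {0}.
           cmod (g (vec_add d (complexify d x) y) - g (complexify d x)) \<le> C6) \<and>
        (\<forall>x\<in>cube d. \<forall>k\<in>{1..<d}.
           \<forall>y\<in>(\<Pi>\<^sub>E i\<in>{1..d}. if i \<le> k then complex_nbhd (\<delta> i) {0} else {0}).
           cmod (g (vec_add d (complexify d x) y) - g (complexify d x)) \<le> C6 * \<delta> (k + 1)))"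

definition marginal :: "nat \<Rightarrow> ((nat \<Rightarrow> real) \<Rightarrow> real) \<Rightarrow> nat \<Rightarrow> (nat \<Rightarrow> real) \<Rightarrow> real" where
  "marginal d f k x =
     (if k = 0 then 1
      else \<integral>t. f (merge {1..k} {k+1..d} (x, t)) \<partial>cube_measure {k+1..d})"

definition conditional :: "nat \<Rightarrow> ((nat \<Rightarrow> real) \<Rightarrow> real) \<Rightarrow> nat \<Rightarrow> (nat \<Rightarrow> real) \<Rightarrow> real" where
  "conditional d f k x = marginal d f k x / marginal d f (k - 1) x"

definition conditional_cdf :: "nat \<Rightarrow> ((nat \<Rightarrow> real) \<Rightarrow> real) \<Rightarrow> nat \<Rightarrow> (nat \<Rightarrow> real) \<Rightarrow> real" where
  "conditional_cdf d f k x = (LBINT t:{-1..x k}. conditional d f k (x(k := t)))"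

text \<open>
  \<open>kr_map d f\<^sub>\<rho> f\<^sub>\<pi> k x\<close> is the vector of the first \<open>k\<close> components of the transport; it only depends
  on the first \<open>k\<close> coordinates of \<open>x\<close>, and for \<open>k = d\<close> it is the whole transport.
\<close>

primrec kr_map ::
    "nat \<Rightarrow> ((nat \<Rightarrow> real) \<Rightarrow> real) \<Rightarrow> ((nat \<Rightarrow> real) \<Rightarrow> real) \<Rightarrow> nat \<Rightarrow> (nat \<Rightarrow> real) \<Rightarrow> nat \<Rightarrow> real" where
  "kr_map d f\<^sub>\<rho> f\<^sub>\<pi> 0 = (\<lambda>x i. undefined)"
| "kr_map d f\<^sub>\<rho> f\<^sub>\<pi> (Suc k) =
     (\<lambda>x. (kr_map d f\<^sub>\<rho> f\<^sub>\<pi> k x)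
        (Suc k := the_inv_into {-1..1}
           (\<lambda>t. conditional_cdf d f\<^sub>\<pi> (Suc k) ((kr_map d f\<^sub>\<rho> f\<^sub>\<pi> k x)(Suc k := t)))
           (conditional_cdf d f\<^sub>\<rho> (Suc k) x)))"

definition kr_comp ::
    "nat \<Rightarrow> ((nat \<Rightarrow> real) \<Rightarrow> real) \<Rightarrow> ((nat \<Rightarrow> real) \<Rightarrow> real) \<Rightarrow> nat \<Rightarrow> (nat \<Rightarrow> real) \<Rightarrow> real" where
  "kr_comp d f\<^sub>\<rho> f\<^sub>\<pi> k x = kr_map d f\<^sub>\<rho> f\<^sub>\<pi> k x k"

text \<open>
  \<open>r\<close> is the holomorphic extension of the partial derivative of the \<open>k\<close>-th component of the
  transport with respect to its last variable (one-sided at the end points).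
\<close>

definition regularity_constants :: "real \<Rightarrow> real \<Rightarrow> real \<Rightarrow> real \<Rightarrow> real \<Rightarrow> bool" where
  "regularity_constants M L C6 C7 C8 \<longleftrightarrow>
     0 < C6 \<and> 0 < C7 \<and> 0 < C8 \<and>
     (\<forall>d \<delta> f\<^sub>\<rho> f\<^sub>\<pi>.
        1 \<le> d \<longrightarrow> (\<forall>j\<in>{1..d}. 0 < \<delta> j) \<longrightarrow>
        assumption_A d M L \<delta> C6 f\<^sub>\<rho> \<longrightarrow> assumption_A d M L \<delta> C6 f\<^sub>\<pi> \<longrightarrow>
        (let \<zeta> = (\<lambda>j. C7 * \<delta> j) in
         \<forall>k\<in>{1..d}. \<exists>r.
           multi_holomorphic_on k r (poly_nbhd k \<zeta> complex_interval) \<and>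
           (\<forall>x\<in>cube k. \<exists>D.
              ((\<lambda>t. kr_comp d f\<^sub>\<rho> f\<^sub>\<pi> k (x(k := t))) has_real_derivative D)
                (at (x k) within {-1..1}) \<and>
              r (complexify k x) = complex_of_real D) \<and>
           r ` poly_nbhd k \<zeta> complex_interval \<subseteq> complex_nbhd C8 {1} \<and>
           (\<forall>z\<in>poly_nbhd k \<zeta> complex_interval. 1 / C8 \<le> Re (r z)) \<and>
           (2 \<le> k \<longrightarrow>
              r ` (\<Pi>\<^sub>E i\<in>{1..k}. if i < k then complex_nbhd (\<zeta> i) complex_interval
                                else complex_interval)
                \<subseteq> complex_nbhd (C8 / max 1 (\<delta> k)) {1})))"

definition poly_space :: "nat \<Rightarrow> (nat \<Rightarrow> nat) set \<Rightarrow> ((nat \<Rightarrow> real) \<Rightarrow> real) set" where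
  "poly_space k \<Lambda> =
     {\<lambda>x. \<Sum>\<nu>\<in>A. c \<nu> * (\<Prod>j=1..k. x j ^ \<nu> j) | A c. finite A \<and> A \<subseteq> \<Lambda>}"

definition index_set :: "(nat \<Rightarrow> real) \<Rightarrow> nat \<Rightarrow> real \<Rightarrow> (nat \<Rightarrow> nat) set" where
  "index_set \<xi> k \<epsilon> =
     {\<nu> \<in> (\<Pi>\<^sub>E j\<in>{1..k}. UNIV).
        \<xi> k powi (- int (max 1 (\<nu> k))) * (\<Prod>j=1..<k. \<xi> j powi (- int (\<nu> j))) \<ge> \<epsilon>}"

definition index_count :: "(nat \<Rightarrow> real) \<Rightarrow> nat \<Rightarrow> real \<Rightarrow> nat" where
  "index_count \<xi> d \<epsilon> = (\<Sum>k=1..d. card (index_set \<xi> k \<epsilon>))"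

definition rate :: "(nat \<Rightarrow> real) \<Rightarrow> nat \<Rightarrow> real" where
  "rate \<xi> d = (fact (d - 1) * (\<Prod>j=1..d. ln (\<xi> j))) powr (1 / real d)"

definition approx_comp :: "nat \<Rightarrow> ((nat \<Rightarrow> real) \<Rightarrow> real) \<Rightarrow> (nat \<Rightarrow> real) \<Rightarrow> real" where
  "approx_comp k p x =
     -1 + 2 / (LBINT t:{-1..1}. (1 + p (x(k := t)))\<^sup>2) * (LBINT t:{-1..x k}. (1 + p (x(k := t)))\<^sup>2)"

definition approx_map ::
    "nat \<Rightarrow> (nat \<Rightarrow> (nat \<Rightarrow> real) \<Rightarrow> real) \<Rightarrow> (nat \<Rightarrow> real) \<Rightarrow> nat \<Rightarrow> real" where
  "approx_map d p x = (\<lambda>k\<in>{1..d}. approx_comp k (p k) x)"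

definition triangular_map :: "nat \<Rightarrow> ((nat \<Rightarrow> real) \<Rightarrow> nat \<Rightarrow> real) \<Rightarrow> bool" where
  "triangular_map d S \<longleftrightarrow>
     (\<forall>j\<in>{1..d}. \<forall>x\<in>cube d. \<forall>y\<in>cube d. (\<forall>i\<in>{1..j}. x i = y i) \<longrightarrow> S x j = S y j)"

definition monotone_in_last :: "nat \<Rightarrow> ((nat \<Rightarrow> real) \<Rightarrow> nat \<Rightarrow> real) \<Rightarrow> bool" where
  "monotone_in_last d S \<longleftrightarrow>
     (\<forall>j\<in>{1..d}. \<forall>x\<in>cube d. mono_on {-1..1} (\<lambda>t. S (x(j := t)) j))"

definition partial_deriv :: "nat \<Rightarrow> ((nat \<Rightarrow> real) \<Rightarrow> real) \<Rightarrow> (nat \<Rightarrow> real) \<Rightarrow> real" where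
  "partial_deriv i \<phi> x = deriv (\<lambda>t. \<phi> (x(i := t))) (x i)"

primrec iter_deriv :: "nat list \<Rightarrow> ((nat \<Rightarrow> real) \<Rightarrow> real) \<Rightarrow> (nat \<Rightarrow> real) \<Rightarrow> real" where
  "iter_deriv [] \<phi> = \<phi>"
| "iter_deriv (i # is) \<phi> = partial_deriv i (iter_deriv is \<phi>)"

definition test_function :: "nat \<Rightarrow> ((nat \<Rightarrow> real) \<Rightarrow> real) \<Rightarrow> bool" where
  "test_function d \<phi> \<longleftrightarrow>
     (\<forall>is\<in>lists {1..d}.
        continuous_on (\<Pi>\<^sub>E i\<in>{1..d}. UNIV) (iter_deriv is \<phi>) \<and>
        (\<forall>x\<in>(\<Pi>\<^sub>E i\<in>{1..d}. UNIV). \<forall>i\<in>{1..d}.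
           (\<lambda>t. iter_deriv is \<phi> (x(i := t))) differentiable (at (x i)))) \<and>
     (\<exists>K. compact K \<and> K \<subseteq> open_cube d \<and> (\<forall>x\<in>(\<Pi>\<^sub>E i\<in>{1..d}. UNIV) - K. \<phi> x = 0))"

definition locally_integrable :: "nat \<Rightarrow> ((nat \<Rightarrow> real) \<Rightarrow> real) \<Rightarrow> bool" where
  "locally_integrable d f \<longleftrightarrow>
     (\<forall>K. compact K \<and> K \<subseteq> open_cube d \<longrightarrow> set_integrable (cube_measure {1..d}) K f)"

text \<open>
  \<open>cube_measure {1..d}\<close> is a constant multiple of Lebesgue measure on the cube; replacing one by the
  other affects neither the weak derivatives nor the essential suprema below.
\<close>

definition weak_deriv ::
    "nat \<Rightarrow> nat list \<Rightarrow> ((nat \<Rightarrow> real) \<Rightarrow> real) \<Rightarrow> ((nat \<Rightarrow> real) \<Rightarrow> real) \<Rightarrow> bool" where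
  "weak_deriv d is f g \<longleftrightarrow>
     locally_integrable d f \<and> locally_integrable d g \<and>
     g \<in> borel_measurable (cube_measure {1..d}) \<and>
     (\<forall>\<phi>. test_function d \<phi> \<longrightarrow>
        (\<integral>x. f x * iter_deriv is \<phi> x \<partial>cube_measure {1..d}) =
        (-1) ^ length is * (\<integral>x. g x * \<phi> x \<partial>cube_measure {1..d}))"

text \<open>
  The \<open>j\<close>-th derivative is the tensor with entries indexed by words of length \<open>j\<close> over \<open>{1..d}\<close>,
  measured in the Euclidean norm. Weak derivatives are unique almost everywhere, so the infimum is
  over a single value, or over the empty set (giving \<open>\<infinity>\<close>) if some weak derivative does not exist.
\<close>

definition words :: "nat \<Rightarrow> nat \<Rightarrow> nat list set" where
  "words d j = {is. set is \<subseteq> {1..d} \<and> length is = j}"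

definition sobolev_norm :: "nat \<Rightarrow> nat \<Rightarrow> ((nat \<Rightarrow> real) \<Rightarrow> real) \<Rightarrow> ereal" where
  "sobolev_norm d m f =
     Inf {\<Sum>j\<le>m. esssup (cube_measure {1..d}) (\<lambda>x. ereal (L2_set (\<lambda>is. D is x) (words d j))) | D.
          \<forall>j\<le>m. \<forall>is\<in>words d j. weak_deriv d is f (D is)}"

definition sobolev_norm_vec :: "nat \<Rightarrow> nat \<Rightarrow> ((nat \<Rightarrow> real) \<Rightarrow> nat \<Rightarrow> real) \<Rightarrow> ereal" where
  "sobolev_norm_vec d m S = (\<Sum>k=1..d. sobolev_norm d m (\<lambda>x. S x k))"

definition hellinger :: "'a measure \<Rightarrow> 'a measure \<Rightarrow> 'a measure \<Rightarrow> real" where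
  "hellinger \<mu> N1 N2 =
     sqrt (1/2 * (\<integral>x. (sqrt (enn2real (RN_deriv \<mu> N1 x)) - sqrt (enn2real (RN_deriv \<mu> N2 x)))\<^sup>2 \<partial>\<mu>))"

definition total_variation :: "'a measure \<Rightarrow> 'a measure \<Rightarrow> real" where
  "total_variation N1 N2 = (SUP A\<in>sets N1. \<bar>measure N1 A - measure N2 A\<bar>)"

text \<open>
  The negative part of the integrand is always integrable, hence a non-integrable log-density means
  that the divergence is \<open>\<infinity>\<close>. Note the argument order of \<open>absolutely_continuous\<close> and
  \<open>KL_divergence\<close>, which take the dominating measure first.
\<close>

definition kl_div :: "'a measure \<Rightarrow> 'a measure \<Rightarrow> ereal" where
  "kl_div N1 N2 =
     (if absolutely_continuous N2 N1 \<and> integrable N1 (entropy_density (exp 1) N2 N1)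
      then ereal (KL_divergence (exp 1) N2 N1) else \<infinity>)"

definition couplings :: "'a measure \<Rightarrow> 'a measure \<Rightarrow> ('a \<times> 'a) measure set" where
  "couplings N1 N2 =
     {\<gamma>. sets \<gamma> = sets (N1 \<Otimes>\<^sub>M N2) \<and> distr \<gamma> N1 fst = N1 \<and> distr \<gamma> N2 snd = N2}"

text \<open>
  For measures on the cube the cost is bounded, so the Bochner integral is the actual cost and the
  infimum over couplings is over a nonempty set bounded below.
\<close>

definition wasserstein :: "nat \<Rightarrow> real \<Rightarrow> (nat \<Rightarrow> real) measure \<Rightarrow> (nat \<Rightarrow> real) measure \<Rightarrow> real" where
  "wasserstein d p N1 N2 =
     (INF \<gamma>\<in>couplings N1 N2.
        (\<integral>z. L2_set (\<lambda>i. fst z i - snd z i) {1..d} powr p \<partial>\<gamma>) powr (1 / p))"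

end

theory Submission
  imports Defs "HOL-Complex_Analysis.Complex_Analysis"
begin

text \<open>
  The derivative \<open>R\<^sub>k\<close> of the \<open>k\<close>-th component of the transport in its last variable is holomorphic with
  positive real part near the cube, hence so is \<open>sqrt R\<^sub>k - 1\<close>. Integrating over ellipses in one variable
  after the other gives a Chebyshev expansion whose coefficient at \<open>\<nu>\<close> is \<open>O(\<Prod>\<^sub>j r\<^sub>j powr (- \<nu>\<^sub>j))\<close>. The
  neighbourhood of radius \<open>\<zeta>\<^sub>j\<close> contains ellipses with \<open>r\<^sub>j > 1 + \<zeta>\<^sub>j = \<xi>\<^sub>j\<close>, and the geometric gain makes the
  truncation to the index set of level \<open>\<epsilon>\<close> accurate to \<open>O(\<epsilon>)\<close>, uniformly on a smaller complex
  neighbourhood. Squaring, integrating and normalising keep the error \<open>O(\<epsilon>)\<close> there, and Cauchy estimates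
  turn it into a Sobolev bound on the cube. Both maps are triangular, so their Jacobians are products
  of the last-variable derivatives; by the change of variables formula the pushforward and the target
  have a density ratio within \<open>1 + O(\<epsilon>)\<close> and bounded away from 0, which controls all the distances but
  the Wasserstein one, for which the two maps themselves form a coupling. Finally, comparing lattice
  points with the volume of a simplex gives \<open>\<epsilon> = O(exp (- \<beta> N powr (1 / d)))\<close>.
\<close>

section \<open>Chebyshev expansions on complex neighbourhoods of the interval\<close>

text \<open>The square in the ansatz makes monotonicity automatic for every \<open>p\<close>, and
  the square root turns the search for \<open>p\<close> into the linear approximation of
  \<open>sqrt R - 1\<close>. Ellipses inside the neighbourhood of radius \<zeta> have semi-axis sums
  up to \<open>\<zeta> + sqrt (1 + \<zeta>^2)\<close>, strictly more than
  \<open>1 + \<zeta>\<close>. This surplus is spent twice: as a geometric factor that makes the sum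
  over all omitted indices converge, so that no factor counting indices enters the error, and as
  room to evaluate off the real cube, without which no Cauchy estimate is possible. Two features of
  the index sets matter: they are downward closed, so a Chebyshev sum over them is a monomial sum
  over them, and the exponent \<open>max 1 (\<nu> k)\<close> costs only one bounded factor
  \<open>\<xi> k\<close>. Since \<open>R_k\<close> integrates to 2 in its last variable, the
  transport is already the normalised antiderivative of \<open>R_k\<close>; it and its approximation
  are therefore two instances of one construction, and their difference is the perturbation of a
  quotient. All constants have to be fixed before \<epsilon>, which is why they are carried
  explicitly.\<close>

definition joukowski :: "complex \<Rightarrow> complex" where
  "joukowski w = (w + 1 / w) / 2"

text \<open>The Chebyshev polynomials of the first kind. They are kept as real polynomials because
  the truncated expansions must end up with real monomial coefficients.\<close>

fun cheb :: "nat \<Rightarrow> real poly" where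
  "cheb 0 = 1"
| "cheb (Suc 0) = [:0, 1:]"
| "cheb (Suc (Suc n)) = [:0, 2:] * cheb (Suc n) - cheb n"

text \<open>Summing up to \<open>n\<close> instead of the degree lets a product over coordinates
  expand over all multi-indices below \<nu>, as \<open>cheb_sum_monomials\<close> requires.\<close>

definition cheb_at :: "nat \<Rightarrow> complex \<Rightarrow> complex" where
  "cheb_at n z = (\<Sum>j\<le>n. of_real (coeff (cheb n) j) * z ^ j)"

lemma degree_cheb_le: "degree (cheb n) \<le> n"
proof (induction n rule: cheb.induct)
  case (3 n)
  have "degree ([:0, 2:] * cheb (Suc n)) \<le> Suc (Suc n)"
    using 3(1) degree_mult_le[of "[:0, 2:]" "cheb (Suc n)"] by simp
  moreover have "degree (cheb n) \<le> Suc (Suc n)" using 3(2) by simp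
  ultimately show ?case by (simp add: degree_diff_le del: mult_pCons_left)
qed auto

lemma cheb_at_poly: "cheb_at n z = poly (map_poly of_real (cheb n)) z"
proof -
  have "degree (map_poly of_real (cheb n) :: complex poly) \<le> n"
    using degree_cheb_le[of n] by (simp add: degree_map_poly)
  then have "poly (map_poly of_real (cheb n)) z
      = (\<Sum>j\<le>n. coeff (map_poly of_real (cheb n) :: complex poly) j * z ^ j)"
    unfolding poly_altdef by (intro sum.mono_neutral_left) (auto simp: coeff_eq_0)
  then show ?thesis by (simp add: cheb_at_def coeff_map_poly)
qed

lemma map_poly_of_real_mult:
  "map_poly of_real (p * q) = (map_poly of_real p * map_poly of_real q :: complex poly)"
  by (intro poly_eqI) (simp add: coeff_map_poly coeff_mult)

lemma cheb_at_rec: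
  "cheb_at 0 z = 1" "cheb_at (Suc 0) z = z"
  "cheb_at (Suc (Suc n)) z = 2 * z * cheb_at (Suc n) z - cheb_at n z"
proof -
  have *: "map_poly of_real (p - q) = (map_poly of_real p - map_poly of_real q :: complex poly)" for p q
    by (intro poly_eqI) (simp add: coeff_map_poly)
  show "cheb_at (Suc (Suc n)) z = 2 * z * cheb_at (Suc n) z - cheb_at n z"
    unfolding cheb_at_poly cheb.simps * map_poly_of_real_mult
    by (simp add: map_poly_pCons)
qed (simp_all add: cheb_at_poly map_poly_pCons)

text \<open>The complex form of \<open>T_n (cos t) = cos (n t)\<close>: both sides satisfy the
  three-term recurrence. It reduces the size of a Chebyshev polynomial on an ellipse to powers of
  \<open>cmod v\<close>.\<close>

lemma cheb_at_joukowski: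
  assumes "v \<noteq> 0"
  shows "cheb_at n (joukowski v) = (v ^ n + 1 / v ^ n) / 2"
proof (induction n rule: cheb.induct)
  case (3 n)
  show ?case unfolding cheb_at_rec 3 using assms
    by (simp add: joukowski_def field_simps power2_eq_square)
qed (auto simp: cheb_at_rec joukowski_def)

lemma norm_cheb_at_joukowski_le:
  assumes "1 \<le> cmod v" "cmod v \<le> s"
  shows "cmod (cheb_at n (joukowski v)) \<le> s ^ n"
proof -
  have v: "v \<noteq> 0" using assms(1) by auto
  have "cmod (v ^ n + 1 / v ^ n) \<le> cmod (v ^ n) + cmod (1 / v ^ n)" by (rule norm_triangle_ineq)
  also have "\<dots> \<le> s ^ n + s ^ n"
  proof (rule add_mono)
    show "cmod (v ^ n) \<le> s ^ n" using assms by (simp add: norm_power power_mono)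
    have "1 \<le> cmod v ^ n" using assms by simp
    then have "cmod (1 / v ^ n) \<le> 1" by (simp add: norm_divide norm_power divide_le_eq)
    also have "1 \<le> s ^ n" using assms by simp
    finally show "cmod (1 / v ^ n) \<le> s ^ n" .
  qed
  finally show ?thesis unfolding cheb_at_joukowski[OF v] by (simp add: norm_divide)
qed

lemma cheb_at_cnj: "cheb_at n (cnj z) = cnj (cheb_at n z)"
  by (simp add: cheb_at_def)

text \<open>The two solutions of \<open>v^2 - 2 z v + 1 = 0\<close> have product 1, so one of them
  has modulus at least 1.\<close>

lemma joukowski_surj:
  obtains v where "joukowski v = z" "1 \<le> cmod v"
proof -
  define s where "s = csqrt (z\<^sup>2 - 1)"
  have s: "s\<^sup>2 = z\<^sup>2 - 1" by (simp add: s_def)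
  define v u where "v = z + s" and "u = z - s"
  have uv: "v * u = 1" using s by (simp add: v_def u_def algebra_simps power2_eq_square)
  then have nz: "v \<noteq> 0" "u \<noteq> 0" by auto
  have inv: "1 / v = u" "1 / u = v" using uv nz by (auto simp: field_simps)
  have J: "joukowski v = z" "joukowski u = z"
    by (simp_all add: joukowski_def inv) (simp_all add: v_def u_def)
  have "cmod v * cmod u = 1" using uv by (metis norm_mult norm_one)
  then have "1 \<le> cmod v \<or> 1 \<le> cmod u"
    by (metis linorder_not_le mult_less_cancel_right2 mult_strict_mono norm_ge_zero
        less_eq_real_def mult.right_neutral not_less)
  then show thesis using that J by blast
qed

text \<open>The circle \<open>cmod v = r\<close> is thus mapped into the ellipse with foci -1 and 1
  whose semi-axes add up to \<open>r\<close>. After taking a square root of \<open>v\<close> both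
  focal distances are halves of squares, and the claim becomes the parallelogram law.\<close>

lemma joukowski_dist_sum:
  assumes "v \<noteq> 0"
  shows "cmod (joukowski v - 1) + cmod (joukowski v + 1) = cmod v + 1 / cmod v"
proof -
  define r where "r = csqrt v"
  have r: "r\<^sup>2 = v" "r \<noteq> 0" using assms by (auto simp: r_def)
  have 1: "joukowski v - 1 = (r - 1 / r)\<^sup>2 / 2" "joukowski v + 1 = (r + 1 / r)\<^sup>2 / 2"
    using r(2) by (simp_all add: joukowski_def r(1)[symmetric] field_simps power2_eq_square)
  have "cmod (r - 1 / r) ^ 2 + cmod (r + 1 / r) ^ 2 = 2 * (cmod r ^ 2 + cmod (1 / r) ^ 2)"
    unfolding cmod_power2 by (simp add: power2_eq_square algebra_simps)
  then show ?thesis unfolding 1 using r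
    by (simp add: norm_divide norm_power power_divide r(1)[symmetric])
qed

text \<open>A point within \<eta> of the interval has focal sum below \<open>2 + 2 \<eta>\<close>;
  the condition on \<eta> says exactly that this is at most \<open>s + 1 / s\<close>, the focal sum
  on the ellipse of parameter \<open>s\<close>.\<close>

lemma stadium_joukowski:
  assumes z: "z \<in> complex_nbhd \<eta> complex_interval" and s: "1 \<le> s" "2 * \<eta> \<le> (s - 1)\<^sup>2 / s"
  obtains v where "joukowski v = z" "1 \<le> cmod v" "cmod v \<le> s"
proof -
  obtain v where v: "joukowski v = z" "1 \<le> cmod v" by (rule joukowski_surj)
  obtain y :: real where y: "-1 \<le> y" "y \<le> 1" "cmod (z - of_real y) < \<eta>"
    using z by (auto simp: complex_nbhd_def complex_interval_def)
  have v0: "v \<noteq> 0" using v by auto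
  have "cmod (z - 1) \<le> cmod (z - of_real y) + cmod (of_real y - 1)"
    using norm_triangle_ineq[of "z - of_real y" "of_real y - 1"] by simp
  moreover have "cmod (of_real y - 1) = 1 - y"
    using y by (metis abs_of_nonpos diff_ge_0_iff_ge minus_diff_eq norm_of_real of_real_1 of_real_diff diff_le_0_iff_le)
  moreover have "cmod (z + 1) \<le> cmod (z - of_real y) + cmod (of_real y + 1)"
    using norm_triangle_ineq[of "z - of_real y" "of_real y + 1"] by simp
  moreover have "cmod (of_real y + 1) = 1 + y"
    using y by (metis abs_of_nonneg add.commute minus_le_iff norm_of_real of_real_1 of_real_add real_0_le_add_iff)
  ultimately have "cmod v + 1 / cmod v < 2 + 2 * \<eta>"
    using joukowski_dist_sum[OF v0] v y by simp
  also have "\<dots> \<le> s + 1 / s" using s by (simp add: field_simps power2_eq_square)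
  finally have lt: "cmod v + 1 / cmod v < s + 1 / s" .
  have "cmod v \<le> s"
  proof (rule ccontr)
    assume "\<not> cmod v \<le> s"
    then have c: "s < cmod v" by simp
    \<comment> \<open>This product is the numerator of the difference of \<open>r + 1 / r\<close> at
      \<open>cmod v\<close> and at \<open>s\<close>; its sign shows that \<open>r + 1 / r\<close>
      increases for \<open>r \<ge> 1\<close>.\<close>
    have "0 < (cmod v - s) * (cmod v * s - 1)"
      using c s by (intro mult_pos_pos) (auto, smt (verit) mult_le_cancel_left1 mult_less_cancel_right2)
    then have "0 < (cmod v - s) * (cmod v * s - 1) / (cmod v * s)"
      by (rule divide_pos_pos) (use c s in \<open>auto intro!: mult_pos_pos\<close>)
    also have "\<dots> = cmod v + 1 / cmod v - (s + 1 / s)" using v0 s by (simp add: field_simps)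
    finally show False using lt by simp
  qed
  then show thesis using that v by blast
qed

text \<open>The point is compared with the image of the unit vector \<open>u\<close> of the same
  argument, which lies in the interval. Their distance is at most the minor semi-axis
  \<open>(\<rho> - 1 / \<rho>) / 2\<close>.\<close>

lemma joukowski_in_stadium:
  assumes w: "cmod w = \<rho>" and "1 < \<rho>" "(\<rho> - 1 / \<rho>) / 2 < \<zeta>"
  shows "joukowski w \<in> complex_nbhd \<zeta> complex_interval"
proof -
  define u where "u = w / of_real \<rho>"
  have u: "cmod u = 1" using assms by (simp add: u_def norm_divide)
  then have u0: "u \<noteq> 0" by auto
  have wu: "w = of_real \<rho> * u" using assms by (simp add: u_def)
  have cu: "1 / u = cnj u" using u u0 complex_div_cnj[of 1 u] by simp
  have ju: "joukowski u = of_real (Re u)" unfolding joukowski_def cu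
    by (simp add: complex_add_cnj)
  have "\<bar>Re u\<bar> \<le> 1" using abs_Re_le_cmod[of u] u by simp
  then have m: "joukowski u \<in> complex_interval" unfolding ju complex_interval_def by (intro imageI) auto
  have "joukowski w - joukowski u = ((\<rho> - 1) / 2) *\<^sub>R (u - (1 / \<rho>) *\<^sub>R (1 / u))"
    unfolding wu joukowski_def scaleR_conv_of_real using u0 assms(2)
    by (simp add: field_simps)
  then have "cmod (joukowski w - joukowski u) = (\<rho> - 1) / 2 * cmod (u - (1 / \<rho>) *\<^sub>R (1 / u))"
    using assms(2) by simp
  also have "cmod (u - (1 / \<rho>) *\<^sub>R (1 / u)) \<le> cmod u + cmod ((1 / \<rho>) *\<^sub>R (1 / u))" by (rule norm_triangle_ineq4)
  also have "\<dots> = 1 + 1 / \<rho>" using u assms(2) by (simp add: norm_divide)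
  also have "(\<rho> - 1) / 2 * (1 + 1 / \<rho>) = (\<rho> - 1 / \<rho>) / 2" using assms(2) by (simp add: field_simps)
  finally have "cmod (joukowski w - joukowski u) < \<zeta>"
    using assms(2,3) by (simp add: mult_left_mono)
  then show ?thesis using m unfolding complex_nbhd_def by blast
qed

section \<open>Complex neighbourhoods of the real interval\<close>

lemma complex_nbhd_Union: "complex_nbhd r S = (\<Union>y\<in>S. ball y r)"
  by (auto simp: complex_nbhd_def dist_norm norm_minus_commute)

lemma open_complex_nbhd [simp]: "open (complex_nbhd r S)"
  unfolding complex_nbhd_Union by auto

lemma convex_complex_nbhd:
  assumes "convex S" shows "convex (complex_nbhd r S)"
proof -
  have "complex_nbhd r S = (\<Union>x\<in>S. \<Union>y\<in>ball 0 r. {x + y})"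
  proof (intro set_eqI iffI)
    fix z assume "z \<in> complex_nbhd r S"
    then obtain y where y: "y \<in> S" "cmod (z - y) < r" by (auto simp: complex_nbhd_def)
    then show "z \<in> (\<Union>x\<in>S. \<Union>y\<in>ball 0 r. {x + y})"
      by (intro UN_I[of y] UN_I[of "z - y"]) auto
  next
    fix z assume "z \<in> (\<Union>x\<in>S. \<Union>y\<in>ball 0 r. {x + y})"
    then obtain x y where "x \<in> S" "cmod y < r" "z = x + y" by auto
    then show "z \<in> complex_nbhd r S" unfolding complex_nbhd_def by (auto intro!: bexI[of _ x])
  qed
  then show ?thesis using convex_sums[OF assms convex_ball[of 0 r]] by simp
qed

lemma convex_complex_interval: "convex complex_interval"
  unfolding complex_interval_def
  by (intro convex_linear_image) (auto simp: linear_iff scaleR_conv_of_real)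

lemma interval_subset_nbhd: "0 < r \<Longrightarrow> complex_interval \<subseteq> complex_nbhd r complex_interval"
  by (force simp: complex_nbhd_def)

lemma complex_nbhd_mono: "r \<le> s \<Longrightarrow> complex_nbhd r S \<subseteq> complex_nbhd s S"
  by (force simp: complex_nbhd_def)

lemma cball_subset_nbhd:
  assumes "z \<in> complex_nbhd r S" "r + s \<le> t"
  shows "cball z s \<subseteq> complex_nbhd t S"
proof
  fix w assume w: "w \<in> cball z s"
  obtain y where y: "y \<in> S" "cmod (z - y) < r" using assms by (auto simp: complex_nbhd_def)
  have "cmod (w - y) \<le> cmod (w - z) + cmod (z - y)"
    using norm_triangle_ineq[of "w - z" "z - y"] by simp
  also have "\<dots> < t" using w y assms(2) by (simp add: dist_norm norm_minus_commute)
  finally show "w \<in> complex_nbhd t S" using y by (auto simp: complex_nbhd_def)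
qed

lemma cnj_complex_nbhd: "z \<in> complex_nbhd r complex_interval \<Longrightarrow> cnj z \<in> complex_nbhd r complex_interval"
proof -
  assume "z \<in> complex_nbhd r complex_interval"
  then obtain y :: real where y: "-1 \<le> y" "y \<le> 1" "cmod (z - of_real y) < r"
    by (auto simp: complex_nbhd_def complex_interval_def)
  have "cmod (cnj z - of_real y) = cmod (z - of_real y)"
    by (metis complex_cnj_complex_of_real complex_cnj_diff complex_mod_cnj)
  then show ?thesis using y unfolding complex_nbhd_def complex_interval_def by force
qed

text \<open>The Cauchy kernel with pole \<open>z\<close>, pulled back along the Joukowski map. The
  factors \<open>2 pi \<i>\<close> and \<open>w\<close> coming from the differential on the circle
  are absorbed, so Cauchy's formula becomes a plain mean over the unit interval.\<close>

definition joukowski_kernel :: "complex \<Rightarrow> complex \<Rightarrow> complex" where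
  "joukowski_kernel z w = (w - 1 / w) / (w + 1 / w - 2 * z)"

definition cheb_weight :: "nat \<Rightarrow> real" where
  "cheb_weight n = (if n = 0 then 1 else 2)"

text \<open>By partial fractions the kernel is \<open>1 / (1 - v/w) + 1 / (1 - 1/(v w)) - 1\<close>.
  The terms of the two geometric series combine to twice \<open>T_n / w^n\<close>, and the
  \<open>-1\<close> removes the doubling at \<open>n = 0\<close>, which is the origin of
  \<open>cheb_weight\<close> and of the condition \<open>1 \<le> N\<close>. The last two summands
  are the geometric tails.\<close>

lemma joukowski_kernel_expansion:
  assumes v: "1 \<le> cmod v" and vw: "cmod v < cmod w" and N: "1 \<le> N"
  shows "joukowski_kernel (joukowski v) w
    = (\<Sum>n<N. cheb_weight n * cheb_at n (joukowski v) / w ^ n)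
      + (v / w) ^ N / (1 - v / w) + (1 / (v * w)) ^ N / (1 - 1 / (v * w))"
proof -
  have nz: "v \<noteq> 0" "w \<noteq> 0" using assms by auto
  have ne: "v \<noteq> w" "v * w \<noteq> 1"
  proof -
    show "v \<noteq> w" using vw by auto
    have "1 * 1 < cmod v * cmod w" using v vw
      by (smt (verit) mult_less_cancel_left_pos mult_le_cancel_right1)
    then show "v * w \<noteq> 1" by (metis norm_mult norm_one less_irrefl mult_1)
  qed
  have "(\<Sum>n<N. cheb_weight n * cheb_at n (joukowski v) / w ^ n)
     = (\<Sum>n<N. (v / w) ^ n + (1 / (v * w)) ^ n - (if n = 0 then 1 else 0))"
    using nz by (intro sum.cong refl)
      (simp add: cheb_weight_def cheb_at_joukowski power_divide power_mult_distrib field_simps)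
  also have "\<dots> = (\<Sum>n<N. (v / w) ^ n) + (\<Sum>n<N. (1 / (v * w)) ^ n) - 1"
    using N by (simp add: sum.distrib sum_subtractf)
  also have "\<dots> = (1 - (v / w) ^ N) / (1 - v / w) + (1 - (1 / (v * w)) ^ N) / (1 - 1 / (v * w)) - 1"
    using ne nz by (subst (1 2) sum_gp_strict) (auto simp: field_simps)
  finally have 1: "(\<Sum>n<N. cheb_weight n * cheb_at n (joukowski v) / w ^ n)
      + (v / w) ^ N / (1 - v / w) + (1 / (v * w)) ^ N / (1 - 1 / (v * w))
    = 1 / (1 - v / w) + 1 / (1 - 1 / (v * w)) - 1"
    by (simp add: diff_divide_distrib)
  have 2: "1 / (1 - v / w) = w / (w - v)" "1 / (1 - 1 / (v * w)) = v * w / (v * w - 1)"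
    using nz by (simp_all add: field_simps)
  have 3: "w + 1 / w - 2 * joukowski v = (w - v) * (v * w - 1) / (v * w)"
    using nz by (simp add: joukowski_def field_simps)
  have "w - v \<noteq> 0" "v * w - 1 \<noteq> 0" using ne by auto
  then show ?thesis unfolding 1 2 joukowski_kernel_def 3 using nz
    by (simp add: divide_simps) (simp add: algebra_simps)
qed

text \<open>Both geometric ratios have modulus at most \<tau>, the second one because
  \<open>1 / cmod v \<le> cmod v\<close>.\<close>

lemma joukowski_kernel_tail:
  assumes v: "1 \<le> cmod v" "cmod v \<le> \<tau> * cmod w" and t: "0 \<le> \<tau>" "\<tau> < 1" and N: "1 \<le> N"
  shows "cmod (joukowski_kernel (joukowski v) w - (\<Sum>n<N. cheb_weight n * cheb_at n (joukowski v) / w ^ n))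
    \<le> 2 * \<tau> ^ N / (1 - \<tau>)"
proof -
  have w0: "0 < cmod w"
  proof (rule ccontr)
    assume "\<not> 0 < cmod w"
    then show False using v by simp
  qed
  have vw: "cmod v < cmod w" using v(2) t w0 by (smt (verit) mult_less_cancel_right2)
  have geo: "cmod (x ^ N / (1 - x)) \<le> \<tau> ^ N / (1 - \<tau>)" if "cmod x \<le> \<tau>" for x
  proof -
    have "1 - \<tau> \<le> cmod (1 - x)" using that norm_triangle_ineq2[of 1 x] by simp
    then show ?thesis unfolding norm_divide norm_power
      using that t by (intro frac_le power_mono) auto
  qed
  have a: "cmod (v / w) \<le> \<tau>" using v w0 by (simp add: norm_divide divide_le_eq)
  have "1 / cmod v \<le> cmod v" using v(1)
    by (smt (verit) divide_le_eq_1 zero_le_divide_1_iff)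
  then have "1 / cmod v / cmod w \<le> cmod v / cmod w" using w0 by (intro divide_right_mono) auto
  then have b: "cmod (1 / (v * w)) \<le> \<tau>" using a by (simp add: norm_divide norm_mult)
  show ?thesis unfolding joukowski_kernel_expansion[OF v(1) vw N]
    using norm_triangle_ineq[of "(v / w) ^ N / (1 - v / w)" "(1 / (v * w)) ^ N / (1 - 1 / (v * w))"]
      geo[OF a] geo[OF b] by (simp add: algebra_simps)
qed

text \<open>Gives the Chebyshev coefficients of the constant 1, from which
  \<open>cheb_expansion\<close> determines a winding number.\<close>

lemma integral_circle_power:
  assumes "0 < \<rho>"
  shows "integral {0..1} (\<lambda>t. 1 / circlepath 0 \<rho> t ^ n) = (if n = 0 then 1 else 0)"
proof (cases "n = 0")
  case False
  define c where "c = - (2 * of_real pi * \<i> * of_nat n)"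
  have c0: "c \<noteq> 0" using False by (simp add: c_def)
  have eq: "1 / circlepath 0 \<rho> t ^ n = exp (c * of_real t) / of_real \<rho> ^ n" for t
    unfolding circlepath
    by (simp add: power_mult_distrib exp_of_nat_mult[symmetric] c_def exp_minus field_simps)
  have "((\<lambda>t. exp (c * of_real t) / of_real \<rho> ^ n) has_integral
      (exp (c * of_real 1) / c / of_real \<rho> ^ n - exp (c * of_real 0) / c / of_real \<rho> ^ n)) {0..1}"
  proof (rule fundamental_theorem_of_calculus)
    fix t :: real
    have "((\<lambda>z. exp (c * z) / c / of_real \<rho> ^ n) has_field_derivative exp (c * of_real t) / of_real \<rho> ^ n)
      (at (of_real t))"
      using c0 assms by (auto intro!: derivative_eq_intros)
    then show "((\<lambda>t. exp (c * of_real t) / c / of_real \<rho> ^ n) has_vector_derivative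
       exp (c * of_real t) / of_real \<rho> ^ n) (at t within {0..1})"
      by (rule has_vector_derivative_real_field)
  qed simp
  moreover have "exp c = 1"
    unfolding c_def exp_minus by (simp add: exp_of_nat_mult mult.commute[of _ "of_nat n"] exp_two_pi_i')
  ultimately have "((\<lambda>t. exp (c * of_real t) / of_real \<rho> ^ n) has_integral 0) {0..1}" by simp
  from integral_unique[OF this] show ?thesis unfolding eq using False by simp
qed simp

text \<open>What remains of the n-th term of the kernel expansion after integration against
  \<open>F\<close>, apart from the factor \<open>T_n\<close>. The ellipse parameter \<rho> stays
  explicit so that the decay \<open>2 / \<rho> ^ n\<close> can be read off the integrand.\<close>

definition cheb_coeff :: "real \<Rightarrow> (complex \<Rightarrow> complex) \<Rightarrow> nat \<Rightarrow> complex" where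
  "cheb_coeff \<rho> F n =
     integral {0..1} (\<lambda>t. F (joukowski (circlepath 0 \<rho> t)) * (cheb_weight n / circlepath 0 \<rho> t ^ n))"

lemma circlepath_facts:
  assumes "0 < \<rho>"
  shows "cmod (circlepath 0 \<rho> t) = \<rho>" "circlepath 0 \<rho> t \<noteq> 0" "continuous_on S (circlepath 0 \<rho>)"
proof -
  show 1: "cmod (circlepath 0 \<rho> t) = \<rho>" using assms by (simp add: circlepath norm_mult)
  then show "circlepath 0 \<rho> t \<noteq> 0" using assms by auto
  show "continuous_on S (circlepath 0 \<rho>)" unfolding circlepath by (intro continuous_intros)
qed

lemma continuous_on_joukowski_circlepath:
  "0 < \<rho> \<Longrightarrow> continuous_on S (\<lambda>t. joukowski (circlepath 0 \<rho> t))"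
  unfolding joukowski_def by (intro continuous_intros circlepath_facts) (auto simp: circlepath_facts)

text \<open>Cauchy's formula along the image of the circle under the Joukowski map. The winding
  number of this ellipse is left as a factor; \<open>cheb_expansion\<close> finds its value.\<close>

lemma joukowski_cauchy_raw:
  assumes V: "convex V" "open V" and F: "F holomorphic_on V" and \<rho>: "0 < \<rho>"
    and path: "\<And>w. cmod w = \<rho> \<Longrightarrow> joukowski w \<in> V - {z}" and z: "z \<in> V"
  shows "((\<lambda>t. F (joukowski (circlepath 0 \<rho> t)) * joukowski_kernel z (circlepath 0 \<rho> t))
     has_integral winding_number (joukowski \<circ> circlepath 0 \<rho>) z * F z) {0..1}"
proof -
  let ?g = "joukowski \<circ> circlepath 0 \<rho>"
  have hol: "joukowski holomorphic_on (UNIV - {0})"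
    unfolding joukowski_def by (intro holomorphic_intros) auto
  have op: "open (UNIV - {0 :: complex})" by auto
  have vp: "valid_path ?g"
    by (rule valid_path_compose_holomorphic[OF _ hol op]) (use \<rho> in auto)
  have ci: "((\<lambda>w. F w / (w - z)) has_contour_integral (2*pi * \<i> * winding_number ?g z * F z)) ?g"
  proof (rule Cauchy_integral_formula_convex_simple[OF V(1) F _ vp])
    show "z \<in> interior V" using V z by (simp add: interior_open)
    show "path_image ?g \<subseteq> V - {z}"
    proof
      fix x assume "x \<in> path_image ?g"
      then obtain t where x: "x = joukowski (circlepath 0 \<rho> t)" by (auto simp: path_image_def)
      show "x \<in> V - {z}" unfolding x by (rule path) (simp add: circlepath_facts \<rho>)
    qed
    show "pathfinish ?g = pathstart ?g"
      by (simp add: pathfinish_compose pathstart_compose)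
  qed
  have vd: "vector_derivative ?g (at t within {0..1})
      = pi * \<i> * (circlepath 0 \<rho> t - 1 / circlepath 0 \<rho> t)" if t: "t \<in> {0..1}" for t
  proof -
    let ?w = "circlepath 0 \<rho> t"
    have w0: "?w \<noteq> 0" using \<rho> by (simp add: circlepath_facts)
    have 1: "(joukowski has_field_derivative (1 - 1 / ?w\<^sup>2) / 2) (at ?w)"
      unfolding joukowski_def[abs_def] using w0
      by (auto intro!: derivative_eq_intros simp: power2_eq_square)
    have 2: "(circlepath 0 \<rho> has_vector_derivative 2 * pi * \<i> * \<rho> * exp (2 * of_real pi * \<i> * t)) (at t within {0..1})"
      by (rule has_vector_derivative_circlepath)
    have "(?g has_vector_derivative (2 * pi * \<i> * \<rho> * exp (2 * of_real pi * \<i> * t)) * ((1 - 1 / ?w\<^sup>2) / 2)) (at t within {0..1})"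
      by (rule field_vector_diff_chain_within[OF 2 has_field_derivative_at_within[OF 1]])
    moreover have "(2 * pi * \<i> * \<rho> * exp (2 * of_real pi * \<i> * t)) = 2 * pi * \<i> * ?w"
      by (simp add: circlepath)
    moreover have "2 * pi * \<i> * ?w * ((1 - 1 / ?w\<^sup>2) / 2) = pi * \<i> * (?w - 1 / ?w)"
      using w0 by (simp add: field_simps power2_eq_square)
    ultimately have "(?g has_vector_derivative (pi * \<i> * (?w - 1 / ?w))) (at t within {0..1})"
      by metis
    then show ?thesis using t
      by (intro vector_derivative_within_closed_interval) auto
  qed
  have "((\<lambda>t. (1 / (2 * pi * \<i>)) * (F (?g t) / (?g t - z) * vector_derivative ?g (at t within {0..1})))
      has_integral (1 / (2 * pi * \<i>)) * (2*pi * \<i> * winding_number ?g z * F z)) {0..1}"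
    using ci unfolding has_contour_integral_def by (intro has_integral_mult_right)
  then have "((\<lambda>t. (1 / (2 * pi * \<i>)) * (F (?g t) / (?g t - z) * vector_derivative ?g (at t within {0..1})))
      has_integral winding_number ?g z * F z) {0..1}" by simp
  then show ?thesis
  proof (rule has_integral_eq[rotated])
    fix t :: real assume t: "t \<in> {0..1}"
    let ?w = "circlepath 0 \<rho> t"
    have w0: "?w \<noteq> 0" using \<rho> by (simp add: circlepath_facts)
    have gz: "joukowski ?w \<noteq> z" using path[of ?w] \<rho> by (auto simp: circlepath_facts)
    have k: "joukowski_kernel z ?w = (?w - 1 / ?w) / (2 * (joukowski ?w - z))"
      unfolding joukowski_kernel_def by (simp add: joukowski_def)
    show "(1 / (2 * pi * \<i>)) * (F (?g t) / (?g t - z) * vector_derivative ?g (at t within {0..1}))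
       = F (joukowski ?w) * joukowski_kernel z ?w"
      unfolding vd[OF t] k comp_apply using gz w0 by (simp add: divide_simps) (simp add: algebra_simps)
  qed
qed

text \<open>Two different preimages of one point are reciprocal to each other, so they cannot both
  lie on or outside the unit circle with different moduli.\<close>

lemma joukowski_inj_outside:
  assumes "joukowski v = joukowski w" "1 \<le> cmod v" "cmod v < cmod w"
  shows False
proof -
  have nz: "v \<noteq> 0" "w \<noteq> 0" using assms by auto
  have "(w - v) * (v * w - 1) = 2 * v * w * (joukowski w - joukowski v)"
    using nz by (simp add: joukowski_def field_simps)
  then have "w = v \<or> v * w = 1" using assms(1) by auto
  moreover have "1 * 1 < cmod v * cmod w" using assms
    by (smt (verit) mult_less_cancel_left_pos mult_le_cancel_right1)
  ultimately show False using assms(3) by (metis norm_mult norm_one less_irrefl mult_1)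
qed

lemma cheb_coeff_integrable:
  assumes F: "continuous_on V F" and \<rho>: "0 < \<rho>"
    and path: "\<And>w. cmod w = \<rho> \<Longrightarrow> joukowski w \<in> V"
  shows "(\<lambda>t. F (joukowski (circlepath 0 \<rho> t)) * (c / circlepath 0 \<rho> t ^ n)) integrable_on {0..1}"
  by (intro integrable_continuous_interval continuous_intros circlepath_facts \<rho>
      continuous_on_compose2[OF F continuous_on_joukowski_circlepath[OF \<rho>]])
     (auto simp: circlepath_facts \<rho> path)

lemma norm_cheb_coeff_le:
  assumes F: "continuous_on V F" and \<rho>: "0 < \<rho>" and path: "\<And>w. cmod w = \<rho> \<Longrightarrow> joukowski w \<in> V"
    and B: "\<And>u. u \<in> V \<Longrightarrow> cmod (F u) \<le> B"
  shows "cmod (cheb_coeff \<rho> F n) \<le> B * (2 / \<rho> ^ n)"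
proof -
  let ?f = "\<lambda>t. F (joukowski (circlepath 0 \<rho> t)) * (cheb_weight n / circlepath 0 \<rho> t ^ n)"
  have "norm (integral {0..1} ?f) \<le> integral {0..1} (\<lambda>t::real. B * (2 / \<rho> ^ n))"
  proof (rule Henstock_Kurzweil_Integration.integral_norm_bound_integral)
    show "?f integrable_on {0..1}" using cheb_coeff_integrable[OF F \<rho> path] .
    fix t :: real
    have "cmod (cheb_weight n / circlepath 0 \<rho> t ^ n) \<le> 2 / \<rho> ^ n"
      using \<rho> by (simp add: norm_divide norm_power circlepath_facts cheb_weight_def divide_right_mono)
    moreover have "cmod (F (joukowski (circlepath 0 \<rho> t))) \<le> B"
      using B path \<rho> by (simp add: circlepath_facts)
    ultimately show "cmod (?f t) \<le> B * (2 / \<rho> ^ n)"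
      unfolding norm_mult by (smt (verit) mult_mono norm_ge_zero)
  qed auto
  then show ?thesis by (simp add: cheb_coeff_def)
qed

text \<open>Stated for an arbitrary value \<open>I\<close> of the integral, because it is applied
  once to the constant 1, with the unknown winding number as \<open>I\<close>, and once to the
  function of interest.\<close>

lemma joukowski_kernel_integral_bound:
  assumes F: "continuous_on V F" and \<rho>: "0 < \<rho>" and path: "\<And>w. cmod w = \<rho> \<Longrightarrow> joukowski w \<in> V"
    and B: "\<And>u. u \<in> V \<Longrightarrow> cmod (F u) \<le> B"
    and v: "1 \<le> cmod v" "cmod v \<le> \<tau> * \<rho>" and t: "0 \<le> \<tau>" "\<tau> < 1" and N: "1 \<le> N"
    and I: "((\<lambda>t. F (joukowski (circlepath 0 \<rho> t)) * joukowski_kernel (joukowski v) (circlepath 0 \<rho> t))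
       has_integral I) {0..1}"
  shows "cmod (I - (\<Sum>n<N. cheb_coeff \<rho> F n * cheb_at n (joukowski v))) \<le> B * (2 * \<tau> ^ N / (1 - \<tau>))"
proof -
  let ?w = "circlepath 0 \<rho>" and ?z = "joukowski v"
  let ?f = "\<lambda>n t. F (joukowski (?w t)) * (cheb_weight n / ?w t ^ n)"
  have "((\<lambda>t. \<Sum>n<N. ?f n t * cheb_at n ?z) has_integral (\<Sum>n<N. cheb_coeff \<rho> F n * cheb_at n ?z)) {0..1}"
  proof (rule has_integral_sum)
    fix n
    have "(?f n has_integral cheb_coeff \<rho> F n) {0..1}"
      using cheb_coeff_integrable[OF F \<rho> path] unfolding cheb_coeff_def by (simp add: has_integral_integral)
    then show "((\<lambda>t. ?f n t * cheb_at n ?z) has_integral cheb_coeff \<rho> F n * cheb_at n ?z) {0..1}"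
      by (rule has_integral_mult_left)
  qed simp
  from has_integral_diff[OF I this]
  have d: "((\<lambda>t. F (joukowski (?w t)) * joukowski_kernel ?z (?w t) - (\<Sum>n<N. ?f n t * cheb_at n ?z))
     has_integral (I - (\<Sum>n<N. cheb_coeff \<rho> F n * cheb_at n ?z))) {0..1}" .
  have "norm (I - (\<Sum>n<N. cheb_coeff \<rho> F n * cheb_at n ?z))
     \<le> B * (2 * \<tau> ^ N / (1 - \<tau>)) * measure lborel {0..1::real}"
  proof (rule has_integral_bound_real[OF _ finite.emptyI d])
    have "0 \<le> B" using B[OF path, of "of_real \<rho>"] \<rho> by (smt (verit) norm_ge_zero norm_of_real)
    then show B0: "0 \<le> B * (2 * \<tau> ^ N / (1 - \<tau>))" using t by simp
    fix t :: real
    have w: "cmod (?w t) = \<rho>" using \<rho> by (simp add: circlepath_facts)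
    have "F (joukowski (?w t)) * joukowski_kernel ?z (?w t) - (\<Sum>n<N. ?f n t * cheb_at n ?z)
      = F (joukowski (?w t)) * (joukowski_kernel ?z (?w t) - (\<Sum>n<N. cheb_weight n * cheb_at n ?z / ?w t ^ n))"
      by (simp add: right_diff_distrib sum_distrib_left mult_ac)
    also have "cmod \<dots> \<le> B * (2 * \<tau> ^ N / (1 - \<tau>))"
      unfolding norm_mult
    proof (rule mult_mono[OF _ _ \<open>0 \<le> B\<close>])
      show "cmod (F (joukowski (?w t))) \<le> B" using B path w by simp
      show "cmod (joukowski_kernel ?z (?w t) - (\<Sum>n<N. cheb_weight n * cheb_at n ?z / ?w t ^ n)) \<le> 2 * \<tau> ^ N / (1 - \<tau>)"
        by (rule joukowski_kernel_tail) (use v w t N in auto)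
    qed simp
    finally show "cmod (F (joukowski (?w t)) * joukowski_kernel ?z (?w t) - (\<Sum>n<N. ?f n t * cheb_at n ?z)) \<le> \<dots>" .
  qed
  then show ?thesis by simp
qed

text \<open>For the constant 1 the partial sums are all equal to 1, so the remainder bound forces
  the distance of the winding number from 1 below a multiple of \<open>\<tau> ^ M\<close> for every
  \<open>M\<close>. Hence it equals 1 without any topological argument, and the same remainder bound
  applied to \<open>F\<close> is the claim.\<close>

theorem cheb_expansion:
  assumes V: "convex V" "open V" and F: "F holomorphic_on V" and \<rho>: "0 < \<rho>"
    and path: "\<And>w. cmod w = \<rho> \<Longrightarrow> joukowski w \<in> V" and z: "joukowski v \<in> V"
    and B: "\<And>u. u \<in> V \<Longrightarrow> cmod (F u) \<le> B"
    and v: "1 \<le> cmod v" "cmod v \<le> \<tau> * \<rho>" and t: "0 \<le> \<tau>" "\<tau> < 1" and N: "1 \<le> N"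
  shows "cmod (F (joukowski v) - (\<Sum>n<N. cheb_coeff \<rho> F n * cheb_at n (joukowski v)))
    \<le> B * (2 * \<tau> ^ N / (1 - \<tau>))"
proof -
  let ?z = "joukowski v" and ?g = "joukowski \<circ> circlepath 0 \<rho>"
  have v\<rho>: "cmod v < \<rho>" using v t \<rho> by (smt (verit) mult_less_cancel_right2)
  have path': "joukowski w \<in> V - {?z}" if "cmod w = \<rho>" for w
    using path[OF that] joukowski_inj_outside[of v w] that v v\<rho> by auto
  let ?W = "winding_number ?g ?z"
  have one: "((\<lambda>t. (\<lambda>_. 1) (joukowski (circlepath 0 \<rho> t)) * joukowski_kernel ?z (circlepath 0 \<rho> t))
     has_integral ?W * (\<lambda>_. 1) ?z) {0..1}"
    by (rule joukowski_cauchy_raw[OF V _ \<rho> path' z]) auto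
  have coeff1: "cheb_coeff \<rho> (\<lambda>_. 1) n = (if n = 0 then 1 else 0)" for n
  proof -
    have "cheb_coeff \<rho> (\<lambda>_. 1) n = integral {0..1} (\<lambda>t. cheb_weight n * (1 / circlepath 0 \<rho> t ^ n))"
      unfolding cheb_coeff_def by simp
    also have "\<dots> = cheb_weight n * integral {0..1} (\<lambda>t. 1 / circlepath 0 \<rho> t ^ n)"
      by (rule integral_mult_right)
    finally show ?thesis unfolding integral_circle_power[OF \<rho>] by (auto simp: cheb_weight_def)
  qed
  have le: "cmod (?W - 1) \<le> 1 * (2 * \<tau> ^ M / (1 - \<tau>))" if M: "1 \<le> M" for M
  proof -
    have "cmod (?W * (\<lambda>_. 1) ?z - (\<Sum>n<M. cheb_coeff \<rho> (\<lambda>_. 1) n * cheb_at n ?z))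
      \<le> 1 * (2 * \<tau> ^ M / (1 - \<tau>))"
      by (rule joukowski_kernel_integral_bound[OF _ \<rho> path _ v t M one]) auto
    moreover have "(\<Sum>n<M. cheb_coeff \<rho> (\<lambda>_. 1) n * cheb_at n ?z) = 1"
      using M by (simp add: coeff1 if_distrib[of "\<lambda>x. x * _"] cheb_at_rec(1) sum.delta cong: if_cong)
    ultimately show ?thesis by simp
  qed
  have "(\<lambda>M. 1 * (2 * \<tau> ^ M / (1 - \<tau>))) \<longlonglongrightarrow> 1 * (2 * 0 / (1 - \<tau>))"
    by (intro tendsto_intros LIMSEQ_realpow_zero t) (use t in auto)
  then have "cmod (?W - 1) \<le> 0"
    by (intro Lim_bounded2[where N=1]) (use le in auto)
  then have W: "?W = 1" by simp
  have "((\<lambda>t. F (joukowski (circlepath 0 \<rho> t)) * joukowski_kernel ?z (circlepath 0 \<rho> t))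
     has_integral ?W * F ?z) {0..1}"
    by (rule joukowski_cauchy_raw[OF V F \<rho> path' z])
  then have "((\<lambda>t. F (joukowski (circlepath 0 \<rho> t)) * joukowski_kernel ?z (circlepath 0 \<rho> t))
     has_integral F ?z) {0..1}" unfolding W by simp
  from joukowski_kernel_integral_bound[OF holomorphic_on_imp_continuous_on[OF F] \<rho> path B v t N this]
  show ?thesis .
qed

section \<open>Holomorphic functions on boxes\<close>

text \<open>
  Joint continuity together with holomorphy in each variable is stable under parametric integrals
  and needs no multivariate derivative. The coordinates outside \<open>I\<close> are unconstrained, which allows
  one to regard a function of fewer variables as a function of more variables.
\<close>

definition hol_on_box :: "nat set \<Rightarrow> (nat \<Rightarrow> complex set) \<Rightarrow> ((nat \<Rightarrow> complex) \<Rightarrow> complex) \<Rightarrow> bool" where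
  "hol_on_box I V F \<longleftrightarrow> continuous_on (Pi I V) F \<and>
     (\<forall>z\<in>Pi I V. \<forall>i\<in>I. (\<lambda>u. F (z(i := u))) holomorphic_on V i)"

section \<open>Closure properties of holomorphy on boxes\<close>

lemma hol_on_box_cont: "hol_on_box I V F \<Longrightarrow> continuous_on (Pi I V) F"
  by (simp add: hol_on_box_def)

lemma hol_on_box_hol:
  "hol_on_box I V F \<Longrightarrow> z \<in> Pi I V \<Longrightarrow> i \<in> I \<Longrightarrow> (\<lambda>u. F (z(i := u))) holomorphic_on V i"
  by (simp add: hol_on_box_def)

lemma fun_upd_in_Pi: "z \<in> Pi I V \<Longrightarrow> u \<in> V i \<Longrightarrow> z(i := u) \<in> Pi I V"
  by auto

lemma continuous_on_fun_upd [continuous_intros]: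
  fixes f :: "'a::topological_space \<Rightarrow> nat \<Rightarrow> 'b::topological_space"
  assumes "continuous_on S f" "continuous_on S g"
  shows "continuous_on S (\<lambda>x. (f x)(i := g x))"
proof (rule continuous_on_coordinatewise_then_product)
  fix j
  show "continuous_on S (\<lambda>x. ((f x)(i := g x)) j)"
    using assms continuous_on_product_coordinates by (cases "j = i") (auto intro: continuous_on_product_then_coordinatewise)
qed

lemma continuous_on_coord [continuous_intros]:
  "continuous_on S (\<lambda>x :: nat \<Rightarrow> 'b::topological_space. x i)"
  by (rule continuous_on_product_then_coordinatewise) (rule continuous_on_id)

lemma continuous_on_fst_coord [continuous_intros]:
  "continuous_on T (\<lambda>x :: (nat \<Rightarrow> 'b::topological_space) \<times> 'c::topological_space. fst x i)"
  by (rule continuous_on_product_then_coordinatewise) (intro continuous_intros)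

lemma hol_on_box_const: "hol_on_box I V (\<lambda>z. c)"
  by (simp add: hol_on_box_def)

lemma hol_on_box_coord: "hol_on_box I V (\<lambda>z. z k)"
proof -
  have "(\<lambda>u. (z(i := u)) k) holomorphic_on S" for z :: "nat \<Rightarrow> complex" and i S
    by (cases "i = k") auto
  then show ?thesis unfolding hol_on_box_def by (auto intro!: continuous_intros)
qed

lemma hol_on_box_add: "hol_on_box I V F \<Longrightarrow> hol_on_box I V G \<Longrightarrow> hol_on_box I V (\<lambda>z. F z + G z)"
  and hol_on_box_diff: "hol_on_box I V F \<Longrightarrow> hol_on_box I V G \<Longrightarrow> hol_on_box I V (\<lambda>z. F z - G z)"
  and hol_on_box_mult: "hol_on_box I V F \<Longrightarrow> hol_on_box I V G \<Longrightarrow> hol_on_box I V (\<lambda>z. F z * G z)"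
  unfolding hol_on_box_def by (auto intro!: continuous_intros holomorphic_intros)

lemma hol_on_box_divide:
  assumes "hol_on_box I V F" "hol_on_box I V G" "\<And>z. z \<in> Pi I V \<Longrightarrow> G z \<noteq> 0"
  shows "hol_on_box I V (\<lambda>z. F z / G z)"
  unfolding hol_on_box_def
proof (intro conjI ballI)
  show "continuous_on (Pi I V) (\<lambda>z. F z / G z)"
    using assms by (intro continuous_intros) (auto simp: hol_on_box_def)
  fix z i assume z: "z \<in> Pi I V" "i \<in> I"
  have "G (z(i := u)) \<noteq> 0" if "u \<in> V i" for u using assms(3) fun_upd_in_Pi[OF z(1) that] by blast
  then show "(\<lambda>u. F (z(i := u)) / G (z(i := u))) holomorphic_on V i"
    using assms z by (intro holomorphic_on_divide) (auto simp: hol_on_box_def)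
qed

lemma hol_on_box_power: "hol_on_box I V F \<Longrightarrow> hol_on_box I V (\<lambda>z. F z ^ n)"
  by (induction n) (auto intro: hol_on_box_const hol_on_box_mult)

lemma hol_on_box_sum: "(\<And>a. a \<in> A \<Longrightarrow> hol_on_box I V (F a)) \<Longrightarrow> hol_on_box I V (\<lambda>z. \<Sum>a\<in>A. F a z)"
  by (induction A rule: infinite_finite_induct) (auto intro: hol_on_box_const hol_on_box_add)

lemma hol_on_box_prod: "(\<And>a. a \<in> A \<Longrightarrow> hol_on_box I V (F a)) \<Longrightarrow> hol_on_box I V (\<lambda>z. \<Prod>a\<in>A. F a z)"
  by (induction A rule: infinite_finite_induct) (auto intro: hol_on_box_const hol_on_box_mult)

lemma hol_on_box_compose:
  assumes "hol_on_box I V F" "h holomorphic_on W" "\<And>z. z \<in> Pi I V \<Longrightarrow> F z \<in> W"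
  shows "hol_on_box I V (\<lambda>z. h (F z))"
  unfolding hol_on_box_def
proof (intro conjI ballI)
  show "continuous_on (Pi I V) (\<lambda>z. h (F z))"
    by (rule continuous_on_compose2[OF holomorphic_on_imp_continuous_on[OF assms(2)] hol_on_box_cont[OF assms(1)]])
       (use assms(3) in auto)
  fix z i assume z: "z \<in> Pi I V" "i \<in> I"
  have "(h \<circ> (\<lambda>u. F (z(i := u)))) holomorphic_on V i"
    by (rule holomorphic_on_compose_gen[OF hol_on_box_hol[OF assms(1) z] assms(2)])
       (use assms(3) fun_upd_in_Pi[OF z(1)] in blast)
  then show "(\<lambda>u. h (F (z(i := u)))) holomorphic_on V i" by (simp add: o_def)
qed

lemma hol_on_box_subset:
  assumes "hol_on_box I V F" "\<And>i. i \<in> I \<Longrightarrow> V' i \<subseteq> V i"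
  shows "hol_on_box I V' F"
  unfolding hol_on_box_def
proof (intro conjI ballI)
  have sub: "Pi I V' \<subseteq> Pi I V" using assms(2) by auto
  show "continuous_on (Pi I V') F" using hol_on_box_cont[OF assms(1)] sub by (rule continuous_on_subset)
  fix z i assume "z \<in> Pi I V'" "i \<in> I"
  then show "(\<lambda>u. F (z(i := u))) holomorphic_on V' i"
    by (intro holomorphic_on_subset[OF hol_on_box_hol[OF assms(1)] assms(2)] subsetD[OF sub]) auto
qed

lemma hol_on_box_cong:
  assumes "hol_on_box I V F" "\<And>z. z \<in> Pi I V \<Longrightarrow> F z = G z"
  shows "hol_on_box I V G"
  unfolding hol_on_box_def
proof (intro conjI ballI)
  show "continuous_on (Pi I V) G" using hol_on_box_cont[OF assms(1)] assms(2) continuous_on_eq by blast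
  fix z i assume z: "z \<in> Pi I V" "i \<in> I"
  show "(\<lambda>u. G (z(i := u))) holomorphic_on V i"
    by (rule holomorphic_transform[OF hol_on_box_hol[OF assms(1) z]])
       (use assms(2) fun_upd_in_Pi[OF z(1)] in blast)
qed

lemma hol_on_box_fix_coord:
  assumes "hol_on_box I V F" "c \<in> V k"
  shows "hol_on_box I V (\<lambda>z. F (z(k := c)))"
  unfolding hol_on_box_def
proof (intro conjI ballI)
  show "continuous_on (Pi I V) (\<lambda>z. F (z(k := c)))"
    by (rule continuous_on_compose2[OF hol_on_box_cont[OF assms(1)]])
       (use assms(2) in \<open>auto intro!: continuous_on_fun_upd continuous_on_id continuous_on_const\<close>)
  fix z i assume z: "z \<in> Pi I V" "i \<in> I"
  show "(\<lambda>u. F ((z(i := u))(k := c))) holomorphic_on V i"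
  proof (cases "i = k")
    case False
    have "z(k := c) \<in> Pi I V" using z assms(2) by auto
    from hol_on_box_hol[OF assms(1) this z(2)] show ?thesis
      using False by (simp add: fun_upd_twist)
  qed simp
qed

text \<open>The Leibniz rule asks for a jointly continuous derivative. Written as a Cauchy integral
  over a circle, the derivative \<open>G\<close> inherits joint continuity from \<open>f\<close>, so
  continuity of \<open>f\<close> itself is enough.\<close>

lemma holomorphic_on_integral_param:
  fixes f :: "complex \<Rightarrow> real \<Rightarrow> complex"
  assumes U: "open U" and cont: "continuous_on (U \<times> {0..1}) (\<lambda>(u, t). f u t)"
    and hol: "\<And>t. t \<in> {0..1} \<Longrightarrow> (\<lambda>u. f u t) holomorphic_on U"
  shows "(\<lambda>u. integral {0..1} (f u)) holomorphic_on U"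
  unfolding holomorphic_on_open[OF U]
proof
  fix u0 assume "u0 \<in> U"
  then obtain r where r: "0 < r" "cball u0 r \<subseteq> U" using U open_contains_cball by blast
  define G where "G u t = (1 / (2 * pi * \<i>)) * integral {0..1} (\<lambda>s. f (circlepath u0 r s) t / (circlepath u0 r s - u)\<^sup>2
      * (2 * pi * \<i> * r * exp (2 * of_real pi * \<i> * s)))" for u t
  have cp: "cmod (circlepath u0 r s - u0) = r" for s
    using r by (simp add: circlepath norm_mult)
  have cpU: "circlepath u0 r s \<in> U" for s
    using r cp[of s] by (auto simp: subset_eq dist_norm norm_minus_commute)
  have ne: "circlepath u0 r s \<noteq> u" if "u \<in> ball u0 r" for s u
    using cp[of s] that by (auto simp: dist_norm norm_minus_commute)
  have der: "((\<lambda>x. f x t) has_field_derivative G u t) (at u within ball u0 r)"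
    if u: "u \<in> ball u0 r" and t: "t \<in> cbox 0 1" for u t
  proof -
    have h: "(\<lambda>u. f u t) holomorphic_on U" using hol t by simp
    have c: "continuous_on (cball u0 r) (\<lambda>u. f u t)"
      using holomorphic_on_imp_continuous_on[OF h] r(2) continuous_on_subset by blast
    have b: "(\<lambda>u. f u t) holomorphic_on ball u0 r"
      using h r(2) ball_subset_cball holomorphic_on_subset by blast
    have "((\<lambda>u. f u t) has_field_derivative
        (1 / (2 * of_real pi * \<i>) * contour_integral (circlepath u0 r) (\<lambda>x. f x t / (x - u)^2))) (at u)"
      by (rule Cauchy_derivative_integral_circlepath(2)[OF c b u])
    also have "contour_integral (circlepath u0 r) (\<lambda>x. f x t / (x - u)^2)
       = integral {0..1} (\<lambda>s. f (circlepath u0 r s) t / (circlepath u0 r s - u)\<^sup>2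
      * (2 * pi * \<i> * r * exp (2 * of_real pi * \<i> * s)))"
      unfolding contour_integral_integral by (simp add: vector_derivative_circlepath)
    finally show ?thesis unfolding G_def by (simp add: has_field_derivative_at_within)
  qed
  have Gc: "continuous_on (ball u0 r \<times> cbox 0 1) (\<lambda>(u, t). G u t)"
  proof -
    have "continuous_on ((ball u0 r \<times> cbox (0::real) 1) \<times> cbox (0::real) 1)
      (\<lambda>(p, s). f (circlepath u0 r s) (snd p) / (circlepath u0 r s - fst p)\<^sup>2
      * (2 * pi * \<i> * r * exp (2 * of_real pi * \<i> * s)))"
    proof -
      have 1: "continuous_on S (\<lambda>x. circlepath u0 r (snd x))" for S :: "((complex \<times> real) \<times> real) set"
        unfolding circlepath by (intro continuous_intros)
      have 2: "continuous_on ((ball u0 r \<times> cbox (0::real) 1) \<times> cbox (0::real) 1)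
        (\<lambda>x. f (circlepath u0 r (snd x)) (snd (fst x)))"
      proof -
        have "continuous_on ((ball u0 r \<times> cbox (0::real) 1) \<times> cbox (0::real) 1)
          (\<lambda>x. (\<lambda>(u, t). f u t) (circlepath u0 r (snd x), snd (fst x)))"
          by (rule continuous_on_compose2[OF cont])
             (intro continuous_intros 1, use cpU in auto)
        then show ?thesis by simp
      qed
      show ?thesis unfolding case_prod_beta
        by (intro continuous_intros 1 2) (use ne in auto)
    qed
    from integral_continuous_on_param[OF this]
    show ?thesis unfolding G_def case_prod_beta by (intro continuous_intros) auto
  qed
  have int: "f u integrable_on cbox 0 1" if "u \<in> ball u0 r" for u
  proof -
    have "u \<in> U" using that r by auto
    then have "continuous_on (cbox 0 1) (\<lambda>t. (\<lambda>(u, t). f u t) (u, t))"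
      by (intro continuous_on_compose2[OF cont] continuous_intros) auto
    then have "continuous_on (cbox 0 1) (f u)" by simp
    then show ?thesis by (rule integrable_continuous)
  qed
  have "(\<lambda>u. integral (cbox 0 1) (f u)) holomorphic_on ball u0 r"
    by (rule leibniz_rule_holomorphic[OF der int Gc]) auto
  then show "\<exists>f'. ((\<lambda>u. integral {0..1} (f u)) has_field_derivative f') (at u0)"
    using r(1) by (simp add: holomorphic_on_open)
qed

lemma hol_on_box_integral:
  assumes V: "\<And>i. i \<in> I \<Longrightarrow> open (V i)"
    and cont: "continuous_on (Pi I V \<times> {0..1}) (\<lambda>(z, t). F z t)"
    and hol: "\<And>t z i. t \<in> {0..1::real} \<Longrightarrow> z \<in> Pi I V \<Longrightarrow> i \<in> I \<Longrightarrow> (\<lambda>u. F (z(i := u)) t) holomorphic_on V i"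
  shows "hol_on_box I V (\<lambda>z. integral {0..1} (F z))"
  unfolding hol_on_box_def
proof (intro conjI ballI)
  show "continuous_on (Pi I V) (\<lambda>z. integral {0..1} (F z))"
    using integral_continuous_on_param[of "Pi I V" 0 1 F] cont by simp
  fix z i assume z: "z \<in> Pi I V" "i \<in> I"
  show "(\<lambda>u. integral {0..1} (F (z(i := u)))) holomorphic_on V i"
  proof (rule holomorphic_on_integral_param[OF V[OF z(2)] _ hol[OF _ z]])
    have "continuous_on (V i \<times> {0..1}) (\<lambda>x. (\<lambda>(z, t). F z t) (z(i := fst x), snd x))"
      by (rule continuous_on_compose2[OF cont])
         (use z in \<open>auto intro!: continuous_on_Pair continuous_on_fun_upd continuous_on_fst
            continuous_on_snd continuous_on_id continuous_on_const\<close>)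
    then show "continuous_on (V i \<times> {0..1}) (\<lambda>(u, t). F (z(i := u)) t)"
      by (simp add: case_prod_beta)
  qed
qed

text \<open>The integral of \<open>F\<close> in coordinate \<open>k\<close> along the segment from
  -1 to \<open>z k\<close>. Parametrising the segment over the fixed interval from 0 to 1 makes it a
  parametric integral, to which \<open>hol_on_box_integral\<close> applies.\<close>

definition box_antideriv :: "nat \<Rightarrow> ((nat \<Rightarrow> complex) \<Rightarrow> complex) \<Rightarrow> (nat \<Rightarrow> complex) \<Rightarrow> complex" where
  "box_antideriv k F z = integral {0..1} (\<lambda>t. (z k + 1) * F (z(k := -1 + of_real t * (z k + 1))))"

lemma convex_segment_from_minus_one:
  assumes "convex S" "-1 \<in> S" "u \<in> S" "t \<in> {0..1}"
  shows "-1 + of_real t * (u + 1) \<in> (S :: complex set)"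
proof -
  have "(1 - t) *\<^sub>R (-1) + t *\<^sub>R u \<in> S" using assms by (intro convexD) auto
  then show ?thesis by (simp add: scaleR_conv_of_real algebra_simps)
qed

lemma continuous_on_box_antideriv_integrand:
  fixes F :: "(nat \<Rightarrow> complex) \<Rightarrow> complex"
  assumes F: "continuous_on (Pi I V) F" and V: "convex (V k)" "-1 \<in> V k" and k: "k \<in> I"
  shows "continuous_on (Pi I V \<times> {0..1}) (\<lambda>(z, t). (z k + 1) * F (z(k := -1 + complex_of_real t * (z k + 1))))"
proof -
  have 1: "continuous_on (Pi I V \<times> {0..1}) (\<lambda>x. F ((fst x)(k := -1 + complex_of_real (snd x) * (fst x k + 1))))"
  proof (rule continuous_on_compose2[OF F])
    show "continuous_on (Pi I V \<times> {0..1}) (\<lambda>x. (fst x)(k := -1 + complex_of_real (snd x) * (fst x k + 1)))"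
      by (rule continuous_on_fun_upd[where f=fst]) (intro continuous_intros)+
    show "(\<lambda>x. (fst x)(k := -1 + complex_of_real (snd x) * (fst x k + 1))) ` (Pi I V \<times> {0..1}) \<subseteq> Pi I V"
    proof clarsimp
      fix z :: "nat \<Rightarrow> complex" and t :: real and i
      assume z: "z \<in> Pi I V" "0 \<le> t" "t \<le> 1" "i \<in> I"
      have "-1 + of_real t * (z k + 1) \<in> V k"
        by (rule convex_segment_from_minus_one[OF V]) (use z k in auto)
      then show "(i = k \<longrightarrow> complex_of_real t * (z k + 1) - 1 \<in> V k) \<and> (i \<noteq> k \<longrightarrow> z i \<in> V i)"
        using z by (auto simp: algebra_simps)
    qed
  qed
  show ?thesis unfolding case_prod_beta by (intro continuous_intros 1)
qed

lemma hol_on_box_antideriv: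
  assumes F: "hol_on_box I V F" and V: "\<And>i. i \<in> I \<Longrightarrow> open (V i)" and k: "k \<in> I"
    and Vk: "convex (V k)" "-1 \<in> V k"
  shows "hol_on_box I V (box_antideriv k F)"
  unfolding box_antideriv_def
proof (rule hol_on_box_integral[OF V continuous_on_box_antideriv_integrand[OF hol_on_box_cont[OF F] Vk k]])
  fix t :: real and z i assume t: "t \<in> {0..1}" and z: "z \<in> Pi I V" "i \<in> I"
  have seg: "-1 + of_real t * (u + 1) \<in> V k" if "u \<in> V k" for u
    by (rule convex_segment_from_minus_one[OF Vk that t])
  show "(\<lambda>u. ((z(i := u)) k + 1) * F ((z(i := u))(k := - 1 + complex_of_real t * ((z(i := u)) k + 1)))) holomorphic_on V i"
  proof (cases "i = k")
    case True
    have "(\<lambda>u. F (z(k := u))) holomorphic_on V k" using hol_on_box_hol[OF F z(1) k] .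
    then have "((\<lambda>u. F (z(k := u))) \<circ> (\<lambda>u. -1 + of_real t * (u + 1))) holomorphic_on V k"
      by (intro holomorphic_on_compose_gen[where t="V k"] holomorphic_intros) (use seg in auto)
    then show ?thesis using True by (auto simp: o_def intro!: holomorphic_intros)
  next
    case False
    have zk: "z k \<in> V k" using z k by auto
    have "z(k := - 1 + complex_of_real t * (z k + 1)) \<in> Pi I V" using z seg[OF zk] by auto
    from hol_on_box_hol[OF F this z(2)] show ?thesis
      using False by (auto simp: fun_upd_twist intro!: holomorphic_intros)
  qed
qed

lemma norm_integral_unit_le:
  fixes f :: "real \<Rightarrow> complex"
  assumes "\<And>t. t \<in> {0..1} \<Longrightarrow> cmod (f t) \<le> B"
  shows "cmod (integral {0..1} f) \<le> B"
proof -
  have B0: "0 \<le> B" by (rule order_trans[OF norm_ge_zero[of "f 0"] assms]) simp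
  show ?thesis
  proof (cases "f integrable_on {0..1}")
    case True
    then have "(f has_integral integral {0..1} f) {0..1}" by (simp add: has_integral_integral)
    from has_integral_bound_real[OF B0 finite.emptyI this] show ?thesis using assms by simp
  qed (use B0 in \<open>simp add: not_integrable_integral\<close>)
qed

lemma norm_box_antideriv_le:
  assumes B: "\<And>z. z \<in> Pi I V \<Longrightarrow> cmod (F z) \<le> B" and Vk: "convex (V k)" "-1 \<in> V k" and k: "k \<in> I"
    and z: "z \<in> Pi I V"
  shows "cmod (box_antideriv k F z) \<le> cmod (z k + 1) * B"
  unfolding box_antideriv_def
proof (rule norm_integral_unit_le)
  fix t :: real assume t: "t \<in> {0..1}"
  have "-1 + of_real t * (z k + 1) \<in> V k"
    by (rule convex_segment_from_minus_one[OF Vk _ t]) (use z k in auto)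
  then have "z(k := -1 + of_real t * (z k + 1)) \<in> Pi I V" using z by auto
  then show "cmod ((z k + 1) * F (z(k := -1 + of_real t * (z k + 1)))) \<le> cmod (z k + 1) * B"
    unfolding norm_mult using B by (intro mult_left_mono) auto
qed

lemma box_antideriv_diff:
  assumes F: "continuous_on (Pi I V) F" and G: "continuous_on (Pi I V) G"
    and Vk: "convex (V k)" "-1 \<in> V k" and k: "k \<in> I" and z: "z \<in> Pi I V"
  shows "box_antideriv k (\<lambda>z. F z - G z) z = box_antideriv k F z - box_antideriv k G z"
proof -
  have int: "(\<lambda>t. (z k + 1) * F (z(k := -1 + complex_of_real t * (z k + 1)))) integrable_on {0..1}"
    if "continuous_on (Pi I V) F" for F
  proof -
    have "continuous_on {0..1} (\<lambda>t. (\<lambda>(z, t). (z k + 1) * F (z(k := -1 + complex_of_real t * (z k + 1)))) (z, t))"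
      by (rule continuous_on_compose2[OF continuous_on_box_antideriv_integrand[OF that Vk k]])
         (use z in \<open>auto intro!: continuous_intros\<close>)
    then show ?thesis by (intro integrable_continuous_interval) simp
  qed
  show ?thesis unfolding box_antideriv_def right_diff_distrib
    by (rule integral_diff[OF int[OF F] int[OF G]])
qed

definition box_deriv :: "nat \<Rightarrow> ((nat \<Rightarrow> complex) \<Rightarrow> complex) \<Rightarrow> (nat \<Rightarrow> complex) \<Rightarrow> complex" where
  "box_deriv j F z = deriv (\<lambda>u. F (z(j := u))) (z j)"

lemma box_deriv_has_derivative:
  assumes "hol_on_box I V F" "open (V j)" "j \<in> I" "z \<in> Pi I V"
  shows "((\<lambda>u. F (z(j := u))) has_field_derivative box_deriv j F z) (at (z j))"
  unfolding box_deriv_def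
  by (rule holomorphic_derivI[OF hol_on_box_hol[OF assms(1,4,3)] assms(2)]) (use assms in auto)

text \<open>Cauchy's formula on the circle of radius \<open>s\<close> around \<open>z j\<close>. It
  yields both the bound on the derivative and its holomorphy in all coordinates, as a parametric
  integral.\<close>

lemma box_deriv_eq_integral:
  assumes F: "hol_on_box I V F" and Vj: "cball (z j) s \<subseteq> V j" and s: "0 < s" and j: "j \<in> I"
    and z: "z \<in> Pi I V"
  shows "box_deriv j F z = integral {0..1} (\<lambda>t. F (z(j := z j + of_real s * exp (2 * of_real pi * \<i> * of_real t)))
     * (exp (- (2 * of_real pi * \<i> * of_real t)) / of_real s))"
proof -
  let ?h = "\<lambda>u. F (z(j := u))"
  have h: "?h holomorphic_on V j" using hol_on_box_hol[OF F z j] .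
  have c: "continuous_on (cball (z j) s) ?h"
    using holomorphic_on_imp_continuous_on[OF h] Vj continuous_on_subset by blast
  have b: "?h holomorphic_on ball (z j) s"
    using h Vj ball_subset_cball holomorphic_on_subset by blast
  have "(?h has_field_derivative
      (1 / (2 * of_real pi * \<i>) * contour_integral (circlepath (z j) s) (\<lambda>x. ?h x / (x - z j)^2))) (at (z j))"
    by (rule Cauchy_derivative_integral_circlepath(2)[OF c b]) (use s in simp)
  then have "box_deriv j F z = 1 / (2 * of_real pi * \<i>) * contour_integral (circlepath (z j) s) (\<lambda>x. ?h x / (x - z j)^2)"
    unfolding box_deriv_def by (rule DERIV_imp_deriv)
  also have "contour_integral (circlepath (z j) s) (\<lambda>x. ?h x / (x - z j)^2)
     = integral {0..1} (\<lambda>t. ?h (circlepath (z j) s t) / (circlepath (z j) s t - z j)\<^sup>2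
      * (2 * pi * \<i> * s * exp (2 * of_real pi * \<i> * of_real t)))"
    unfolding contour_integral_integral by (simp add: vector_derivative_circlepath)
  also have "1 / (2 * of_real pi * \<i>) * \<dots> = integral {0..1} (\<lambda>t. 1 / (2 * of_real pi * \<i>) *
     (?h (circlepath (z j) s t) / (circlepath (z j) s t - z j)\<^sup>2
      * (2 * pi * \<i> * s * exp (2 * of_real pi * \<i> * of_real t))))"
    by (rule integral_mult_right[symmetric])
  also have "\<dots> = integral {0..1} (\<lambda>t. F (z(j := z j + of_real s * exp (2 * of_real pi * \<i> * of_real t)))
     * (exp (- (2 * of_real pi * \<i> * of_real t)) / of_real s))"
  proof (rule integral_cong)
    fix t :: real
    have key: "1 / (2 * of_real pi * \<i>) * (x / (c + of_real s * exp y - c)\<^sup>2 * (of_real (2 * pi) * \<i> * of_real s * exp y))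
        = x * (exp (- y) / of_real s)" for x y c :: complex
      using s by (simp add: exp_minus field_simps power2_eq_square)
    show "1 / (2 * of_real pi * \<i>) *
     (?h (circlepath (z j) s t) / (circlepath (z j) s t - z j)\<^sup>2
      * (2 * pi * \<i> * s * exp (2 * of_real pi * \<i> * of_real t)))
      = F (z(j := z j + of_real s * exp (2 * of_real pi * \<i> * of_real t)))
     * (exp (- (2 * of_real pi * \<i> * of_real t)) / of_real s)"
      unfolding circlepath by (rule key)
  qed
  finally show ?thesis .
qed

lemma circle_point_in:
  assumes "cball u s \<subseteq> V" "0 < s"
  shows "u + of_real s * exp (2 * of_real pi * \<i> * of_real t) \<in> V"
proof -
  have "cmod (exp (2 * of_real pi * \<i> * of_real t)) = 1" by simp
  then have "u + of_real s * exp (2 * of_real pi * \<i> * of_real t) \<in> cball u s"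
    using assms(2) by (simp add: dist_norm norm_mult)
  then show ?thesis using assms(1) by blast
qed

lemma norm_box_deriv_le:
  assumes F: "hol_on_box I V F" and Vj: "cball (z j) s \<subseteq> V j" and s: "0 < s" and j: "j \<in> I"
    and z: "z \<in> Pi I V" and B: "\<And>z. z \<in> Pi I V \<Longrightarrow> cmod (F z) \<le> B"
  shows "cmod (box_deriv j F z) \<le> B / s"
  unfolding box_deriv_eq_integral[OF F Vj s j z]
proof (rule norm_integral_unit_le)
  fix t :: real
  have "z(j := z j + of_real s * exp (2 * of_real pi * \<i> * of_real t)) \<in> Pi I V"
    using z circle_point_in[OF Vj s] by auto
  then have "cmod (F (z(j := z j + of_real s * exp (2 * of_real pi * \<i> * of_real t)))) \<le> B" by (rule B)
  moreover have "cmod (exp (- (2 * of_real pi * \<i> * of_real t)) / of_real s) = 1 / s"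
    using s by (simp add: norm_divide)
  ultimately show "cmod (F (z(j := z j + of_real s * exp (2 * of_real pi * \<i> * of_real t)))
     * (exp (- (2 * of_real pi * \<i> * of_real t)) / of_real s)) \<le> B / s"
    unfolding norm_mult using s by (simp add: divide_right_mono)
qed

text \<open>The margin \<open>s\<close> between the two boxes allows one circle radius for all
  points, which keeps the integrand of the Cauchy formula jointly continuous.\<close>

lemma hol_on_box_deriv:
  assumes F: "hol_on_box I V F" and V': "\<And>i. i \<in> I \<Longrightarrow> open (V' i)" "\<And>i. i \<in> I \<Longrightarrow> V' i \<subseteq> V i"
    and s: "0 < s" "\<And>u. u \<in> V' j \<Longrightarrow> cball u s \<subseteq> V j" and j: "j \<in> I"
  shows "hol_on_box I V' (box_deriv j F)"
proof -
  let ?f = "\<lambda>z t. F (z(j := z j + of_real s * exp (2 * of_real pi * \<i> * of_real t)))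
     * (exp (- (2 * of_real pi * \<i> * of_real t)) / of_real s)"
  have pt: "z(j := z j + of_real s * exp (2 * of_real pi * \<i> * of_real t)) \<in> Pi I V" if "z \<in> Pi I V'" for z t
  proof -
    have zj: "z j \<in> V' j" using that j by auto
    have zV: "z \<in> Pi I V" using that V'(2) by auto
    show ?thesis using circle_point_in[OF s(2)[OF zj] s(1)] zV by (intro fun_upd_in_Pi) auto
  qed
  have "hol_on_box I V' (\<lambda>z. integral {0..1} (?f z))"
  proof (rule hol_on_box_integral[OF V'(1)])
    have "continuous_on (Pi I V' \<times> {0..1}) (\<lambda>x. F ((fst x)(j := fst x j + of_real s * exp (2 * of_real pi * \<i> * of_real (snd x)))))"
      by (rule continuous_on_compose2[OF hol_on_box_cont[OF F]])
         (rule continuous_on_fun_upd, intro continuous_intros, intro continuous_intros,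
           use pt in \<open>auto simp: image_subset_iff simp del: fun_upd_apply\<close>)
    then show "continuous_on (Pi I V' \<times> {0..1}) (\<lambda>(z, t). ?f z t)"
      unfolding case_prod_beta by (intro continuous_intros) (use s in auto)
    fix t :: real and z i assume z: "z \<in> Pi I V'" "i \<in> I"
    let ?c = "of_real s * exp (2 * of_real pi * \<i> * of_real t)"
    show "(\<lambda>u. ?f (z(i := u)) t) holomorphic_on V' i"
    proof (cases "i = j")
      case True
      have zV: "z \<in> Pi I V" using z V'(2) by auto
      have "(\<lambda>u. F (z(j := u))) holomorphic_on V j" using hol_on_box_hol[OF F zV j] .
      then have "((\<lambda>u. F (z(j := u))) \<circ> (\<lambda>u. u + ?c)) holomorphic_on V' j"
        by (intro holomorphic_on_compose_gen[where t="V j"] holomorphic_intros)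
           (use circle_point_in[OF s(2) s(1)] in auto)
      then show ?thesis using True s(1) by (auto simp: o_def intro!: holomorphic_intros)
    next
      case False
      from hol_on_box_hol[OF F pt[OF z(1)] z(2), of t] V'(2)[OF z(2)]
      have "(\<lambda>u. F (z(j := z j + ?c, i := u))) holomorphic_on V' i"
        by (rule holomorphic_on_subset)
      then show ?thesis
        using False s(1) by (auto simp: fun_upd_twist intro!: holomorphic_intros)
    qed
  qed
  then show ?thesis
  proof (rule hol_on_box_cong)
    fix z assume z: "z \<in> Pi I V'"
    have zV: "z \<in> Pi I V" using z V'(2) by auto
    show "integral {0..1} (?f z) = box_deriv j F z"
      by (rule box_deriv_eq_integral[OF F _ s(1) j zV, symmetric]) (use s(2) z j in auto)
  qed
qed

definition box_cheb_coeff :: "real \<Rightarrow> nat \<Rightarrow> nat \<Rightarrow> ((nat \<Rightarrow> complex) \<Rightarrow> complex) \<Rightarrow> (nat \<Rightarrow> complex) \<Rightarrow> complex" where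
  "box_cheb_coeff \<rho> i n F z = cheb_coeff \<rho> (\<lambda>u. F (z(i := u))) n"

text \<open>Expanding in coordinate \<open>i\<close> leaves coefficients that are holomorphic in the
  remaining coordinates; this is what carries the induction on the number of variables.\<close>

lemma hol_on_box_cheb_coeff:
  assumes F: "hol_on_box (insert i I) V F" and V: "\<And>i. i \<in> I \<Longrightarrow> open (V i)" and i: "i \<notin> I"
    and \<rho>: "0 < \<rho>" "\<And>w. cmod w = \<rho> \<Longrightarrow> joukowski w \<in> V i"
  shows "hol_on_box I V (box_cheb_coeff \<rho> i n F)"
  unfolding box_cheb_coeff_def cheb_coeff_def
proof (rule hol_on_box_integral[OF V])
  let ?J = "\<lambda>t. joukowski (circlepath 0 \<rho> t)"
  have pt: "z(i := ?J t) \<in> Pi (insert i I) V" if "z \<in> Pi I V" for z t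
    using that i \<rho> by (auto simp: circlepath_facts)
  have 1: "continuous_on S (\<lambda>x. circlepath 0 \<rho> (snd x))" for S :: "((nat \<Rightarrow> complex) \<times> real) set"
    unfolding circlepath by (intro continuous_intros)
  have 2: "continuous_on S (\<lambda>x. ?J (snd x))" for S :: "((nat \<Rightarrow> complex) \<times> real) set"
    using continuous_on_compose2[OF continuous_on_joukowski_circlepath[OF \<rho>(1), of UNIV] continuous_on_snd[OF continuous_on_id]]
    by auto
  have "continuous_on (Pi I V \<times> {0..1}) (\<lambda>x. F ((fst x)(i := ?J (snd x))))"
    by (rule continuous_on_compose2[OF hol_on_box_cont[OF F]])
       (rule continuous_on_fun_upd, intro continuous_intros, rule 2,
         use pt in \<open>auto simp: image_subset_iff simp del: fun_upd_apply\<close>)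
  then show "continuous_on (Pi I V \<times> {0..1})
     (\<lambda>(z, t). F (z(i := ?J t)) * (of_real (cheb_weight n) / circlepath 0 \<rho> t ^ n))"
    unfolding case_prod_beta by (intro continuous_intros 1) (use \<rho> in \<open>auto simp: circlepath_facts\<close>)
  fix t :: real and z k assume z: "z \<in> Pi I V" "k \<in> I"
  have ki: "k \<noteq> i" using z i by auto
  have "(\<lambda>u. F (z(i := ?J t, k := u))) holomorphic_on V k"
    by (rule hol_on_box_hol[OF F pt[OF z(1)]]) (use z in auto)
  then show "(\<lambda>u. F (z(k := u, i := ?J t)) * (of_real (cheb_weight n) / circlepath 0 \<rho> t ^ n)) holomorphic_on V k"
    using ki \<rho> by (auto simp: fun_upd_twist circlepath_facts intro!: holomorphic_intros)
qed

section \<open>Counting the index sets\<close>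

definition simplex_points :: "nat set \<Rightarrow> (nat \<Rightarrow> real) \<Rightarrow> real \<Rightarrow> (nat \<Rightarrow> nat) set" where
  "simplex_points I a s = {\<nu> \<in> (\<Pi>\<^sub>E i\<in>I. UNIV). (\<Sum>i\<in>I. real (\<nu> i) * a i) \<le> s}"

text \<open>The mean value inequality for powers. It compares sums of slices with integrals, and
  later absorbs lower-order terms into a shifted power.\<close>

lemma power_diff_ge:
  fixes x a :: real
  assumes "0 \<le> x" "0 \<le> a"
  shows "real (Suc k) * a * x ^ k \<le> (x + a) ^ Suc k - x ^ Suc k"
proof (induction k)
  case (Suc k)
  have "real (Suc (Suc k)) * a * x ^ Suc k = x * (real (Suc k) * a * x ^ k) + a * x ^ Suc k"
    by (simp add: algebra_simps)
  also have "\<dots> \<le> x * ((x + a) ^ Suc k - x ^ Suc k) + a * (x + a) ^ Suc k"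
    using assms by (intro add_mono mult_left_mono Suc power_mono) auto
  also have "\<dots> = (x + a) ^ Suc (Suc k) - x ^ Suc (Suc k)" by (simp add: algebra_simps)
  finally show ?case .
qed simp

text \<open>A decreasing Riemann sum of slice volumes is at most the integral over a range that is
  one step longer; the integral appears as a telescoping sum.\<close>

lemma sum_power_telescope:
  fixes a x :: real
  assumes "0 < a" and nn: "\<And>n. n \<le> m \<Longrightarrow> 0 \<le> x - real n * a"
  shows "(\<Sum>n\<le>m. (x - real n * a) ^ k) \<le> (x + a) ^ Suc k / (real (Suc k) * a)"
proof -
  have "(\<Sum>n\<le>m. real (Suc k) * a * (x - real n * a) ^ k)
      \<le> (\<Sum>n\<le>m. (x - real n * a + a) ^ Suc k - (x - real n * a) ^ Suc k)"
    using assms by (intro sum_mono power_diff_ge) auto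
  also have "\<dots> = (\<Sum>n\<le>m. (x + a - real n * a) ^ Suc k - (x + a - real (Suc n) * a) ^ Suc k)"
    by (intro sum.cong refl) (simp add: algebra_simps)
  also have "\<dots> = (x + a) ^ Suc k - (x + a - real (Suc m) * a) ^ Suc k"
    by (subst sum_telescope) simp
  also have "\<dots> \<le> (x + a) ^ Suc k"
  proof -
    have "0 \<le> x + a - real (Suc m) * a" using nn[of m] by (simp add: algebra_simps)
    then show ?thesis by (simp del: of_nat_Suc)
  qed
  finally have "real (Suc k) * a * (\<Sum>n\<le>m. (x - real n * a) ^ k) \<le> (x + a) ^ Suc k"
    by (simp only: sum_distrib_left)
  then show ?thesis using assms(1) by (subst pos_le_divide_eq) (auto simp: mult.commute)
qed

text \<open>Each lattice point carries a unit cell, and all cells lie in the simplex enlarged by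
  \<open>sum a I\<close>, whose volume is the bound. Instead of measure theory the proof slices by
  the value of one coordinate and sums the bounds for the slices. The claim for negative
  \<open>s\<close> makes the induction uniform.\<close>

lemma simplex_points_bound:
  assumes "finite I" and "\<And>i. i \<in> I \<Longrightarrow> 0 < a i"
  shows "finite (simplex_points I a s) \<and> (0 \<le> s \<longrightarrow>
     real (card (simplex_points I a s))
       \<le> (s + sum a I) ^ card I / (fact (card I) * prod a I)) \<and> (s < 0 \<longrightarrow> simplex_points I a s = {})"
  using assms
proof (induction I arbitrary: s rule: finite_induct)
  case empty
  have "simplex_points {} a s = (if 0 \<le> s then {\<lambda>_. undefined} else {})"
    by (auto simp: simplex_points_def)
  then show ?case by auto
next
  case (insert i I)
  have ai: "0 < a i" and aI: "\<And>j. j \<in> I \<Longrightarrow> 0 < a j" using insert.prems by auto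
  note IH = insert.IH[OF aI]
  have neg: "simplex_points (insert i I) a s = {}" if "s < 0"
  proof -
    have "0 \<le> (\<Sum>i\<in>insert i I. real (\<nu> i) * a i)" for \<nu> :: "nat \<Rightarrow> nat"
      by (intro sum_nonneg mult_nonneg_nonneg) (use insert.prems in \<open>auto intro: less_imp_le\<close>)
    then show ?thesis using that unfolding simplex_points_def by (smt (verit) Collect_empty_eq)
  qed
  show ?case
  proof (cases "0 \<le> s")
    case False
    then show ?thesis using neg by auto
  next
    case True
    \<comment> \<open>The largest value that coordinate \<open>i\<close> can take.\<close>
    define m where "m = nat \<lfloor>s / a i\<rfloor>"
    have nm: "real n * a i \<le> s \<longleftrightarrow> n \<le> m" for n
      using True ai unfolding m_def by (simp add: le_nat_iff le_floor_iff pos_le_divide_eq)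
    \<comment> \<open>The slices glued back together; an inclusion into \<open>U\<close> is enough
      for an upper bound.\<close>
    define U where "U = (\<Union>n\<in>{..m}. (\<lambda>\<nu>. \<nu>(i := n)) ` simplex_points I a (s - real n * a i))"
    have sub: "simplex_points (insert i I) a s \<subseteq> U"
    proof
      fix \<nu> assume \<nu>: "\<nu> \<in> simplex_points (insert i I) a s"
      have le: "real (\<nu> i) * a i + (\<Sum>j\<in>I. real (\<nu> j) * a j) \<le> s"
        using \<nu> insert.hyps by (simp add: simplex_points_def)
      have "0 \<le> (\<Sum>j\<in>I. real (\<nu> j) * a j)"
        by (intro sum_nonneg mult_nonneg_nonneg) (use aI in \<open>auto intro: less_imp_le\<close>)
      then have "\<nu> i \<le> m" using le nm by (smt (verit))
      have eq: "restrict \<nu> I j = \<nu> j" if "j \<in> I" for j using that by simp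
      have "(\<Sum>j\<in>I. real (restrict \<nu> I j) * a j) \<le> s - real (\<nu> i) * a i" using le by simp
      then have "restrict \<nu> I \<in> simplex_points I a (s - real (\<nu> i) * a i)"
        by (simp add: simplex_points_def)
      moreover have "\<nu> = (restrict \<nu> I)(i := \<nu> i)"
        using \<nu> by (auto simp: simplex_points_def PiE_def extensional_def fun_eq_iff)
      ultimately show "\<nu> \<in> U" unfolding U_def using \<open>\<nu> i \<le> m\<close> by blast
    qed
    have fU: "finite U" unfolding U_def using IH by auto
    have "real (card (simplex_points (insert i I) a s)) \<le> real (card U)"
      using card_mono[OF fU sub] by simp
    also have "\<dots> \<le> (\<Sum>n\<le>m. real (card (simplex_points I a (s - real n * a i))))"
    proof -
      have "card U \<le> (\<Sum>n\<le>m. card ((\<lambda>\<nu>. \<nu>(i := n)) ` simplex_points I a (s - real n * a i)))"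
        unfolding U_def by (rule card_UN_le) simp
      also have "\<dots> \<le> (\<Sum>n\<le>m. card (simplex_points I a (s - real n * a i)))"
        using IH by (intro sum_mono card_image_le) auto
      finally show ?thesis by (simp add: of_nat_sum[symmetric] del: of_nat_sum)
    qed
    also have "\<dots> \<le> (\<Sum>n\<le>m. (s - real n * a i + sum a I) ^ card I / (fact (card I) * prod a I))"
      using IH nm by (intro sum_mono) auto
    also have "\<dots> = (\<Sum>n\<le>m. (s + sum a I - real n * a i) ^ card I) / (fact (card I) * prod a I)"
      by (simp add: sum_divide_distrib algebra_simps)
    also have "\<dots> \<le> ((s + sum a I + a i) ^ Suc (card I) / (real (Suc (card I)) * a i)) / (fact (card I) * prod a I)"
    proof (intro divide_right_mono sum_power_telescope ai)
      have sa: "0 \<le> sum a I" by (intro sum_nonneg) (use aI in \<open>auto intro: less_imp_le\<close>)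
      fix n assume "n \<le> m"
      then show "0 \<le> s + sum a I - real n * a i" using nm[of n] sa by linarith
    next
      show "0 \<le> fact (card I) * prod a I"
        by (intro mult_nonneg_nonneg prod_nonneg) (use aI in \<open>auto intro: less_imp_le\<close>)
    qed
    also have "\<dots> = (s + sum a (insert i I)) ^ card (insert i I) / (fact (card (insert i I)) * prod a (insert i I))"
      using insert.hyps by (simp add: algebra_simps)
    finally show ?thesis using finite_subset[OF sub fU] True by auto
  qed
qed

text \<open>Taking logarithms of the defining inequality turns it into a linear one, after
  \<open>max 1 (\<nu> k)\<close> has been lowered to \<open>\<nu> k\<close>, which only increases
  the product.\<close>

lemma index_set_subset_simplex:
  assumes \<xi>: "\<And>j. j \<in> {1..k} \<Longrightarrow> 1 < \<xi> j" and k: "1 \<le> k" and e: "0 < \<epsilon>"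
  shows "index_set \<xi> k \<epsilon> \<subseteq> simplex_points {1..k} (\<lambda>j. ln (\<xi> j)) (- ln \<epsilon>)"
proof
  fix \<nu> assume \<nu>: "\<nu> \<in> index_set \<xi> k \<epsilon>"
  have pos: "0 < \<xi> j" if "j \<in> {1..k}" for j using \<xi>[OF that] by linarith
  have split: "{1..k} = insert k {1..<k}" using k by auto
  have "\<epsilon> \<le> \<xi> k powi (- int (max 1 (\<nu> k))) * (\<Prod>j=1..<k. \<xi> j powi (- int (\<nu> j)))"
    using \<nu> by (simp add: index_set_def)
  also have "\<dots> \<le> \<xi> k powi (- int (\<nu> k)) * (\<Prod>j=1..<k. \<xi> j powi (- int (\<nu> j)))"
  proof (rule mult_right_mono)
    show "\<xi> k powi (- int (max 1 (\<nu> k))) \<le> \<xi> k powi (- int (\<nu> k))"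
      using \<xi>[of k] k by (intro power_int_increasing) auto
    show "0 \<le> (\<Prod>j=1..<k. \<xi> j powi (- int (\<nu> j)))"
      by (intro prod_nonneg zero_le_power_int) (use pos in \<open>auto intro: less_imp_le\<close>)
  qed
  also have "\<dots> = (\<Prod>j=1..k. \<xi> j powi (- int (\<nu> j)))" unfolding split by simp
  finally have "ln \<epsilon> \<le> ln (\<Prod>j=1..k. \<xi> j powi (- int (\<nu> j)))" using e
    by (intro ln_mono) auto
  also have "\<dots> = (\<Sum>j=1..k. ln (\<xi> j powi (- int (\<nu> j))))"
  proof (rule ln_prod)
    fix j assume "j \<in> {1..k}"
    then show "\<xi> j powi (- int (\<nu> j)) \<noteq> 0" using pos[of j] by simp
  qed simp
  also have "\<dots> = (\<Sum>j=1..k. - (real (\<nu> j) * ln (\<xi> j)))"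
    using pos by (intro sum.cong refl) (simp add: power_int_minus ln_inverse ln_realpow)
  finally show "\<nu> \<in> simplex_points {1..k} (\<lambda>j. ln (\<xi> j)) (- ln \<epsilon>)"
    using \<nu> by (simp add: simplex_points_def index_set_def sum_negf)
qed

lemma finite_index_set:
  assumes "\<And>j. j \<in> {1..k} \<Longrightarrow> 1 < \<xi> j" "1 \<le> k" "0 < \<epsilon>"
  shows "finite (index_set \<xi> k \<epsilon>)"
  using index_set_subset_simplex[OF assms] simplex_points_bound[of "{1..k}" "\<lambda>j. ln (\<xi> j)"] assms(1)
  by (meson finite_atLeastAtMost finite_subset ln_gt_zero)

text \<open>Lowering exponents increases every factor, as all bases exceed 1. Downward closure is
  what allows a Chebyshev sum to be rewritten with monomials from the same index set.\<close>

lemma index_set_downward: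
  assumes \<xi>: "\<And>j. j \<in> {1..k} \<Longrightarrow> 1 < \<xi> j" and k: "1 \<le> k"
    and \<nu>: "\<nu> \<in> index_set \<xi> k \<epsilon>" and \<mu>: "\<mu> \<in> (\<Pi>\<^sub>E j\<in>{1..k}. UNIV)" "\<And>j. j \<in> {1..k} \<Longrightarrow> \<mu> j \<le> \<nu> j"
  shows "\<mu> \<in> index_set \<xi> k \<epsilon>"
proof -
  have nn: "0 \<le> \<xi> j" if "Suc 0 \<le> j" "j \<le> k" for j using \<xi>[of j] that by auto
  have "\<xi> k powi (- int (max 1 (\<nu> k))) * (\<Prod>j=1..<k. \<xi> j powi (- int (\<nu> j)))
    \<le> \<xi> k powi (- int (max 1 (\<mu> k))) * (\<Prod>j=1..<k. \<xi> j powi (- int (\<mu> j)))"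
  proof (intro mult_mono prod_mono conjI power_int_increasing zero_le_power_int prod_nonneg)
    fix j assume "j \<in> {1..<k}"
    then have j: "j \<in> {1..k}" by auto
    show "1 \<le> \<xi> j" "0 \<le> \<xi> j" using \<xi>[OF j] by auto
    show "- int (\<nu> j) \<le> - int (\<mu> j)" using \<mu>(2)[OF j] by simp
  qed (use \<mu>(2)[of k] \<xi>[of k] k nn in auto)
  then show ?thesis using \<nu> \<mu>(1) by (auto simp: index_set_def)
qed

text \<open>With \<epsilon> = \<open>exp (- s)\<close> the count is at most a polynomial of degree
  \<open>d\<close> in \<open>s\<close> with leading coefficient \<open>c d\<close>. A shift of the
  argument absorbs all lower-order terms, so the d-th root of the count is at most
  \<open>c d powr (1 / d)\<close> times \<open>s\<close> plus a constant, and that constant becomes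
  the factor \<open>C\<close>.\<close>

lemma index_count_exp_bound:
  assumes d: "1 \<le> d" and \<xi>: "\<And>j. j \<in> {1..d} \<Longrightarrow> 1 < \<xi> j" and \<beta>: "\<beta> \<le> rate \<xi> d"
  shows "\<exists>C>0. \<forall>\<epsilon>\<in>{0<..<1}. \<epsilon> \<le> C * exp (- \<beta> * real (index_count \<xi> d \<epsilon>) powr (1 / real d))"
proof -
  define a where "a j = ln (\<xi> j)" for j
  have a: "0 < a j" if "j \<in> {1..d}" for j using \<xi>[OF that] by (simp add: a_def)
  define A where "A = sum a {1..d}"
  have A0: "0 \<le> A" unfolding A_def by (intro sum_nonneg) (use a in \<open>auto intro: less_imp_le\<close>)
  define c where "c k = 1 / (fact k * prod a {1..k})" for k
  have pa: "0 < prod a {1..k}" if "k \<le> d" for k by (intro prod_pos) (use a that in auto)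
  have c: "0 < c k" if "k \<le> d" for k using pa[OF that] by (simp add: c_def)
  define D where "D = sum c {1..<d}"
  have D0: "0 \<le> D" unfolding D_def by (intro sum_nonneg) (use c in \<open>auto intro: less_imp_le\<close>)
  \<comment> \<open>Chosen such that the first-order term \<open>d * c d * K * y ^ (d - 1)\<close>
    of \<open>c d * (y + K) ^ d\<close> equals \<open>D * y ^ (d - 1)\<close>, the bound for all
    index sets with \<open>k < d\<close> together.\<close>
  define K where "K = D / (real d * c d)"
  have cd: "0 < c d" using c by simp
  have K0: "0 \<le> K" unfolding K_def using D0 cd by simp
  have bound: "\<beta> * real (index_count \<xi> d \<epsilon>) powr (1 / real d) \<le> - ln \<epsilon> + (A + 1 + K)"
    if e: "\<epsilon> \<in> {0<..<1}" for \<epsilon>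
  proof -
    define s where "s = - ln \<epsilon>"
    have s0: "0 \<le> s" using e by (simp add: s_def ln_le_zero_iff)
    \<comment> \<open>\<open>A\<close> pays for the enlargement of the simplices in every dimension;
      the summand 1 gives \<open>1 \<le> y\<close>, so that all powers below \<open>d\<close> are
      dominated by \<open>y ^ (d - 1)\<close>.\<close>
    define y where "y = s + A + 1"
    have y1: "1 \<le> y" using s0 A0 by (simp add: y_def)
    have ck: "real (card (index_set \<xi> k \<epsilon>)) \<le> c k * y ^ k" if k: "k \<in> {1..d}" for k
    proof -
      have sub: "index_set \<xi> k \<epsilon> \<subseteq> simplex_points {1..k} a s"
        using index_set_subset_simplex[of k \<xi> \<epsilon>] \<xi> k e unfolding a_def s_def by auto
      have sp: "finite (simplex_points {1..k} a s)"
        "real (card (simplex_points {1..k} a s)) \<le> (s + sum a {1..k}) ^ k / (fact k * prod a {1..k})"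
        using simplex_points_bound[of "{1..k}" a s] a k s0 by auto
      have "real (card (index_set \<xi> k \<epsilon>)) \<le> real (card (simplex_points {1..k} a s))"
        using card_mono[OF sp(1) sub] by simp
      also have "\<dots> \<le> (s + sum a {1..k}) ^ k / (fact k * prod a {1..k})" by (rule sp(2))
      also have "\<dots> \<le> y ^ k / (fact k * prod a {1..k})"
      proof (intro divide_right_mono power_mono)
        have "sum a {1..k} \<le> A" unfolding A_def
          by (intro sum_mono2) (use a k in \<open>auto intro: less_imp_le\<close>)
        then show "s + sum a {1..k} \<le> y" by (simp add: y_def)
        have "0 \<le> sum a {1..k}" by (intro sum_nonneg) (use a k in \<open>auto intro: less_imp_le\<close>)
        then show "0 \<le> s + sum a {1..k}" using s0 by simp
        show "0 \<le> fact k * prod a {1..k}" using pa[of k] k by simp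
      qed
      finally show ?thesis by (simp add: c_def)
    qed
    have "real (index_count \<xi> d \<epsilon>) \<le> (\<Sum>k=1..d. c k * y ^ k)"
      unfolding index_count_def of_nat_sum by (intro sum_mono ck)
    also have "\<dots> = c d * y ^ d + (\<Sum>k=1..<d. c k * y ^ k)"
    proof -
      have "{1..d} = insert d {1..<d}" using d by auto
      then show ?thesis by simp
    qed
    also have "(\<Sum>k=1..<d. c k * y ^ k) \<le> (\<Sum>k=1..<d. c k * y ^ (d - 1))"
      using c y1 by (intro sum_mono mult_left_mono power_increasing) (auto intro: less_imp_le)
    also have "\<dots> = D * y ^ (d - 1)" by (simp add: D_def sum_distrib_right)
    also have "c d * y ^ d + D * y ^ (d - 1) \<le> c d * (y + K) ^ d"
    proof -
      have "real d * K * y ^ (d - 1) \<le> (y + K) ^ d - y ^ d"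
        using power_diff_ge[of y K "d - 1"] y1 K0 d by simp
      then have "c d * (real d * K * y ^ (d - 1)) \<le> c d * ((y + K) ^ d - y ^ d)"
        using cd by (intro mult_left_mono) auto
      moreover have "c d * (real d * K * y ^ (d - 1)) = D * y ^ (d - 1)"
        using cd d by (simp add: K_def)
      ultimately show ?thesis unfolding right_diff_distrib by linarith
    qed
    finally have N: "real (index_count \<xi> d \<epsilon>) \<le> c d * (y + K) ^ d" by simp
    have yK: "0 < y + K" using y1 K0 by simp
    have pw: "((y + K) ^ d) powr (1 / real d) = y + K"
      using yK d by (simp add: powr_realpow[symmetric] powr_powr)
    have "real (index_count \<xi> d \<epsilon>) powr (1 / real d) \<le> (c d * (y + K) ^ d) powr (1 / real d)"
      using N by (intro powr_mono2) auto
    also have "\<dots> = c d powr (1 / real d) * (y + K)"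
      using cd yK by (simp add: powr_mult pw)
    finally have N1: "real (index_count \<xi> d \<epsilon>) powr (1 / real d) \<le> c d powr (1 / real d) * (y + K)" .
    have r0: "0 \<le> rate \<xi> d" by (simp add: rate_def)
    \<comment> \<open>The product under the root is \<open>(d - 1)! / d! = 1 / d\<close>, since the
      products of logarithms cancel.\<close>
    have rc: "rate \<xi> d * c d powr (1 / real d) \<le> 1"
    proof -
      have "rate \<xi> d * c d powr (1 / real d) = (fact (d - 1) * prod a {1..d} * c d) powr (1 / real d)"
        unfolding rate_def a_def using pa[of d] cd by (subst powr_mult[symmetric]) (auto simp: a_def)
      also have "fact (d - 1) * prod a {1..d} * c d = 1 / real d"
      proof -
        have "fact d = real d * fact (d - 1)" using d by (simp add: fact_reduce)
        moreover have "fact (d - 1) * q * (1 / (real d * fact (d - 1) * q)) = 1 / real d" if "0 < q" for q :: real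
          using that d by simp
        ultimately show ?thesis using pa[OF order_refl] unfolding c_def by metis
      qed
      also have "(1 / real d) powr (1 / real d) \<le> 1 powr (1 / real d)"
        using d by (intro powr_mono2) auto
      finally show ?thesis by simp
    qed
    have "\<beta> * real (index_count \<xi> d \<epsilon>) powr (1 / real d)
      \<le> rate \<xi> d * real (index_count \<xi> d \<epsilon>) powr (1 / real d)"
      using \<beta> by (intro mult_right_mono) auto
    also have "\<dots> \<le> rate \<xi> d * (c d powr (1 / real d) * (y + K))"
      using N1 r0 by (rule mult_left_mono)
    also have "\<dots> \<le> 1 * (y + K)"
      unfolding mult.assoc[symmetric] using rc yK by (intro mult_right_mono) auto
    finally show ?thesis by (simp add: y_def s_def)
  qed
  show ?thesis
  proof (intro exI[of _ "exp (A + 1 + K)"] conjI ballI)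
    fix \<epsilon> :: real assume e: "\<epsilon> \<in> {0<..<1}"
    have "\<epsilon> = exp (ln \<epsilon>)" using e by simp
    also have "\<dots> \<le> exp (A + 1 + K + (- \<beta> * real (index_count \<xi> d \<epsilon>) powr (1 / real d)))"
      using bound[OF e] by simp
    finally show "\<epsilon> \<le> exp (A + 1 + K) * exp (- \<beta> * real (index_count \<xi> d \<epsilon>) powr (1 / real d))"
      by (simp only: exp_add)
  qed simp
qed

section \<open>Polynomial approximation with the index sets\<close>

lemma sum_PiE_insert:
  fixes g :: "('a \<Rightarrow> 'b) \<Rightarrow> 'c::comm_monoid_add"
  assumes "i \<notin> I"
  shows "sum g (PiE (insert i I) B) = (\<Sum>n\<in>B i. \<Sum>\<mu>\<in>PiE I B. g (\<mu>(i := n)))"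
  unfolding PiE_insert_eq sum.cartesian_product
  by (subst sum.reindex[OF inj_combinator[OF assms]]) (simp add: case_prod_beta o_def)

text \<open>Expansion in one coordinate after the other. \<open>F\<close> and \<open>B\<close> are
  quantified inside because the induction hypothesis is applied to the coefficient functions in the
  new coordinate, with bounds \<open>B * (2 / \<rho> i ^ n)\<close>, whereas \<open>D\<close> must
  be common to all of them. That decay beats the growth of the Chebyshev factor, at most
  \<open>\<sigma> ^ n \<le> (\<tau> * \<rho> i) ^ n\<close>. The dependence condition makes
  \<open>F\<close> constant in the base case.\<close>

lemma box_cheb_expansion:
  fixes V W :: "nat \<Rightarrow> complex set" and \<rho> :: "nat \<Rightarrow> real"
  assumes "finite I"
    and V: "\<And>i. i \<in> I \<Longrightarrow> open (V i) \<and> convex (V i) \<and> W i \<subseteq> V i"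
    and \<rho>: "\<And>i. i \<in> I \<Longrightarrow> 0 < \<rho> i" "\<And>i w. i \<in> I \<Longrightarrow> cmod w = \<rho> i \<Longrightarrow> joukowski w \<in> V i"
    and W: "\<And>i z. i \<in> I \<Longrightarrow> z \<in> W i \<Longrightarrow> \<exists>v. joukowski v = z \<and> 1 \<le> cmod v \<and> cmod v \<le> \<sigma>"
    and \<sigma>: "\<And>i. i \<in> I \<Longrightarrow> \<sigma> \<le> \<tau> * \<rho> i" "0 \<le> \<sigma>" and \<tau>: "0 \<le> \<tau>" "\<tau> < 1"
  shows "\<exists>D\<ge>0. \<forall>F B. hol_on_box I V F \<longrightarrow> (\<forall>z\<in>Pi I V. cmod (F z) \<le> B) \<longrightarrow>
     (\<forall>z z'. (\<forall>i\<in>I. z i = z' i) \<longrightarrow> F z = F z') \<longrightarrow>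
     (\<exists>a. (\<forall>\<nu>\<in>I \<rightarrow>\<^sub>E UNIV. cmod (a \<nu>) \<le> B * (\<Prod>i\<in>I. 2 / \<rho> i ^ \<nu> i)) \<and>
       (\<forall>z\<in>Pi I W. \<forall>N\<ge>1. cmod (F z - (\<Sum>\<nu>\<in>I \<rightarrow>\<^sub>E {..<N}. a \<nu> * (\<Prod>i\<in>I. cheb_at (\<nu> i) (z i)))) \<le> B * D * \<tau> ^ N))"
  using assms(1) V \<rho> W \<sigma>(1)
proof (induction I rule: finite_induct)
  case empty
  show ?case
  proof (intro exI[of _ 0] conjI allI impI)
    fix F :: "(nat \<Rightarrow> complex) \<Rightarrow> complex" and B :: real
    assume b: "\<forall>z\<in>Pi {} V. cmod (F z) \<le> B" and dep: "\<forall>z z'. (\<forall>i\<in>{}. z i = z' i) \<longrightarrow> F z = F z'"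
    have "F z = F (\<lambda>_. 0)" for z using dep by blast
    then show "\<exists>a. (\<forall>\<nu>\<in>{} \<rightarrow>\<^sub>E UNIV. cmod (a \<nu>) \<le> B * (\<Prod>i\<in>{}. 2 / \<rho> i ^ \<nu> i)) \<and>
       (\<forall>z\<in>Pi {} W. \<forall>N\<ge>1. cmod (F z - (\<Sum>\<nu>\<in>{} \<rightarrow>\<^sub>E {..<N}. a \<nu> * (\<Prod>i\<in>{}. cheb_at (\<nu> i) (z i)))) \<le> B * 0 * \<tau> ^ N)"
      using b by (intro exI[of _ "\<lambda>_. F (\<lambda>_. 0)"]) auto
  qed simp
next
  case (insert i I)
  have "\<exists>D\<ge>0. \<forall>F B. hol_on_box I V F \<longrightarrow> (\<forall>z\<in>Pi I V. cmod (F z) \<le> B) \<longrightarrow>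
     (\<forall>z z'. (\<forall>i\<in>I. z i = z' i) \<longrightarrow> F z = F z') \<longrightarrow>
     (\<exists>a. (\<forall>\<nu>\<in>I \<rightarrow>\<^sub>E UNIV. cmod (a \<nu>) \<le> B * (\<Prod>i\<in>I. 2 / \<rho> i ^ \<nu> i)) \<and>
       (\<forall>z\<in>Pi I W. \<forall>N\<ge>1. cmod (F z - (\<Sum>\<nu>\<in>I \<rightarrow>\<^sub>E {..<N}. a \<nu> * (\<Prod>i\<in>I. cheb_at (\<nu> i) (z i)))) \<le> B * D * \<tau> ^ N))"
  proof (rule insert.IH)
    show "\<exists>v. joukowski v = z \<and> 1 \<le> cmod v \<and> cmod v \<le> \<sigma>" if "j \<in> I" "z \<in> W j" for j z
      using insert.prems(4)[of j z] that by blast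
  qed (use insert.prems in auto)
  then obtain D where D: "0 \<le> D" and
    IH: "\<And>F B. hol_on_box I V F \<Longrightarrow> (\<forall>z\<in>Pi I V. cmod (F z) \<le> B) \<Longrightarrow>
     (\<forall>z z'. (\<forall>i\<in>I. z i = z' i) \<longrightarrow> F z = F z') \<Longrightarrow>
     (\<exists>a. (\<forall>\<nu>\<in>I \<rightarrow>\<^sub>E UNIV. cmod (a \<nu>) \<le> B * (\<Prod>i\<in>I. 2 / \<rho> i ^ \<nu> i)) \<and>
       (\<forall>z\<in>Pi I W. \<forall>N\<ge>1. cmod (F z - (\<Sum>\<nu>\<in>I \<rightarrow>\<^sub>E {..<N}. a \<nu> * (\<Prod>i\<in>I. cheb_at (\<nu> i) (z i)))) \<le> B * D * \<tau> ^ N))"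
    by blast
  \<comment> \<open>The 1 stands for the remainder in the new coordinate, the \<open>D\<close> for
    the errors of its coefficients, summed as a geometric series in \<tau>.\<close>
  define D' where "D' = 2 / (1 - \<tau>) * (1 + D)"
  have Vi: "open (V i)" "convex (V i)" "W i \<subseteq> V i" and \<rho>i: "0 < \<rho> i" "\<And>w. cmod w = \<rho> i \<Longrightarrow> joukowski w \<in> V i"
    and \<sigma>i: "\<sigma> \<le> \<tau> * \<rho> i" using insert.prems by auto
  show ?case
  proof (intro exI[of _ D'] conjI allI impI)
    show "0 \<le> D'" using D \<tau> by (simp add: D'_def)
    fix F :: "(nat \<Rightarrow> complex) \<Rightarrow> complex" and B :: real
    assume hol: "hol_on_box (insert i I) V F" and B: "\<forall>z\<in>Pi (insert i I) V. cmod (F z) \<le> B"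
      and dep: "\<forall>z z'. (\<forall>i\<in>insert i I. z i = z' i) \<longrightarrow> F z = F z'"
    let ?C = "\<lambda>n. box_cheb_coeff (\<rho> i) i n F"
    have hC: "hol_on_box I V (?C n)" for n
      by (rule hol_on_box_cheb_coeff[OF hol _ insert.hyps(2) \<rho>i]) (use insert.prems(1) in auto)
    have one: "(\<lambda>u. F (z(i := u))) holomorphic_on V i" "\<And>u. u \<in> V i \<Longrightarrow> cmod (F (z(i := u))) \<le> B"
      if z: "z \<in> Pi I V" for z
    proof -
      have up: "z(i := u) \<in> Pi (insert i I) V" if "u \<in> V i" for u
        using z that insert.hyps(2) by auto
      show "\<And>u. u \<in> V i \<Longrightarrow> cmod (F (z(i := u))) \<le> B" using up B by blast
      \<comment> \<open>Coordinate \<open>i\<close> of \<open>z\<close> is unconstrained here, so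
        some point of \<open>V i\<close> has to be inserted before holomorphy on the larger box can
        be used.\<close>
      have "joukowski (of_real (\<rho> i)) \<in> V i" using \<rho>i by auto
      from hol_on_box_hol[OF hol up[OF this] insertI1]
      show "(\<lambda>u. F (z(i := u))) holomorphic_on V i" by simp
    qed
    have bC: "\<forall>z\<in>Pi I V. cmod (?C n z) \<le> B * (2 / \<rho> i ^ n)" for n
    proof
      fix z assume z: "z \<in> Pi I V"
      show "cmod (?C n z) \<le> B * (2 / \<rho> i ^ n)" unfolding box_cheb_coeff_def
        by (rule norm_cheb_coeff_le[OF holomorphic_on_imp_continuous_on[OF one(1)[OF z]] \<rho>i one(2)[OF z]])
    qed
    have dC: "\<forall>z z'. (\<forall>i\<in>I. z i = z' i) \<longrightarrow> ?C n z = ?C n z'" for n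
    proof (intro allI impI)
      fix z z' :: "nat \<Rightarrow> complex" assume "\<forall>i\<in>I. z i = z' i"
      then have "F (z(i := u)) = F (z'(i := u))" for u by (intro dep[rule_format]) auto
      then show "?C n z = ?C n z'" by (simp add: box_cheb_coeff_def)
    qed
    have "\<forall>n. \<exists>a. (\<forall>\<nu>\<in>I \<rightarrow>\<^sub>E UNIV. cmod (a \<nu>) \<le> B * (2 / \<rho> i ^ n) * (\<Prod>i\<in>I. 2 / \<rho> i ^ \<nu> i)) \<and>
       (\<forall>z\<in>Pi I W. \<forall>N\<ge>1. cmod (?C n z - (\<Sum>\<nu>\<in>I \<rightarrow>\<^sub>E {..<N}. a \<nu> * (\<Prod>i\<in>I. cheb_at (\<nu> i) (z i)))) \<le> B * (2 / \<rho> i ^ n) * D * \<tau> ^ N)"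
      by (intro allI IH[OF hC bC dC])
    from choice[OF this] obtain a where a: "\<forall>n. (\<forall>\<nu>\<in>I \<rightarrow>\<^sub>E UNIV. cmod (a n \<nu>) \<le> B * (2 / \<rho> i ^ n) * (\<Prod>i\<in>I. 2 / \<rho> i ^ \<nu> i)) \<and>
       (\<forall>z\<in>Pi I W. \<forall>N\<ge>1. cmod (?C n z - (\<Sum>\<nu>\<in>I \<rightarrow>\<^sub>E {..<N}. a n \<nu> * (\<Prod>i\<in>I. cheb_at (\<nu> i) (z i)))) \<le> B * (2 / \<rho> i ^ n) * D * \<tau> ^ N)" ..
    have a1: "\<And>n \<nu>. \<nu>\<in>I \<rightarrow>\<^sub>E UNIV \<Longrightarrow> cmod (a n \<nu>) \<le> B * (2 / \<rho> i ^ n) * (\<Prod>i\<in>I. 2 / \<rho> i ^ \<nu> i)"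
      and a2: "\<And>n z N. z\<in>Pi I W \<Longrightarrow> N\<ge>1 \<Longrightarrow> cmod (?C n z - (\<Sum>\<nu>\<in>I \<rightarrow>\<^sub>E {..<N}. a n \<nu> * (\<Prod>i\<in>I. cheb_at (\<nu> i) (z i)))) \<le> B * (2 / \<rho> i ^ n) * D * \<tau> ^ N"
      using a by auto
    define b where "b \<nu> = a (\<nu> i) (restrict \<nu> I)" for \<nu>
    have pr: "(\<Prod>j\<in>I. f j ((\<mu>(i := n)) j)) = (\<Prod>j\<in>I. f j (\<mu> j))" for f :: "nat \<Rightarrow> nat \<Rightarrow> complex" and \<mu> n
      using insert.hyps by (intro prod.cong) auto
    have b2: "b (\<mu>(i := n)) = a n \<mu>" if "\<mu> \<in> I \<rightarrow>\<^sub>E S" for \<mu> n S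
    proof -
      have "restrict (\<mu>(i := n)) I = \<mu>"
        using that insert.hyps(2) by (auto simp: fun_eq_iff PiE_def extensional_def)
      then show ?thesis by (simp add: b_def)
    qed
    have bb: "cmod (b \<nu>) \<le> B * (\<Prod>i\<in>insert i I. 2 / \<rho> i ^ \<nu> i)" for \<nu>
    proof -
      have "cmod (b \<nu>) \<le> B * (2 / \<rho> i ^ \<nu> i) * (\<Prod>j\<in>I. 2 / \<rho> j ^ restrict \<nu> I j)"
        unfolding b_def by (rule a1) auto
      also have "(\<Prod>j\<in>I. 2 / \<rho> j ^ restrict \<nu> I j) = (\<Prod>j\<in>I. 2 / \<rho> j ^ \<nu> j)" by (intro prod.cong) auto
      finally show ?thesis using insert.hyps by (simp add: mult.assoc)
    qed
    have err: "cmod (F z - (\<Sum>\<nu>\<in>insert i I \<rightarrow>\<^sub>E {..<N}. b \<nu> * (\<Prod>i\<in>insert i I. cheb_at (\<nu> i) (z i)))) \<le> B * D' * \<tau> ^ N"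
      if z: "z \<in> Pi (insert i I) W" and N: "1 \<le> N" for z N
    proof -
      have zI: "z \<in> Pi I W" "z \<in> Pi I V" "z i \<in> W i" "z i \<in> V i"
        using z insert.prems(1) by (auto simp: Pi_iff)
      obtain v where v: "joukowski v = z i" "1 \<le> cmod v" "cmod v \<le> \<sigma>" using insert.prems(4)[of i "z i"] zI by auto
      have B0: "0 \<le> B" using one(2)[OF zI(2,4)] norm_ge_zero order_trans by blast
      have "cmod ((\<lambda>u. F (z(i := u))) (joukowski v) - (\<Sum>n<N. cheb_coeff (\<rho> i) (\<lambda>u. F (z(i := u))) n * cheb_at n (joukowski v)))
         \<le> B * (2 * \<tau> ^ N / (1 - \<tau>))"
        by (rule cheb_expansion[OF Vi(2,1) one(1)[OF zI(2)] \<rho>i _ one(2)[OF zI(2)] v(2) _ \<tau> N])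
           (use v \<sigma>i zI in auto)
      then have e1: "cmod (F z - (\<Sum>n<N. ?C n z * cheb_at n (z i))) \<le> B * (2 * \<tau> ^ N / (1 - \<tau>))"
        using v(1) by (simp add: box_cheb_coeff_def)
      define S where "S n = (\<Sum>\<nu>\<in>I \<rightarrow>\<^sub>E {..<N}. a n \<nu> * (\<Prod>i\<in>I. cheb_at (\<nu> i) (z i)))" for n
      have "(\<Sum>\<nu>\<in>insert i I \<rightarrow>\<^sub>E {..<N}. b \<nu> * (\<Prod>i\<in>insert i I. cheb_at (\<nu> i) (z i)))
        = (\<Sum>n<N. \<Sum>\<mu>\<in>I \<rightarrow>\<^sub>E {..<N}. b (\<mu>(i := n)) * (cheb_at n (z i) * (\<Prod>j\<in>I. cheb_at (\<mu> j) (z j))))"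
        unfolding sum_PiE_insert[OF insert.hyps(2)]
        using insert.hyps pr[of "\<lambda>j k. cheb_at k (z j)"] by (intro sum.cong refl) simp
      also have "\<dots> = (\<Sum>n<N. S n * cheb_at n (z i))"
        unfolding S_def sum_distrib_right using b2 by (intro sum.cong refl) (simp add: mult_ac)
      finally have eq: "(\<Sum>\<nu>\<in>insert i I \<rightarrow>\<^sub>E {..<N}. b \<nu> * (\<Prod>i\<in>insert i I. cheb_at (\<nu> i) (z i))) = (\<Sum>n<N. S n * cheb_at n (z i))" .
      have "cmod ((\<Sum>n<N. ?C n z * cheb_at n (z i)) - (\<Sum>n<N. S n * cheb_at n (z i)))
         \<le> (\<Sum>n<N. cmod ((?C n z - S n) * cheb_at n (z i)))"
        unfolding sum_subtractf[symmetric] left_diff_distrib[symmetric] by (rule norm_sum)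
      also have "\<dots> \<le> (\<Sum>n<N. (2 * B * D * \<tau> ^ N) * \<tau> ^ n)"
      proof (rule sum_mono)
        fix n
        have "cmod (cheb_at n (z i)) \<le> \<sigma> ^ n" using norm_cheb_at_joukowski_le[OF v(2,3)] v(1) by simp
        also have "\<dots> \<le> (\<tau> * \<rho> i) ^ n" using \<sigma>i \<sigma>(2) by (intro power_mono) auto
        finally have c: "cmod (cheb_at n (z i)) \<le> \<tau> ^ n * \<rho> i ^ n" by (simp add: power_mult_distrib)
        have "cmod ((?C n z - S n) * cheb_at n (z i)) \<le> (B * (2 / \<rho> i ^ n) * D * \<tau> ^ N) * (\<tau> ^ n * \<rho> i ^ n)"
          unfolding norm_mult using a2[OF zI(1) N, of n] c B0 D \<tau> \<rho>i(1)
          by (intro mult_mono) (auto simp: S_def)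
        also have "\<dots> = (2 * B * D * \<tau> ^ N) * \<tau> ^ n" using \<rho>i(1) by simp
        finally show "cmod ((?C n z - S n) * cheb_at n (z i)) \<le> \<dots>" .
      qed
      also have "\<dots> = (2 * B * D * \<tau> ^ N) * ((1 - \<tau> ^ N) / (1 - \<tau>))"
        using \<tau> by (simp add: sum_distrib_left[symmetric] sum_gp_strict)
      also have "\<dots> \<le> (2 * B * D * \<tau> ^ N) * (1 / (1 - \<tau>))"
        using \<tau> B0 D by (intro mult_left_mono divide_right_mono) auto
      finally have e2: "cmod ((\<Sum>n<N. ?C n z * cheb_at n (z i)) - (\<Sum>n<N. S n * cheb_at n (z i))) \<le> (2 * B * D * \<tau> ^ N) * (1 / (1 - \<tau>))" .
      have "cmod (F z - (\<Sum>n<N. S n * cheb_at n (z i))) \<le> B * (2 * \<tau> ^ N / (1 - \<tau>)) + (2 * B * D * \<tau> ^ N) * (1 / (1 - \<tau>))"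
        using norm_triangle_le[OF add_mono[OF e1 e2]] by simp
      also have "\<dots> = B * D' * \<tau> ^ N" by (simp add: D'_def divide_inverse algebra_simps)
      finally show ?thesis unfolding eq .
    qed
    show "\<exists>a. (\<forall>\<nu>\<in>insert i I \<rightarrow>\<^sub>E UNIV. cmod (a \<nu>) \<le> B * (\<Prod>i\<in>insert i I. 2 / \<rho> i ^ \<nu> i)) \<and>
       (\<forall>z\<in>Pi (insert i I) W. \<forall>N\<ge>1. cmod (F z - (\<Sum>\<nu>\<in>insert i I \<rightarrow>\<^sub>E {..<N}. a \<nu> * (\<Prod>i\<in>insert i I. cheb_at (\<nu> i) (z i)))) \<le> B * D' * \<tau> ^ N)"
      using bb err by (intro exI[of _ b]) auto
  qed
qed

text \<open>Since \<open>\<sigma> * \<xi> i \<le> \<tau> * \<rho> i\<close>, each term outside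
  \<Lambda> is at most \<kappa> times a product of powers \<open>\<tau> ^ \<nu> i\<close>. These sum
  to \<open>(1 / (1 - \<tau>)) ^ card I\<close> over all multi-indices, so the error does not depend
  on the size or shape of \<Lambda>. The coefficients are chosen before \<Lambda> and
  \<kappa>.\<close>

lemma box_cheb_truncation:
  fixes V W :: "nat \<Rightarrow> complex set" and \<rho> \<xi> :: "nat \<Rightarrow> real"
  assumes I: "finite I"
    and V: "\<And>i. i \<in> I \<Longrightarrow> open (V i) \<and> convex (V i) \<and> W i \<subseteq> V i"
    and \<rho>: "\<And>i. i \<in> I \<Longrightarrow> 0 < \<rho> i" "\<And>i w. i \<in> I \<Longrightarrow> cmod w = \<rho> i \<Longrightarrow> joukowski w \<in> V i"
    and W: "\<And>i z. i \<in> I \<Longrightarrow> z \<in> W i \<Longrightarrow> \<exists>v. joukowski v = z \<and> 1 \<le> cmod v \<and> cmod v \<le> \<sigma>"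
    and \<sigma>: "\<And>i. i \<in> I \<Longrightarrow> \<sigma> * \<xi> i \<le> \<tau> * \<rho> i" "0 \<le> \<sigma>" and \<tau>: "0 \<le> \<tau>" "\<tau> < 1"
    and \<xi>: "\<And>i. i \<in> I \<Longrightarrow> 1 \<le> \<xi> i"
    and hol: "hol_on_box I V F" and B: "\<And>z. z \<in> Pi I V \<Longrightarrow> cmod (F z) \<le> B"
    and dep: "\<And>z z'. (\<And>i. i \<in> I \<Longrightarrow> z i = z' i) \<Longrightarrow> F z = F z'"
  obtains a where "\<And>\<Lambda> \<kappa> z. finite \<Lambda> \<Longrightarrow> \<Lambda> \<subseteq> I \<rightarrow>\<^sub>E UNIV \<Longrightarrow> z \<in> Pi I W \<Longrightarrow>
      (\<And>\<nu>. \<nu> \<in> I \<rightarrow>\<^sub>E UNIV \<Longrightarrow> \<nu> \<notin> \<Lambda> \<Longrightarrow> (\<Prod>i\<in>I. 1 / \<xi> i ^ \<nu> i) \<le> \<kappa>) \<Longrightarrow> 0 \<le> \<kappa> \<Longrightarrow>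
      cmod (F z - (\<Sum>\<nu>\<in>\<Lambda>. a \<nu> * (\<Prod>i\<in>I. cheb_at (\<nu> i) (z i)))) \<le> B * (2 / (1 - \<tau>)) ^ card I * \<kappa>"
proof -
  have \<sigma>1: "\<sigma> \<le> \<tau> * \<rho> i" if "i \<in> I" for i
  proof -
    have "\<sigma> * 1 \<le> \<sigma> * \<xi> i" using \<xi>[OF that] \<sigma>(2) by (intro mult_left_mono) auto
    then show ?thesis using \<sigma>(1)[OF that] by simp
  qed
  have "\<exists>D\<ge>0. \<forall>F B. hol_on_box I V F \<longrightarrow> (\<forall>z\<in>Pi I V. cmod (F z) \<le> B) \<longrightarrow>
     (\<forall>z z'. (\<forall>i\<in>I. z i = z' i) \<longrightarrow> F z = F z') \<longrightarrow>
     (\<exists>a. (\<forall>\<nu>\<in>I \<rightarrow>\<^sub>E UNIV. cmod (a \<nu>) \<le> B * (\<Prod>i\<in>I. 2 / \<rho> i ^ \<nu> i)) \<and>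
       (\<forall>z\<in>Pi I W. \<forall>N\<ge>1. cmod (F z - (\<Sum>\<nu>\<in>I \<rightarrow>\<^sub>E {..<N}. a \<nu> * (\<Prod>i\<in>I. cheb_at (\<nu> i) (z i)))) \<le> B * D * \<tau> ^ N))"
    by (rule box_cheb_expansion[where \<sigma>=\<sigma>], rule I, rule V, assumption, rule \<rho>(1), assumption,
        rule \<rho>(2), assumption, assumption, rule W, assumption, assumption, rule \<sigma>1, assumption,
        rule \<sigma>(2), rule \<tau>(1), rule \<tau>(2))
  then obtain D where D: "0 \<le> D" and
    ex: "\<And>F B. hol_on_box I V F \<Longrightarrow> (\<forall>z\<in>Pi I V. cmod (F z) \<le> B) \<Longrightarrow>
     (\<forall>z z'. (\<forall>i\<in>I. z i = z' i) \<longrightarrow> F z = F z') \<Longrightarrow>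
     (\<exists>a. (\<forall>\<nu>\<in>I \<rightarrow>\<^sub>E UNIV. cmod (a \<nu>) \<le> B * (\<Prod>i\<in>I. 2 / \<rho> i ^ \<nu> i)) \<and>
       (\<forall>z\<in>Pi I W. \<forall>N\<ge>1. cmod (F z - (\<Sum>\<nu>\<in>I \<rightarrow>\<^sub>E {..<N}. a \<nu> * (\<Prod>i\<in>I. cheb_at (\<nu> i) (z i)))) \<le> B * D * \<tau> ^ N))"
    by blast
  have "\<forall>z\<in>Pi I V. cmod (F z) \<le> B" "\<forall>z z'. (\<forall>i\<in>I. z i = z' i) \<longrightarrow> F z = F z'"
    by (blast intro: B) (intro allI impI dep, blast)
  from ex[OF hol this]
  obtain a where a: "(\<forall>\<nu>\<in>I \<rightarrow>\<^sub>E UNIV. cmod (a \<nu>) \<le> B * (\<Prod>i\<in>I. 2 / \<rho> i ^ \<nu> i)) \<and>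
       (\<forall>z\<in>Pi I W. \<forall>N\<ge>1. cmod (F z - (\<Sum>\<nu>\<in>I \<rightarrow>\<^sub>E {..<N}. a \<nu> * (\<Prod>i\<in>I. cheb_at (\<nu> i) (z i)))) \<le> B * D * \<tau> ^ N)" ..
  have a1: "\<And>\<nu>. \<nu>\<in>I \<rightarrow>\<^sub>E UNIV \<Longrightarrow> cmod (a \<nu>) \<le> B * (\<Prod>i\<in>I. 2 / \<rho> i ^ \<nu> i)"
    and a2: "\<And>z N. z\<in>Pi I W \<Longrightarrow> N\<ge>1 \<Longrightarrow> cmod (F z - (\<Sum>\<nu>\<in>I \<rightarrow>\<^sub>E {..<N}. a \<nu> * (\<Prod>i\<in>I. cheb_at (\<nu> i) (z i)))) \<le> B * D * \<tau> ^ N"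
    using a by auto
  show thesis
  proof (rule that[of a])
    fix \<Lambda> \<kappa> and z :: "nat \<Rightarrow> complex"
    assume fin: "finite \<Lambda>" and sub: "\<Lambda> \<subseteq> I \<rightarrow>\<^sub>E UNIV" and z: "z \<in> Pi I W"
      and out: "\<And>\<nu>. \<nu> \<in> I \<rightarrow>\<^sub>E UNIV \<Longrightarrow> \<nu> \<notin> \<Lambda> \<Longrightarrow> (\<Prod>i\<in>I. 1 / \<xi> i ^ \<nu> i) \<le> \<kappa>" and \<kappa>: "0 \<le> \<kappa>"
    have zV: "z \<in> Pi I V" using z V by (auto simp: Pi_iff)
    have B0: "0 \<le> B" using B[OF zV] norm_ge_zero order_trans by blast
    let ?t = "\<lambda>\<nu>. a \<nu> * (\<Prod>i\<in>I. cheb_at (\<nu> i) (z i))"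
    let ?K = "B * (2 / (1 - \<tau>)) ^ card I * \<kappa>"
    \<comment> \<open>A size from which on the boxes of indices below \<open>N\<close> contain
      \<Lambda>; inserting 0 covers the empty case.\<close>
    define N0 where "N0 = Suc (Max (insert 0 ((\<lambda>(\<nu>, i). \<nu> i) ` (\<Lambda> \<times> I))))"
    have box: "\<Lambda> \<subseteq> I \<rightarrow>\<^sub>E {..<N}" if "N0 \<le> N" for N
    proof
      fix \<nu> assume \<nu>: "\<nu> \<in> \<Lambda>"
      have "\<nu> i < N" if i: "i \<in> I" for i
      proof -
        have "\<nu> i \<le> Max (insert 0 ((\<lambda>(\<nu>, i). \<nu> i) ` (\<Lambda> \<times> I)))"
          using fin I \<nu> i by (intro Max_ge) force+
        then show ?thesis using \<open>N0 \<le> N\<close> by (simp add: N0_def)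
      qed
      then show "\<nu> \<in> I \<rightarrow>\<^sub>E {..<N}" using sub \<nu> by (auto simp: PiE_iff)
    qed
    have trm: "cmod (?t \<nu>) \<le> B * 2 ^ card I * \<kappa> * (\<Prod>i\<in>I. \<tau> ^ \<nu> i)" if \<nu>: "\<nu> \<in> I \<rightarrow>\<^sub>E UNIV" "\<nu> \<notin> \<Lambda>" for \<nu>
    proof -
      have "cmod (?t \<nu>) \<le> (B * (\<Prod>i\<in>I. 2 / \<rho> i ^ \<nu> i)) * (\<Prod>i\<in>I. \<sigma> ^ \<nu> i)"
        unfolding norm_mult
      proof (intro mult_mono a1 \<nu>)
        show "cmod (\<Prod>i\<in>I. cheb_at (\<nu> i) (z i)) \<le> (\<Prod>i\<in>I. \<sigma> ^ \<nu> i)"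
          unfolding prod_norm[symmetric]
        proof (intro prod_mono conjI norm_ge_zero)
          fix i assume i: "i \<in> I"
          obtain v where "joukowski v = z i" "1 \<le> cmod v" "cmod v \<le> \<sigma>" using W[OF i, of "z i"] z i by auto
          then show "cmod (cheb_at (\<nu> i) (z i)) \<le> \<sigma> ^ \<nu> i" using norm_cheb_at_joukowski_le by metis
        qed
        show "0 \<le> B * (\<Prod>i\<in>I. 2 / \<rho> i ^ \<nu> i)"
          using B0 \<rho>(1) by (intro mult_nonneg_nonneg prod_nonneg) (auto intro: less_imp_le)
      qed simp
      also have "\<dots> = B * (\<Prod>i\<in>I. 2 * (\<sigma> / \<rho> i) ^ \<nu> i)"
        by (simp add: prod.distrib[symmetric] mult.assoc power_divide)
      also have "\<dots> \<le> B * (\<Prod>i\<in>I. 2 * (\<tau> ^ \<nu> i * (1 / \<xi> i ^ \<nu> i)))"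
      proof (intro mult_left_mono[OF _ B0] prod_mono conjI)
        fix i assume i: "i \<in> I"
        have r: "0 < \<rho> i" "0 < \<xi> i" using \<rho>(1)[OF i] \<xi>[OF i] by auto
        show "0 \<le> 2 * (\<sigma> / \<rho> i) ^ \<nu> i" using r \<sigma>(2) by simp
        have "\<sigma> / \<rho> i \<le> \<tau> / \<xi> i" using r \<sigma>(1)[OF i] by (simp add: field_simps)
        then have "(\<sigma> / \<rho> i) ^ \<nu> i \<le> (\<tau> / \<xi> i) ^ \<nu> i" using r \<sigma>(2) by (intro power_mono) auto
        then show "2 * (\<sigma> / \<rho> i) ^ \<nu> i \<le> 2 * (\<tau> ^ \<nu> i * (1 / \<xi> i ^ \<nu> i))" by (simp add: power_divide)
      qed
      also have "\<dots> = B * 2 ^ card I * ((\<Prod>i\<in>I. \<tau> ^ \<nu> i) * (\<Prod>i\<in>I. 1 / \<xi> i ^ \<nu> i))"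
        by (simp only: prod.distrib prod_constant mult.assoc)
      also have "\<dots> \<le> B * 2 ^ card I * ((\<Prod>i\<in>I. \<tau> ^ \<nu> i) * \<kappa>)"
        using B0 \<tau> out[OF \<nu>] by (intro mult_left_mono prod_nonneg) auto
      finally show ?thesis by (simp add: mult_ac)
    qed
    have main: "cmod (F z - (\<Sum>\<nu>\<in>\<Lambda>. ?t \<nu>)) \<le> B * D * \<tau> ^ N + ?K" if N: "N0 \<le> N" for N
    proof -
      have N1: "1 \<le> N" using N by (simp add: N0_def)
      have fb: "finite (I \<rightarrow>\<^sub>E {..<N})" using I by (intro finite_PiE) auto
      have "F z - (\<Sum>\<nu>\<in>\<Lambda>. ?t \<nu>) = (F z - (\<Sum>\<nu>\<in>I \<rightarrow>\<^sub>E {..<N}. ?t \<nu>)) + (\<Sum>\<nu>\<in>(I \<rightarrow>\<^sub>E {..<N}) - \<Lambda>. ?t \<nu>)"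
        using sum.subset_diff[OF box[OF N] fb, of ?t] by simp
      also have "cmod \<dots> \<le> B * D * \<tau> ^ N + (\<Sum>\<nu>\<in>(I \<rightarrow>\<^sub>E {..<N}) - \<Lambda>. B * 2 ^ card I * \<kappa> * (\<Prod>i\<in>I. \<tau> ^ \<nu> i))"
        by (intro norm_triangle_le add_mono a2[OF z N1] sum_norm_le trm) auto
      also have "(\<Sum>\<nu>\<in>(I \<rightarrow>\<^sub>E {..<N}) - \<Lambda>. B * 2 ^ card I * \<kappa> * (\<Prod>i\<in>I. \<tau> ^ \<nu> i))
         \<le> (\<Sum>\<nu>\<in>I \<rightarrow>\<^sub>E {..<N}. B * 2 ^ card I * \<kappa> * (\<Prod>i\<in>I. \<tau> ^ \<nu> i))"
        using fb B0 \<kappa> \<tau> by (intro sum_mono2 mult_nonneg_nonneg prod_nonneg) auto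
      also have "\<dots> = B * 2 ^ card I * \<kappa> * (\<Prod>i\<in>I. \<Sum>n<N. \<tau> ^ n)"
        using I by (subst prod_sum_PiE) (auto simp: sum_distrib_left)
      also have "\<dots> \<le> B * 2 ^ card I * \<kappa> * (\<Prod>i\<in>I. 1 / (1 - \<tau>))"
        using B0 \<kappa> \<tau> by (intro mult_left_mono prod_mono conjI sum_nonneg)
          (auto simp: sum_gp_strict divide_right_mono)
      also have "\<dots> = ?K" by (simp add: power_divide)
      finally show ?thesis by simp
    qed
    \<comment> \<open>Letting the box of indices grow removes the remainder of the full expansion,
      and with it the constant \<open>D\<close>.\<close>
    have "(\<lambda>N. B * D * \<tau> ^ N + ?K) \<longlonglongrightarrow> B * D * 0 + ?K"
      by (intro tendsto_intros LIMSEQ_realpow_zero \<tau>)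
    then show "cmod (F z - (\<Sum>\<nu>\<in>\<Lambda>. ?t \<nu>)) \<le> ?K"
      by (intro Lim_bounded2[where N=N0]) (use main in auto)
  qed
qed

text \<open>A product of Chebyshev polynomials with degrees \<nu> involves only monomials with
  exponents below \<nu>, and these stay in \<Lambda> by downward closure.\<close>

lemma cheb_sum_monomials:
  fixes b :: "(nat \<Rightarrow> nat) \<Rightarrow> real"
  assumes I: "finite I" and \<Lambda>: "finite \<Lambda>" "\<Lambda> \<subseteq> I \<rightarrow>\<^sub>E UNIV"
    and down: "\<And>\<mu> \<nu>. \<nu> \<in> \<Lambda> \<Longrightarrow> \<mu> \<in> I \<rightarrow>\<^sub>E UNIV \<Longrightarrow> (\<And>i. i \<in> I \<Longrightarrow> \<mu> i \<le> \<nu> i) \<Longrightarrow> \<mu> \<in> \<Lambda>"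
  obtains c :: "(nat \<Rightarrow> nat) \<Rightarrow> real" where
    "\<And>z. (\<Sum>\<nu>\<in>\<Lambda>. of_real (b \<nu>) * (\<Prod>i\<in>I. cheb_at (\<nu> i) (z i))) = (\<Sum>\<mu>\<in>\<Lambda>. of_real (c \<mu>) * (\<Prod>i\<in>I. z i ^ \<mu> i))"
proof
  define e where "e \<nu> \<mu> = (\<Prod>i\<in>I. coeff (cheb (\<nu> i)) (\<mu> i))" for \<nu> \<mu> :: "nat \<Rightarrow> nat"
  define le where "le \<mu> \<nu> \<longleftrightarrow> (\<forall>i\<in>I. \<mu> i \<le> \<nu> i)" for \<mu> \<nu> :: "nat \<Rightarrow> nat"
  fix z :: "nat \<Rightarrow> complex"
  have 1: "(\<Prod>i\<in>I. cheb_at (\<nu> i) (z i)) = (\<Sum>\<mu>\<in>\<Lambda>. if le \<mu> \<nu> then of_real (e \<nu> \<mu>) * (\<Prod>i\<in>I. z i ^ \<mu> i) else 0)"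
    if \<nu>: "\<nu> \<in> \<Lambda>" for \<nu>
  proof -
    have "(\<Prod>i\<in>I. cheb_at (\<nu> i) (z i)) = (\<Sum>\<mu>\<in>(\<Pi>\<^sub>E i\<in>I. {..\<nu> i}). \<Prod>i\<in>I. of_real (coeff (cheb (\<nu> i)) (\<mu> i)) * z i ^ \<mu> i)"
      unfolding cheb_at_def using I by (subst prod_sum_PiE) auto
    also have "\<dots> = (\<Sum>\<mu>\<in>(\<Pi>\<^sub>E i\<in>I. {..\<nu> i}). of_real (e \<nu> \<mu>) * (\<Prod>i\<in>I. z i ^ \<mu> i))"
      by (simp add: prod.distrib e_def)
    also have "(\<Pi>\<^sub>E i\<in>I. {..\<nu> i}) = {\<mu>\<in>\<Lambda>. le \<mu> \<nu>}"
      using down[OF \<nu>] \<Lambda>(2) by (auto simp: le_def PiE_iff)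
    also have "(\<Sum>\<mu>\<in>{\<mu>\<in>\<Lambda>. le \<mu> \<nu>}. of_real (e \<nu> \<mu>) * (\<Prod>i\<in>I. z i ^ \<mu> i))
       = (\<Sum>\<mu>\<in>\<Lambda>. if le \<mu> \<nu> then of_real (e \<nu> \<mu>) * (\<Prod>i\<in>I. z i ^ \<mu> i) else 0)"
      using \<Lambda>(1) by (rule sum.inter_filter)
    finally show ?thesis .
  qed
  have "(\<Sum>\<nu>\<in>\<Lambda>. of_real (b \<nu>) * (\<Prod>i\<in>I. cheb_at (\<nu> i) (z i)))
     = (\<Sum>\<nu>\<in>\<Lambda>. \<Sum>\<mu>\<in>\<Lambda>. of_real (if le \<mu> \<nu> then b \<nu> * e \<nu> \<mu> else 0) * (\<Prod>i\<in>I. z i ^ \<mu> i))"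
    unfolding sum_distrib_left by (intro sum.cong refl) (simp add: 1 sum_distrib_left, intro sum.cong, auto)
  also have "\<dots> = (\<Sum>\<mu>\<in>\<Lambda>. of_real (\<Sum>\<nu>\<in>\<Lambda>. if le \<mu> \<nu> then b \<nu> * e \<nu> \<mu> else 0) * (\<Prod>i\<in>I. z i ^ \<mu> i))"
    by (subst sum.swap) (simp add: sum_distrib_right)
  finally show "(\<Sum>\<nu>\<in>\<Lambda>. of_real (b \<nu>) * (\<Prod>i\<in>I. cheb_at (\<nu> i) (z i)))
     = (\<Sum>\<mu>\<in>\<Lambda>. of_real ((\<lambda>\<mu>. \<Sum>\<nu>\<in>\<Lambda>. if le \<mu> \<nu> then b \<nu> * e \<nu> \<mu> else 0) \<mu>) * (\<Prod>i\<in>I. z i ^ \<mu> i))" by simp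
qed

text \<open>The minor semi-axis equals \<zeta> exactly at
  \<open>\<rho> = \<zeta> + sqrt (1 + \<zeta>^2)\<close>, which exceeds \<open>1 + \<zeta>\<close>;
  any value strictly between the two will do. This gap is the origin of the geometric gain.\<close>

lemma ellipse_parameter:
  fixes \<zeta> :: real
  assumes "0 < \<zeta>"
  shows "\<exists>\<rho>. 1 + \<zeta> < \<rho> \<and> (\<rho> - 1 / \<rho>) / 2 < \<zeta>"
proof -
  have "1 < sqrt (1 + \<zeta>\<^sup>2)" using assms by simp
  then obtain s where s: "1 < s" "s < sqrt (1 + \<zeta>\<^sup>2)" using dense by blast
  have "s\<^sup>2 < (sqrt (1 + \<zeta>\<^sup>2))\<^sup>2" using s by (intro power_strict_mono) auto
  then have "s\<^sup>2 < 1 + \<zeta>\<^sup>2" by simp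
  then have "(\<zeta> + s)\<^sup>2 - 1 < 2 * \<zeta> * (\<zeta> + s)" by (simp add: power2_eq_square algebra_simps)
  then have "((\<zeta> + s) - 1 / (\<zeta> + s)) / 2 < \<zeta>" using assms s by (simp add: field_simps power2_eq_square)
  then show ?thesis using s by (intro exI[of _ "\<zeta> + s"]) auto
qed

theorem holomorphic_index_set_approximation:
  fixes \<zeta> \<xi> :: "nat \<Rightarrow> real"
  assumes k: "1 \<le> k" and \<zeta>: "\<And>j. j \<in> {1..k} \<Longrightarrow> 0 < \<zeta> j" and \<xi>: "\<And>j. j \<in> {1..k} \<Longrightarrow> \<xi> j = 1 + \<zeta> j"
    and hol: "hol_on_box {1..k} (\<lambda>j. complex_nbhd (\<zeta> j) complex_interval) F"
    and B: "\<And>z. z \<in> (\<Pi> j\<in>{1..k}. complex_nbhd (\<zeta> j) complex_interval) \<Longrightarrow> cmod (F z) \<le> B"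
    and dep: "\<And>z z'. (\<And>i. i \<in> {1..k} \<Longrightarrow> z i = z' i) \<Longrightarrow> F z = F z'"
    and sym: "\<And>z. F (\<lambda>i. cnj (z i)) = cnj (F z)"
  obtains \<eta> K where "0 < \<eta>" "\<And>j. j \<in> {1..k} \<Longrightarrow> \<eta> \<le> \<zeta> j" "0 \<le> K"
    "\<And>\<epsilon>. 0 < \<epsilon> \<Longrightarrow> \<exists>c :: (nat \<Rightarrow> nat) \<Rightarrow> real. \<forall>z\<in>(\<Pi> j\<in>{1..k}. complex_nbhd \<eta> complex_interval).
       cmod (F z - (\<Sum>\<nu>\<in>index_set \<xi> k \<epsilon>. of_real (c \<nu>) * (\<Prod>j=1..k. z j ^ \<nu> j))) \<le> K * \<epsilon>"
proof -
  let ?I = "{1..k}"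
  define \<rho> where "\<rho> j = (SOME \<rho>. 1 + \<zeta> j < \<rho> \<and> (\<rho> - 1 / \<rho>) / 2 < \<zeta> j)" for j
  have \<rho>: "1 + \<zeta> j < \<rho> j" "(\<rho> j - 1 / \<rho> j) / 2 < \<zeta> j" if "j \<in> ?I" for j
    using someI_ex[OF ellipse_parameter[OF \<zeta>[OF that]]] unfolding \<rho>_def by auto
  have \<rho>\<xi>: "0 < \<rho> j" "1 < \<rho> j" "\<xi> j < \<rho> j" "1 < \<xi> j" if "j \<in> ?I" for j
    using \<rho>[OF that] \<zeta>[OF that] \<xi>[OF that] by auto
  \<comment> \<open>The worst ratio over the coordinates, still below 1. It is now split as
    \<open>t0 = \<tau> / \<sigma>\<close>: the factor \<tau> < 1 sums the omitted terms, the factor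
    \<sigma> > 1 is the parameter of the ellipse on which they are evaluated.\<close>
  define t0 where "t0 = Max ((\<lambda>j. \<xi> j / \<rho> j) ` ?I)"
  have t0: "\<xi> j / \<rho> j \<le> t0" if "j \<in> ?I" for j unfolding t0_def using that by (intro Max_ge) auto
  have t01: "t0 < 1" unfolding t0_def using k \<rho>\<xi> by (subst Max_less_iff) auto
  have t0p: "0 < t0" using t0[of 1] \<rho>\<xi>[of 1] k by (smt (verit) atLeastAtMost_iff divide_pos_pos order_refl)
  define \<tau> where "\<tau> = (1 + t0) / 2"
  define \<sigma> where "\<sigma> = \<tau> / t0"
  have \<tau>: "0 \<le> \<tau>" "\<tau> < 1" and \<sigma>: "1 < \<sigma>" using t0p t01 by (auto simp: \<tau>_def \<sigma>_def)
  \<comment> \<open>The first entry places the neighbourhood inside the ellipse of parameter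
    \<sigma>, the second inside every domain of holomorphy.\<close>
  define \<eta> where "\<eta> = min ((\<sigma> - 1)\<^sup>2 / \<sigma> / 2) (Min (\<zeta> ` ?I))"
  have \<eta>0: "0 < \<eta>" unfolding \<eta>_def using \<sigma> k \<zeta> by (simp add: Min_gr_iff)
  have \<eta>\<zeta>: "\<eta> \<le> \<zeta> j" if "j \<in> ?I" for j
  proof -
    have "Min (\<zeta> ` ?I) \<le> \<zeta> j" using that by (intro Min_le) auto
    then show ?thesis by (simp add: \<eta>_def)
  qed
  have \<eta>\<sigma>: "2 * \<eta> \<le> (\<sigma> - 1)\<^sup>2 / \<sigma>" by (simp add: \<eta>_def min_def)
  let ?V = "\<lambda>j. complex_nbhd (\<zeta> j) complex_interval" and ?W = "\<lambda>j::nat. complex_nbhd \<eta> complex_interval"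
  obtain a where a: "\<And>\<Lambda> \<kappa> z. finite \<Lambda> \<Longrightarrow> \<Lambda> \<subseteq> ?I \<rightarrow>\<^sub>E UNIV \<Longrightarrow> z \<in> Pi ?I ?W \<Longrightarrow>
      (\<And>\<nu>. \<nu> \<in> ?I \<rightarrow>\<^sub>E UNIV \<Longrightarrow> \<nu> \<notin> \<Lambda> \<Longrightarrow> (\<Prod>i\<in>?I. 1 / \<xi> i ^ \<nu> i) \<le> \<kappa>) \<Longrightarrow> 0 \<le> \<kappa> \<Longrightarrow>
      cmod (F z - (\<Sum>\<nu>\<in>\<Lambda>. a \<nu> * (\<Prod>i\<in>?I. cheb_at (\<nu> i) (z i)))) \<le> B * (2 / (1 - \<tau>)) ^ card ?I * \<kappa>"
  proof (rule box_cheb_truncation[of ?I ?V ?W \<rho> \<sigma> \<xi> \<tau> F B])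
    show "finite ?I" by simp
    show "open (?V i) \<and> convex (?V i) \<and> ?W i \<subseteq> ?V i" if "i \<in> ?I" for i
      using complex_nbhd_mono[OF \<eta>\<zeta>[OF that]] convex_complex_nbhd[OF convex_complex_interval] by auto
    show "0 < \<rho> i" "1 \<le> \<xi> i" if "i \<in> ?I" for i using \<rho>\<xi>[OF that] by auto
    show "joukowski w \<in> ?V i" if "i \<in> ?I" "cmod w = \<rho> i" for i w
      using joukowski_in_stadium[OF that(2)] \<rho>\<xi>[OF that(1)] \<rho>[OF that(1)] by auto
    show "\<exists>v. joukowski v = z \<and> 1 \<le> cmod v \<and> cmod v \<le> \<sigma>" if "i \<in> ?I" "z \<in> ?W i" for i z
      using stadium_joukowski[OF that(2) less_imp_le[OF \<sigma>] \<eta>\<sigma>] by metis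
    show "\<sigma> * \<xi> i \<le> \<tau> * \<rho> i" if "i \<in> ?I" for i
    proof -
      have "\<xi> i \<le> t0 * \<rho> i" using t0[OF that] \<rho>\<xi>[OF that] by (simp add: divide_le_eq)
      then have "\<sigma> * \<xi> i \<le> \<sigma> * (t0 * \<rho> i)" using \<sigma> by (intro mult_left_mono) auto
      then show ?thesis using t0p by (simp add: \<sigma>_def)
    qed
    show "F z = F z'" if "\<And>i. i \<in> ?I \<Longrightarrow> z i = z' i" for z z' using that by (rule dep)
  qed (use \<sigma> \<tau> hol B in auto)
  \<comment> \<open>The factor \<open>\<xi> k\<close> is the price of \<open>max 1 (\<nu> k)\<close>
    in the index set: an omitted index with \<open>\<nu> k = 0\<close> is only known to have weight
    below \<open>\<xi> k * \<epsilon>\<close>.\<close>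
  define K where "K = B * (2 / (1 - \<tau>)) ^ k * \<xi> k"
  have "0 \<in> complex_interval" unfolding complex_interval_def by (rule image_eqI[of _ _ 0]) auto
  then have "(\<lambda>i. 0) \<in> Pi ?I ?V" by (intro Pi_I subsetD[OF interval_subset_nbhd] \<zeta>)
  then have B0: "0 \<le> B" using B norm_ge_zero order_trans by blast
  have \<xi>k: "1 < \<xi> k" using \<rho>\<xi>[of k] k by auto
  have K0: "0 \<le> K" unfolding K_def using B0 \<tau> \<xi>k by simp
  show thesis
  proof (rule that[OF \<eta>0 \<eta>\<zeta> K0])
    fix \<epsilon> :: real assume \<epsilon>: "0 < \<epsilon>"
    let ?\<Lambda> = "index_set \<xi> k \<epsilon>"
    have fin: "finite ?\<Lambda>" by (rule finite_index_set) (use \<rho>\<xi> k \<epsilon> in auto)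
    have sub: "?\<Lambda> \<subseteq> ?I \<rightarrow>\<^sub>E UNIV" by (auto simp: index_set_def)
    have out: "(\<Prod>i\<in>?I. 1 / \<xi> i ^ \<nu> i) \<le> \<xi> k * \<epsilon>" if \<nu>: "\<nu> \<in> ?I \<rightarrow>\<^sub>E UNIV" "\<nu> \<notin> ?\<Lambda>" for \<nu>
    proof -
      have lt: "\<xi> k powi (- int (max 1 (\<nu> k))) * (\<Prod>j=1..<k. \<xi> j powi (- int (\<nu> j))) < \<epsilon>"
        using \<nu> by (simp add: index_set_def)
      have pw: "\<xi> j powi (- int n) = 1 / \<xi> j ^ n" for j n by (simp add: power_int_minus divide_inverse)
      have nn: "0 \<le> (\<Prod>j=1..<k. 1 / \<xi> j ^ \<nu> j)"
      proof (intro prod_nonneg ballI)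
        fix j assume "j \<in> {1..<k}"
        then show "0 \<le> 1 / \<xi> j ^ \<nu> j" using \<rho>\<xi>(4)[of j] by simp
      qed
      have split: "?I = insert k {1..<k}" using k by auto
      have "1 / \<xi> k ^ \<nu> k \<le> \<xi> k * (1 / \<xi> k ^ max 1 (\<nu> k))"
        using \<xi>k by (cases "\<nu> k = 0") (auto simp: max_def divide_right_mono)
      moreover have "(\<Prod>i\<in>?I. 1 / \<xi> i ^ \<nu> i) = (1 / \<xi> k ^ \<nu> k) * (\<Prod>j=1..<k. 1 / \<xi> j ^ \<nu> j)"
        unfolding split by simp
      ultimately have "(\<Prod>i\<in>?I. 1 / \<xi> i ^ \<nu> i) \<le> (\<xi> k * (1 / \<xi> k ^ max 1 (\<nu> k))) * (\<Prod>j=1..<k. 1 / \<xi> j ^ \<nu> j)"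
        using mult_right_mono[OF _ nn] by metis
      also have "\<dots> \<le> \<xi> k * \<epsilon>"
        using lt \<xi>k unfolding pw mult.assoc by (intro mult_left_mono) auto
      finally show ?thesis .
    qed
    let ?p = "\<lambda>z. \<Sum>\<nu>\<in>?\<Lambda>. a \<nu> * (\<Prod>i\<in>?I. cheb_at (\<nu> i) (z i))"
    \<comment> \<open>Taking real parts of the coefficients averages the approximant with its
      conjugate reflection. As \<open>F\<close> and the domain are invariant under this reflection,
      the error bound is preserved.\<close>
    let ?q = "\<lambda>z. \<Sum>\<nu>\<in>?\<Lambda>. of_real (Re (a \<nu>)) * (\<Prod>i\<in>?I. cheb_at (\<nu> i) (z i))"
    have pe: "cmod (F z - ?p z) \<le> K * \<epsilon>" if "z \<in> Pi ?I ?W" for z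
      using a[OF fin sub that out] \<xi>k \<epsilon> by (simp add: K_def mult.assoc)
    have qe: "cmod (F z - ?q z) \<le> K * \<epsilon>" if z: "z \<in> Pi ?I ?W" for z
    proof -
      let ?z = "\<lambda>i. cnj (z i)"
      have z': "?z \<in> Pi ?I ?W" using z cnj_complex_nbhd by auto
      have cp: "cnj (?p ?z) = (\<Sum>\<nu>\<in>?\<Lambda>. cnj (a \<nu>) * (\<Prod>i\<in>?I. cheb_at (\<nu> i) (z i)))"
        by (simp add: cheb_at_cnj)
      have "?q z = (?p z + cnj (?p ?z)) / 2"
        unfolding cp sum.distrib[symmetric] distrib_right[symmetric] complex_add_cnj sum_divide_distrib
        by simp
      then have eq: "F z - ?q z = ((F z - ?p z) + cnj (F ?z - ?p ?z)) / 2"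
        by (simp add: sym field_simps)
      have half: "cmod ((X + cnj Y) / 2) \<le> (cmod X + cmod Y) / 2" for X Y
        using norm_triangle_ineq[of X "cnj Y"] by (simp add: norm_divide)
      have "cmod (F z - ?q z) \<le> (cmod (F z - ?p z) + cmod (F ?z - ?p ?z)) / 2"
        unfolding eq by (rule half)
      also have "\<dots> \<le> K * \<epsilon>" using pe[OF z] pe[OF z'] by simp
      finally show ?thesis .
    qed
    obtain c where c: "\<And>z. ?q z = (\<Sum>\<mu>\<in>?\<Lambda>. of_real (c \<mu>) * (\<Prod>i\<in>?I. z i ^ \<mu> i))"
    proof (rule cheb_sum_monomials[of ?I ?\<Lambda> "\<lambda>\<nu>. Re (a \<nu>)"])
      show "\<mu> \<in> ?\<Lambda>" if "\<nu> \<in> ?\<Lambda>" "\<mu> \<in> ?I \<rightarrow>\<^sub>E UNIV" "\<And>i. i \<in> ?I \<Longrightarrow> \<mu> i \<le> \<nu> i" for \<mu> \<nu>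
        by (rule index_set_downward[OF \<rho>\<xi>(4) k that])
    qed (use fin sub in auto)
    show "\<exists>c :: (nat \<Rightarrow> nat) \<Rightarrow> real. \<forall>z\<in>Pi ?I ?W.
       cmod (F z - (\<Sum>\<nu>\<in>?\<Lambda>. of_real (c \<nu>) * (\<Prod>j=1..k. z j ^ \<nu> j))) \<le> K * \<epsilon>"
      using qe unfolding c by blast
  qed
qed

section \<open>Smooth triangular maps of the cube\<close>

lemma space_half_lebesgue [simp]: "space half_lebesgue = {-1..1}"
  by (simp add: half_lebesgue_def space_scale_measure space_restrict_space)

lemma sets_half_lebesgue: "sets half_lebesgue = sets (restrict_space borel {-1..1})"
  unfolding half_lebesgue_def sets_scale_measure by (rule sets_restrict_space_cong) simp

lemma measurable_half_lebesgueI: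
  assumes "f \<in> borel_measurable M" "\<And>x. x \<in> space M \<Longrightarrow> f x \<in> {-1..1}"
  shows "f \<in> measurable M half_lebesgue"
  unfolding measurable_cong_sets[OF refl sets_half_lebesgue]
  by (rule measurable_restrict_space2) (use assms in auto)

lemma half_lebesgue_density: "half_lebesgue = density (restrict_space lborel {-1..1}) (\<lambda>_. ennreal (1/2))"
  unfolding half_lebesgue_def
  by (rule measure_eqI) (auto simp: emeasure_density_const)

lemma nn_integral_half_lebesgue:
  assumes "f \<in> borel_measurable half_lebesgue"
  shows "(\<integral>\<^sup>+t. f t \<partial>half_lebesgue) = ennreal (1/2) * (\<integral>\<^sup>+t. f t * indicator {-1..1} t \<partial>lborel)"
proof -
  have "f \<in> borel_measurable (restrict_space lborel {-1..1})" using assms by (simp add: half_lebesgue_def)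
  then show ?thesis unfolding half_lebesgue_def
    by (simp add: nn_integral_scale_measure nn_integral_restrict_space)
qed

lemma integral_half_lebesgue:
  fixes f :: "real \<Rightarrow> real"
  assumes "f \<in> borel_measurable half_lebesgue"
  shows "(\<integral>t. f t \<partial>half_lebesgue) = (1/2) * (LBINT t:{-1..1}. f t)"
proof -
  have m: "f \<in> borel_measurable (restrict_space lborel {-1..1})" using assms by (simp add: half_lebesgue_def)
  show ?thesis unfolding half_lebesgue_density
    using m by (subst integral_real_density) (auto simp: integral_restrict_space set_lebesgue_integral_def)
qed

interpretation half: prob_space half_lebesgue
proof
  have "emeasure half_lebesgue {-1..1} = ennreal (1/2) * emeasure (restrict_space lborel {-1..1}) {-1..1::real}"
    by (simp add: half_lebesgue_def)
  also have "emeasure (restrict_space lborel {-1..1::real}) {-1..1} = ennreal 2"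
    by (subst emeasure_restrict_space) auto
  also have "ennreal (1/2) * ennreal 2 = ennreal (1/2 * 2)" by (rule ennreal_mult[symmetric]) auto
  finally show "emeasure half_lebesgue (space half_lebesgue) = 1" by simp
qed

interpretation cube: product_prob_space "\<lambda>_::nat. half_lebesgue" UNIV
  by standard

lemma prob_space_cube_measure: "prob_space (cube_measure I)"
  unfolding cube_measure_def by (intro prob_space_PiM half.prob_space_axioms)

lemma space_cube_measure: "space (cube_measure {1..d}) = cube d" "space (cube_measure {Suc 0..d}) = cube d"
  by (simp_all add: cube_measure_def space_PiM cube_def)

lemma cube_fun_upd:
  "x \<in> cube n \<Longrightarrow> t \<in> {-1..1} \<Longrightarrow> x(Suc n := t) \<in> cube (Suc n)"
  "x \<in> cube n \<Longrightarrow> t \<in> {-1..1} \<Longrightarrow> i \<in> {1..n} \<Longrightarrow> x(i := t) \<in> cube n"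
  by (auto simp: cube_def PiE_iff extensional_def)

lemma restrict_cube: "x \<in> cube n \<Longrightarrow> k \<le> n \<Longrightarrow> restrict x {1..k} \<in> cube k"
  by (auto simp: cube_def PiE_iff extensional_def)

lemma cube_memD: "x \<in> cube n \<Longrightarrow> i \<in> {1..n} \<Longrightarrow> x i \<in> {-1..1}"
  by (auto simp: cube_def PiE_iff)

lemma measurable_half_iff:
  fixes f :: "real \<Rightarrow> 'b::{second_countable_topology, real_normed_vector}"
  shows "f \<in> borel_measurable half_lebesgue \<longleftrightarrow> f \<in> borel_measurable (restrict_space borel {-1..1})"
  unfolding measurable_cong_sets[OF sets_half_lebesgue refl] by (rule refl)

lemma continuous_measurable_half:
  fixes f :: "real \<Rightarrow> real"
  assumes "continuous_on {-1..1} f" shows "f \<in> borel_measurable half_lebesgue"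
  unfolding measurable_half_iff by (rule borel_measurable_continuous_on_restrict[OF assms])

lemma measurable_cube_coord: "i \<in> I \<Longrightarrow> (\<lambda>x. x i) \<in> borel_measurable (cube_measure I)"
proof -
  assume i: "i \<in> I"
  have id: "(\<lambda>t. t) \<in> borel_measurable half_lebesgue" by (intro continuous_measurable_half continuous_intros)
  show ?thesis unfolding cube_measure_def
    using measurable_compose[OF measurable_component_singleton[OF i, where M="\<lambda>_. half_lebesgue"] id] .
qed

lemma measurable_cube_restrict:
  assumes "f \<in> borel_measurable (cube_measure {1..k})" "k \<le> n"
    and "\<And>x y. (\<And>i. i \<in> {1..k} \<Longrightarrow> x i = y i) \<Longrightarrow> f x = f y"
  shows "f \<in> borel_measurable (cube_measure {1..n})"
proof -
  have "(\<lambda>x. f (restrict x {1..k})) \<in> borel_measurable (cube_measure {1..n})"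
    using assms(1,2) unfolding cube_measure_def
    by (intro measurable_compose[OF measurable_restrict_subset]) auto
  moreover have "f (restrict x {1..k}) = f x" for x by (rule assms(3)) auto
  ultimately show ?thesis by simp
qed

lemma measurable_into_cube:
  assumes "\<And>k. k \<in> {1..n} \<Longrightarrow> (\<lambda>x. S x k) \<in> borel_measurable M"
    and "\<And>x k. x \<in> space M \<Longrightarrow> k \<in> {1..n} \<Longrightarrow> S x k \<in> {-1..1}"
  shows "(\<lambda>x. \<lambda>k\<in>{1..n}. S x k) \<in> measurable M (cube_measure {1..n})"
  unfolding cube_measure_def
proof (rule measurable_restrict)
  fix k assume k: "k \<in> {1..n}"
  show "(\<lambda>x. S x k) \<in> measurable M half_lebesgue"
    by (rule measurable_half_lebesgueI) (use assms k in auto)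
qed

section \<open>Integration over the last coordinate and one-dimensional substitution\<close>

lemma cube_nn_integral_Suc:
  assumes "h \<in> borel_measurable (cube_measure {1..Suc n})"
  shows "(\<integral>\<^sup>+x. h x \<partial>cube_measure {1..Suc n})
    = (\<integral>\<^sup>+x. (\<integral>\<^sup>+t. h (x(Suc n := t)) \<partial>half_lebesgue) \<partial>cube_measure {1..n})"
proof -
  have "{1..Suc n} = insert (Suc n) {1..n}" by auto
  then show ?thesis using assms unfolding cube_measure_def
    by (subst cube.product_nn_integral_insert[symmetric]) auto
qed

lemma measurable_cube_update:
  assumes "h \<in> borel_measurable (cube_measure {1..Suc n})" "x \<in> cube n"
  shows "(\<lambda>t. h (x(Suc n := t))) \<in> borel_measurable half_lebesgue"
proof -
  have ins: "{1..Suc n} = insert (Suc n) {1..n}" by auto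
  have "x \<in> space (PiM {1..n} (\<lambda>_. half_lebesgue))" using assms(2) by (simp add: space_PiM cube_def)
  from measurable_component_update[OF this, of "Suc n"]
  have "(\<lambda>v. x(Suc n := v)) \<in> measurable half_lebesgue (cube_measure {1..Suc n})"
    unfolding cube_measure_def ins by simp
  then show ?thesis using assms(1) by (rule measurable_compose)
qed

lemma measurable_cube_nn_integral:
  fixes h :: "(nat \<Rightarrow> real) \<Rightarrow> ennreal"
  assumes "h \<in> borel_measurable (cube_measure {1..Suc n})"
  shows "(\<lambda>x. \<integral>\<^sup>+t. h (x(Suc n := t)) \<partial>half_lebesgue) \<in> borel_measurable (cube_measure {1..n})"
proof -
  have ins: "{1..Suc n} = insert (Suc n) {1..n}" by auto
  have "(\<lambda>(x, t). h (x(Suc n := t))) \<in> borel_measurable (cube_measure {1..n} \<Otimes>\<^sub>M half_lebesgue)"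
    using measurable_compose[OF measurable_add_dim[of "Suc n" "{1..n}" "\<lambda>_. half_lebesgue"], of h borel] assms
    unfolding cube_measure_def ins by (simp add: case_prod_beta)
  then show ?thesis by (rule half.borel_measurable_nn_integral)
qed

lemma nn_integral_half_substitution:
  fixes g g' :: "real \<Rightarrow> real" and f :: "real \<Rightarrow> ennreal"
  assumes deriv: "\<And>t. t \<in> {-1..1} \<Longrightarrow> (g has_real_derivative g' t) (at t)"
    and cont: "continuous_on {-1..1} g'" and nn: "\<And>t. t \<in> {-1..1} \<Longrightarrow> 0 \<le> g' t"
    and ends: "g (-1) = -1" "g 1 = 1" and f: "f \<in> borel_measurable half_lebesgue"
  shows "(\<integral>\<^sup>+t. f (g t) * ennreal (g' t) \<partial>half_lebesgue) = (\<integral>\<^sup>+t. f t \<partial>half_lebesgue)"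
proof -
  \<comment> \<open>Extension by zero makes \<open>f\<close> Borel on the whole line, as the
    substitution rule for Lebesgue measure requires.\<close>
  define fb where "fb y = f y * indicator {-1..1} y" for y
  have "f \<in> borel_measurable (restrict_space lborel {-1..1})" using f by (simp add: half_lebesgue_def)
  then have fb: "fb \<in> borel_measurable borel" unfolding fb_def
    by (subst (asm) borel_measurable_restrict_space_iff_ennreal) auto
  have mono: "g x \<le> g y" if "x \<in> {-1..1}" "y \<in> {-1..1}" "x \<le> y" for x y
  proof (rule DERIV_nonneg_imp_nondecreasing[OF \<open>x \<le> y\<close>])
    fix u assume "x \<le> u" "u \<le> y"
    then have "u \<in> {-1..1}" using that by auto
    then show "\<exists>D. (g has_real_derivative D) (at u) \<and> 0 \<le> D" using deriv nn by blast
  qed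
  have range: "g t \<in> {-1..1}" if "t \<in> {-1..1}" for t
    using mono[of "-1" t] mono[of t 1] that ends by auto
  have gm: "g \<in> borel_measurable half_lebesgue"
    by (intro continuous_measurable_half continuous_at_imp_continuous_on)
       (use deriv DERIV_isCont in blast)
  have gm': "g \<in> measurable half_lebesgue half_lebesgue"
    by (rule measurable_half_lebesgueI) (use gm range in auto)
  have m: "(\<lambda>t. f (g t) * ennreal (g' t)) \<in> borel_measurable half_lebesgue"
    using measurable_compose[OF gm' f] continuous_measurable_half[OF cont] by measurable
  have "(\<integral>\<^sup>+t. f (g t) * ennreal (g' t) \<partial>half_lebesgue)
     = ennreal (1/2) * (\<integral>\<^sup>+t. f (g t) * ennreal (g' t) * indicator {-1..1} t \<partial>lborel)"
    by (rule nn_integral_half_lebesgue[OF m])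
  also have "(\<integral>\<^sup>+t. f (g t) * ennreal (g' t) * indicator {-1..1} t \<partial>lborel)
     = (\<integral>\<^sup>+t. fb (g t) * ennreal (g' t) * indicator {-1..1} t \<partial>lborel)"
    by (intro nn_integral_cong) (use range in \<open>auto simp: fb_def split: split_indicator\<close>)
  also have "\<dots> = (\<integral>\<^sup>+t. fb t * indicator {g (-1)..g 1} t \<partial>lborel)"
    by (rule nn_integral_substitution_aux[symmetric, OF fb _ deriv cont nn]) auto
  also have "\<dots> = (\<integral>\<^sup>+t. f t * indicator {-1..1} t \<partial>lborel)"
    unfolding ends by (intro nn_integral_cong) (auto simp: fb_def split: split_indicator)
  also have "ennreal (1/2) * \<dots> = (\<integral>\<^sup>+t. f t \<partial>half_lebesgue)"
    by (rule nn_integral_half_lebesgue[OF f, symmetric])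
  finally show ?thesis .
qed

section \<open>Triangular maps with positive diagonal derivatives\<close>

lemma increasing_between:
  fixes g g' :: "real \<Rightarrow> real"
  assumes deriv: "\<And>t. t \<in> {-1..1} \<Longrightarrow> (g has_real_derivative g' t) (at t)"
    and nn: "\<And>t. t \<in> {-1..1} \<Longrightarrow> 0 \<le> g' t"
    and ends: "g (-1) = -1" "g 1 = 1" and t: "t \<in> {-1..1}"
  shows "g t \<in> {-1..1}"
proof -
  have mono: "g x \<le> g y" if "x \<in> {-1..1}" "y \<in> {-1..1}" "x \<le> y" for x y
  proof (rule DERIV_nonneg_imp_nondecreasing[OF \<open>x \<le> y\<close>])
    fix u assume "x \<le> u" "u \<le> y"
    then have "u \<in> {-1..1}" using that by auto
    then show "\<exists>D. (g has_real_derivative D) (at u) \<and> 0 \<le> D" using deriv nn by blast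
  qed
  then show ?thesis using mono[of "-1" t] mono[of t 1] t ends by auto
qed

text \<open>\<open>s k\<close> is the k-th diagonal entry of the Jacobian matrix. Derivatives are
  two-sided even at the end points, since the maps in question extend beyond the cube. Only the last
  variable of each component is differentiated.\<close>

locale smooth_triangular =
  fixes n :: nat and S :: "(nat \<Rightarrow> real) \<Rightarrow> nat \<Rightarrow> real" and s :: "nat \<Rightarrow> (nat \<Rightarrow> real) \<Rightarrow> real"
  assumes meas: "k \<in> {1..n} \<Longrightarrow> (\<lambda>x. S x k) \<in> borel_measurable (cube_measure {1..k})"
      "k \<in> {1..n} \<Longrightarrow> s k \<in> borel_measurable (cube_measure {1..k})"
    and dep: "k \<in> {1..n} \<Longrightarrow> (\<And>i. i \<in> {1..k} \<Longrightarrow> x i = y i) \<Longrightarrow> S x k = S y k"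
      "k \<in> {1..n} \<Longrightarrow> (\<And>i. i \<in> {1..k} \<Longrightarrow> x i = y i) \<Longrightarrow> s k x = s k y"
    and deriv: "k \<in> {1..n} \<Longrightarrow> x \<in> cube k \<Longrightarrow> ((\<lambda>t. S (x(k := t)) k) has_real_derivative s k x) (at (x k))"
    and cont: "k \<in> {1..n} \<Longrightarrow> x \<in> cube k \<Longrightarrow> continuous_on {-1..1} (\<lambda>t. s k (x(k := t)))"
    and pos: "k \<in> {1..n} \<Longrightarrow> x \<in> cube k \<Longrightarrow> 0 < s k x"
    and ends: "k \<in> {1..n} \<Longrightarrow> x \<in> cube k \<Longrightarrow> S (x(k := -1)) k = -1" "k \<in> {1..n} \<Longrightarrow> x \<in> cube k \<Longrightarrow> S (x(k := 1)) k = 1"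
begin

lemma deriv_at:
  assumes "k \<in> {1..n}" "x \<in> cube k" "t \<in> {-1..1}"
  shows "((\<lambda>t. S (x(k := t)) k) has_real_derivative s k (x(k := t))) (at t)" "0 < s k (x(k := t))"
proof -
  have x: "x(k := t) \<in> cube k" using assms by (intro cube_fun_upd) auto
  show "((\<lambda>t. S (x(k := t)) k) has_real_derivative s k (x(k := t))) (at t)"
    using deriv[OF assms(1) x] by simp
  show "0 < s k (x(k := t))" by (rule pos[OF assms(1) x])
qed

lemma range: "k \<in> {1..n} \<Longrightarrow> x \<in> cube k \<Longrightarrow> t \<in> {-1..1} \<Longrightarrow> S (x(k := t)) k \<in> {-1..1}"
  by (rule increasing_between[where g="\<lambda>t. S (x(k := t)) k" and g'="\<lambda>t. s k (x(k := t))"])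
     (auto simp del: fun_upd_apply simp: deriv_at ends less_imp_le)

lemma range': 
  assumes "k \<in> {1..n}" "x \<in> cube m" "k \<le> m"
  shows "S x k \<in> {-1..1}"
proof -
  have r: "restrict x {1..k} \<in> cube k" using restrict_cube assms by auto
  have xk: "x k \<in> {-1..1}" using assms by (intro cube_memD) auto
  have "S x k = S ((restrict x {1..k})(k := x k)) k" using assms by (intro dep) auto
  also have "\<dots> \<in> {-1..1}" by (rule range[OF assms(1) r xk])
  finally show ?thesis .
qed

lemma measurable_S: "m \<le> n \<Longrightarrow> (\<lambda>x. \<lambda>k\<in>{1..m}. S x k) \<in> measurable (cube_measure {1..m}) (cube_measure {1..m})"
proof (rule measurable_into_cube)
  fix k assume m: "m \<le> n" and k: "k \<in> {1..m}"
  show "(\<lambda>x. S x k) \<in> borel_measurable (cube_measure {1..m})"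
    by (rule measurable_cube_restrict[OF meas(1)]) (use m k in \<open>auto intro: dep(1)\<close>)
  fix x assume "x \<in> space (cube_measure {1..m})"
  then show "S x k \<in> {-1..1}" using m k by (intro range'[of k x m]) (auto simp: space_cube_measure)
qed

lemma measurable_s: "k \<in> {1..m} \<Longrightarrow> m \<le> n \<Longrightarrow> s k \<in> borel_measurable (cube_measure {1..m})"
  by (rule measurable_cube_restrict[OF meas(2)]) (auto intro: dep(2))

text \<open>Change of variables by induction on the dimension: only the last component depends on
  the last variable, so the inner integral is a one-dimensional substitution and the other factors
  of the Jacobian leave it.\<close>

theorem substitution:
  assumes "m \<le> n" "h \<in> borel_measurable (cube_measure {1..m})"
  shows "(\<integral>\<^sup>+x. h (\<lambda>k\<in>{1..m}. S x k) * (\<Prod>k=1..m. ennreal (s k x)) \<partial>cube_measure {1..m})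
    = (\<integral>\<^sup>+x. h x \<partial>cube_measure {1..m})"
  using assms
proof (induction m arbitrary: h)
  case 0
  have e: "cube_measure {1..0} = PiM {} (\<lambda>_. half_lebesgue)" by (simp add: cube_measure_def)
  show ?case unfolding e using prob_space.emeasure_space_1[OF prob_space_cube_measure[of "{}"]]
    by (simp add: cube_measure_def cube.nn_integral_empty restrict_def)
next
  case (Suc m)
  have mn: "Suc m \<in> {1..n}" using Suc.prems by auto
  let ?S = "\<lambda>x. \<lambda>k\<in>{1..m}. S x k" and ?S' = "\<lambda>x. \<lambda>k\<in>{1..Suc m}. S x k"
  note h = Suc.prems(2)
  have mS': "?S' \<in> measurable (cube_measure {1..Suc m}) (cube_measure {1..Suc m})"
    by (rule measurable_S) (use Suc.prems in auto)
  have ms: "(\<lambda>x. \<Prod>k=1..Suc m. ennreal (s k x)) \<in> borel_measurable (cube_measure {1..Suc m})"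
    using measurable_s Suc.prems by (intro borel_measurable_prod_ennreal measurable_compose[OF _ measurable_ennreal]) auto
  have mF: "(\<lambda>x. h (?S' x) * (\<Prod>k=1..Suc m. ennreal (s k x))) \<in> borel_measurable (cube_measure {1..Suc m})"
    using measurable_compose[OF mS' h] ms by (rule borel_measurable_times_ennreal)
  have "(\<integral>\<^sup>+x. h (?S' x) * (\<Prod>k=1..Suc m. ennreal (s k x)) \<partial>cube_measure {1..Suc m})
     = (\<integral>\<^sup>+x. (\<integral>\<^sup>+t. h (?S' (x(Suc m := t))) * (\<Prod>k=1..Suc m. ennreal (s k (x(Suc m := t)))) \<partial>half_lebesgue) \<partial>cube_measure {1..m})"
    by (rule cube_nn_integral_Suc[OF mF])
  also have "\<dots> = (\<integral>\<^sup>+x. (\<integral>\<^sup>+t. h ((?S x)(Suc m := t)) \<partial>half_lebesgue) * (\<Prod>k=1..m. ennreal (s k x)) \<partial>cube_measure {1..m})"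
  proof (rule nn_integral_cong)
    fix x assume "x \<in> space (cube_measure {1..m})"
    then have x: "x \<in> cube m" by (simp add: space_cube_measure)
    \<comment> \<open>A point of the larger cube over \<open>x\<close>; the value 0 is a placeholder
      that every later update overwrites.\<close>
    have x1: "x(Suc m := 0) \<in> cube (Suc m)" using x by (intro cube_fun_upd) auto
    have Sx: "?S x \<in> cube m"
      using range'[of _ x m] x Suc.prems by (auto simp: cube_def)
    have upd: "x(Suc m := t) = (x(Suc m := 0))(Suc m := t)" for t by simp
    let ?g = "\<lambda>t. S (x(Suc m := t)) (Suc m)" and ?g' = "\<lambda>t. s (Suc m) (x(Suc m := t))"
    have eq1: "?S' (x(Suc m := t)) = (?S x)(Suc m := ?g t)" for t
    proof
      fix k
      have "S (x(Suc m := t)) k = S x k" if "k \<in> {1..m}"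
        using that Suc.prems by (intro dep) auto
      then show "?S' (x(Suc m := t)) k = ((?S x)(Suc m := ?g t)) k" by (auto simp: restrict_def)
    qed
    have eq2: "(\<Prod>k=1..Suc m. ennreal (s k (x(Suc m := t)))) = (\<Prod>k=1..m. ennreal (s k x)) * ennreal (?g' t)" for t
    proof -
      have "(\<Prod>k=1..m. ennreal (s k (x(Suc m := t)))) = (\<Prod>k=1..m. ennreal (s k x))"
        using Suc.prems by (intro prod.cong refl arg_cong[where f=ennreal] dep) auto
      then show ?thesis by simp
    qed
    have f: "(\<lambda>t. h ((?S x)(Suc m := t))) \<in> borel_measurable half_lebesgue"
      by (rule measurable_cube_update[OF h Sx])
    have fg: "(\<integral>\<^sup>+t. h ((?S x)(Suc m := ?g t)) * ennreal (?g' t) \<partial>half_lebesgue)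
       = (\<integral>\<^sup>+t. h ((?S x)(Suc m := t)) \<partial>half_lebesgue)"
    proof (rule nn_integral_half_substitution[OF _ _ _ _ _ f, of ?g ?g'])
      fix t :: real assume t: "t \<in> {-1..1}"
      show "(?g has_real_derivative ?g' t) (at t)" "0 \<le> ?g' t"
        using deriv_at[OF mn x1 t] by (simp_all add: less_imp_le)
    next
      show "continuous_on {-1..1} ?g'" using cont[OF mn x1] by simp
      show "?g (-1) = -1" "?g 1 = 1" using ends[OF mn x1] by simp_all
    qed
    have gm: "(\<lambda>t. h ((?S x)(Suc m := ?g t)) * ennreal (?g' t)) \<in> borel_measurable half_lebesgue"
    proof -
      have "(\<lambda>t. h (?S' (x(Suc m := t)))) \<in> borel_measurable half_lebesgue"
        by (rule measurable_cube_update[OF measurable_compose[OF mS' h] x])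
      moreover have "?g' \<in> borel_measurable half_lebesgue"
        using cont[OF mn x1] by (intro continuous_measurable_half) simp
      ultimately show ?thesis unfolding eq1 by measurable
    qed
    have "(\<integral>\<^sup>+t. h (?S' (x(Suc m := t))) * (\<Prod>k=1..Suc m. ennreal (s k (x(Suc m := t)))) \<partial>half_lebesgue)
       = (\<integral>\<^sup>+t. (\<Prod>k=1..m. ennreal (s k x)) * (h ((?S x)(Suc m := ?g t)) * ennreal (?g' t)) \<partial>half_lebesgue)"
      unfolding eq1 eq2 by (simp add: mult_ac)
    also have "\<dots> = (\<Prod>k=1..m. ennreal (s k x)) * (\<integral>\<^sup>+t. h ((?S x)(Suc m := ?g t)) * ennreal (?g' t) \<partial>half_lebesgue)"
      by (rule nn_integral_cmult[OF gm])
    finally show "(\<integral>\<^sup>+t. h (?S' (x(Suc m := t))) * (\<Prod>k=1..Suc m. ennreal (s k (x(Suc m := t)))) \<partial>half_lebesgue)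
       = (\<integral>\<^sup>+t. h ((?S x)(Suc m := t)) \<partial>half_lebesgue) * (\<Prod>k=1..m. ennreal (s k x))"
      unfolding fg by (simp add: mult.commute)
  qed
  also have "\<dots> = (\<integral>\<^sup>+x. (\<integral>\<^sup>+t. h (x(Suc m := t)) \<partial>half_lebesgue) \<partial>cube_measure {1..m})"
    by (rule Suc.IH[OF _ measurable_cube_nn_integral[OF h]]) (use Suc.prems in auto)
  also have "\<dots> = (\<integral>\<^sup>+x. h x \<partial>cube_measure {1..Suc m})"
    by (rule cube_nn_integral_Suc[OF h, symmetric])
  finally show ?case .
qed

end

section \<open>Distances of two measures with almost equal densities\<close>

text \<open>On the set where \<open>h\<close> exceeds \<open>c\<close> the excess has integral at
  most 0, hence it vanishes almost everywhere.\<close>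

lemma AE_density_le:
  assumes fin: "finite_measure N" and h: "h \<in> borel_measurable N"
    and le: "\<And>A. A \<in> sets N \<Longrightarrow> (\<integral>\<^sup>+x. h x * indicator A x \<partial>N) \<le> ennreal c * emeasure N A"
  shows "AE x in N. h x \<le> ennreal c"
proof -
  interpret finite_measure N by fact
  define A where "A = {x \<in> space N. ennreal c < h x}"
  have A[measurable]: "A \<in> sets N" unfolding A_def using h by measurable
  note h[measurable]
  have eq: "h x * indicator A x = (h x - ennreal c) * indicator A x + ennreal c * indicator A x" for x
    by (auto simp: A_def indicator_def diff_add_cancel_ennreal less_imp_le)
  have "(\<integral>\<^sup>+x. h x * indicator A x \<partial>N) = (\<integral>\<^sup>+x. (h x - ennreal c) * indicator A x \<partial>N) + (\<integral>\<^sup>+x. ennreal c * indicator A x \<partial>N)"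
    unfolding eq by (rule nn_integral_add) auto
  also have "(\<integral>\<^sup>+x. ennreal c * indicator A x \<partial>N) = ennreal c * emeasure N A"
    by (rule nn_integral_cmult_indicator[OF A])
  finally have "ennreal c * emeasure N A + (\<integral>\<^sup>+x. (h x - ennreal c) * indicator A x \<partial>N) \<le> ennreal c * emeasure N A + 0"
    using le[OF A] by (simp add: add.commute)
  moreover have "ennreal c * emeasure N A \<noteq> \<infinity>" by (simp add: ennreal_mult_eq_top_iff)
  ultimately have "(\<integral>\<^sup>+x. (h x - ennreal c) * indicator A x \<partial>N) \<le> 0"
    unfolding ennreal_add_left_cancel_le by blast
  then have "(\<integral>\<^sup>+x. (h x - ennreal c) * indicator A x \<partial>N) = 0" by simp
  then have "AE x in N. (h x - ennreal c) * indicator A x = 0"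
    by (subst (asm) nn_integral_0_iff_AE) auto
  moreover have "AE x in N. x \<in> space N" by (rule AE_space)
  ultimately show ?thesis
  proof eventually_elim
    case (elim x)
    then show ?case
    proof (cases "x \<in> A")
      case True
      then have "h x - ennreal c = 0" using elim by simp
      then show ?thesis by (simp add: ennreal_minus_eq_0)
    next
      case False
      then show ?thesis using elim by (auto simp: A_def not_less)
    qed
  qed
qed

lemma AE_density_ge:
  assumes fin: "finite_measure N" and h: "h \<in> borel_measurable N"
    and ge: "\<And>A. A \<in> sets N \<Longrightarrow> ennreal c * emeasure N A \<le> (\<integral>\<^sup>+x. h x * indicator A x \<partial>N)"
  shows "AE x in N. ennreal c \<le> h x"
proof -
  interpret finite_measure N by fact
  define A where "A = {x \<in> space N. h x < ennreal c}"
  have A[measurable]: "A \<in> sets N" unfolding A_def using h by measurable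
  note h[measurable]
  have eq: "ennreal c * indicator A x = (ennreal c - h x) * indicator A x + h x * indicator A x" for x
    by (auto simp: A_def indicator_def diff_add_cancel_ennreal less_imp_le)
  \<comment> \<open>Cancelling this integral in the extended nonnegative reals requires that it be
    finite, which holds as \<open>h < c\<close> on \<open>A\<close>.\<close>
  have fin: "(\<integral>\<^sup>+x. h x * indicator A x \<partial>N) \<noteq> \<infinity>"
  proof -
    have "(\<integral>\<^sup>+x. h x * indicator A x \<partial>N) \<le> (\<integral>\<^sup>+x. ennreal c \<partial>N)"
      by (intro nn_integral_mono) (auto simp: A_def indicator_def less_imp_le)
    also have "\<dots> = ennreal c * ennreal (measure N (space N))" by (simp add: emeasure_eq_measure)
    also have "\<dots> < \<infinity>" by (simp add: ennreal_mult_less_top)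
    finally show ?thesis by simp
  qed
  have "ennreal c * emeasure N A = (\<integral>\<^sup>+x. ennreal c * indicator A x \<partial>N)"
    by (rule nn_integral_cmult_indicator[OF A, symmetric])
  also have "\<dots> = (\<integral>\<^sup>+x. (ennreal c - h x) * indicator A x \<partial>N) + (\<integral>\<^sup>+x. h x * indicator A x \<partial>N)"
    unfolding eq by (rule nn_integral_add) auto
  finally have "(\<integral>\<^sup>+x. h x * indicator A x \<partial>N) + (\<integral>\<^sup>+x. (ennreal c - h x) * indicator A x \<partial>N)
     \<le> (\<integral>\<^sup>+x. h x * indicator A x \<partial>N) + 0"
    using ge[OF A] by (simp add: add.commute)
  then have "(\<integral>\<^sup>+x. (ennreal c - h x) * indicator A x \<partial>N) \<le> 0"
    unfolding ennreal_add_left_cancel_le using fin by blast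
  then have "(\<integral>\<^sup>+x. (ennreal c - h x) * indicator A x \<partial>N) = 0" by simp
  then have "AE x in N. (ennreal c - h x) * indicator A x = 0"
    by (subst (asm) nn_integral_0_iff_AE) auto
  moreover have "AE x in N. x \<in> space N" by (rule AE_space)
  ultimately show ?thesis
  proof eventually_elim
    case (elim x)
    then show ?case
    proof (cases "x \<in> A")
      case True
      then have "ennreal c - h x = 0" using elim by simp
      then show ?thesis by (simp add: ennreal_minus_eq_0)
    qed (auto simp: A_def not_less)
  qed
qed

text \<open>\<open>c\<close> is a bound of its own beside \<open>1 - a\<close> because the latter
  may fail to be positive, while an integrable logarithm needs a positive lower bound. All
  conclusions are bounded by \<open>a\<close> alone.\<close>

locale density_comparison =
  fixes \<mu> :: "'a measure" and f :: "'a \<Rightarrow> real" and P N :: "'a measure" and a c :: real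
  assumes \<mu>: "sigma_finite_measure \<mu>"
    and f: "f \<in> borel_measurable \<mu>" "\<And>x. x \<in> space \<mu> \<Longrightarrow> 0 \<le> f x"
    and P: "P = density \<mu> (\<lambda>x. ennreal (f x))" "prob_space P"
    and N: "prob_space N" "sets N = sets \<mu>"
    and a: "0 \<le> a" and c: "0 < c" "1 - a \<le> c" "c \<le> 1 + a"
    and upper: "\<And>A. A \<in> sets \<mu> \<Longrightarrow> emeasure N A \<le> ennreal (1 + a) * emeasure P A"
    and lower: "\<And>A. A \<in> sets \<mu> \<Longrightarrow> ennreal c * emeasure P A \<le> emeasure N A"
begin

sublocale P: prob_space P by (rule P(2))
sublocale N: prob_space N by (rule N(1))

lemma sets_P: "sets P = sets \<mu>" by (simp add: P(1))

definition ratio :: "'a \<Rightarrow> real" where "ratio x = enn2real (RN_deriv P N x)"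

lemma ac: "absolutely_continuous P N"
  unfolding absolutely_continuous_def null_sets_def
proof clarify
  fix A assume A: "A \<in> sets P" "emeasure P A = 0"
  then have "emeasure N A \<le> 0" using upper[of A] by (simp add: sets_P)
  then show "A \<in> sets N \<and> emeasure N A = 0" using A by (simp add: sets_P N(2))
qed

lemma N_density_RN: "N = density P (RN_deriv P N)"
  by (rule P.density_RN_deriv[OF ac, symmetric]) (simp add: sets_P N(2))

lemma RN_bounds: "AE x in P. ennreal c \<le> RN_deriv P N x \<and> RN_deriv P N x \<le> ennreal (1 + a)"
proof -
  have int: "(\<integral>\<^sup>+x. RN_deriv P N x * indicator A x \<partial>P) = emeasure N A" if "A \<in> sets P" for A
    using that by (subst N_density_RN) (simp add: emeasure_density)
  have "AE x in P. RN_deriv P N x \<le> ennreal (1 + a)"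
    by (rule AE_density_le) (use upper in \<open>auto simp: int sets_P P.finite_measure_axioms\<close>)
  moreover have "AE x in P. ennreal c \<le> RN_deriv P N x"
    by (rule AE_density_ge) (use lower in \<open>auto simp: int sets_P P.finite_measure_axioms\<close>)
  ultimately show ?thesis by eventually_elim auto
qed

lemma ratio_bounds: "AE x in P. RN_deriv P N x = ennreal (ratio x) \<and> c \<le> ratio x \<and> ratio x \<le> 1 + a"
  using RN_bounds
proof eventually_elim
  case (elim x)
  have nt: "RN_deriv P N x < top" using elim ennreal_less_top[of "1 + a"] by (meson le_less_trans)
  then have r: "RN_deriv P N x = ennreal (ratio x)" by (simp add: ratio_def)
  have "0 \<le> ratio x" by (simp add: ratio_def)
  then show ?case using elim a c ennreal_le_iff[of "1 + a" "ratio x"] ennreal_le_iff[of "ratio x" c]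
    unfolding r by auto
qed

lemma ratio_measurable [measurable]: "ratio \<in> borel_measurable P"
  unfolding ratio_def by measurable

lemma N_density: "N = density P (\<lambda>x. ennreal (ratio x))"
proof -
  have "density P (RN_deriv P N) = density P (\<lambda>x. ennreal (ratio x))"
    using ratio_bounds by (intro density_cong) auto
  then show ?thesis using N_density_RN by simp
qed

lemma ac_base: "absolutely_continuous \<mu> N"
proof -
  have "absolutely_continuous \<mu> P" unfolding P(1)
    by (rule absolutely_continuousI_density) (use f in measurable)
  then show ?thesis using ac unfolding absolutely_continuous_def by blast
qed

lemma total_variation_le: "total_variation N P \<le> a"
  unfolding total_variation_def
proof (rule cSUP_least)
  fix A assume A: "A \<in> sets N"
  then have A': "A \<in> sets \<mu>" by (simp add: N(2))
  have "ennreal (measure N A) \<le> ennreal ((1 + a) * measure P A)"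
    using upper[OF A'] a by (simp add: N.emeasure_eq_measure P.emeasure_eq_measure ennreal_mult)
  then have u: "measure N A \<le> (1 + a) * measure P A" using a by (subst (asm) ennreal_le_iff) auto
  have "ennreal (c * measure P A) \<le> ennreal (measure N A)"
    using lower[OF A'] c by (simp add: N.emeasure_eq_measure P.emeasure_eq_measure ennreal_mult)
  then have l: "c * measure P A \<le> measure N A" by (subst (asm) ennreal_le_iff) auto
  have "(1 - a) * measure P A \<le> c * measure P A" using c by (intro mult_right_mono) auto
  moreover have "a * measure P A \<le> a * 1" using a by (intro mult_left_mono) auto
  ultimately show "\<bar>measure N A - measure P A\<bar> \<le> a" using u l by (simp add: algebra_simps abs_le_iff)
qed auto

text \<open>Pointwise the integrand is the density of \<open>P\<close> times
  \<open>(sqrt r - 1)^2\<close>, and the modulus of \<open>sqrt r - 1\<close> is at most that of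
  \<open>r - 1\<close> because \<open>sqrt r + 1 \<ge> 1\<close>.\<close>

lemma hellinger_le: "hellinger \<mu> N P \<le> a"
proof -
  interpret \<mu>: sigma_finite_measure \<mu> by (rule \<mu>)
  note f(1)[measurable]
  have rm[measurable]: "ratio \<in> borel_measurable \<mu>"
    using ratio_measurable unfolding measurable_cong_sets[OF sets_P refl] .
  have "N = density \<mu> (\<lambda>x. ennreal (f x) * ennreal (ratio x))"
  proof -
    have "N = density P (\<lambda>x. ennreal (ratio x))" by (rule N_density)
    also have "\<dots> = density (density \<mu> (\<lambda>x. ennreal (f x))) (\<lambda>x. ennreal (ratio x))"
      by (rule arg_cong[where f="\<lambda>Q. density Q (\<lambda>x. ennreal (ratio x))", OF P(1)])
    also have "\<dots> = density \<mu> (\<lambda>x. ennreal (f x) * ennreal (ratio x))"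
      by (rule density_density_eq) measurable
    finally show ?thesis .
  qed
  then have 1: "AE x in \<mu>. ennreal (f x) * ennreal (ratio x) = RN_deriv \<mu> N x"
    by (intro \<mu>.RN_deriv_unique) auto
  have 2: "AE x in \<mu>. ennreal (f x) = RN_deriv \<mu> P x"
    by (intro \<mu>.RN_deriv_unique) (auto simp: P(1))
  \<comment> \<open>A statement holding almost everywhere for \<open>P\<close> says nothing about
    points where \<open>f\<close> vanishes; there both densities are 0.\<close>
  have 3: "AE x in \<mu>. 0 < ennreal (f x) \<longrightarrow> c \<le> ratio x \<and> ratio x \<le> 1 + a"
  proof -
    have "AE x in P. c \<le> ratio x \<and> ratio x \<le> 1 + a" using ratio_bounds by eventually_elim blast
    then have "AE x in density \<mu> (\<lambda>x. ennreal (f x)). c \<le> ratio x \<and> ratio x \<le> 1 + a"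
      by (subst P(1)[symmetric])
    moreover have "(\<lambda>x. ennreal (f x)) \<in> borel_measurable \<mu>" by measurable
    ultimately show ?thesis by (simp only: AE_density)
  qed
  have fi: "integrable \<mu> f" and f1: "(\<integral>x. f x \<partial>\<mu>) = 1"
  proof -
    have "(\<integral>\<^sup>+x. ennreal (f x) \<partial>\<mu>) = emeasure P (space P)"
      unfolding P(1) by (simp add: emeasure_density cong: nn_integral_cong)
    then have n1: "(\<integral>\<^sup>+x. ennreal (f x) \<partial>\<mu>) = ennreal 1" using P.emeasure_space_1 by simp
    show "integrable \<mu> f" by (rule integrableI_nn_integral_finite[OF _ _ n1]) (use f in auto)
    show "(\<integral>x. f x \<partial>\<mu>) = 1" by (rule integral_eq_nn_integral[THEN trans]) (use f n1 in auto)
  qed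
  let ?d = "\<lambda>x. (sqrt (enn2real (RN_deriv \<mu> N x)) - sqrt (enn2real (RN_deriv \<mu> P x)))\<^sup>2"
  have "AE x in \<mu>. x \<in> space \<mu>" by (rule AE_space)
  with 1 2 3 have bd: "AE x in \<mu>. ?d x \<le> a\<^sup>2 * f x"
  proof eventually_elim
    case (elim x)
    have f0: "0 \<le> f x" using f(2) elim by auto
    have r0: "0 \<le> ratio x" by (simp add: ratio_def)
    have e1: "enn2real (RN_deriv \<mu> N x) = f x * ratio x"
      unfolding elim(1)[symmetric] using f0 r0 by (simp add: ennreal_mult[symmetric])
    have e2: "enn2real (RN_deriv \<mu> P x) = f x" unfolding elim(2)[symmetric] using f0 by simp
    show ?case
    proof (cases "f x = 0")
      case False
      then have r: "c \<le> ratio x" "ratio x \<le> 1 + a" using elim(3) f0 by auto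
      have "\<bar>sqrt (ratio x) - 1\<bar> \<le> \<bar>sqrt (ratio x) - 1\<bar> * (sqrt (ratio x) + 1)"
        using r0 by (simp add: mult_le_cancel_left1)
      also have "\<dots> = \<bar>(sqrt (ratio x) - 1) * (sqrt (ratio x) + 1)\<bar>" using r0 by (simp add: abs_mult)
      also have "\<dots> = \<bar>ratio x - 1\<bar>" using r0 by (simp add: algebra_simps)
      also have "\<dots> \<le> a" using r c by auto
      finally have "(sqrt (ratio x) - 1)\<^sup>2 \<le> a\<^sup>2" using abs_le_square_iff[of "sqrt (ratio x) - 1" a] a by simp
      moreover have "?d x = f x * (sqrt (ratio x) - 1)\<^sup>2"
      proof -
        have "sqrt (f x * ratio x) - sqrt (f x) = sqrt (f x) * (sqrt (ratio x) - 1)"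
          by (simp add: real_sqrt_mult algebra_simps)
        then show ?thesis unfolding e1 e2 using f0 by (simp add: power_mult_distrib)
      qed
      ultimately show ?thesis using f0 by (simp add: mult_left_mono mult.commute)
    qed (simp add: e1 e2)
  qed
  have "(\<integral>x. ?d x \<partial>\<mu>) \<le> (\<integral>x. a\<^sup>2 * f x \<partial>\<mu>)"
  proof (rule integral_mono_AE[OF _ _ bd])
    show "integrable \<mu> (\<lambda>x. a\<^sup>2 * f x)" using fi by simp
    show "integrable \<mu> ?d"
    proof (rule Bochner_Integration.integrable_bound[OF \<open>integrable \<mu> (\<lambda>x. a\<^sup>2 * f x)\<close>])
      show "AE x in \<mu>. norm (?d x) \<le> norm (a\<^sup>2 * f x)" using bd by eventually_elim auto
    qed measurable
  qed
  also have "\<dots> = a\<^sup>2" using f1 by simp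
  finally have "(\<integral>x. ?d x \<partial>\<mu>) \<le> a\<^sup>2" .
  moreover have "0 \<le> a\<^sup>2" by simp
  ultimately have "1/2 * (\<integral>x. ?d x \<partial>\<mu>) \<le> a\<^sup>2" by linarith
  then have "sqrt (1/2 * (\<integral>x. ?d x \<partial>\<mu>)) \<le> sqrt (a\<^sup>2)" by (rule real_sqrt_le_mono)
  then show ?thesis using a by (simp add: hellinger_def)
qed

text \<open>The upper bound is \<open>ln r \<le> r - 1 \<le> a\<close>. The lower bound
  \<open>ln c\<close> supplies the integrability on which finiteness depends in the definition of
  \<open>kl_div\<close>.\<close>

lemma kl_div_le: "kl_div N P \<le> ereal a"
proof -
  have rN: "AE x in N. c \<le> ratio x \<and> ratio x \<le> 1 + a"
    by (rule absolutely_continuous_AE[OF _ ac]) (use ratio_bounds in \<open>auto simp: sets_P N(2)\<close>)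
  have ed: "entropy_density (exp 1) P N x = ln (ratio x)" for x
    by (simp add: entropy_density_def ratio_def log_def)
  have b: "AE x in N. ln c \<le> entropy_density (exp 1) P N x \<and> entropy_density (exp 1) P N x \<le> a"
    using rN
  proof eventually_elim
    case (elim x)
    have "ln (ratio x) \<le> ratio x - 1" using elim c by (intro ln_le_minus_one) auto
    then show ?case unfolding ed using elim c by auto
  qed
  have m: "entropy_density (exp 1) P N \<in> borel_measurable N"
    using measurable_entropy_density[of "exp 1" P N]
    unfolding measurable_cong_sets[OF sets_P refl] measurable_cong_sets[OF N(2) refl] .
  have int: "integrable N (entropy_density (exp 1) P N)"
  proof (rule N.integrable_const_bound[where B="max \<bar>ln c\<bar> a", OF _ m])
    show "AE x in N. norm (entropy_density (exp 1) P N x) \<le> max \<bar>ln c\<bar> a"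
      using b by eventually_elim auto
  qed
  have "KL_divergence (exp 1) P N \<le> (\<integral>x. a \<partial>N)" unfolding KL_divergence_def
    by (rule integral_mono_AE[OF int]) (use b in auto)
  then show ?thesis using ac int N.prob_space by (simp add: kl_div_def)
qed

end

lemma wasserstein_le:
  assumes \<rho>: "prob_space \<rho>" and S: "S \<in> measurable \<rho> M" and T: "T \<in> measurable \<rho> M"
    and coord: "\<And>i. i \<in> {1..d} \<Longrightarrow> (\<lambda>x. x i) \<in> borel_measurable M"
    and le: "\<And>x. x \<in> space \<rho> \<Longrightarrow> L2_set (\<lambda>i. S x i - T x i) {1..d} \<le> B" and p: "1 \<le> p"
  shows "wasserstein d p (distr \<rho> M S) (distr \<rho> M T) \<le> B"
proof -
  interpret prob_space \<rho> by fact
  note S[measurable] T[measurable] coord[measurable]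
  let ?c = "\<lambda>z. L2_set (\<lambda>i. fst z i - snd z i) {1..d} powr p"
  define \<gamma> where "\<gamma> = distr \<rho> (M \<Otimes>\<^sub>M M) (\<lambda>x. (S x, T x))"
  have st: "(\<lambda>x. (S x, T x)) \<in> measurable \<rho> (M \<Otimes>\<^sub>M M)" by measurable
  have \<gamma>: "\<gamma> \<in> couplings (distr \<rho> M S) (distr \<rho> M T)"
  proof -
    have 1: "distr \<gamma> (distr \<rho> M S) fst = distr \<rho> M S"
    proof -
      have "distr \<gamma> (distr \<rho> M S) fst = distr \<gamma> M fst" by (rule distr_cong) auto
      also have "\<dots> = distr \<rho> M (fst \<circ> (\<lambda>x. (S x, T x)))"
        unfolding \<gamma>_def by (rule distr_distr[OF _ st]) simp
      finally show ?thesis by (simp add: o_def)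
    qed
    have 2: "distr \<gamma> (distr \<rho> M T) snd = distr \<rho> M T"
    proof -
      have "distr \<gamma> (distr \<rho> M T) snd = distr \<gamma> M snd" by (rule distr_cong) auto
      also have "\<dots> = distr \<rho> M (snd \<circ> (\<lambda>x. (S x, T x)))"
        unfolding \<gamma>_def by (rule distr_distr[OF _ st]) simp
      finally show ?thesis by (simp add: o_def)
    qed
    have "sets \<gamma> = sets (distr \<rho> M S \<Otimes>\<^sub>M distr \<rho> M T)"
      unfolding \<gamma>_def sets_distr by (rule sets_pair_measure_cong) auto
    with 1 2 show ?thesis by (simp add: couplings_def)
  qed
  have B0: "0 \<le> B"
  proof -
    obtain x where x: "x \<in> space \<rho>" using not_empty by blast
    have "0 \<le> L2_set (\<lambda>i. S x i - T x i) {1..d}" by (rule L2_set_nonneg)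
    then show ?thesis using le[OF x] by linarith
  qed
  have cm: "?c \<in> borel_measurable (M \<Otimes>\<^sub>M M)"
  proof -
    have "(\<lambda>z. fst z i - snd z i) \<in> borel_measurable (M \<Otimes>\<^sub>M M)" if "i \<in> {1..d}" for i
      using coord[OF that] by measurable
    then show ?thesis unfolding L2_set_def
      by (intro powr_real_measurable measurable_compose[OF _ borel_measurable_sqrt] borel_measurable_sum
          borel_measurable_power) auto
  qed
  have "(\<integral>z. ?c z \<partial>\<gamma>) = (\<integral>x. L2_set (\<lambda>i. S x i - T x i) {1..d} powr p \<partial>\<rho>)"
    unfolding \<gamma>_def by (subst integral_distr[OF st cm]) simp
  also have "\<dots> \<le> (\<integral>x. B powr p \<partial>\<rho>)"
  proof (rule integral_mono')
    show "L2_set (\<lambda>i. S x i - T x i) {1..d} powr p \<le> B powr p" if "x \<in> space \<rho>" for x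
      using le[OF that] p by (intro powr_mono2) (auto simp: L2_set_nonneg)
  qed auto
  also have "\<dots> = B powr p" using prob_space by simp
  finally have i: "(\<integral>z. ?c z \<partial>\<gamma>) \<le> B powr p" .
  have "wasserstein d p (distr \<rho> M S) (distr \<rho> M T) \<le> (\<integral>z. ?c z \<partial>\<gamma>) powr (1 / p)"
    unfolding wasserstein_def by (rule cINF_lower[OF _ \<gamma>]) (auto intro!: bdd_belowI[of _ 0])
  also have "\<dots> \<le> (B powr p) powr (1 / p)"
    using i p by (intro powr_mono2) (auto intro!: Bochner_Integration.integral_nonneg)
  also have "\<dots> = B" using B0 p by (simp add: powr_powr)
  finally show ?thesis .
qed

section \<open>Sobolev norms of holomorphic functions\<close>

text \<open>In contrast to \<open>complexify\<close> nothing is cut off outside the index range.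
  Boxes leave those coordinates free, and this form commutes with updates of single
  coordinates.\<close>

definition real_point :: "(nat \<Rightarrow> real) \<Rightarrow> nat \<Rightarrow> complex" where
  "real_point x = (\<lambda>i. complex_of_real (x i))"

lemma real_point_upd: "real_point (x(i := t)) = (real_point x)(i := of_real t)"
  by (auto simp: real_point_def)

lemma real_point_in_Pi:
  assumes "x \<in> cube d" "\<And>i. i \<in> {1..d} \<Longrightarrow> complex_interval \<subseteq> V i"
  shows "real_point x \<in> Pi {1..d} V"
proof
  fix i assume i: "i \<in> {1..d}"
  then have "real_point x i \<in> complex_interval"
    using cube_memD[OF assms(1) i] by (auto simp: real_point_def complex_interval_def)
  then show "real_point x i \<in> V i" using assms(2)[OF i] by blast
qed

section \<open>Measurability and integration on the cube\<close>

lemma open_Pi_finite: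
  fixes V :: "nat \<Rightarrow> 'b::topological_space set"
  assumes "finite I" "\<And>i. i \<in> I \<Longrightarrow> open (V i)"
  shows "open (Pi I V)"
proof -
  have "Pi I V = (\<Inter>i\<in>I. (\<lambda>z. z i) -` V i)" by (auto simp: Pi_def)
  moreover have "open ((\<lambda>z::nat \<Rightarrow> 'b. z i) -` V i)" if "i \<in> I" for i
    using assms(2)[OF that] by (intro open_vimage continuous_on_product_coordinates)
  ultimately show ?thesis using assms(1) by (simp add: open_INT)
qed

lemma measurable_into_product_borel:
  fixes f :: "'a \<Rightarrow> nat \<Rightarrow> 'b::second_countable_topology"
  assumes "\<And>i. (\<lambda>x. f x i) \<in> borel_measurable M"
  shows "f \<in> borel_measurable M"
proof -
  have "(\<lambda>x i. f x i) \<in> measurable M (Pi\<^sub>M UNIV (\<lambda>_. borel))"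
    by (rule measurable_PiM_single') (use assms in auto)
  then show ?thesis by (simp add: measurable_cong_sets[OF refl sets_PiM_equal_borel])
qed

text \<open>Outside the index range a coordinate is the constant \<open>undefined\<close> on the
  cube. Having all coordinates measurable makes the identity Borel into the full product space, on
  which box functions live.\<close>

lemma measurable_cube_coord':
  "(\<lambda>x. x i) \<in> borel_measurable (cube_measure {1..d})"
proof (cases "i \<in> {1..d}")
  case False
  have "(\<lambda>x. x i) \<in> borel_measurable (cube_measure {1..d}) \<longleftrightarrow> (\<lambda>x. undefined :: real) \<in> borel_measurable (cube_measure {1..d})"
    by (rule measurable_cong) (use False in \<open>auto simp: space_cube_measure cube_def PiE_def extensional_def\<close>)
  then show ?thesis by simp
qed (rule measurable_cube_coord)

lemma measurable_cube_identity: "(\<lambda>x. x) \<in> borel_measurable (cube_measure {1..d})"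
  by (rule measurable_into_product_borel) (rule measurable_cube_coord')

lemma measurable_real_point: "real_point \<in> borel_measurable (cube_measure {1..d})"
  by (rule measurable_into_product_borel)
     (auto simp: real_point_def intro!: measurable_compose[OF measurable_cube_coord'[unfolded One_nat_def]])

text \<open>Extended by zero off the open box the function is Borel on the whole product space, and
  points of the cube never leave the box.\<close>

lemma measurable_box_function:
  assumes F: "continuous_on (Pi {1..d} V) F"
    and V: "\<And>i. i \<in> {1..d} \<Longrightarrow> open (V i)" "\<And>i. i \<in> {1..d} \<Longrightarrow> complex_interval \<subseteq> V i"
  shows "(\<lambda>x. Re (F (real_point x))) \<in> borel_measurable (cube_measure {1..d})"
proof -
  have "open (Pi {1..d} V)" by (rule open_Pi_finite) (use V in auto)
  then have "(\<lambda>z. indicator (Pi {1..d} V) z *\<^sub>R F z) \<in> borel_measurable borel"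
    using F by (intro borel_measurable_continuous_on_indicator) auto
  from measurable_compose[OF measurable_real_point this]
  have "(\<lambda>x. Re (indicator (Pi {1..d} V) (real_point x) *\<^sub>R F (real_point x))) \<in> borel_measurable (cube_measure {1..d})"
    by measurable
  moreover have "Re (indicator (Pi {1..d} V) (real_point x) *\<^sub>R F (real_point x)) = Re (F (real_point x))"
    if "x \<in> space (cube_measure {1..d})" for x
    using real_point_in_Pi[of x d V] that V by (simp add: space_cube_measure)
  ultimately show ?thesis by (rule measurable_cong[THEN iffD1, rotated])
qed

lemma has_real_derivative_Re:
  assumes "(g has_field_derivative D) (at (complex_of_real t))"
  shows "((\<lambda>t. Re (g (of_real t))) has_real_derivative Re D) (at t)"
proof -
  have "((\<lambda>t. g (of_real t)) has_vector_derivative D) (at t)"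
    using has_vector_derivative_real_field[OF assms, of UNIV] by simp
  then have "((\<lambda>t. Re (g (of_real t))) has_vector_derivative Re D) (at t)"
    by (rule bounded_linear.has_vector_derivative[OF bounded_linear_Re])
  then show ?thesis by (simp add: has_real_derivative_iff_has_vector_derivative)
qed

lemma box_deriv_real:
  assumes "hol_on_box I V F" "open (V j)" "j \<in> I" "real_point x \<in> Pi I V"
  shows "((\<lambda>t. Re (F (real_point (x(j := t))))) has_real_derivative Re (box_deriv j F (real_point x))) (at (x j))"
  unfolding real_point_upd
  by (rule has_real_derivative_Re)
     (use box_deriv_has_derivative[OF assms] in \<open>simp only: real_point_def[of x, THEN fun_cong, of j]\<close>)

lemma cube_bounded_integrable:
  fixes g :: "(nat \<Rightarrow> real) \<Rightarrow> real"
  assumes "g \<in> borel_measurable (cube_measure {1..d})" "\<And>x. x \<in> cube d \<Longrightarrow> \<bar>g x\<bar> \<le> B"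
  shows "integrable (cube_measure {1..d}) g"
proof -
  interpret prob_space "cube_measure {1..d}" by (rule prob_space_cube_measure)
  show ?thesis
    by (rule integrable_const_bound[where B=B])
       (use assms in \<open>auto intro!: AE_I2 simp: space_cube_measure\<close>)
qed

lemma integral_half_derivative:
  fixes g g' :: "real \<Rightarrow> real"
  assumes "\<And>t. t \<in> {-1..1} \<Longrightarrow> (g has_real_derivative g' t) (at t)" "continuous_on {-1..1} g'"
  shows "(\<integral>t. g' t \<partial>half_lebesgue) = (g 1 - g (-1)) / 2"
proof -
  have "(\<integral>t. g' t \<partial>half_lebesgue) = (1/2) * (LBINT t:{-1..1}. g' t)"
    by (rule integral_half_lebesgue[OF continuous_measurable_half[OF assms(2)]])
  also have "(LBINT t:{-1..1}. g' t) = g 1 - g (-1)"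
    unfolding set_lebesgue_integral_def
  proof (rule integral_FTC_atLeastAtMost)
    fix t :: real assume "-1 \<le> t" "t \<le> 1"
    then have "(g has_real_derivative g' t) (at t within {-1..1})"
      by (intro has_field_derivative_at_within[OF assms(1)]) auto
    then show "(g has_vector_derivative g' t) (at t within {-1..1})"
      by (simp add: has_real_derivative_iff_has_vector_derivative)
  qed (use assms in auto)
  finally show ?thesis by simp
qed

lemma cube_integral_coordinate:
  fixes H :: "(nat \<Rightarrow> real) \<Rightarrow> real"
  assumes i: "i \<in> {1..d}" and H: "integrable (cube_measure {1..d}) H"
    and zero: "\<And>x. x \<in> cube d \<Longrightarrow> (\<integral>t. H (x(i := t)) \<partial>half_lebesgue) = 0"
  shows "(\<integral>x. H x \<partial>cube_measure {1..d}) = 0"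
proof -
  have ins: "{1..d} = insert i ({1..d} - {i})" using i by auto
  have "(\<integral>x. H x \<partial>cube_measure {1..d}) = (\<integral>x. (\<integral>t. H (x(i := t)) \<partial>half_lebesgue) \<partial>cube_measure ({1..d} - {i}))"
    unfolding cube_measure_def
    by (subst ins, rule cube.product_integral_insert) (use H ins[symmetric] in \<open>auto simp: cube_measure_def\<close>)
  also have "\<dots> = (\<integral>x. 0 \<partial>cube_measure ({1..d} - {i}))"
  proof (rule Bochner_Integration.integral_cong[OF refl])
    fix x assume x: "x \<in> space (cube_measure ({1..d} - {i}))"
    have "x(i := 0) \<in> cube d"
      using x i by (auto simp: cube_measure_def space_PiM cube_def PiE_iff extensional_def)
    from zero[OF this] show "(\<integral>t. H (x(i := t)) \<partial>half_lebesgue) = 0" by simp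
  qed
  finally show ?thesis by simp
qed

section \<open>Integration by parts against test functions, and weak derivatives\<close>

lemma PiE_upd: "x \<in> (\<Pi>\<^sub>E i\<in>{1..d}. UNIV) \<Longrightarrow> i \<in> {1..d} \<Longrightarrow> x(i := t) \<in> (\<Pi>\<^sub>E i\<in>{1..d}. UNIV)"
  by (auto simp: PiE_iff extensional_def)

lemma cube_subset_PiE: "cube d \<subseteq> (\<Pi>\<^sub>E i\<in>{1..d}. UNIV)"
  by (auto simp: cube_def)

lemma open_cube_subset: "open_cube d \<subseteq> cube d"
  by (force simp: cube_def open_cube_def PiE_iff)

lemma continuous_on_upd: "continuous_on S (\<lambda>t. (x :: nat \<Rightarrow> 'b::topological_space)(i := t))"
  by (rule continuous_on_fun_upd[where f="\<lambda>_. x"]) (intro continuous_intros)+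

text \<open>The compact set is fixed independently of the function, because all iterated derivatives
  of a test function vanish outside one and the same set.\<close>

locale compact_support =
  fixes d :: nat and K :: "(nat \<Rightarrow> real) set"
  assumes K: "compact K" "K \<subseteq> open_cube d"
begin

definition test_like :: "((nat \<Rightarrow> real) \<Rightarrow> real) \<Rightarrow> bool" where
  "test_like \<psi> \<longleftrightarrow> continuous_on (\<Pi>\<^sub>E i\<in>{1..d}. UNIV) \<psi> \<and> (\<forall>x\<in>(\<Pi>\<^sub>E i\<in>{1..d}. UNIV) - K. \<psi> x = 0)"

lemma test_like_measurable: "test_like \<psi> \<Longrightarrow> \<psi> \<in> borel_measurable (cube_measure {1..d})"
proof -
  assume t: "test_like \<psi>"
  have "(\<lambda>x. x) \<in> measurable (cube_measure {1..d}) (restrict_space borel (\<Pi>\<^sub>E i\<in>{1..d}. UNIV))"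
    by (rule measurable_restrict_space2[OF _ measurable_cube_identity])
       (use cube_subset_PiE in \<open>auto simp: space_cube_measure\<close>)
  from measurable_compose[OF this borel_measurable_continuous_on_restrict] t
  show ?thesis by (auto simp: test_like_def)
qed

lemma test_like_bounded:
  assumes "test_like \<psi>"
  shows "\<exists>B\<ge>0. \<forall>x\<in>cube d. \<bar>\<psi> x\<bar> \<le> B"
proof -
  have sub: "K \<subseteq> (\<Pi>\<^sub>E i\<in>{1..d}. UNIV)" using K open_cube_subset cube_subset_PiE by blast
  have "continuous_on K \<psi>" using assms sub continuous_on_subset by (auto simp: test_like_def)
  then have "compact (\<psi> ` K)" using K compact_continuous_image by blast
  then obtain B where B: "\<And>y. y \<in> \<psi> ` K \<Longrightarrow> norm y \<le> B" using compact_imp_bounded bounded_iff by metis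
  have "\<bar>\<psi> x\<bar> \<le> max B 0" if "x \<in> cube d" for x
  proof (cases "x \<in> K")
    case True
    then show ?thesis using B[of "\<psi> x"] by auto
  next
    case False
    moreover have "x \<in> (\<Pi>\<^sub>E i\<in>{1..d}. UNIV)" using that cube_subset_PiE by blast
    ultimately have "\<psi> x = 0" using assms unfolding test_like_def by blast
    then show ?thesis by simp
  qed
  then show ?thesis by (intro exI[of _ "max B 0"]) auto
qed

text \<open>The complement of \<open>K\<close> is open, so the function is zero on a small piece of
  each coordinate line through the point.\<close>

lemma partial_deriv_zero_outside:
  assumes "test_like \<psi>" "x \<in> (\<Pi>\<^sub>E i\<in>{1..d}. UNIV) - K" "i \<in> {1..d}"
  shows "partial_deriv i \<psi> x = 0"
proof -
  have "closed K" using K compact_imp_closed by blast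
  then have "open ((\<lambda>t. x(i := t)) -` (- K))" by (intro open_vimage continuous_on_upd) auto
  moreover have "x i \<in> (\<lambda>t. x(i := t)) -` (- K)" using assms by simp
  moreover have "0 = \<psi> (x(i := t))" if "t \<in> (\<lambda>t. x(i := t)) -` (- K)" for t
    using that PiE_upd[of x d i t] assms by (auto simp: test_like_def)
  ultimately have "((\<lambda>t. \<psi> (x(i := t))) has_real_derivative 0) (at (x i))"
    by (intro has_field_derivative_transform_within_open[OF DERIV_const]) auto
  then show ?thesis unfolding partial_deriv_def by (rule DERIV_imp_deriv)
qed

lemma boundary_zero:
  assumes "test_like \<psi>" "x \<in> cube d" "i \<in> {1..d}" "t = -1 \<or> t = 1"
  shows "\<psi> (x(i := t)) = 0"
proof -
  have "x(i := t) \<notin> open_cube d" using assms by (auto simp: open_cube_def PiE_iff)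
  then have "x(i := t) \<notin> K" using K by blast
  moreover have "x(i := t) \<in> (\<Pi>\<^sub>E i\<in>{1..d}. UNIV)" using assms cube_subset_PiE by (intro PiE_upd) auto
  ultimately show ?thesis using assms(1) by (auto simp: test_like_def)
qed

text \<open>On each line in direction \<open>i\<close> the two integrands add up to the derivative
  of a product that vanishes on the faces of the cube. The bound \<open>B\<close> serves
  integrability, which Fubini's theorem and the splitting of the integral need.\<close>

lemma integration_by_parts:
  assumes F: "hol_on_box {1..d} (\<lambda>_. complex_nbhd \<eta> complex_interval) F"
    and \<eta>: "0 < \<eta>" and i: "i \<in> {1..d}"
    and F': "continuous_on (Pi {1..d} (\<lambda>_. complex_nbhd \<eta>' complex_interval)) (box_deriv i F)" "0 < \<eta>'"
    and B: "\<And>x. x \<in> cube d \<Longrightarrow> \<bar>Re (F (real_point x))\<bar> \<le> B" "\<And>x. x \<in> cube d \<Longrightarrow> \<bar>Re (box_deriv i F (real_point x))\<bar> \<le> B"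
    and \<psi>: "test_like \<psi>" "test_like (partial_deriv i \<psi>)"
      "\<And>x. x \<in> (\<Pi>\<^sub>E i\<in>{1..d}. UNIV) \<Longrightarrow> (\<lambda>t. \<psi> (x(i := t))) differentiable (at (x i))"
  shows "(\<integral>x. Re (F (real_point x)) * partial_deriv i \<psi> x \<partial>cube_measure {1..d})
    = - (\<integral>x. Re (box_deriv i F (real_point x)) * \<psi> x \<partial>cube_measure {1..d})"
proof -
  let ?V = "complex_nbhd \<eta> complex_interval" and ?V' = "complex_nbhd \<eta>' complex_interval"
  let ?f = "\<lambda>x. Re (F (real_point x))" and ?g = "\<lambda>x. Re (box_deriv i F (real_point x))"
  let ?\<psi>' = "partial_deriv i \<psi>"
  obtain C where C: "0 \<le> C" "\<And>x. x \<in> cube d \<Longrightarrow> \<bar>\<psi> x\<bar> \<le> C" using test_like_bounded[OF \<psi>(1)] by blast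
  obtain C' where C': "0 \<le> C'" "\<And>x. x \<in> cube d \<Longrightarrow> \<bar>?\<psi>' x\<bar> \<le> C'" using test_like_bounded[OF \<psi>(2)] by blast
  have mf: "?f \<in> borel_measurable (cube_measure {1..d})"
    by (rule measurable_box_function[OF hol_on_box_cont[OF F]]) (use interval_subset_nbhd[OF \<eta>] in auto)
  have mg: "?g \<in> borel_measurable (cube_measure {1..d})"
    by (rule measurable_box_function[OF F'(1)]) (use interval_subset_nbhd[OF F'(2)] in auto)
  note m\<psi> = test_like_measurable[OF \<psi>(1)] test_like_measurable[OF \<psi>(2)]
  have i1: "integrable (cube_measure {1..d}) (\<lambda>x. ?f x * ?\<psi>' x)"
    by (rule cube_bounded_integrable[where B="B * C'"])
       (use mf m\<psi> B C' in \<open>auto simp: abs_mult intro!: mult_mono intro: order_trans[OF abs_ge_zero]\<close>)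
  have i2: "integrable (cube_measure {1..d}) (\<lambda>x. ?g x * \<psi> x)"
    by (rule cube_bounded_integrable[where B="B * C"])
       (use mg m\<psi> B C in \<open>auto simp: abs_mult intro!: mult_mono intro: order_trans[OF abs_ge_zero]\<close>)
  have "(\<integral>x. ?f x * ?\<psi>' x + ?g x * \<psi> x \<partial>cube_measure {1..d}) = 0"
  proof (rule cube_integral_coordinate[OF i])
    show "integrable (cube_measure {1..d}) (\<lambda>x. ?f x * ?\<psi>' x + ?g x * \<psi> x)" using i1 i2 by simp
    fix x assume x: "x \<in> cube d"
    have xt: "x(i := t) \<in> cube d" if "t \<in> {-1..1}" for t by (rule cube_fun_upd(2)[OF x that i])
    have V: "real_point (x(i := t)) \<in> Pi {1..d} (\<lambda>_. complex_nbhd r complex_interval)" if "t \<in> {-1..1}" "0 < r" for t r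
      by (rule real_point_in_Pi[OF xt[OF that(1)]]) (rule interval_subset_nbhd[OF that(2)])
    have "(\<integral>t. (?f (x(i := t)) * ?\<psi>' (x(i := t)) + ?g (x(i := t)) * \<psi> (x(i := t))) \<partial>half_lebesgue)
       = (?f (x(i := 1)) * \<psi> (x(i := 1)) - ?f (x(i := -1)) * \<psi> (x(i := -1))) / 2"
    proof (rule integral_half_derivative[where g="\<lambda>t. ?f (x(i := t)) * \<psi> (x(i := t))"])
      fix t :: real assume t: "t \<in> {-1..1}"
      have "((\<lambda>s. Re (F (real_point ((x(i := t))(i := s))))) has_real_derivative
         Re (box_deriv i F (real_point (x(i := t))))) (at ((x(i := t)) i))"
        by (rule box_deriv_real[OF F _ i V[OF t \<eta>]]) simp
      then have d1: "((\<lambda>s. ?f (x(i := s))) has_real_derivative ?g (x(i := t))) (at t)" by simp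
      have "(\<lambda>s. \<psi> ((x(i := t))(i := s))) differentiable (at ((x(i := t)) i))"
        by (rule \<psi>(3)) (use xt[OF t] cube_subset_PiE in blast)
      then have "((\<lambda>s. \<psi> (x(i := s))) has_real_derivative ?\<psi>' (x(i := t))) (at t)"
        unfolding partial_deriv_def by (simp add: DERIV_deriv_iff_real_differentiable)
      from DERIV_mult[OF d1 this]
      show "((\<lambda>t. ?f (x(i := t)) * \<psi> (x(i := t))) has_real_derivative
         (?f (x(i := t)) * ?\<psi>' (x(i := t)) + ?g (x(i := t)) * \<psi> (x(i := t)))) (at t)"
        by (simp add: add.commute mult.commute)
    next
      have c\<psi>: "continuous_on {-1..1} (\<lambda>t. \<theta> (x(i := t)))" if "test_like \<theta>" for \<theta>
        using that xt cube_subset_PiE unfolding test_like_def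
        by (intro continuous_on_compose2[OF _ continuous_on_upd]) blast+
      have cF: "continuous_on {-1..1} (\<lambda>t. Re (G (real_point (x(i := t)))))"
        if "continuous_on (Pi {1..d} (\<lambda>_. complex_nbhd r complex_interval)) G" "0 < r" for G r
      proof -
        have "continuous_on {-1..1} (\<lambda>t. real_point (x(i := t)))"
          unfolding real_point_upd
          by (rule continuous_on_fun_upd[where f="\<lambda>_. real_point x"]) (intro continuous_intros)+
        from continuous_on_compose2[OF that(1) this] V[OF _ that(2)]
        show ?thesis by (intro continuous_intros) blast
      qed
      show "continuous_on {-1..1} (\<lambda>t. ?f (x(i := t)) * ?\<psi>' (x(i := t)) + ?g (x(i := t)) * \<psi> (x(i := t)))"
        by (intro continuous_on_add continuous_on_mult c\<psi> \<psi> cF[OF hol_on_box_cont[OF F] \<eta>] cF[OF F'])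
    qed
    also have "\<dots> = 0" using boundary_zero[OF \<psi>(1) x i] by simp
    finally show "(\<integral>t. (?f (x(i := t)) * ?\<psi>' (x(i := t)) + ?g (x(i := t)) * \<psi> (x(i := t))) \<partial>half_lebesgue) = 0" .
  qed
  then show ?thesis using i1 i2 by simp
qed

end

text \<open>The head of the word is applied first here, whereas \<open>iter_deriv\<close> applies it
  last: integration by parts moves the outermost derivative of the test function to \<open>F\<close>
  first.\<close>

primrec box_derivs :: "nat list \<Rightarrow> ((nat \<Rightarrow> complex) \<Rightarrow> complex) \<Rightarrow> (nat \<Rightarrow> complex) \<Rightarrow> complex" where
  "box_derivs [] F = F"
| "box_derivs (i # is) F = box_derivs is (box_deriv i F)"

text \<open>Every derivative costs \<open>s\<close> of the radius and a factor
  \<open>1 / s\<close>.\<close>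

lemma box_derivs_bound:
  fixes \<eta> s B :: real
  assumes "hol_on_box {1..d} (\<lambda>_. complex_nbhd \<eta> complex_interval) F"
    and "\<And>z. z \<in> Pi {1..d} (\<lambda>_. complex_nbhd \<eta> complex_interval) \<Longrightarrow> cmod (F z) \<le> B"
    and "0 < s" "set is \<subseteq> {1..d}"
  shows "hol_on_box {1..d} (\<lambda>_. complex_nbhd (\<eta> - length is * s) complex_interval) (box_derivs is F)
    \<and> (\<forall>z\<in>Pi {1..d} (\<lambda>_. complex_nbhd (\<eta> - length is * s) complex_interval). cmod (box_derivs is F z) \<le> B / s ^ length is)"
  using assms
proof (induction "is" arbitrary: F B \<eta>)
  case (Cons i "is")
  let ?W = "complex_nbhd (\<eta> - s) complex_interval"
  have i: "i \<in> {1..d}" using Cons.prems by simp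
  have cb: "cball u s \<subseteq> complex_nbhd \<eta> complex_interval" if "u \<in> ?W" for u
    using cball_subset_nbhd[OF that, of s \<eta>] by simp
  have sub: "?W \<subseteq> complex_nbhd \<eta> complex_interval" using Cons.prems by (intro complex_nbhd_mono) auto
  have h: "hol_on_box {1..d} (\<lambda>_. ?W) (box_deriv i F)"
    by (rule hol_on_box_deriv[where V="\<lambda>_. complex_nbhd \<eta> complex_interval" and s=s])
       (use Cons.prems(1) \<open>0 < s\<close> i cb sub in auto)
  have b: "cmod (box_deriv i F z) \<le> B / s" if z: "z \<in> Pi {1..d} (\<lambda>_. ?W)" for z
  proof (rule norm_box_deriv_le[where V="\<lambda>_. complex_nbhd \<eta> complex_interval"])
    show "cball (z i) s \<subseteq> complex_nbhd \<eta> complex_interval" by (rule cb) (use z i in auto)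
    show "z \<in> Pi {1..d} (\<lambda>_. complex_nbhd \<eta> complex_interval)" using z sub by auto
  qed (use Cons.prems i in auto)
  have r: "\<eta> - real (length (i # is)) * s = \<eta> - s - real (length is) * s" by (simp add: algebra_simps)
  have q: "B / s ^ length (i # is) = B / s / s ^ length is" by simp
  show ?case unfolding r q box_derivs.simps
    by (rule Cons.IH[OF h b \<open>0 < s\<close>]) (use Cons.prems in auto)
qed simp

lemma weak_deriv_box:
  fixes \<eta> s B :: real
  assumes F: "hol_on_box {1..d} (\<lambda>_. complex_nbhd \<eta> complex_interval) F"
    and B: "\<And>z. z \<in> Pi {1..d} (\<lambda>_. complex_nbhd \<eta> complex_interval) \<Longrightarrow> cmod (F z) \<le> B"
    and s: "0 < s" "length is * s < \<eta>" and "is": "set is \<subseteq> {1..d}" and \<phi>: "test_function d \<phi>"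
  shows "(\<integral>x. Re (F (real_point x)) * iter_deriv is \<phi> x \<partial>cube_measure {1..d}) =
        (-1) ^ length is * (\<integral>x. Re (box_derivs is F (real_point x)) * \<phi> x \<partial>cube_measure {1..d})"
proof -
  obtain K where K': "compact K" "K \<subseteq> open_cube d" "\<forall>x\<in>(\<Pi>\<^sub>E i\<in>{1..d}. UNIV) - K. \<phi> x = 0"
    using \<phi> by (auto simp: test_function_def)
  interpret compact_support d K by standard (use K' in auto)
  have tl: "test_like (iter_deriv js \<phi>)" if "set js \<subseteq> {1..d}" for js
    using that
  proof (induction js)
    case Nil
    then show ?case using \<phi> K'(3) by (auto simp: test_like_def test_function_def dest: bspec[of _ _ "[]"])
  next
    case (Cons j js)
    have "continuous_on (\<Pi>\<^sub>E i\<in>{1..d}. UNIV) (iter_deriv (j # js) \<phi>)"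
      using \<phi> Cons.prems unfolding test_function_def by blast
    then show ?case
      using partial_deriv_zero_outside[OF Cons.IH] Cons.prems unfolding test_like_def by simp
  qed
  have df: "(\<lambda>t. iter_deriv js \<phi> (x(i := t))) differentiable (at (x i))"
    if "set js \<subseteq> {1..d}" "x \<in> (\<Pi>\<^sub>E i\<in>{1..d}. UNIV)" "i \<in> {1..d}" for js x i
    using \<phi> that unfolding test_function_def by blast
  show ?thesis using F B s "is"
  proof (induction "is" arbitrary: F B \<eta>)
    case (Cons i "is")
    have i: "i \<in> {1..d}" "set is \<subseteq> {1..d}" using Cons.prems by auto
    let ?W = "complex_nbhd (\<eta> - s) complex_interval"
    have pos: "0 \<le> real (length is) * s" using s by simp
    have lt: "real (length is) * s < \<eta> - s" using Cons.prems(4) by (simp add: algebra_simps)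
    have d1: "hol_on_box {1..d} (\<lambda>_. ?W) (box_deriv i F)"
      "\<And>z. z \<in> Pi {1..d} (\<lambda>_. ?W) \<Longrightarrow> cmod (box_deriv i F z) \<le> B / s"
      using box_derivs_bound[OF Cons.prems(1,2) s(1), of "[i]"] i by auto
    have rp: "real_point x \<in> Pi {1..d} (\<lambda>_. complex_nbhd r complex_interval)" if "x \<in> cube d" "0 < r" for x r
      by (rule real_point_in_Pi[OF that(1) interval_subset_nbhd[OF that(2)]])
    have "(\<integral>x. Re (F (real_point x)) * partial_deriv i (iter_deriv is \<phi>) x \<partial>cube_measure {1..d})
      = - (\<integral>x. Re (box_deriv i F (real_point x)) * iter_deriv is \<phi> x \<partial>cube_measure {1..d})"
    proof (rule integration_by_parts[OF Cons.prems(1) _ i(1) hol_on_box_cont[OF d1(1)], where B="max B (B / s)"])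
      show "0 < \<eta>" "0 < \<eta> - s" using lt pos s by linarith+
      show "\<bar>Re (F (real_point x))\<bar> \<le> max B (B / s)" if "x \<in> cube d" for x
        using abs_Re_le_cmod[of "F (real_point x)"] Cons.prems(2)[OF rp[OF that]] lt pos s by force
      show "\<bar>Re (box_deriv i F (real_point x))\<bar> \<le> max B (B / s)" if "x \<in> cube d" for x
        using abs_Re_le_cmod[of "box_deriv i F (real_point x)"] d1(2)[OF rp[OF that]] lt pos s by force
      show "test_like (iter_deriv is \<phi>)" by (rule tl[OF i(2)])
      show "test_like (partial_deriv i (iter_deriv is \<phi>))" using tl[of "i # is"] i by simp
      show "(\<lambda>t. iter_deriv is \<phi> (x(i := t))) differentiable (at (x i))" if "x \<in> (\<Pi>\<^sub>E i\<in>{1..d}. UNIV)" for x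
        by (rule df[OF i(2) that i(1)])
    qed
    also have "\<dots> = - ((-1) ^ length is * (\<integral>x. Re (box_derivs is (box_deriv i F) (real_point x)) * \<phi> x \<partial>cube_measure {1..d}))"
      using Cons.IH[OF d1 s(1) lt i(2)] by simp
    finally show ?case by simp
  qed simp
qed

lemma set_integrable_cube_bounded:
  assumes "g \<in> borel_measurable (cube_measure {1..d})" "\<And>x. x \<in> cube d \<Longrightarrow> \<bar>g x\<bar> \<le> B"
  shows "locally_integrable d g"
  unfolding locally_integrable_def
proof (intro allI impI)
  fix K assume K: "compact K \<and> K \<subseteq> open_cube d"
  then have "K \<in> sets borel" by (intro borel_closed compact_imp_closed) auto
  then have "(\<lambda>x. indicator K x :: real) \<in> borel_measurable (cube_measure {1..d})"
    by (intro measurable_compose[OF measurable_cube_identity] borel_measurable_indicator)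
  then show "set_integrable (cube_measure {1..d}) K g"
    unfolding set_integrable_def
    by (intro cube_bounded_integrable[where B=B])
       (use assms in \<open>auto simp: indicator_def intro: order_trans[OF abs_ge_zero]\<close>)
qed

theorem sobolev_norm_box_le:
  fixes \<eta> :: real
  assumes \<eta>: "0 < \<eta>"
  shows "\<exists>K\<ge>0. \<forall>F f (B::real). hol_on_box {1..d} (\<lambda>_. complex_nbhd \<eta> complex_interval) F \<longrightarrow>
    (\<forall>z\<in>Pi {1..d} (\<lambda>_. complex_nbhd \<eta> complex_interval). cmod (F z) \<le> B) \<longrightarrow>
    (\<forall>x\<in>cube d. f x = Re (F (real_point x))) \<longrightarrow> sobolev_norm d m f \<le> ereal (K * B)"
proof -
  \<comment> \<open>With this step \<open>m\<close> derivatives still leave a positive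
    radius.\<close>
  define s where "s = \<eta> / (real m + 1)"
  have s: "0 < s" using \<eta> by (simp add: s_def)
  have lt: "real j * s < \<eta>" if "j \<le> m" for j
  proof -
    have "real j * \<eta> < (real m + 1) * \<eta>" using that \<eta> by (intro mult_strict_right_mono) auto
    then show ?thesis by (simp add: s_def divide_less_eq mult.commute)
  qed
  \<comment> \<open>The Euclidean norm of the derivative tensor is bounded by the sum of the moduli
    of its entries, one for each word.\<close>
  define K where "K = (\<Sum>j\<le>m. real (card (words d j)) / s ^ j)"
  show ?thesis
  proof (intro exI[of _ K] conjI allI impI)
    show "0 \<le> K" unfolding K_def using s by (intro sum_nonneg) auto
    fix F and f :: "(nat \<Rightarrow> real) \<Rightarrow> real" and B :: real
    assume F: "hol_on_box {1..d} (\<lambda>_. complex_nbhd \<eta> complex_interval) F"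
      and B: "\<forall>z\<in>Pi {1..d} (\<lambda>_. complex_nbhd \<eta> complex_interval). cmod (F z) \<le> B"
      and f: "\<forall>x\<in>cube d. f x = Re (F (real_point x))"
    define D where "D is x = Re (box_derivs is F (real_point x))" for "is" x
    have rp: "real_point x \<in> Pi {1..d} (\<lambda>_. complex_nbhd r complex_interval)" if "x \<in> cube d" "0 < r" for x r
      by (rule real_point_in_Pi[OF that(1) interval_subset_nbhd[OF that(2)]])
    have Dm: "D is \<in> borel_measurable (cube_measure {1..d})"
      and Db: "\<And>x. x \<in> cube d \<Longrightarrow> \<bar>D is x\<bar> \<le> B / s ^ j" if j: "j \<le> m" "is \<in> words d j" for "is" j
    proof -
      have l: "length is = j" "set is \<subseteq> {1..d}" using j by (auto simp: words_def)
      have h: "hol_on_box {1..d} (\<lambda>_. complex_nbhd (\<eta> - j * s) complex_interval) (box_derivs is F)"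
        "\<forall>z\<in>Pi {1..d} (\<lambda>_. complex_nbhd (\<eta> - j * s) complex_interval). cmod (box_derivs is F z) \<le> B / s ^ j"
        using box_derivs_bound[OF F _ s l(2)] B unfolding l(1) by blast+
      have p: "0 < \<eta> - j * s" using lt[OF j(1)] by simp
      show "D is \<in> borel_measurable (cube_measure {1..d})" unfolding D_def
        by (rule measurable_box_function[OF hol_on_box_cont[OF h(1)]]) (use interval_subset_nbhd[OF p] in auto)
      show "\<bar>D is x\<bar> \<le> B / s ^ j" if "x \<in> cube d" for x
        unfolding D_def using abs_Re_le_cmod[of "box_derivs is F (real_point x)"] h(2) rp[OF that p] by force
    qed
    have wd: "weak_deriv d is f (D is)" if j: "j \<le> m" "is \<in> words d j" for "is" j
      unfolding weak_deriv_def
    proof (intro conjI allI impI)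
      have l: "length is = j" "set is \<subseteq> {1..d}" using j by (auto simp: words_def)
      show "D is \<in> borel_measurable (cube_measure {1..d})" by (rule Dm[OF j])
      show "locally_integrable d (D is)" by (rule set_integrable_cube_bounded[OF Dm[OF j] Db[OF j]])
      \<comment> \<open>The empty word reproduces \<open>f\<close> on the cube, whence
        \<open>f\<close> inherits measurability and boundedness.\<close>
      have "[] \<in> words d 0" by (simp add: words_def)
      note D0 = Dm[OF le0 this] Db[OF le0 this]
      have fD: "f x = D [] x" if "x \<in> cube d" for x using f that by (simp add: D_def)
      have fm: "f \<in> borel_measurable (cube_measure {1..d})"
        by (rule measurable_cong[THEN iffD2, OF _ D0(1)]) (use fD in \<open>auto simp: space_cube_measure\<close>)
      show "locally_integrable d f"
        by (rule set_integrable_cube_bounded[OF fm, of B]) (use D0(2) fD in auto)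
      fix \<phi> assume \<phi>: "test_function d \<phi>"
      have "(\<integral>x. f x * iter_deriv is \<phi> x \<partial>cube_measure {1..d}) = (\<integral>x. Re (F (real_point x)) * iter_deriv is \<phi> x \<partial>cube_measure {1..d})"
        by (rule Bochner_Integration.integral_cong[OF refl]) (use f in \<open>auto simp: space_cube_measure\<close>)
      also have "\<dots> = (-1) ^ length is * (\<integral>x. D is x * \<phi> x \<partial>cube_measure {1..d})"
        unfolding D_def by (rule weak_deriv_box[OF F _ s _ l(2) \<phi>]) (use B lt[OF j(1)] l in auto)
      finally show "(\<integral>x. f x * iter_deriv is \<phi> x \<partial>cube_measure {1..d}) = (-1) ^ length is * (\<integral>x. D is x * \<phi> x \<partial>cube_measure {1..d})" .
    qed
    have "sobolev_norm d m f \<le> (\<Sum>j\<le>m. esssup (cube_measure {1..d}) (\<lambda>x. ereal (L2_set (\<lambda>is. D is x) (words d j))))"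
      unfolding sobolev_norm_def by (rule Inf_lower) (use wd in blast)
    also have "\<dots> \<le> (\<Sum>j\<le>m. ereal (real (card (words d j)) * (B / s ^ j)))"
    proof (rule sum_mono)
      fix j assume "j \<in> {..m}"
      then have j: "j \<le> m" by simp
      have "(\<lambda>x. L2_set (\<lambda>is. D is x) (words d j)) \<in> borel_measurable (cube_measure {1..d})"
        unfolding L2_set_def using Dm[OF j]
        by (intro measurable_compose[OF _ borel_measurable_sqrt] borel_measurable_sum borel_measurable_power) auto
      then have m: "(\<lambda>x. ereal (L2_set (\<lambda>is. D is x) (words d j))) \<in> borel_measurable (cube_measure {1..d})" by measurable
      show "esssup (cube_measure {1..d}) (\<lambda>x. ereal (L2_set (\<lambda>is. D is x) (words d j))) \<le> ereal (real (card (words d j)) * (B / s ^ j))"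
      proof (rule esssup_I[OF m AE_I2])
        fix x assume "x \<in> space (cube_measure {1..d})"
        then have x: "x \<in> cube d" by (simp add: space_cube_measure)
        have "L2_set (\<lambda>is. D is x) (words d j) \<le> (\<Sum>is\<in>words d j. \<bar>D is x\<bar>)" by (rule L2_set_le_sum_abs)
        also have "\<dots> \<le> (\<Sum>is\<in>words d j. B / s ^ j)" using Db[OF j _ x] by (intro sum_mono) auto
        finally show "ereal (L2_set (\<lambda>is. D is x) (words d j)) \<le> ereal (real (card (words d j)) * (B / s ^ j))" by simp
      qed
    qed
    also have "\<dots> = ereal (K * B)" by (simp add: K_def sum_distrib_right)
    finally show "sobolev_norm d m f \<le> ereal (K * B)" .
  qed
qed

section \<open>The Knothe-Rosenblatt transport\<close>

text \<open>Here \<open>m\<close> is the lower bound of the density. The Lipschitz constant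
  \<Lambda> has two uses: continuity of the marginals in their last variable, and the comparison of
  a target density at the images of one point under two maps.\<close>

locale lipschitz_density =
  fixes d :: nat and f :: "(nat \<Rightarrow> real) \<Rightarrow> real" and m L \<Lambda> :: real
  assumes meas: "f \<in> borel_measurable (cube_measure {1..d})"
    and m: "0 < m" and lower: "x \<in> cube d \<Longrightarrow> m \<le> f x" and upper: "x \<in> cube d \<Longrightarrow> f x \<le> L"
    and \<Lambda>: "0 \<le> \<Lambda>" and lip: "x \<in> cube d \<Longrightarrow> y \<in> cube d \<Longrightarrow> \<bar>f x - f y\<bar> \<le> \<Lambda> * (\<Sum>i=1..d. \<bar>x i - y i\<bar>)"
    and total: "(\<integral>x. f x \<partial>cube_measure {1..d}) = 1"
begin

lemma merge_in_cube:
  assumes "x \<in> {1..k} \<rightarrow> {-1..1}" "k \<le> d" "t \<in> space (cube_measure {k+1..d})"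
  shows "merge {1..k} {k+1..d} (x, t) \<in> cube d"
  using assms by (auto simp: cube_def merge_def cube_measure_def space_PiM PiE_iff extensional_def)

lemma measurable_merge_cube:
  assumes "x \<in> {1..k} \<rightarrow> {-1..1}" "k \<le> d"
  shows "(\<lambda>t. merge {1..k} {k+1..d} (x, t)) \<in> measurable (cube_measure {k+1..d}) (cube_measure {1..d})"
proof -
  have "(\<lambda>t. \<lambda>i\<in>{1..d}. if i \<in> {1..k} then x i else t i) \<in> measurable (cube_measure {k+1..d}) (cube_measure {1..d})"
    unfolding cube_measure_def
  proof (rule measurable_restrict)
    fix i assume i: "i \<in> {1..d}"
    show "(\<lambda>t. if i \<in> {1..k} then x i else t i) \<in> measurable (Pi\<^sub>M {k+1..d} (\<lambda>i. half_lebesgue)) half_lebesgue"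
    proof (cases "i \<in> {1..k}")
      case True
      then have "x i \<in> space half_lebesgue" using assms(1) by (simp add: Pi_iff)
      with True show ?thesis by (simp only: True if_True) (rule measurable_const)
    next
      case False
      then have "i \<in> {k+1..d}" using i by auto
      then have "(\<lambda>t. t i) \<in> measurable (Pi\<^sub>M {k+1..d} (\<lambda>i. half_lebesgue)) half_lebesgue"
        by (rule measurable_component_singleton)
      then show ?thesis by (simp only: False if_False)
    qed
  qed
  also have "(\<lambda>t. \<lambda>i\<in>{1..d}. if i \<in> {1..k} then x i else t i) = (\<lambda>t. merge {1..k} {k+1..d} (x, t))"
    using assms(2) by (auto simp: fun_eq_iff merge_def restrict_def)
  finally show ?thesis .
qed

lemma integrable_merge:
  assumes "x \<in> {1..k} \<rightarrow> {-1..1}" "k \<le> d"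
  shows "integrable (cube_measure {k+1..d}) (\<lambda>t. f (merge {1..k} {k+1..d} (x, t)))"
proof -
  interpret M: prob_space "cube_measure {k+1..d}" by (rule prob_space_cube_measure)
  show ?thesis
  proof (rule M.integrable_const_bound[where B=L])
    show "AE t in cube_measure {k+1..d}. norm (f (merge {1..k} {k+1..d} (x, t))) \<le> L"
    proof (rule AE_I2)
      fix t assume "t \<in> space (cube_measure {k+1..d})"
      from merge_in_cube[OF assms this] show "norm (f (merge {1..k} {k+1..d} (x, t))) \<le> L"
        using lower upper m by (force intro: order_trans)
    qed
    show "(\<lambda>t. f (merge {1..k} {k+1..d} (x, t))) \<in> borel_measurable (cube_measure {k+1..d})"
      by (rule measurable_compose[OF measurable_merge_cube[OF assms] meas])
  qed
qed

text \<open>Because the total mass is 1, the integral formula also covers \<open>k = 0\<close>,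
  which the definition treats separately.\<close>

lemma marginal_eq:
  "marginal d f k x = (\<integral>t. f (merge {1..k} {k+1..d} (x, t)) \<partial>cube_measure {k+1..d})"
proof (cases "k = 0")
  case True
  have "(\<integral>t. f (merge {1..0} {0+1..d} (x, t)) \<partial>cube_measure {0+1..d}) = (\<integral>t. f t \<partial>cube_measure {1..d})"
  proof (rule Bochner_Integration.integral_cong)
    fix t assume "t \<in> space (cube_measure {1..d})"
    then have "merge {1..0} {0+1..d} (x, t) = t"
      by (auto simp: merge_def fun_eq_iff space_cube_measure cube_def PiE_iff extensional_def)
    then show "f (merge {1..0} {0+1..d} (x, t)) = f t" by simp
  qed simp
  then show ?thesis using True total by (simp add: marginal_def)
qed (simp add: marginal_def)

lemma marginal_dep: "(\<And>i. i \<in> {1..k} \<Longrightarrow> x i = y i) \<Longrightarrow> marginal d f k x = marginal d f k y"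
proof -
  assume "\<And>i. i \<in> {1..k} \<Longrightarrow> x i = y i"
  then have "merge {1..k} {k+1..d} (x, t) = merge {1..k} {k+1..d} (y, t)" for t
    by (auto simp: merge_def fun_eq_iff)
  then show ?thesis by (simp add: marginal_def)
qed

lemma marginal_pos:
  assumes "x \<in> {1..k} \<rightarrow> {-1..1}" "k \<le> d"
  shows "0 < marginal d f k x"
proof -
  interpret M: prob_space "cube_measure {k+1..d}" by (rule prob_space_cube_measure)
  have "(\<integral>t. m \<partial>cube_measure {k+1..d}) \<le> marginal d f k x"
    unfolding marginal_eq
    by (rule integral_mono[OF M.integrable_const integrable_merge[OF assms]])
       (rule lower[OF merge_in_cube[OF assms]])
  then show ?thesis using m M.prob_space by simp
qed

lemma marginal_continuous:
  assumes x: "x \<in> {1..<k} \<rightarrow> {-1..1}" and k: "1 \<le> k" "k \<le> d"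
  shows "continuous_on {-1..1} (\<lambda>t. marginal d f k (x(k := t)))"
proof -
  have "\<Lambda>-lipschitz_on {-1..1} (\<lambda>t. marginal d f k (x(k := t)))"
  proof (rule lipschitz_onI[OF _ \<Lambda>])
    fix s t :: real assume st: "s \<in> {-1..1}" "t \<in> {-1..1}"
    interpret M: prob_space "cube_measure {k+1..d}" by (rule prob_space_cube_measure)
    have xs: "x(k := s) \<in> {1..k} \<rightarrow> {-1..1}" "x(k := t) \<in> {1..k} \<rightarrow> {-1..1}"
      using st x by (auto simp: Pi_iff)
    let ?h = "\<lambda>s u. f (merge {1..k} {k+1..d} (x(k := s), u))"
    note int = integrable_merge[OF xs(1) k(2)] integrable_merge[OF xs(2) k(2)]
    have pt: "\<bar>?h s u - ?h t u\<bar> \<le> \<Lambda> * \<bar>s - t\<bar>" if u: "u \<in> space (cube_measure {k+1..d})" for u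
    proof -
      let ?a = "merge {1..k} {k+1..d} (x(k := s), u)" and ?b = "merge {1..k} {k+1..d} (x(k := t), u)"
      have "\<bar>f ?a - f ?b\<bar> \<le> \<Lambda> * (\<Sum>i=1..d. \<bar>?a i - ?b i\<bar>)"
        by (rule lip[OF merge_in_cube[OF xs(1) k(2) u] merge_in_cube[OF xs(2) k(2) u]])
      also have "(\<Sum>i=1..d. \<bar>?a i - ?b i\<bar>) = (\<Sum>i=1..d. if i = k then \<bar>s - t\<bar> else 0)"
        using k by (intro sum.cong) (auto simp: merge_def)
      also have "\<dots> = \<bar>s - t\<bar>" using k by simp
      finally show ?thesis .
    qed
    have "\<bar>(\<integral>u. ?h s u - ?h t u \<partial>cube_measure {k+1..d})\<bar> \<le> (\<integral>u. \<bar>?h s u - ?h t u\<bar> \<partial>cube_measure {k+1..d})"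
      by (rule integral_abs_bound)
    also have "\<dots> \<le> (\<integral>u. \<Lambda> * \<bar>s - t\<bar> \<partial>cube_measure {k+1..d})"
      by (rule integral_mono[OF integrable_abs[OF Bochner_Integration.integrable_diff[OF int]] M.integrable_const pt])
    also have "\<dots> = \<Lambda> * \<bar>s - t\<bar>" using M.prob_space by simp
    finally show "dist (marginal d f k (x(k := s))) (marginal d f k (x(k := t))) \<le> \<Lambda> * dist s t"
      unfolding marginal_eq dist_real_def using int by simp
  qed
  then show ?thesis by (rule lipschitz_on_continuous_on)
qed

text \<open>Fubini: integrating the last variable of a marginal leads to the preceding one. Hence
  the conditionals have mass 1 with respect to half the Lebesgue measure.\<close>

lemma marginal_step:
  assumes x: "x \<in> {1..<k} \<rightarrow> {-1..1}" and k: "1 \<le> k" "k \<le> d"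
  shows "(\<integral>t. marginal d f k (x(k := t)) \<partial>half_lebesgue) = marginal d f (k - 1) x"
proof -
  let ?H = "\<lambda>t. f (merge {1..k-1} {k-1+1..d} (x, t))"
  have x': "x \<in> {1..k-1} \<rightarrow> {-1..1}" using x k by (auto simp: Pi_iff)
  have set: "{k-1+1..d} = {k} \<union> {k+1..d}" using k by auto
  have int: "integrable (Pi\<^sub>M ({k} \<union> {k+1..d}) (\<lambda>_. half_lebesgue)) ?H"
    using integrable_merge[OF x'] k unfolding set cube_measure_def by auto
  have "marginal d f (k - 1) x = (\<integral>t. ?H t \<partial>Pi\<^sub>M ({k} \<union> {k+1..d}) (\<lambda>_. half_lebesgue))"
    unfolding marginal_eq unfolding set cube_measure_def by simp
  also have "\<dots> = (\<integral>s. (\<integral>u. ?H (merge {k} {k+1..d} (s, u)) \<partial>Pi\<^sub>M {k+1..d} (\<lambda>_. half_lebesgue)) \<partial>Pi\<^sub>M {k} (\<lambda>_. half_lebesgue))"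
    by (rule cube.product_integral_fold[OF _ _ _ int]) auto
  also have "\<dots> = (\<integral>s. marginal d f k (x(k := s k)) \<partial>Pi\<^sub>M {k} (\<lambda>_. half_lebesgue))"
  proof (rule Bochner_Integration.integral_cong[OF refl])
    fix s
    have "merge {1..k-1} {k-1+1..d} (x, merge {k} {k+1..d} (s, u)) = merge {1..k} {k+1..d} (x(k := s k), u)" for u
      using k by (auto simp: merge_def fun_eq_iff)
    then show "(\<integral>u. ?H (merge {k} {k+1..d} (s, u)) \<partial>Pi\<^sub>M {k+1..d} (\<lambda>_. half_lebesgue)) = marginal d f k (x(k := s k))"
      unfolding marginal_eq cube_measure_def by simp
  qed
  also have "\<dots> = (\<integral>t. marginal d f k (x(k := t)) \<partial>half_lebesgue)"
    by (rule cube.product_integral_singleton)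
       (rule continuous_measurable_half[OF marginal_continuous[OF x k]])
  finally show ?thesis by simp
qed

lemma marginal_full: "x \<in> cube d \<Longrightarrow> marginal d f d x = f x"
proof -
  assume x: "x \<in> cube d"
  interpret M: prob_space "cube_measure {d+1..d}" by (rule prob_space_cube_measure)
  have "merge {1..d} {d+1..d} (x, t) = x" for t
    using x by (auto simp: merge_def fun_eq_iff cube_def PiE_iff extensional_def)
  then show ?thesis unfolding marginal_eq using M.prob_space by simp
qed

lemma conditional_dep: "1 \<le> k \<Longrightarrow> (\<And>i. i \<in> {1..k} \<Longrightarrow> x i = y i) \<Longrightarrow> conditional d f k x = conditional d f k y"
proof -
  assume k: "1 \<le> k" and eq: "\<And>i. i \<in> {1..k} \<Longrightarrow> x i = y i"
  have "marginal d f k x = marginal d f k y" by (rule marginal_dep) (rule eq)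
  moreover have "marginal d f (k - 1) x = marginal d f (k - 1) y" by (rule marginal_dep) (use k eq in auto)
  ultimately show ?thesis by (simp add: conditional_def)
qed

lemma conditional_upd: "1 \<le> k \<Longrightarrow> conditional d f k (x(k := t)) = marginal d f k (x(k := t)) / marginal d f (k - 1) x"
proof -
  assume k: "1 \<le> k"
  have "marginal d f (k - 1) (x(k := t)) = marginal d f (k - 1) x" by (rule marginal_dep) (use k in auto)
  then show ?thesis by (simp add: conditional_def)
qed

lemma conditional_cdf_dep: "1 \<le> k \<Longrightarrow> (\<And>i. i \<in> {1..k} \<Longrightarrow> x i = y i) \<Longrightarrow> conditional_cdf d f k x = conditional_cdf d f k y"
proof -
  assume k: "1 \<le> k" and eq: "\<And>i. i \<in> {1..k} \<Longrightarrow> x i = y i"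
  have "conditional d f k (x(k := t)) = conditional d f k (y(k := t))" for t
    using k eq by (intro conditional_dep) auto
  moreover have "x k = y k" using eq k by auto
  ultimately show ?thesis by (simp add: conditional_cdf_def)
qed

section \<open>One-dimensional conditional distribution functions\<close>

context
  fixes k :: nat and x :: "nat \<Rightarrow> real"
  assumes x: "x \<in> {1..<k} \<rightarrow> {-1..1}" and k: "1 \<le> k" "k \<le> d"
begin

lemma conditional_continuous: "continuous_on {-1..1} (\<lambda>t. conditional d f k (x(k := t)))"
proof -
  have "0 < marginal d f (k - 1) x" by (rule marginal_pos) (use x k in \<open>auto simp: Pi_iff\<close>)
  then show ?thesis unfolding conditional_upd[OF k(1)]
    by (intro continuous_intros marginal_continuous[OF x k]) auto
qed

lemma conditional_pos: "t \<in> {-1..1} \<Longrightarrow> 0 < conditional d f k (x(k := t))"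
  unfolding conditional_upd[OF k(1)]
  by (intro divide_pos_pos marginal_pos) (use x k in \<open>auto simp: Pi_iff\<close>)

lemma cdf_eq: "t \<in> {-1..1} \<Longrightarrow> conditional_cdf d f k (x(k := t)) = integral {-1..t} (\<lambda>s. conditional d f k (x(k := s)))"
proof -
  assume t: "t \<in> {-1..1}"
  have "continuous_on {-1..t} (\<lambda>s. conditional d f k (x(k := s)))"
    by (rule continuous_on_subset[OF conditional_continuous]) (use t in auto)
  then have "set_integrable lborel {-1..t} (\<lambda>s. conditional d f k (x(k := s)))"
    by (rule borel_integrable_atLeastAtMost')
  from set_borel_integral_eq_integral(2)[OF this] show ?thesis by (simp add: conditional_cdf_def)
qed

lemma cdf_deriv:
  assumes t: "t \<in> {-1..1}"
  shows "((\<lambda>t. conditional_cdf d f k (x(k := t))) has_real_derivative conditional d f k (x(k := t))) (at t within {-1..1})"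
proof -
  have "((\<lambda>t. integral {-1..t} (\<lambda>s. conditional d f k (x(k := s)))) has_real_derivative conditional d f k (x(k := t))) (at t within {-1..1})"
    by (rule integral_has_real_derivative[OF conditional_continuous t])
  then show ?thesis
    by (rule has_field_derivative_transform_within[OF _ zero_less_one t]) (use cdf_eq in auto)
qed

lemma cdf_left: "conditional_cdf d f k (x(k := -1)) = 0"
  by (subst cdf_eq) auto

text \<open>The value is 2 rather than 1 because densities refer to half the Lebesgue measure, while
  the distribution function integrates against the full one.\<close>

lemma cdf_right: "conditional_cdf d f k (x(k := 1)) = 2"
proof -
  have pos: "0 < marginal d f (k - 1) x" by (rule marginal_pos) (use x k in \<open>auto simp: Pi_iff\<close>)
  have "(1/2) * conditional_cdf d f k (x(k := 1)) = (\<integral>t. conditional d f k (x(k := t)) \<partial>half_lebesgue)"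
    using integral_half_lebesgue[OF continuous_measurable_half[OF conditional_continuous]]
    by (simp add: conditional_cdf_def)
  also have "\<dots> = (\<integral>t. marginal d f k (x(k := t)) \<partial>half_lebesgue) / marginal d f (k - 1) x"
    unfolding conditional_upd[OF k(1)] by simp
  also have "\<dots> = 1" using marginal_step[OF x k] pos by simp
  finally show ?thesis by simp
qed

lemma cdf_strict_mono:
  assumes "s \<in> {-1..1}" "t \<in> {-1..1}" "s < t"
  shows "conditional_cdf d f k (x(k := s)) < conditional_cdf d f k (x(k := t))"
proof -
  let ?G = "\<lambda>t. conditional_cdf d f k (x(k := t))"
  have c: "continuous_on {-1..1} ?G"
    using cdf_deriv DERIV_continuous continuous_on_eq_continuous_within by blast
  have "?G s < ?G t"
  proof (rule DERIV_pos_imp_increasing_open[OF assms(3)])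
    show "continuous_on {s..t} ?G" by (rule continuous_on_subset[OF c]) (use assms in auto)
    fix u assume u: "s < u" "u < t"
    then have ui: "u \<in> {-1..1}" "u \<in> {-1<..<1}" using assms by auto
    have "(?G has_real_derivative conditional d f k (x(k := u))) (at u within {-1<..<1})"
      by (rule DERIV_subset[OF cdf_deriv[OF ui(1)]]) auto
    then have "(?G has_real_derivative conditional d f k (x(k := u))) (at u)"
      using at_within_open[OF ui(2)] by simp
    then show "\<exists>D. (?G has_real_derivative D) (at u) \<and> 0 < D" using conditional_pos[OF ui(1)] by blast
  qed
  then show ?thesis .
qed

lemma cdf_continuous: "continuous_on {-1..1} (\<lambda>t. conditional_cdf d f k (x(k := t)))"
  using cdf_deriv DERIV_continuous continuous_on_eq_continuous_within by blast

lemma cdf_inj: "inj_on (\<lambda>t. conditional_cdf d f k (x(k := t))) {-1..1}"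
  by (rule linorder_inj_onI) (use cdf_strict_mono in \<open>force+\<close>)

lemma cdf_range:
  assumes t: "t \<in> {-1..1}" shows "conditional_cdf d f k (x(k := t)) \<in> {0..2}"
proof -
  have "conditional_cdf d f k (x(k := -1)) \<le> conditional_cdf d f k (x(k := t))"
    using cdf_strict_mono[of "-1" t] t by (cases "t = -1") auto
  moreover have "conditional_cdf d f k (x(k := t)) \<le> conditional_cdf d f k (x(k := 1))"
    using cdf_strict_mono[of t 1] t by (cases "t = 1") auto
  ultimately show ?thesis unfolding cdf_left cdf_right by simp
qed

lemma cdf_inverse:
  assumes "v \<in> {0..2}"
  defines "y \<equiv> the_inv_into {-1..1} (\<lambda>t. conditional_cdf d f k (x(k := t))) v"
  shows "y \<in> {-1..1}" "conditional_cdf d f k (x(k := y)) = v"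
proof -
  let ?G = "\<lambda>t. conditional_cdf d f k (x(k := t))"
  have "\<exists>t\<ge>-1. t \<le> 1 \<and> ?G t = v"
    by (rule IVT'[OF _ _ _ cdf_continuous]) (use assms(1) in \<open>auto simp: cdf_left cdf_right\<close>)
  then have "v \<in> ?G ` {-1..1}" by auto
  then show "y \<in> {-1..1}" "conditional_cdf d f k (x(k := y)) = v"
    unfolding y_def using the_inv_into_into[OF cdf_inj, of v "{-1..1}"] f_the_inv_into_f[OF cdf_inj, of v] by auto
qed

end

text \<open>The quotients of consecutive marginals telescope, from the constant 1 to the density
  itself.\<close>

lemma prod_conditional:
  assumes x: "x \<in> cube d"
  shows "(\<Prod>k=1..d. conditional d f k x) = f x"
proof -
  have "(\<Prod>k=1..n. conditional d f k x) = marginal d f n x" if "n \<le> d" for n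
    using that
  proof (induction n)
    case 0
    then show ?case by (simp add: marginal_def)
  next
    case (Suc n)
    have "0 < marginal d f n x" by (rule marginal_pos) (use Suc.prems in \<open>auto intro!: cube_memD[OF x]\<close>)
    then show ?case using Suc by (simp add: conditional_def)
  qed
  from this[OF order_refl] show ?thesis using marginal_full[OF x] by simp
qed

end

section \<open>The transport between two densities\<close>

locale kr_pair = \<rho>: lipschitz_density d f\<^sub>\<rho> m L \<Lambda> + \<pi>: lipschitz_density d f\<^sub>\<pi> m L \<Lambda>
  for d f\<^sub>\<rho> f\<^sub>\<pi> m L \<Lambda>
begin

abbreviation kr where "kr k \<equiv> kr_map d f\<^sub>\<rho> f\<^sub>\<pi> k"
abbreviation T where "T \<equiv> kr_comp d f\<^sub>\<rho> f\<^sub>\<pi>"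

lemma kr_eq: "i \<in> {1..k} \<Longrightarrow> kr k x i = T i x"
proof (induction k)
  case (Suc k)
  then show ?case by (cases "i = Suc k") (auto simp: kr_comp_def)
qed simp

lemma kr_undefined: "i \<notin> {1..k} \<Longrightarrow> kr k x i = undefined"
  by (induction k) auto

lemma T_dep: "k \<in> {1..d} \<Longrightarrow> (\<And>i. i \<in> {1..k} \<Longrightarrow> x i = y i) \<Longrightarrow> T k x = T k y"
proof -
  have "kr k x = kr k y" if "k \<le> d" "\<And>i. i \<in> {1..k} \<Longrightarrow> x i = y i" for k
    using that
  proof (induction k)
    case (Suc k)
    have "kr k x = kr k y" using Suc by auto
    moreover have "conditional_cdf d f\<^sub>\<rho> (Suc k) x = conditional_cdf d f\<^sub>\<rho> (Suc k) y"
      using Suc by (intro \<rho>.conditional_cdf_dep) auto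
    ultimately show ?case by simp
  qed simp
  then show "k \<in> {1..d} \<Longrightarrow> (\<And>i. i \<in> {1..k} \<Longrightarrow> x i = y i) \<Longrightarrow> T k x = T k y"
    by (simp add: kr_comp_def)
qed

text \<open>The equation that defines the transport. The inverse of a conditional distribution
  function is only under control when all earlier components lie in the interval, so both claims are
  proved together by strong induction.\<close>

lemma T_cdf:
  assumes "k \<in> {1..d}" and x: "x \<in> {1..k} \<rightarrow> {-1..1}"
  shows "T k x \<in> {-1..1} \<and> conditional_cdf d f\<^sub>\<pi> k (kr k x) = conditional_cdf d f\<^sub>\<rho> k x"
  using assms
proof (induction k rule: less_induct)
  case (less k)
  obtain j where j: "k = Suc j" using less.prems by (cases k) auto
  have prev: "kr j x \<in> {1..<k} \<rightarrow> {-1..1}"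
  proof
    fix i assume i: "i \<in> {1..<k}"
    have "T i x \<in> {-1..1} \<and> conditional_cdf d f\<^sub>\<pi> i (kr i x) = conditional_cdf d f\<^sub>\<rho> i x"
      by (rule less.IH) (use i less.prems in auto)
    then show "kr j x i \<in> {-1..1}" using kr_eq[of i j x] i j by simp
  qed
  have k: "1 \<le> k" "k \<le> d" using less.prems by auto
  have "conditional_cdf d f\<^sub>\<rho> k (x(k := x k)) \<in> {0..2}"
    by (rule \<rho>.cdf_range) (use less.prems in \<open>auto simp: Pi_iff\<close>)
  then have v: "conditional_cdf d f\<^sub>\<rho> k x \<in> {0..2}" by simp
  have T: "T k x = the_inv_into {-1..1} (\<lambda>t. conditional_cdf d f\<^sub>\<pi> k ((kr j x)(k := t))) (conditional_cdf d f\<^sub>\<rho> k x)"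
    by (simp add: kr_comp_def j)
  have kx: "kr k x = (kr j x)(k := T k x)" by (simp add: kr_comp_def j)
  show ?case unfolding kx unfolding T
    by (intro conjI \<pi>.cdf_inverse[OF prev k v])
qed

lemma T_range: "k \<in> {1..d} \<Longrightarrow> x \<in> {1..k} \<rightarrow> {-1..1} \<Longrightarrow> T k x \<in> {-1..1}"
  using T_cdf by blast

lemma T_cdf':
  assumes k: "k \<in> {1..d}" and x: "x \<in> {1..k} \<rightarrow> {-1..1}"
  shows "conditional_cdf d f\<^sub>\<pi> k (kr d x) = conditional_cdf d f\<^sub>\<rho> k x"
proof -
  have "conditional_cdf d f\<^sub>\<pi> k (kr d x) = conditional_cdf d f\<^sub>\<pi> k (kr k x)"
    using k kr_eq[of _ d x] kr_eq[of _ k x] by (intro \<pi>.conditional_cdf_dep) auto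
  then show ?thesis using T_cdf[OF k x] by simp
qed

lemma T_upd:
  assumes x: "x \<in> cube d" and k: "k \<in> {1..d}" and t: "t \<in> {-1..1}"
  shows "T k (x(k := t)) \<in> {-1..1}"
    "conditional_cdf d f\<^sub>\<pi> k ((kr d x)(k := T k (x(k := t)))) = conditional_cdf d f\<^sub>\<rho> k (x(k := t))"
proof -
  have xt: "x(k := t) \<in> {1..k} \<rightarrow> {-1..1}"
  proof
    fix i assume "i \<in> {1..k}"
    then show "(x(k := t)) i \<in> {-1..1}" using t k cube_memD[OF x, of i] by (cases "i = k") auto
  qed
  show "T k (x(k := t)) \<in> {-1..1}" by (rule T_range[OF k xt])
  have "conditional_cdf d f\<^sub>\<pi> k ((kr d x)(k := T k (x(k := t)))) = conditional_cdf d f\<^sub>\<pi> k (kr d (x(k := t)))"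
  proof (rule \<pi>.conditional_cdf_dep)
    fix i assume i: "i \<in> {1..k}"
    show "((kr d x)(k := T k (x(k := t)))) i = kr d (x(k := t)) i"
    proof (cases "i = k")
      case False
      have "T i x = T i (x(k := t))" by (rule T_dep) (use i k False in auto)
      then show ?thesis using False i k kr_eq[of i d] by simp
    qed (use k kr_eq[of k d] in simp)
  qed (use k in auto)
  then show "conditional_cdf d f\<^sub>\<pi> k ((kr d x)(k := T k (x(k := t)))) = conditional_cdf d f\<^sub>\<rho> k (x(k := t))"
    using T_cdf'[OF k xt] by simp
qed

lemma kr_in_cube: "x \<in> cube d \<Longrightarrow> kr d x \<in> cube d"
proof -
  assume x: "x \<in> cube d"
  have "T i x \<in> {-1..1}" if "i \<in> {1..d}" for i
    by (rule T_range[OF that]) (use that in \<open>auto intro!: cube_memD[OF x]\<close>)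
  then show ?thesis using kr_eq[of _ d x] kr_undefined[of _ d x]
    by (auto simp: cube_def PiE_iff extensional_def)
qed

text \<open>Both distribution functions take the values 0 and 2 at the end points, and the one of
  the target is injective.\<close>

lemma T_ends:
  assumes x: "x \<in> cube d" and k: "k \<in> {1..d}"
  shows "T k (x(k := -1)) = -1" "T k (x(k := 1)) = 1"
proof -
  have kr: "kr d x \<in> {1..<k} \<rightarrow> {-1..1}" by (rule Pi_I, rule cube_memD[OF kr_in_cube[OF x]]) (use k in auto)
  have xi: "x \<in> {1..<k} \<rightarrow> {-1..1}" by (rule Pi_I, rule cube_memD[OF x]) (use k in auto)
  have k': "1 \<le> k" "k \<le> d" using k by auto
  note inj = \<pi>.cdf_inj[OF kr k', THEN inj_onD]
  show "T k (x(k := -1)) = -1"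
    by (rule inj) (use T_upd[OF x k, of "-1"] \<pi>.cdf_left[OF kr k'] \<rho>.cdf_left[OF xi k'] in auto)
  show "T k (x(k := 1)) = 1"
    by (rule inj) (use T_upd[OF x k, of 1] \<pi>.cdf_right[OF kr k'] \<rho>.cdf_right[OF xi k'] in auto)
qed

text \<open>Differentiates the defining equation in the last variable by the chain rule. The
  existence of \<open>D\<close> is assumed here; it comes with the regularity constants.\<close>

lemma T_derivative_relation:
  assumes x: "x \<in> cube d" and k: "k \<in> {1..d}"
    and D: "((\<lambda>t. T k (x(k := t))) has_real_derivative D) (at (x k) within {-1..1})"
  shows "D * conditional d f\<^sub>\<pi> k (kr d x) = conditional d f\<^sub>\<rho> k x"
proof -
  have kr: "kr d x \<in> {1..<k} \<rightarrow> {-1..1}" by (rule Pi_I, rule cube_memD[OF kr_in_cube[OF x]]) (use k in auto)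
  have xi: "x \<in> {1..<k} \<rightarrow> {-1..1}" by (rule Pi_I, rule cube_memD[OF x]) (use k in auto)
  have k': "1 \<le> k" "k \<le> d" using k by auto
  have xk: "x k \<in> {-1..1}" using cube_memD[OF x k] .
  let ?u = "\<lambda>t. T k (x(k := t))" and ?G = "\<lambda>y. conditional_cdf d f\<^sub>\<pi> k ((kr d x)(k := y))"
  let ?H = "\<lambda>t. conditional_cdf d f\<^sub>\<rho> k (x(k := t))"
  have u: "?u t \<in> {-1..1}" if "t \<in> {-1..1}" for t by (rule T_upd(1)[OF x k that])
  have uk: "?u (x k) = kr d x k" using kr_eq[of k d x] k by simp
  have "(?G has_real_derivative conditional d f\<^sub>\<pi> k ((kr d x)(k := ?u (x k)))) (at (?u (x k)) within {-1..1})"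
    by (rule \<pi>.cdf_deriv[OF kr k' u[OF xk]])
  then have "(?G has_real_derivative conditional d f\<^sub>\<pi> k (kr d x)) (at (?u (x k)) within {-1..1})"
    unfolding uk by simp
  then have "(?G has_real_derivative conditional d f\<^sub>\<pi> k (kr d x)) (at (?u (x k)) within ?u ` {-1..1})"
    by (rule DERIV_subset) (use u in blast)
  from DERIV_image_chain[OF this D]
  have 1: "((?G \<circ> ?u) has_real_derivative conditional d f\<^sub>\<pi> k (kr d x) * D) (at (x k) within {-1..1})" .
  have 2: "((?G \<circ> ?u) has_real_derivative conditional d f\<^sub>\<rho> k (x(k := x k))) (at (x k) within {-1..1})"
    by (rule has_field_derivative_transform_within[OF \<rho>.cdf_deriv[OF xi k' xk] zero_less_one xk])
       (unfold comp_apply, rule T_upd(2)[OF x k, symmetric])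
  have "conditional d f\<^sub>\<pi> k (kr d x) * D = conditional d f\<^sub>\<rho> k (x(k := x k))"
    by (rule vector_derivative_unique_within_closed_interval[of "-1" 1 "x k" "?G \<circ> ?u"])
       (use xk 1 2 in \<open>auto simp: has_real_derivative_iff_has_vector_derivative\<close>)
  then show ?thesis by (simp add: mult.commute)
qed

text \<open>The change of variables formula for the transport in pointwise form, obtained by
  multiplying the one-dimensional relations and telescoping the conditionals on both sides.\<close>

lemma density_relation:
  assumes x: "x \<in> cube d"
    and D: "\<And>k. k \<in> {1..d} \<Longrightarrow> ((\<lambda>t. T k (x(k := t))) has_real_derivative D k) (at (x k) within {-1..1})"
  shows "f\<^sub>\<rho> x = f\<^sub>\<pi> (kr d x) * (\<Prod>k=1..d. D k)"
proof -
  have "f\<^sub>\<rho> x = (\<Prod>k=1..d. conditional d f\<^sub>\<rho> k x)" using \<rho>.prod_conditional[OF x] by simp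
  also have "\<dots> = (\<Prod>k=1..d. D k * conditional d f\<^sub>\<pi> k (kr d x))"
    by (intro prod.cong refl T_derivative_relation[OF x _ D, symmetric]) auto
  also have "\<dots> = (\<Prod>k=1..d. D k) * f\<^sub>\<pi> (kr d x)"
    unfolding prod.distrib \<pi>.prod_conditional[OF kr_in_cube[OF x]] ..
  finally show ?thesis by (simp add: mult.commute)
qed

end

section \<open>From the assumptions to boxes\<close>

lemma continuous_on_L2_coords:
  fixes z :: "nat \<Rightarrow> complex"
  shows "continuous_on UNIV (\<lambda>w :: nat \<Rightarrow> complex. L2_set (\<lambda>i. cmod (w i - z i)) {1..n})"
  unfolding L2_set_def by (intro continuous_intros)

text \<open>Frechet differentiability gives continuity, and along coordinate lines complex
  differentiability. Restriction maps the box, with its free outer coordinates, into the domain of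
  \<open>g\<close>.\<close>

lemma hol_on_box_multi_holomorphic:
  assumes g: "multi_holomorphic_on n g (PiE {1..n} V)" and V: "\<And>i. i \<in> {1..n} \<Longrightarrow> open (V i)" and I: "{1..n} \<subseteq> I"
  shows "hol_on_box I V (\<lambda>z. g (restrict z {1..n}))"
  unfolding hol_on_box_def
proof (intro conjI ballI)
  have mem: "restrict z {1..n} \<in> PiE {1..n} V" if "z \<in> Pi I V" for z using that I by auto
  have L2: "L2_set (\<lambda>i. cmod (restrict w {1..n} i - restrict z {1..n} i)) {1..n} = L2_set (\<lambda>i. cmod (w i - z i)) {1..n}" for w z
    by (intro L2_set_cong) auto
  show "continuous_on (Pi I V) (\<lambda>z. g (restrict z {1..n}))"
    unfolding continuous_on_def
  proof
    fix z assume z: "z \<in> Pi I V"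
    obtain a :: "nat \<Rightarrow> complex" where a: "\<forall>e>0. \<exists>r>0. \<forall>w\<in>PiE {1..n} V.
        L2_set (\<lambda>i. cmod (w i - restrict z {1..n} i)) {1..n} < r \<longrightarrow>
        cmod (g w - g (restrict z {1..n}) - (\<Sum>i=1..n. a i * (w i - restrict z {1..n} i)))
          \<le> e * L2_set (\<lambda>i. cmod (w i - restrict z {1..n} i)) {1..n}"
      using g mem[OF z] unfolding multi_holomorphic_on_def by blast
    \<comment> \<open>Tolerance 1 is enough for continuity: the increment is then at most the norm
      plus the modulus of the linear part, and both tend to 0.\<close>
    obtain r where r: "r > 0" "\<forall>w\<in>PiE {1..n} V.
        L2_set (\<lambda>i. cmod (w i - restrict z {1..n} i)) {1..n} < r \<longrightarrow>
        cmod (g w - g (restrict z {1..n}) - (\<Sum>i=1..n. a i * (w i - restrict z {1..n} i)))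
          \<le> 1 * L2_set (\<lambda>i. cmod (w i - restrict z {1..n} i)) {1..n}"
      using a[rule_format, of 1] by auto
    let ?N = "\<lambda>w. L2_set (\<lambda>i. cmod (w i - z i)) {1..n}"
    let ?h = "\<lambda>w. ?N w + cmod (\<Sum>i=1..n. a i * (w i - z i))"
    have ch: "continuous_on UNIV ?h" by (intro continuous_intros continuous_on_L2_coords)
    have N0: "?N z = 0" by (simp add: L2_set_def)
    have hz: "?h z = 0" using N0 by simp
    have "(?N \<longlongrightarrow> ?N z) (at z within Pi I V)"
      using continuous_on_subset[OF continuous_on_L2_coords[of z n] subset_UNIV, of "Pi I V"] z
      unfolding continuous_on_def by blast
    then have "(?N \<longlongrightarrow> 0) (at z within Pi I V)" unfolding N0 .
    then have ev: "\<forall>\<^sub>F w in at z within Pi I V. ?N w < r"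
      using r(1) by (rule order_tendstoD)
    have "(?h \<longlongrightarrow> ?h z) (at z within Pi I V)"
      using continuous_on_subset[OF ch subset_UNIV, of "Pi I V"] z unfolding continuous_on_def by blast
    then have h0: "(?h \<longlongrightarrow> 0) (at z within Pi I V)" unfolding hz .
    have "\<forall>\<^sub>F w in at z within Pi I V. w \<in> Pi I V" by (simp add: eventually_at_filter)
    with ev have "\<forall>\<^sub>F w in at z within Pi I V. norm (g (restrict w {1..n}) - g (restrict z {1..n})) \<le> ?h w"
    proof eventually_elim
      case (elim w)
      have S: "(\<Sum>i=1..n. a i * (restrict w {1..n} i - restrict z {1..n} i)) = (\<Sum>i=1..n. a i * (w i - z i))"
        by (intro sum.cong) auto
      have "cmod (g (restrict w {1..n}) - g (restrict z {1..n}) - (\<Sum>i=1..n. a i * (w i - z i))) \<le> ?N w"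
        using r(2)[rule_format, OF mem[OF elim(2)]] elim(1) unfolding L2 S by simp
      then show ?case
        using norm_triangle_ineq2[of "g (restrict w {1..n}) - g (restrict z {1..n})" "\<Sum>i=1..n. a i * (w i - z i)"]
        by linarith
    qed
    then have "((\<lambda>w. g (restrict w {1..n}) - g (restrict z {1..n})) \<longlongrightarrow> 0) (at z within Pi I V)"
      using h0 by (rule Lim_null_comparison)
    then show "((\<lambda>w. g (restrict w {1..n})) \<longlongrightarrow> g (restrict z {1..n})) (at z within Pi I V)"
      by (rule LIM_zero_cancel)
  qed
  fix z i assume z: "z \<in> Pi I V" and i: "i \<in> I"
  show "(\<lambda>u. g (restrict (z(i := u)) {1..n})) holomorphic_on V i"
  proof (cases "i \<in> {1..n}")
    case False
    then have "restrict (z(i := u)) {1..n} = restrict z {1..n}" for u by (auto simp: fun_eq_iff restrict_def)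
    then show ?thesis by simp
  next
    case True
    show ?thesis unfolding holomorphic_on_def
    proof
      fix u assume u: "u \<in> V i"
      let ?z = "\<lambda>u. restrict (z(i := u)) {1..n}"
      have zu: "?z v \<in> PiE {1..n} V" if "v \<in> V i" for v by (rule mem) (use z that in auto)
      obtain a :: "nat \<Rightarrow> complex" where a: "\<forall>e>0. \<exists>r>0. \<forall>w\<in>PiE {1..n} V.
        L2_set (\<lambda>j. cmod (w j - ?z u j)) {1..n} < r \<longrightarrow>
        cmod (g w - g (?z u) - (\<Sum>j=1..n. a j * (w j - ?z u j)))
          \<le> e * L2_set (\<lambda>j. cmod (w j - ?z u j)) {1..n}"
        using g zu[OF u] unfolding multi_holomorphic_on_def by blast
      have L: "L2_set (\<lambda>j. cmod (?z v j - ?z u j)) {1..n} = cmod (v - u)" for v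
      proof -
        have "L2_set (\<lambda>j. cmod (?z v j - ?z u j)) {1..n} = L2_set (\<lambda>j. if j = i then cmod (v - u) else 0) {1..n}"
          by (intro L2_set_cong) auto
        also have "\<dots> = sqrt (\<Sum>j=1..n. if j = i then (cmod (v - u))\<^sup>2 else 0)"
          unfolding L2_set_def by (intro arg_cong[where f=sqrt] sum.cong) auto
        finally show ?thesis using True by simp
      qed
      have S: "(\<Sum>j=1..n. a j * (?z v j - ?z u j)) = a i * (v - u)" for v
      proof -
        have "(\<Sum>j=1..n. a j * (?z v j - ?z u j)) = (\<Sum>j=1..n. if j = i then a i * (v - u) else 0)"
          by (intro sum.cong) auto
        then show ?thesis using True by simp
      qed
      have "((\<lambda>u. g (?z u)) has_field_derivative a i) (at u within V i)"
        unfolding has_field_derivative_def has_derivative_within_alt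
      proof (intro conjI allI impI)
        show "bounded_linear ((*) (a i))" by (rule bounded_linear_mult_right)
        fix e :: real assume "0 < e"
        then obtain r where r: "r > 0" "\<forall>w\<in>PiE {1..n} V.
          L2_set (\<lambda>j. cmod (w j - ?z u j)) {1..n} < r \<longrightarrow>
          cmod (g w - g (?z u) - (\<Sum>j=1..n. a j * (w j - ?z u j)))
            \<le> e * L2_set (\<lambda>j. cmod (w j - ?z u j)) {1..n}" using a by blast
        have "norm (g (?z y) - g (?z u) - a i * (y - u)) \<le> e * norm (y - u)" if y: "y \<in> V i" "norm (y - u) < r" for y
          using r(2)[rule_format, OF zu[OF y(1)]] y(2) unfolding L S by simp
        then show "\<exists>d>0. \<forall>y\<in>V i. norm (y - u) < d \<longrightarrow> norm (g (?z y) - g (?z u) - a i * (y - u)) \<le> e * norm (y - u)"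
          using r(1) by blast
      qed
      then show "(\<lambda>u. g (?z u)) field_differentiable at u within V i"
        unfolding field_differentiable_def by blast
    qed
  qed
qed

text \<open>Coordinates of \<open>x\<close> are replaced by those of \<open>y\<close> one at a time,
  and each intermediate point stays in the cube.\<close>

lemma coordinatewise_lipschitz:
  fixes f :: "(nat \<Rightarrow> real) \<Rightarrow> real"
  assumes one: "\<And>x i t. x \<in> cube d \<Longrightarrow> i \<in> {1..d} \<Longrightarrow> t \<in> {-1..1} \<Longrightarrow> \<bar>f (x(i := t)) - f x\<bar> \<le> \<Lambda> * \<bar>t - x i\<bar>"
    and x: "x \<in> cube d" and y: "y \<in> cube d"
  shows "\<bar>f x - f y\<bar> \<le> \<Lambda> * (\<Sum>i=1..d. \<bar>x i - y i\<bar>)"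
proof -
  have "\<bar>f x - f y\<bar> \<le> \<Lambda> * (\<Sum>i=1..n. \<bar>x i - y i\<bar>)"
    if "n \<le> d" "\<And>i. n < i \<Longrightarrow> x i = y i" "x \<in> cube d" for n x
    using that
  proof (induction n arbitrary: x)
    case 0
    \<comment> \<open>Index 0 lies outside the index range, so both vectors are
      \<open>undefined\<close> there.\<close>
    have "x i = y i" for i
    proof (cases "i = 0")
      case True
      then show ?thesis using 0(3) y by (auto simp: cube_def PiE_iff extensional_def)
    qed (use 0 in auto)
    then have "x = y" by auto
    then show ?case by simp
  next
    case (Suc n)
    let ?x = "x(Suc n := y (Suc n))"
    have yn: "y (Suc n) \<in> {-1..1}" using cube_memD[OF y] Suc.prems by auto
    have x': "?x \<in> cube d" by (rule cube_fun_upd(2)[OF Suc.prems(3) yn]) (use Suc.prems in auto)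
    have "\<bar>f ?x - f y\<bar> \<le> \<Lambda> * (\<Sum>i=1..n. \<bar>?x i - y i\<bar>)"
      by (rule Suc.IH[OF _ _ x']) (use Suc.prems in \<open>auto simp: less_Suc_eq\<close>)
    also have "(\<Sum>i=1..n. \<bar>?x i - y i\<bar>) = (\<Sum>i=1..n. \<bar>x i - y i\<bar>)" by (intro sum.cong) auto
    finally have 1: "\<bar>f ?x - f y\<bar> \<le> \<Lambda> * (\<Sum>i=1..n. \<bar>x i - y i\<bar>)" .
    have 2: "\<bar>f ?x - f x\<bar> \<le> \<Lambda> * \<bar>y (Suc n) - x (Suc n)\<bar>"
      by (rule one[OF Suc.prems(3) _ yn]) (use Suc.prems in auto)
    have "\<Lambda> * (\<Sum>i=1..Suc n. \<bar>x i - y i\<bar>) = \<Lambda> * (\<Sum>i=1..n. \<bar>x i - y i\<bar>) + \<Lambda> * \<bar>y (Suc n) - x (Suc n)\<bar>"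
      by (simp add: distrib_left abs_minus_commute)
    then show ?case using 1 2 by linarith
  qed
  from this[of d x] show ?thesis using x y by (auto simp: cube_def PiE_iff extensional_def)
qed

section \<open>Densities satisfying the assumption, and real values of complex
  antiderivatives\<close>

lemma complexify_real_point: "complexify n x = restrict (real_point x) {1..n}"
  by (simp add: complexify_def real_point_def restrict_def)

lemma common_radius:
  assumes "\<And>j. j \<in> {1..d::nat} \<Longrightarrow> 0 < \<delta> j"
  obtains \<eta> :: real where "0 < \<eta>" "\<And>j. j \<in> {1..d} \<Longrightarrow> \<eta> \<le> \<delta> j"
proof
  show "0 < Min (insert 1 (\<delta> ` {1..d}))" using assms by (subst Min_gr_iff) auto
  show "\<And>j. j \<in> {1..d} \<Longrightarrow> Min (insert 1 (\<delta> ` {1..d})) \<le> \<delta> j" by (intro Min_le) auto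
qed

text \<open>A Cauchy estimate bounds the partial derivatives on the cube. The claim holds for all
  larger constants as well, so that two densities can share one.\<close>

lemma assumption_A_lipschitz_density:
  assumes A: "assumption_A d M L \<delta> C6 f" and M: "0 < M" and \<delta>: "\<And>j. j \<in> {1..d} \<Longrightarrow> 0 < \<delta> j"
  shows "\<exists>\<Lambda>0\<ge>0. \<forall>\<Lambda>\<ge>\<Lambda>0. lipschitz_density d f M L \<Lambda>"
proof -
  obtain g where hol: "multi_holomorphic_on d g (poly_nbhd d \<delta> complex_interval)"
    and ext: "\<And>x. x \<in> cube d \<Longrightarrow> g (complexify d x) = complex_of_real (f x)"
    and bd: "\<And>z. z\<in>poly_nbhd d \<delta> complex_interval \<Longrightarrow> M \<le> cmod (g z) \<and> cmod (g z) \<le> L"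
    and pd: "prob_density d f"
    using A unfolding assumption_A_def by blast
  obtain \<eta> where \<eta>: "0 < \<eta>" "\<And>j. j \<in> {1..d} \<Longrightarrow> \<eta> \<le> \<delta> j"
    using common_radius[of d \<delta>] \<delta> by blast
  define F where "F z = g (restrict z {1..d})" for z
  have F0: "hol_on_box {1..d} (\<lambda>i. complex_nbhd (\<delta> i) complex_interval) F"
    unfolding F_def using hol unfolding poly_nbhd_def by (rule hol_on_box_multi_holomorphic) auto
  let ?V = "complex_nbhd \<eta> complex_interval"
  have F: "hol_on_box {1..d} (\<lambda>_. ?V) F"
    by (rule hol_on_box_subset[OF F0]) (intro complex_nbhd_mono \<eta>(2))
  have FL: "cmod (F z) \<le> L" if z: "z \<in> Pi {1..d} (\<lambda>_. ?V)" for z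
  proof -
    have "restrict z {1..d} \<in> poly_nbhd d \<delta> complex_interval"
      unfolding poly_nbhd_def using z complex_nbhd_mono[OF \<eta>(2)] by (simp only: restrict_PiE_iff) blast
    then show ?thesis using bd unfolding F_def by blast
  qed
  have Ff: "F (real_point x) = of_real (f x)" if "x \<in> cube d" for x
    using ext[OF that] by (simp add: F_def complexify_real_point)
  have fpos: "0 < f x" if "x \<in> cube d" for x using pd that by (simp add: prob_density_def)
  have rp: "real_point x \<in> Pi {1..d} (\<lambda>_. complex_nbhd r complex_interval)" if "x \<in> cube d" "0 < r" for x r
    by (rule real_point_in_Pi[OF that(1) interval_subset_nbhd[OF that(2)]])
  \<comment> \<open>The Cauchy bound on circles of radius half \<eta>, which stay in the domain
    where the modulus is at most \<open>L\<close>.\<close>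
  define \<Lambda>0 where "\<Lambda>0 = L / (\<eta> / 2)"
  have bounds: "M \<le> f x \<and> f x \<le> L" if x: "x \<in> cube d" for x
  proof -
    have "restrict (real_point x) {1..d} \<in> poly_nbhd d \<delta> complex_interval"
      unfolding poly_nbhd_def using rp[OF x \<eta>(1)] complex_nbhd_mono[OF \<eta>(2)] by (simp only: restrict_PiE_iff) blast
    from bd[OF this] show ?thesis using Ff[OF x] fpos[OF x] by (simp add: F_def)
  qed
  have one: "\<bar>f (x(i := t)) - f x\<bar> \<le> \<Lambda>0 * \<bar>t - x i\<bar>"
    if x: "x \<in> cube d" and i: "i \<in> {1..d}" and t: "t \<in> {-1..1}" for x i t
  proof -
    have xs: "x(i := s) \<in> cube d" if "s \<in> {-1..1}" for s by (rule cube_fun_upd(2)[OF x that i])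
    have "norm (f (x(i := t)) - f (x(i := x i))) \<le> \<Lambda>0 * norm (t - x i)"
    proof (rule field_differentiable_bound[of "{-1..1}" "\<lambda>s. f (x(i := s))" "\<lambda>s. Re (box_deriv i F (real_point (x(i := s))))"])
      fix s :: real assume s: "s \<in> {-1..1}"
      have "((\<lambda>r. Re (F (real_point ((x(i := s))(i := r))))) has_real_derivative Re (box_deriv i F (real_point (x(i := s))))) (at ((x(i := s)) i))"
        by (rule box_deriv_real[OF F _ i rp[OF xs[OF s] \<eta>(1)]]) simp
      then have "((\<lambda>r. Re (F (real_point (x(i := r))))) has_real_derivative Re (box_deriv i F (real_point (x(i := s))))) (at s)"
        by simp
      then have "((\<lambda>r. Re (F (real_point (x(i := r))))) has_real_derivative Re (box_deriv i F (real_point (x(i := s))))) (at s within {-1..1})"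
        by (rule has_field_derivative_at_within)
      then show "((\<lambda>r. f (x(i := r))) has_real_derivative Re (box_deriv i F (real_point (x(i := s))))) (at s within {-1..1})"
        by (rule has_field_derivative_transform_within[OF _ zero_less_one s]) (use Ff xs in simp)
      have z2: "real_point (x(i := s)) \<in> Pi {1..d} (\<lambda>_. complex_nbhd (\<eta>/2) complex_interval)"
        by (rule rp[OF xs[OF s]]) (use \<eta> in simp)
      have "cmod (box_deriv i F (real_point (x(i := s)))) \<le> L / (\<eta> / 2)"
      proof (rule norm_box_deriv_le[OF F _ _ i rp[OF xs[OF s] \<eta>(1)] FL])
        show "cball (real_point (x(i := s)) i) (\<eta>/2) \<subseteq> ?V"
          by (rule cball_subset_nbhd[of _ "\<eta>/2"]) (use z2 i in auto)
      qed (use \<eta> in auto)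
      then show "norm (Re (box_deriv i F (real_point (x(i := s))))) \<le> \<Lambda>0"
        using abs_Re_le_cmod[of "box_deriv i F (real_point (x(i := s)))"] by (simp add: \<Lambda>0_def)
    qed (use t cube_memD[OF x i] in auto)
    then show ?thesis by simp
  qed
  have "0 \<le> L" using bounds[of "\<lambda>i\<in>{1..d}. 0"] M by (auto simp: cube_def)
  then have \<Lambda>0: "0 \<le> \<Lambda>0" using \<eta> by (simp add: \<Lambda>0_def)
  have fm: "f \<in> borel_measurable (cube_measure {1..d})" using pd by (simp add: prob_density_def)
  have tot: "(\<integral>x. f x \<partial>cube_measure {1..d}) = 1"
  proof -
    have "(\<integral>x. f x \<partial>cube_measure {1..d}) = enn2real (\<integral>\<^sup>+x. ennreal (f x) \<partial>cube_measure {1..d})"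
      by (rule integral_eq_nn_integral[OF fm]) (use fpos in \<open>auto intro!: AE_I2 less_imp_le simp: space_cube_measure\<close>)
    then show ?thesis using pd by (simp add: prob_density_def)
  qed
  have "lipschitz_density d f M L \<Lambda>" if l: "\<Lambda>0 \<le> \<Lambda>" for \<Lambda>
  proof
    show "\<bar>f x - f y\<bar> \<le> \<Lambda> * (\<Sum>i=1..d. \<bar>x i - y i\<bar>)" if "x \<in> cube d" "y \<in> cube d" for x y
    proof -
      have "\<bar>f x - f y\<bar> \<le> \<Lambda>0 * (\<Sum>i=1..d. \<bar>x i - y i\<bar>)"
        by (rule coordinatewise_lipschitz[OF one that])
      also have "\<dots> \<le> \<Lambda> * (\<Sum>i=1..d. \<bar>x i - y i\<bar>)" using l by (intro mult_right_mono sum_nonneg) auto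
      finally show ?thesis .
    qed
  qed (use fm M bounds l \<Lambda>0 tot in auto)
  then show ?thesis using \<Lambda>0 by blast
qed

text \<open>A convex domain carries a primitive \<open>g\<close>, and the integral along the segment
  is \<open>g w - g (-1)\<close>.\<close>

lemma box_antideriv_has_derivative:
  assumes F: "hol_on_box I V F" and V: "open (V k)" "convex (V k)" "-1 \<in> V k" and k: "k \<in> I"
    and z: "z \<in> Pi I V" and u: "u \<in> V k"
  shows "((\<lambda>u. box_antideriv k F (z(k := u))) has_field_derivative F (z(k := u))) (at u)"
    and "box_antideriv k F (z(k := -1)) = 0"
proof -
  let ?f = "\<lambda>u. F (z(k := u))"
  have "?f holomorphic_on V k" by (rule hol_on_box_hol[OF F z k])
  from holomorphic_convex_primitive'[OF V(2,1) this]
  obtain g where g: "\<And>x. x \<in> V k \<Longrightarrow> (g has_field_derivative ?f x) (at x within V k)" by blast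
  have eq: "box_antideriv k F (z(k := w)) = g w - g (-1)" if w: "w \<in> V k" for w
  proof -
    have "((\<lambda>t. (w + 1) * ?f (-1 + of_real t * (w + 1))) has_integral
       g (-1 + of_real 1 * (w + 1)) - g (-1 + of_real 0 * (w + 1))) {0..1}"
    proof (rule fundamental_theorem_of_calculus)
      fix t :: real assume t: "t \<in> {0..1}"
      let ?p = "-1 + of_real t * (w + 1)"
      have p: "?p \<in> V k" by (rule convex_segment_from_minus_one[OF V(2,3) w t])
      have "(g has_field_derivative ?f ?p) (at ?p)" using g[OF p] at_within_open[OF p V(1)] by simp
      moreover have "((\<lambda>s. -1 + s * (w + 1)) has_field_derivative (w + 1)) (at (of_real t))"
        by (auto intro!: derivative_eq_intros)
      ultimately have "((\<lambda>s. g (-1 + s * (w + 1))) has_field_derivative ?f ?p * (w + 1)) (at (of_real t))"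
        by (rule DERIV_chain2)
      from has_vector_derivative_real_field[OF this]
      show "((\<lambda>t. g (-1 + of_real t * (w + 1))) has_vector_derivative (w + 1) * ?f ?p) (at t within {0..1})"
        by (simp add: mult.commute)
    qed simp
    from integral_unique[OF this] show ?thesis unfolding box_antideriv_def by simp
  qed
  show "box_antideriv k F (z(k := -1)) = 0" using eq[OF V(3)] by simp
  have "((\<lambda>w. g w - g (-1)) has_field_derivative ?f u) (at u)"
    using g[OF u] at_within_open[OF u V(1)] by (auto intro!: derivative_eq_intros)
  then show "((\<lambda>u. box_antideriv k F (z(k := u))) has_field_derivative ?f u) (at u)"
    by (rule has_field_derivative_transform_within_open[OF _ V(1) u]) (use eq in simp)
qed

lemma box_antideriv_dep:
  assumes dep: "\<And>z z'. (\<And>i. i \<in> {1..k} \<Longrightarrow> z i = z' i) \<Longrightarrow> F z = F z'" and "1 \<le> k"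
    and eq: "\<And>i. i \<in> {1..k} \<Longrightarrow> z i = z' i"
  shows "box_antideriv k F z = box_antideriv k F z'"
proof -
  have zk: "z k = z' k" using eq assms(2) by auto
  have "F (z(k := u)) = F (z'(k := u))" for u by (rule dep) (use eq in auto)
  then show ?thesis unfolding box_antideriv_def zk by simp
qed

lemma one_in_complex_nbhd:
  assumes "0 < \<eta>"
  shows "1 \<in> complex_nbhd \<eta> complex_interval" "-1 \<in> complex_nbhd \<eta> complex_interval"
proof -
  have "1 \<in> complex_interval" "-1 \<in> complex_interval"
    unfolding complex_interval_def by (rule image_eqI[of _ _ 1], auto, rule image_eqI[of _ _ "-1"], auto)
  then show "1 \<in> complex_nbhd \<eta> complex_interval" "-1 \<in> complex_nbhd \<eta> complex_interval"
    using interval_subset_nbhd[OF assms] by auto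
qed

text \<open>Connects the complex antiderivative with the real integrals in
  \<open>approx_comp\<close>. The domain extends beyond the end points of the interval, so the
  fundamental theorem applies on all of it.\<close>

lemma box_antideriv_real:
  fixes g :: "(nat \<Rightarrow> real) \<Rightarrow> real"
  assumes F: "hol_on_box {1..k} (\<lambda>_. complex_nbhd \<eta> complex_interval) F" and \<eta>: "0 < \<eta>" and k: "1 \<le> k"
    and g: "\<And>x. x \<in> {1..k} \<rightarrow> {-1..1} \<Longrightarrow> F (real_point x) = of_real (g x)"
    and x: "x \<in> {1..k} \<rightarrow> {-1..1}"
  shows "box_antideriv k F (real_point x) = of_real (LBINT t:{-1..x k}. g (x(k := t)))"
proof -
  let ?V = "complex_nbhd \<eta> complex_interval"
  let ?A = "\<lambda>t. box_antideriv k F (real_point (x(k := t)))"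
  have xk: "x k \<in> {-1..1}" using x k by auto
  have xt: "x(k := t) \<in> {1..k} \<rightarrow> {-1..1}" if "t \<in> {-1..1}" for t using x that by auto
  have rpt: "real_point y \<in> Pi {1..k} (\<lambda>_. ?V)" if "y \<in> {1..k} \<rightarrow> {-1..1}" for y
    using that interval_subset_nbhd[OF \<eta>] unfolding real_point_def complex_interval_def by (auto simp: Pi_iff)
  have m1: "-1 \<in> ?V" by (rule one_in_complex_nbhd(2)[OF \<eta>])
  have cv: "convex ?V" by (rule convex_complex_nbhd[OF convex_complex_interval])
  have cont: "continuous_on {-1..x k} (\<lambda>t. complex_of_real (g (x(k := t))))"
  proof -
    have "continuous_on {-1..x k} (\<lambda>t. real_point (x(k := t)))"
      unfolding real_point_upd
      by (rule continuous_on_fun_upd[where f="\<lambda>_. real_point x"]) (intro continuous_intros)+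
    then have "continuous_on {-1..x k} (\<lambda>t. F (real_point (x(k := t))))"
      by (rule continuous_on_compose2[OF hol_on_box_cont[OF F]]) (intro image_subsetI rpt xt, use xk in auto)
    then show ?thesis by (rule continuous_on_eq) (use g xt xk in auto)
  qed
  have "integral\<^sup>L lborel (\<lambda>t. indicator {-1..x k} t *\<^sub>R complex_of_real (g (x(k := t)))) = ?A (x k) - ?A (-1)"
  proof (rule integral_FTC_atLeastAtMost[OF _ _ cont])
    show "-1 \<le> x k" using xk by simp
    fix t assume t: "-1 \<le> t" "t \<le> x k"
    then have t': "t \<in> {-1..1}" using xk by auto
    have "((\<lambda>u. box_antideriv k F ((real_point x)(k := u))) has_field_derivative F ((real_point x)(k := of_real t))) (at (of_real t))"
    proof (rule box_antideriv_has_derivative[OF F _ cv m1 _ rpt[OF x]])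
      show "complex_of_real t \<in> ?V"
        using t' by (intro subsetD[OF interval_subset_nbhd[OF \<eta>]]) (auto simp: complex_interval_def)
    qed (use k in auto)
    from has_vector_derivative_real_field[OF this, of "{-1..x k}"]
    show "(?A has_vector_derivative complex_of_real (g (x(k := t)))) (at t within {-1..x k})"
      unfolding real_point_upd[symmetric] g[OF xt[OF t']] .
  qed
  also have "?A (-1) = 0"
    using box_antideriv_has_derivative(2)[OF F _ cv m1 _ rpt[OF x] m1] k by (simp add: real_point_upd)
  also have "?A (x k) = box_antideriv k F (real_point x)" by simp
  also have "integral\<^sup>L lborel (\<lambda>t. indicator {-1..x k} t *\<^sub>R complex_of_real (g (x(k := t))))
     = of_real (LBINT t:{-1..x k}. g (x(k := t)))"
    unfolding set_lebesgue_integral_def by (simp add: scaleR_conv_of_real flip: integral_complex_of_real)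
  finally show ?thesis by simp
qed

section \<open>Triangular maps from positive holomorphic functions\<close>

context smooth_triangular
begin

lemma strict_increasing:
  assumes k: "k \<in> {1..n}" and x: "x \<in> cube k" and st: "a \<in> {-1..1}" "b \<in> {-1..1}" "a < b"
  shows "S (x(k := a)) k < S (x(k := b)) k"
proof (rule DERIV_pos_imp_increasing[OF st(3)])
  fix u assume "a \<le> u" "u \<le> b"
  then have "u \<in> {-1..1}" using st by auto
  from deriv_at[OF k x this]
  show "\<exists>D. ((\<lambda>t. S (x(k := t)) k) has_real_derivative D) (at u) \<and> 0 < D" by blast
qed

lemma strict_increasing':
  assumes k: "k \<in> {1..n}" and x: "x \<in> cube n" and st: "a \<in> {-1..1}" "b \<in> {-1..1}" "a < b"
  shows "S (x(k := a)) k < S (x(k := b)) k"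
proof -
  have r: "restrict x {1..k} \<in> cube k" using restrict_cube[OF x] k by auto
  have "S (x(k := t)) k = S ((restrict x {1..k})(k := t)) k" for t
    by (rule dep(1)[OF k]) auto
  then show ?thesis using strict_increasing[OF k r st] by simp
qed

lemma section_surj:
  assumes k: "k \<in> {1..n}" and x: "x \<in> cube k" and v: "v \<in> {-1..1}"
  shows "\<exists>t\<in>{-1..1}. S (x(k := t)) k = v"
proof -
  have "continuous_on {-1..1} (\<lambda>t. S (x(k := t)) k)"
    by (intro continuous_at_imp_continuous_on ballI) (use deriv_at[OF k x] DERIV_isCont in blast)
  then have "\<exists>t\<ge>-1. t \<le> 1 \<and> S (x(k := t)) k = v"
    by (intro IVT') (use v ends[OF k x] in auto)
  then show ?thesis by auto
qed

text \<open>Injectivity follows coordinate by coordinate from strict monotonicity; a preimage is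
  built up in the same order, each new coordinate coming from the intermediate value
  theorem.\<close>

theorem bij_betw_cube: "bij_betw (\<lambda>x. \<lambda>k\<in>{1..n}. S x k) (cube n) (cube n)"
  unfolding bij_betw_def
proof
  show "inj_on (\<lambda>x. \<lambda>k\<in>{1..n}. S x k) (cube n)"
  proof (rule inj_onI)
    fix x y assume x: "x \<in> cube n" and y: "y \<in> cube n" and eq: "(\<lambda>k\<in>{1..n}. S x k) = (\<lambda>k\<in>{1..n}. S y k)"
    have "x k = y k" if "k \<in> {1..n}" for k
      using that
    proof (induction k rule: less_induct)
      case (less k)
      have "S y k = S (x(k := y k)) k"
        by (rule dep(1)[OF less.prems]) (use less in \<open>auto simp: le_less\<close>)
      moreover have "S x k = S y k" using fun_cong[OF eq, of k] less.prems by simp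
      ultimately have e: "S (x(k := x k)) k = S (x(k := y k)) k" by simp
      show "x k = y k"
        using strict_increasing'[OF less.prems x cube_memD[OF x less.prems] cube_memD[OF y less.prems]]
          strict_increasing'[OF less.prems x cube_memD[OF y less.prems] cube_memD[OF x less.prems]] e
        by (cases "x k" "y k" rule: linorder_cases) auto
    qed
    then show "x = y" by (rule PiE_ext[OF x[unfolded cube_def] y[unfolded cube_def]])
  qed
  have "\<forall>y\<in>cube m. \<exists>x\<in>cube m. \<forall>k\<in>{1..m}. S x k = y k" if "m \<le> n" for m
    using that
  proof (induction m)
    case (Suc m)
    show ?case
    proof
      fix y assume y: "y \<in> cube (Suc m)"
      have "restrict y {1..m} \<in> cube m" by (rule restrict_cube[OF y]) simp
      then obtain x where x: "x \<in> cube m" "\<And>k. k \<in> {1..m} \<Longrightarrow> S x k = restrict y {1..m} k"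
        using Suc by fastforce
      have k: "Suc m \<in> {1..n}" using Suc.prems by auto
      have x0: "x(Suc m := 0) \<in> cube (Suc m)" using x by (intro cube_fun_upd) auto
      obtain t where t: "t \<in> {-1..1}" "S (x(Suc m := t)) (Suc m) = y (Suc m)"
        using section_surj[OF k x0, of "y (Suc m)"] cube_memD[OF y, of "Suc m"] by auto
      have "S (x(Suc m := t)) k = y k" if "k \<in> {1..Suc m}" for k
      proof (cases "k = Suc m")
        case False
        then have k': "k \<in> {1..m}" using that by auto
        have "S (x(Suc m := t)) k = S x k" by (rule dep(1)) (use k' Suc.prems in auto)
        then show ?thesis using x(2)[OF k'] k' by simp
      qed (use t in simp)
      then show "\<exists>x\<in>cube (Suc m). \<forall>k\<in>{1..Suc m}. S x k = y k"
        using cube_fun_upd(1)[OF x(1) t(1)] by blast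
    qed
  qed simp
  then have surj: "\<exists>x\<in>cube n. \<forall>k\<in>{1..n}. S x k = y k" if "y \<in> cube n" for y using that by blast
  show "(\<lambda>x. \<lambda>k\<in>{1..n}. S x k) ` cube n = cube n"
  proof
    show "(\<lambda>x. \<lambda>k\<in>{1..n}. S x k) ` cube n \<subseteq> cube n"
    proof clarify
      fix x assume x: "x \<in> cube n"
      have "S x k \<in> {-1..1}" if "k \<in> {1..n}" for k by (rule range'[OF that x]) (use that in auto)
      then show "(\<lambda>k\<in>{1..n}. S x k) \<in> cube n" by (auto simp: cube_def)
    qed
    show "cube n \<subseteq> (\<lambda>x. \<lambda>k\<in>{1..n}. S x k) ` cube n"
    proof
      fix y assume y: "y \<in> cube n"
      obtain x where x: "x \<in> cube n" "\<forall>k\<in>{1..n}. S x k = y k" using surj[OF y] by blast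
      have "y = (\<lambda>k\<in>{1..n}. S x k)" using x y by (auto simp: cube_def PiE_iff extensional_def fun_eq_iff)
      then show "y \<in> (\<lambda>x. \<lambda>k\<in>{1..n}. S x k) ` cube n" using x by blast
    qed
  qed
qed

end

section \<open>Normalised antiderivatives of positive holomorphic functions\<close>

lemma real_point_in_box:
  assumes "x \<in> {1..k} \<rightarrow> {-1..1}" "0 < \<eta>"
  shows "real_point x \<in> Pi {1..k} (\<lambda>_. complex_nbhd \<eta> complex_interval)"
proof
  fix i assume "i \<in> {1..k}"
  then have "x i \<in> {-1..1}" using assms(1) by auto
  then show "real_point x i \<in> complex_nbhd \<eta> complex_interval"
    by (intro subsetD[OF interval_subset_nbhd[OF assms(2)]]) (auto simp: real_point_def complex_interval_def)
qed

lemma cube_Pi: "x \<in> cube n \<Longrightarrow> k \<le> n \<Longrightarrow> x \<in> {1..k} \<rightarrow> {-1..1}"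
  using cube_memD[of x n] by auto

lemma continuous_on_real_section:
  assumes F: "continuous_on (Pi {1..k} (\<lambda>_. complex_nbhd \<eta> complex_interval)) F"
    and \<eta>: "0 < \<eta>" and x: "x \<in> {1..k} \<rightarrow> {-1..1}"
  shows "continuous_on {-1..1} (\<lambda>t. Re (F (real_point (x(i := t)))))"
proof -
  have "continuous_on {-1..1} (\<lambda>t. real_point (x(i := t)))"
    unfolding real_point_upd
    by (rule continuous_on_fun_upd[where f="\<lambda>_. real_point x"]) (intro continuous_intros)+
  then have "continuous_on {-1..1} (\<lambda>t. F (real_point (x(i := t))))"
    by (rule continuous_on_compose2[OF F]) (intro image_subsetI real_point_in_box \<eta>, use x in auto)
  then show ?thesis by (intro continuous_intros)
qed

text \<open>\<open>G k\<close> stands for the derivative \<open>R_k\<close> of the transport or for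
  the square of \<open>1 + p\<close>. Positivity on the real cube does not keep the normalising
  integral away from 0 at complex points, hence the separate assumption \<open>nz\<close>.\<close>

locale positive_box_family =
  fixes d :: nat and \<eta> :: real and G :: "nat \<Rightarrow> (nat \<Rightarrow> complex) \<Rightarrow> complex"
  assumes \<eta>: "0 < \<eta>"
    and hol: "k \<in> {1..d} \<Longrightarrow> hol_on_box {1..k} (\<lambda>_. complex_nbhd \<eta> complex_interval) (G k)"
    and G_dep: "k \<in> {1..d} \<Longrightarrow> (\<And>i. i \<in> {1..k} \<Longrightarrow> z i = z' i) \<Longrightarrow> G k z = G k z'"
    and real: "k \<in> {1..d} \<Longrightarrow> x \<in> {1..k} \<rightarrow> {-1..1} \<Longrightarrow> Im (G k (real_point x)) = 0 \<and> 0 < Re (G k (real_point x))"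
    and nz: "k \<in> {1..d} \<Longrightarrow> z \<in> Pi {1..k} (\<lambda>_. complex_nbhd \<eta> complex_interval) \<Longrightarrow> box_antideriv k (G k) (z(k := 1)) \<noteq> 0"
begin

definition density where "density k x = Re (G k (real_point x))"
definition mass where "mass k z = box_antideriv k (G k) (z(k := 1))"
text \<open>\<open>flow - 1\<close> is the holomorphic extension of the k-th component of the map.
  Cauchy estimates are applied to the difference of two flows, in which the constant
  cancels.\<close>

definition flow where "flow k z = 2 * box_antideriv k (G k) z / mass k z"
definition tri where "tri x k = Re (flow k (real_point x)) - 1"
definition tri_deriv where "tri_deriv k x = Re (2 * G k (real_point x) / mass k (real_point x))"

abbreviation "nb \<equiv> complex_nbhd \<eta> complex_interval"

lemma nb: "convex nb" "open nb" "1 \<in> nb" "-1 \<in> nb"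
  using one_in_complex_nbhd[OF \<eta>] convex_complex_nbhd[OF convex_complex_interval] by auto

context
  fixes k :: nat
  assumes k: "k \<in> {1..d}"
begin

lemma kk: "1 \<le> k" "k \<in> {1..k}" using k by auto

lemma G_real: "x \<in> {1..k} \<rightarrow> {-1..1} \<Longrightarrow> G k (real_point x) = of_real (density k x)"
  using real[OF k] by (auto simp: density_def complex_eq_iff)

lemma density_pos: "x \<in> {1..k} \<rightarrow> {-1..1} \<Longrightarrow> 0 < density k x"
  using real[OF k] by (auto simp: density_def)

lemma antideriv_real: "x \<in> {1..k} \<rightarrow> {-1..1} \<Longrightarrow>
    box_antideriv k (G k) (real_point x) = of_real (LBINT t:{-1..x k}. density k (x(k := t)))"
  by (rule box_antideriv_real[OF hol[OF k] \<eta> kk(1) G_real])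

lemma mass_real:
  assumes x: "x \<in> {1..k} \<rightarrow> {-1..1}"
  shows "mass k (real_point x) = of_real (LBINT t:{-1..1}. density k (x(k := t)))"
proof -
  have x1: "x(k := 1) \<in> {1..k} \<rightarrow> {-1..1}" using x by auto
  have "mass k (real_point x) = box_antideriv k (G k) (real_point (x(k := 1)))"
    by (simp add: mass_def real_point_upd)
  then show ?thesis using antideriv_real[OF x1] by simp
qed

lemma mass_pos:
  assumes x: "x \<in> {1..k} \<rightarrow> {-1..1}"
  shows "0 < (LBINT t:{-1..1}. density k (x(k := t)))"
proof -
  have "mass k (real_point x) \<noteq> 0" unfolding mass_def by (rule nz[OF k real_point_in_box[OF x \<eta>]])
  then have "(LBINT t:{-1..1}. density k (x(k := t))) \<noteq> 0" unfolding mass_real[OF x] by simp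
  moreover have "0 \<le> (LBINT t:{-1..1}. density k (x(k := t)))"
    unfolding set_lebesgue_integral_def
  proof (rule Bochner_Integration.integral_nonneg)
    fix t :: real
    have "0 \<le> density k (x(k := t))" if "t \<in> {-1..1}"
    proof -
      have "x(k := t) \<in> {1..k} \<rightarrow> {-1..1}" using x that by auto
      then show ?thesis using density_pos less_imp_le by blast
    qed
    then show "0 \<le> indicat_real {-1..1} t *\<^sub>R density k (x(k := t))" by (auto simp: indicator_def)
  qed
  ultimately show ?thesis by simp
qed

lemma tri_eq:
  assumes x: "x \<in> {1..k} \<rightarrow> {-1..1}"
  shows "tri x k = -1 + 2 / (LBINT t:{-1..1}. density k (x(k := t))) * (LBINT t:{-1..x k}. density k (x(k := t)))"
proof -
  have "flow k (real_point x) = of_real (2 / (LBINT t:{-1..1}. density k (x(k := t))) * (LBINT t:{-1..x k}. density k (x(k := t))))"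
    unfolding flow_def mass_real[OF x] antideriv_real[OF x] by simp
  then show ?thesis by (simp add: tri_def)
qed

lemma tri_deriv_eq:
  assumes x: "x \<in> {1..k} \<rightarrow> {-1..1}"
  shows "tri_deriv k x = 2 * density k x / (LBINT t:{-1..1}. density k (x(k := t)))"
proof -
  have "2 * G k (real_point x) / mass k (real_point x) = of_real (2 * density k x / (LBINT t:{-1..1}. density k (x(k := t))))"
    unfolding mass_real[OF x] G_real[OF x] by simp
  then show ?thesis unfolding tri_deriv_def by (metis Re_complex_of_real)
qed

lemma tri_deriv_pos: "x \<in> {1..k} \<rightarrow> {-1..1} \<Longrightarrow> 0 < tri_deriv k x"
  unfolding tri_deriv_eq using density_pos mass_pos by simp

lemma mass_upd: "mass k (z(k := u)) = mass k z" by (simp add: mass_def)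

lemma hol_antideriv: "hol_on_box {1..k} (\<lambda>_. nb) (box_antideriv k (G k))"
  by (rule hol_on_box_antideriv[OF hol[OF k] _ kk(2)]) (use nb in auto)

lemma hol_mass: "hol_on_box {1..k} (\<lambda>_. nb) (mass k)"
  unfolding mass_def by (rule hol_on_box_fix_coord[OF hol_antideriv]) (rule nb(3))

lemma mass_nz: "z \<in> Pi {1..k} (\<lambda>_. nb) \<Longrightarrow> mass k z \<noteq> 0"
  unfolding mass_def by (rule nz[OF k])

lemma hol_flow: "hol_on_box {1..k} (\<lambda>_. nb) (flow k)"
  unfolding flow_def
  by (rule hol_on_box_divide[OF hol_on_box_mult[OF hol_on_box_const hol_antideriv] hol_mass mass_nz])

lemma hol_tri_deriv: "hol_on_box {1..k} (\<lambda>_. nb) (\<lambda>z. 2 * G k z / mass k z)"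
  by (rule hol_on_box_divide[OF hol_on_box_mult[OF hol_on_box_const hol[OF k]] hol_mass mass_nz])

lemma antideriv_dep:
  assumes "\<And>i. i \<in> {1..k} \<Longrightarrow> z i = z' i"
  shows "box_antideriv k (G k) z = box_antideriv k (G k) z'"
  by (rule box_antideriv_dep[OF G_dep[OF k] kk(1) assms])

lemma flow_dep:
  assumes "\<And>i. i \<in> {1..k} \<Longrightarrow> z i = z' i"
  shows "flow k z = flow k z'" "mass k z = mass k z'"
proof -
  show "mass k z = mass k z'" unfolding mass_def by (rule antideriv_dep) (use assms in auto)
  then show "flow k z = flow k z'" unfolding flow_def using antideriv_dep[OF assms] by simp
qed

lemma tri_has_derivative:
  assumes x: "x \<in> {1..k} \<rightarrow> {-1..1}"
  shows "((\<lambda>t. tri (x(k := t)) k) has_real_derivative tri_deriv k x) (at (x k))"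
proof -
  let ?z = "real_point x"
  have xk: "x k \<in> {-1..1}" using x kk by auto
  have u: "complex_of_real (x k) \<in> nb"
    using xk by (intro subsetD[OF interval_subset_nbhd[OF \<eta>]]) (auto simp: complex_interval_def)
  have zu: "?z(k := of_real (x k)) = ?z" by (auto simp: real_point_def)
  have "((\<lambda>u. box_antideriv k (G k) (?z(k := u))) has_field_derivative G k ?z) (at (of_real (x k)))"
    using box_antideriv_has_derivative(1)[OF hol[OF k] nb(2,1,4) kk(2) real_point_in_box[OF x \<eta>] u] unfolding zu .
  then have "((\<lambda>u. 2 * box_antideriv k (G k) (?z(k := u)) / mass k ?z) has_field_derivative 2 * G k ?z / mass k ?z) (at (of_real (x k)))"
    by (intro DERIV_cdivide DERIV_cmult)
  then have "((\<lambda>u. flow k (?z(k := u))) has_field_derivative 2 * G k ?z / mass k ?z) (at (of_real (x k)))"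
    unfolding flow_def mass_upd .
  from has_real_derivative_Re[OF this]
  have "((\<lambda>t. Re (flow k (real_point (x(k := t))))) has_real_derivative tri_deriv k x) (at (x k))"
    unfolding real_point_upd tri_deriv_def .
  from DERIV_diff[OF this DERIV_const[of 1]] show ?thesis unfolding tri_def by simp
qed

lemma tri_ends:
  assumes x: "x \<in> {1..k} \<rightarrow> {-1..1}"
  shows "tri (x(k := -1)) k = -1" "tri (x(k := 1)) k = 1"
proof -
  have "box_antideriv k (G k) ((real_point x)(k := -1)) = 0"
    by (rule box_antideriv_has_derivative(2)[OF hol[OF k] nb(2,1,4) kk(2) real_point_in_box[OF x \<eta>] nb(4)])
  then show "tri (x(k := -1)) k = -1" by (simp add: tri_def flow_def real_point_upd)
  have "flow k ((real_point x)(k := 1)) = 2"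
    using mass_nz[OF real_point_in_box[OF x \<eta>]] by (simp add: flow_def mass_def)
  then show "tri (x(k := 1)) k = 1" by (simp add: tri_def real_point_upd)
qed

end

sublocale smooth_triangular d tri tri_deriv
proof
  fix k assume k: "k \<in> {1..d}"
  have m: "(\<lambda>x. Re (F (real_point x))) \<in> borel_measurable (cube_measure {1..k})"
    if "hol_on_box {1..k} (\<lambda>_. nb) F" for F
    by (rule measurable_box_function[OF hol_on_box_cont[OF that]]) (use nb interval_subset_nbhd[OF \<eta>] in auto)
  show "(\<lambda>x. tri x k) \<in> borel_measurable (cube_measure {1..k})"
    unfolding tri_def using m[OF hol_flow[OF k]] by measurable
  show "tri_deriv k \<in> borel_measurable (cube_measure {1..k})"
    unfolding tri_deriv_def[abs_def] by (rule m[OF hol_tri_deriv[OF k]])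
  fix x y :: "nat \<Rightarrow> real"
  {
    assume eq: "\<And>i. i \<in> {1..k} \<Longrightarrow> x i = y i"
    have rp: "real_point x i = real_point y i" if "i \<in> {1..k}" for i using eq[OF that] by (simp add: real_point_def)
    show "tri x k = tri y k" unfolding tri_def using flow_dep(1)[OF k rp] by simp
    have "G k (real_point x) = G k (real_point y)" by (rule G_dep[OF k rp])
    then show "tri_deriv k x = tri_deriv k y" unfolding tri_deriv_def using flow_dep(2)[OF k rp] by simp
  next
    assume "x \<in> cube k"
    then have x: "x \<in> {1..k} \<rightarrow> {-1..1}" by (rule cube_Pi) simp
    show "((\<lambda>t. tri (x(k := t)) k) has_real_derivative tri_deriv k x) (at (x k))" by (rule tri_has_derivative[OF k x])
    show "continuous_on {-1..1} (\<lambda>t. tri_deriv k (x(k := t)))"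
      unfolding tri_deriv_def by (rule continuous_on_real_section[OF hol_on_box_cont[OF hol_tri_deriv[OF k]] \<eta> x])
    show "0 < tri_deriv k x" by (rule tri_deriv_pos[OF k x])
    show "tri (x(k := -1)) k = -1" "tri (x(k := 1)) k = 1" using tri_ends[OF k x] by auto
  }
qed

end

text \<open>With \<open>z k\<close> replaced by 1 the path of integration is the real interval of
  length 2, so real parts integrate to real parts.\<close>

lemma Re_box_antideriv_one_ge:
  assumes F: "continuous_on (Pi I V) F" and b: "\<And>z. z \<in> Pi I V \<Longrightarrow> b \<le> Re (F z)"
    and V: "convex (V k)" "-1 \<in> V k" "1 \<in> V k" and k: "k \<in> I" and z: "z \<in> Pi I V"
  shows "2 * b \<le> Re (box_antideriv k F (z(k := 1)))"
proof -
  let ?w = "z(k := 1)"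
  let ?f = "\<lambda>t. (?w k + 1) * F (?w(k := -1 + complex_of_real t * (?w k + 1)))"
  have w: "?w \<in> Pi I V" using z V by auto
  have "continuous_on {0..1} (\<lambda>t. (\<lambda>(z, t). (z k + 1) * F (z(k := -1 + complex_of_real t * (z k + 1)))) (?w, t))"
    by (rule continuous_on_compose2[OF continuous_on_box_antideriv_integrand[OF F V(1,2) k]])
       (use w in \<open>auto intro!: continuous_intros\<close>)
  then have "?f integrable_on {0..1}" by (intro integrable_continuous_interval) simp
  then have "(?f has_integral box_antideriv k F ?w) {0..1}"
    unfolding box_antideriv_def by (rule integrable_integral)
  from has_integral_linear[OF this bounded_linear_Re]
  have up: "((\<lambda>t. Re (?f t)) has_integral Re (box_antideriv k F ?w)) {0..1}" by (simp add: o_def)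
  have lo: "((\<lambda>t. 2 * b) has_integral 2 * b) {0..1::real}"
    using has_integral_const_real[of "2 * b" 0 1] by simp
  show ?thesis
  proof (rule has_integral_le[OF lo up])
    fix t :: real assume t: "t \<in> {0..1}"
    have "-1 + complex_of_real t * (?w k + 1) \<in> V k"
      by (rule convex_segment_from_minus_one[OF V(1,2) _ t]) (use V in simp)
    then have "?w(k := -1 + complex_of_real t * (?w k + 1)) \<in> Pi I V" by (rule fun_upd_in_Pi[OF w])
    from b[OF this] show "2 * b \<le> Re (?f t)" by simp
  qed
qed

section \<open>Quotient perturbation and the approximation of a single component\<close>

lemma norm_box_antideriv_diff_le:
  assumes F: "continuous_on (Pi I V) F" and G: "continuous_on (Pi I V) G"
    and V: "convex (V k)" "-1 \<in> V k" and k: "k \<in> I" and z: "z \<in> Pi I V"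
    and e: "\<And>z. z \<in> Pi I V \<Longrightarrow> cmod (F z - G z) \<le> e"
  shows "cmod (box_antideriv k F z - box_antideriv k G z) \<le> cmod (z k + 1) * e"
  unfolding box_antideriv_diff[OF F G V k z, symmetric]
  by (rule norm_box_antideriv_le[OF e V k z])

lemma norm_quotient_diff_le:
  fixes a a' b b' :: complex
  assumes "cmod (a - a') \<le> e" "cmod (b - b') \<le> e'" "cmod a \<le> A" "\<beta> \<le> cmod b" "\<beta> \<le> cmod b'" "0 < \<beta>"
  shows "cmod (a / b - a' / b') \<le> e / \<beta> + A * e' / \<beta>\<^sup>2"
proof -
  have nz: "b \<noteq> 0" "b' \<noteq> 0" using assms by auto
  have "a / b - a' / b' = (a - a') / b' + a * (b' - b) / (b * b')"
    using nz by (simp add: field_simps)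
  also have "cmod \<dots> \<le> cmod ((a - a') / b') + cmod (a * (b' - b) / (b * b'))" by (rule norm_triangle_ineq)
  also have "cmod ((a - a') / b') \<le> e / \<beta>"
    unfolding norm_divide using assms by (intro frac_le order_trans[OF norm_ge_zero]) auto
  also have "cmod (a * (b' - b) / (b * b')) \<le> A * e' / \<beta>\<^sup>2"
    unfolding norm_divide norm_mult power2_eq_square
  proof (rule frac_le)
    show "cmod a * cmod (b' - b) \<le> A * e'"
      using assms by (intro mult_mono) (auto simp: norm_minus_commute intro: order_trans[OF norm_ge_zero])
    show "0 \<le> A * e'" using assms by (intro mult_nonneg_nonneg) (auto intro: order_trans[OF norm_ge_zero])
    show "0 < \<beta> * \<beta>" "\<beta> * \<beta> \<le> cmod b * cmod b'" using assms by (auto intro!: mult_mono)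
  qed
  finally show ?thesis by simp
qed

text \<open>Conjugating argument and value preserves holomorphy, as in the Schwarz reflection; it is
  used to symmetrise the extension of a function that is real on the cube.\<close>

lemma hol_on_box_cnj:
  assumes F: "hol_on_box I V F" and V: "\<And>i. i \<in> I \<Longrightarrow> open (V i)" "\<And>i u. i \<in> I \<Longrightarrow> u \<in> V i \<Longrightarrow> cnj u \<in> V i"
  shows "hol_on_box I V (\<lambda>z. cnj (F (\<lambda>i. cnj (z i))))"
  unfolding hol_on_box_def
proof (intro conjI ballI)
  have cv: "continuous_on S (\<lambda>z :: nat \<Rightarrow> complex. \<lambda>i. cnj (z i))" for S
    by (rule continuous_on_coordinatewise_then_product) (intro continuous_intros)
  have "continuous_on (Pi I V) (\<lambda>z. F (\<lambda>i. cnj (z i)))"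
    by (rule continuous_on_compose2[OF hol_on_box_cont[OF F] cv]) (use V(2) in auto)
  then show "continuous_on (Pi I V) (\<lambda>z. cnj (F (\<lambda>i. cnj (z i))))" by (intro continuous_intros)
  fix z i assume z: "z \<in> Pi I V" and i: "i \<in> I"
  let ?z = "\<lambda>i. cnj (z i)"
  have z': "?z \<in> Pi I V" using z V(2) by auto
  have im: "cnj ` V i = V i"
  proof
    show "V i \<subseteq> cnj ` V i"
    proof
      fix u assume "u \<in> V i"
      then show "u \<in> cnj ` V i" using V(2)[OF i] by (intro image_eqI[of _ _ "cnj u"]) auto
    qed
  qed (use V(2)[OF i] in auto)
  have "(\<lambda>u. F (?z(i := u))) holomorphic_on cnj ` V i" unfolding im by (rule hol_on_box_hol[OF F z' i])
  from holomorphic_on_compose_cnj_cnj[OF this V(1)[OF i]]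
  have "(\<lambda>u. cnj (F (?z(i := cnj u)))) holomorphic_on V i" by (simp add: o_def)
  moreover have "(\<lambda>j. cnj ((z(i := u)) j)) = ?z(i := cnj u)" for u by auto
  ultimately show "(\<lambda>u. cnj (F (\<lambda>j. cnj ((z(i := u)) j)))) holomorphic_on V i" by simp
qed

definition shifted_poly :: "nat \<Rightarrow> (nat \<Rightarrow> nat) set \<Rightarrow> ((nat \<Rightarrow> nat) \<Rightarrow> real) \<Rightarrow> (nat \<Rightarrow> complex) \<Rightarrow> complex" where
  "shifted_poly k \<Lambda> c z = 1 + (\<Sum>\<nu>\<in>\<Lambda>. of_real (c \<nu>) * (\<Prod>j=1..k. z j ^ \<nu> j))"

lemma shifted_poly_real: "shifted_poly k \<Lambda> c (real_point x) = of_real (1 + (\<Sum>\<nu>\<in>\<Lambda>. c \<nu> * (\<Prod>j=1..k. x j ^ \<nu> j)))"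
  by (simp add: shifted_poly_def real_point_def)

lemma hol_shifted_poly: "hol_on_box I V (shifted_poly k \<Lambda> c)"
  unfolding shifted_poly_def[abs_def]
  by (intro hol_on_box_add hol_on_box_const hol_on_box_sum hol_on_box_mult hol_on_box_prod hol_on_box_power hol_on_box_coord)

text \<open>The conclusions are claimed for every radius below a threshold, with \<open>K\<close>
  and \<open>c0\<close> independent of the radius and of \<epsilon>, because all components must
  later share one radius. The lower bounds by \<open>c0\<close> keep the normalising integral away
  from 0 at complex points and the derivative positive on the cube.\<close>

theorem component_approximation:
  fixes \<zeta> \<xi> :: "nat \<Rightarrow> real"
  assumes k: "1 \<le> k" and \<zeta>: "\<And>j. j \<in> {1..k} \<Longrightarrow> 0 < \<zeta> j" and \<xi>: "\<And>j. j \<in> {1..k} \<Longrightarrow> \<xi> j = 1 + \<zeta> j"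
    and r: "multi_holomorphic_on k r (poly_nbhd k \<zeta> complex_interval)" and C8: "0 < C8"
    and img: "r ` poly_nbhd k \<zeta> complex_interval \<subseteq> complex_nbhd C8 {1}"
    and Re_r: "\<And>z. z \<in> poly_nbhd k \<zeta> complex_interval \<Longrightarrow> 1 / C8 \<le> Re (r z)"
    and real: "\<And>x. x \<in> cube k \<Longrightarrow> Im (r (complexify k x)) = 0"
  shows "\<exists>R. (\<forall>z z'. (\<forall>i\<in>{1..k}. z i = z' i) \<longrightarrow> R z = R z') \<and>
    (\<forall>x\<in>{1..k} \<rightarrow> {-1..1}. R (real_point x) = r (complexify k x)) \<and>
    (\<exists>\<eta>0>0. \<forall>\<eta>. 0 < \<eta> \<longrightarrow> \<eta> \<le> \<eta>0 \<longrightarrow>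
       hol_on_box {1..k} (\<lambda>_. complex_nbhd \<eta> complex_interval) R \<and>
       (\<forall>z\<in>Pi {1..k} (\<lambda>_. complex_nbhd \<eta> complex_interval). 1 / C8 \<le> Re (R z) \<and> cmod (R z) \<le> 1 + C8)) \<and>
    (\<exists>\<eta>0>0. \<exists>K\<ge>0. \<exists>c0>0. \<forall>\<eta>. 0 < \<eta> \<longrightarrow> \<eta> \<le> \<eta>0 \<longrightarrow> (\<forall>\<epsilon>\<in>{0<..<1}. \<exists>c.
       (\<forall>z\<in>Pi {1..k} (\<lambda>_. complex_nbhd \<eta> complex_interval).
          cmod (R z - (shifted_poly k (index_set \<xi> k \<epsilon>) c z)\<^sup>2) \<le> K * \<epsilon> \<and>
          c0 \<le> cmod (box_antideriv k (\<lambda>z. (shifted_poly k (index_set \<xi> k \<epsilon>) c z)\<^sup>2) (z(k := 1)))) \<and>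
       (\<forall>x\<in>{1..k} \<rightarrow> {-1..1}. c0 \<le> Re ((shifted_poly k (index_set \<xi> k \<epsilon>) c (real_point x))\<^sup>2))))"
proof -
  let ?I = "{1..k}" and ?V = "\<lambda>j. complex_nbhd (\<zeta> j) complex_interval"
  have kI: "k \<in> ?I" using k by simp
  \<comment> \<open>\<open>r\<close> is real on the cube; symmetrising it gives its Chebyshev expansion real coefficients
    without appealing to the identity theorem.\<close>
  define R0 where "R0 z = r (restrict z ?I)" for z
  define R where "R z = (R0 z + cnj (R0 (\<lambda>i. cnj (z i)))) / 2" for z
  have mem: "restrict z ?I \<in> poly_nbhd k \<zeta> complex_interval" if "z \<in> Pi ?I ?V" for z
    using that unfolding poly_nbhd_def by (simp only: restrict_PiE_iff) blast
  have cnjP: "(\<lambda>i. cnj (z i)) \<in> Pi ?I ?V" if "z \<in> Pi ?I ?V" for z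
    using that cnj_complex_nbhd by auto
  have hR0: "hol_on_box ?I ?V R0"
    unfolding R0_def using r unfolding poly_nbhd_def by (rule hol_on_box_multi_holomorphic) auto
  have hR: "hol_on_box ?I ?V R"
    unfolding R_def
    by (intro hol_on_box_divide hol_on_box_add hR0 hol_on_box_const hol_on_box_cnj cnj_complex_nbhd) auto
  have R0b: "1 / C8 \<le> Re (R0 z) \<and> cmod (R0 z) \<le> 1 + C8" if z: "z \<in> Pi ?I ?V" for z
  proof -
    have "cmod (R0 z - 1) < C8" using img mem[OF z] unfolding R0_def complex_nbhd_def by blast
    then have "cmod (R0 z) \<le> 1 + C8" using norm_triangle_ineq2[of "R0 z" 1] by simp
    then show ?thesis using Re_r[OF mem[OF z]] by (simp add: R0_def)
  qed
  have Rb: "1 / C8 \<le> Re (R z) \<and> cmod (R z) \<le> 1 + C8" if z: "z \<in> Pi ?I ?V" for z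
  proof -
    have "cmod (R z) \<le> (cmod (R0 z) + cmod (R0 (\<lambda>i. cnj (z i)))) / 2"
      using norm_triangle_ineq[of "R0 z" "cnj (R0 (\<lambda>i. cnj (z i)))"] by (simp add: R_def norm_divide)
    then show ?thesis using R0b[OF z] R0b[OF cnjP[OF z]] by (simp add: R_def)
  qed
  have Rdep: "R z = R z'" if "\<And>i. i \<in> ?I \<Longrightarrow> z i = z' i" for z z'
  proof -
    have "restrict z ?I = restrict z' ?I" "restrict (\<lambda>i. cnj (z i)) ?I = restrict (\<lambda>i. cnj (z' i)) ?I"
      using that by (auto simp: fun_eq_iff)
    then show ?thesis by (simp add: R_def R0_def)
  qed
  have Rreal: "R (real_point x) = r (complexify k x) \<and> Im (R (real_point x)) = 0" if x: "x \<in> ?I \<rightarrow> {-1..1}" for x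
  proof -
    have e: "restrict (real_point x) ?I = complexify k x" by (rule complexify_real_point[symmetric])
    have "restrict x ?I \<in> cube k" using x by (auto simp: cube_def)
    moreover have "complexify k (restrict x ?I) = complexify k x" by (auto simp: complexify_def fun_eq_iff)
    ultimately have im: "Im (r (complexify k x)) = 0" using real by metis
    have "(\<lambda>i. cnj (real_point x i)) = real_point x" by (simp add: real_point_def)
    then show ?thesis using im e by (simp add: R_def R0_def complex_eq_iff)
  qed
  have C8': "0 < 1 / C8" using C8 by simp
  have Rnn: "R z \<notin> \<real>\<^sub>\<le>\<^sub>0" if "z \<in> Pi ?I ?V" for z
  proof -
    have "0 < Re (R z)" using Rb[OF that] C8' by linarith
    then show ?thesis by (auto simp: complex_nonpos_Reals_iff)
  qed
  \<comment> \<open>The value off the right half plane is arbitrary, but a real constant keeps the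
    conjugation symmetry of \<open>F\<close> valid at every point, also where the principal square
    root violates it.\<close>
  define F where "F z = (if 0 < Re (R z) then csqrt (R z) else 1) - 1" for z
  have Fsq: "(F z + 1)\<^sup>2 = R z" if "z \<in> Pi ?I ?V" for z
  proof -
    have "0 < Re (R z)" using Rb[OF that] C8' by linarith
    then show ?thesis by (simp add: F_def)
  qed
  have hF: "hol_on_box ?I ?V F"
  proof -
    have "hol_on_box ?I ?V (\<lambda>z. csqrt (R z))"
      by (rule hol_on_box_compose[OF hR holomorphic_on_csqrt]) (use Rnn in auto)
    then have "hol_on_box ?I ?V (\<lambda>z. csqrt (R z) - 1)" by (intro hol_on_box_diff hol_on_box_const)
    then show ?thesis
    proof (rule hol_on_box_cong)
      fix z assume z: "z \<in> Pi ?I ?V"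
      have "0 < Re (R z)" using Rb[OF z] C8' by linarith
      then show "csqrt (R z) - 1 = F z" by (simp add: F_def)
    qed
  qed
  define B where "B = 2 + C8"
  have B1: "1 \<le> B" using C8 by (simp add: B_def)
  have FB: "cmod (F z) \<le> B + 1" "cmod (F z + 1) \<le> B" if z: "z \<in> Pi ?I ?V" for z
  proof -
    have "cmod (F z + 1) ^ 2 \<le> 1 + C8" using Rb[OF z] Fsq[OF z] by (metis norm_power)
    also have "\<dots> \<le> B ^ 2" using C8 by (simp add: B_def power2_eq_square algebra_simps)
    finally have "cmod (F z + 1) ^ 2 \<le> B ^ 2" .
    then show "cmod (F z + 1) \<le> B" by (rule power2_le_imp_le) (use B1 in simp)
    then show "cmod (F z) \<le> B + 1" using norm_triangle_ineq4[of "F z + 1" 1] by simp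
  qed
  have Fdep: "F z = F z'" if "\<And>i. i \<in> ?I \<Longrightarrow> z i = z' i" for z z'
  proof -
    have "R z = R z'" by (rule Rdep) (rule that)
    then show ?thesis by (simp only: F_def)
  qed
  have Rsym: "R (\<lambda>i. cnj (z i)) = cnj (R z)" for z by (simp add: R_def add.commute)
  have Fsym: "F (\<lambda>i. cnj (z i)) = cnj (F z)" for z
  proof (cases "0 < Re (R z)")
    case True
    then have "R z \<notin> \<real>\<^sub>\<le>\<^sub>0" by (auto simp: complex_nonpos_Reals_iff)
    from cnj_csqrt[OF this] True show ?thesis by (simp add: F_def Rsym)
  qed (simp add: F_def Rsym)
  obtain \<eta>1 K1 where \<eta>1: "0 < \<eta>1" "\<And>j. j \<in> ?I \<Longrightarrow> \<eta>1 \<le> \<zeta> j" and K1: "0 \<le> K1"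
    and appr: "\<And>\<epsilon>. 0 < \<epsilon> \<Longrightarrow> \<exists>c :: (nat \<Rightarrow> nat) \<Rightarrow> real. \<forall>z\<in>(\<Pi> j\<in>?I. complex_nbhd \<eta>1 complex_interval).
       cmod (F z - (\<Sum>\<nu>\<in>index_set \<xi> k \<epsilon>. of_real (c \<nu>) * (\<Prod>j=1..k. z j ^ \<nu> j))) \<le> K1 * \<epsilon>"
    by (rule holomorphic_index_set_approximation[of k \<zeta> \<xi> F "B + 1"])
       (use k \<zeta> \<xi> hF FB(1) Fdep Fsym in \<open>blast+\<close>)
  have sub: "Pi ?I (\<lambda>_. complex_nbhd \<eta> complex_interval) \<subseteq> Pi ?I ?V"
    "Pi ?I (\<lambda>_. complex_nbhd \<eta> complex_interval) \<subseteq> Pi ?I (\<lambda>_. complex_nbhd \<eta>1 complex_interval)" if "\<eta> \<le> \<eta>1" for \<eta>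
  proof -
    have "complex_nbhd \<eta> complex_interval \<subseteq> ?V j" if "j \<in> ?I" for j
      by (rule complex_nbhd_mono) (use \<eta>1(2)[OF that] \<open>\<eta> \<le> \<eta>1\<close> in auto)
    then show "Pi ?I (\<lambda>_. complex_nbhd \<eta> complex_interval) \<subseteq> Pi ?I ?V" by (intro Pi_mono)
    show "Pi ?I (\<lambda>_. complex_nbhd \<eta> complex_interval) \<subseteq> Pi ?I (\<lambda>_. complex_nbhd \<eta>1 complex_interval)"
      by (intro Pi_mono complex_nbhd_mono that)
  qed
  \<comment> \<open>If the error of \<open>sqrt R\<close> is at most \<kappa>, the factor
    \<open>2 * B + 1\<close> bounds the sum in the difference of squares, and the square is off by
    at most \<open>1 / (2 * C8)\<close>, half of the lower bound for \<open>Re R\<close>.\<close>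
  define \<kappa> where "\<kappa> = min 1 (1 / (2 * C8) / (2 * B + 1))"
  have \<kappa>: "0 < \<kappa>" "\<kappa> \<le> 1" "\<kappa> * (2 * B + 1) \<le> 1 / (2 * C8)"
  proof -
    show "0 < \<kappa>" "\<kappa> \<le> 1" using C8 B1 by (auto simp: \<kappa>_def)
    have "\<kappa> \<le> 1 / (2 * C8) / (2 * B + 1)" unfolding \<kappa>_def by (rule min.cobounded2)
    then have "\<kappa> * (2 * B + 1) \<le> 1 / (2 * C8) / (2 * B + 1) * (2 * B + 1)"
      by (rule mult_right_mono) (use B1 in simp)
    also have "\<dots> = 1 / (2 * C8)" using B1 by simp
    finally show "\<kappa> * (2 * B + 1) \<le> 1 / (2 * C8)" .
  qed
  \<comment> \<open>The second entry serves the zero polynomial: where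
    \<open>K1 * \<epsilon> > \<kappa>\<close>, it lifts \<open>K * \<epsilon>\<close> above
    \<open>2 + C8\<close>, a bound for the modulus of \<open>R - 1\<close>.\<close>
  define K where "K = max (K1 * (2 * B + 1)) ((2 + C8) * K1 / \<kappa>)"
  define c0 where "c0 = min 1 (1 / (2 * C8))"
  have c0: "0 < c0" using C8 by (simp add: c0_def)
  have "0 \<le> K1 * (2 * B + 1)" using K1 B1 by (intro mult_nonneg_nonneg) auto
  then have K0: "0 \<le> K" unfolding K_def by (rule max.coboundedI1)
  have main: "\<exists>c. (\<forall>z\<in>Pi ?I (\<lambda>_. complex_nbhd \<eta> complex_interval).
          cmod (R z - (shifted_poly k (index_set \<xi> k \<epsilon>) c z)\<^sup>2) \<le> K * \<epsilon> \<and>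
          c0 \<le> cmod (box_antideriv k (\<lambda>z. (shifted_poly k (index_set \<xi> k \<epsilon>) c z)\<^sup>2) (z(k := 1)))) \<and>
       (\<forall>x\<in>?I \<rightarrow> {-1..1}. c0 \<le> Re ((shifted_poly k (index_set \<xi> k \<epsilon>) c (real_point x))\<^sup>2))"
    if \<eta>: "0 < \<eta>" "\<eta> \<le> \<eta>1" and \<epsilon>: "\<epsilon> \<in> {0<..<1}" for \<eta> \<epsilon>
  \<comment> \<open>For small \<open>\<epsilon>\<close> the polynomial approximates \<open>sqrt R - 1\<close> closely enough for the square to stay away
    from 0; for the other \<open>\<epsilon>\<close> the zero polynomial does, at the price of a larger constant.\<close>
  proof (cases "K1 * \<epsilon> \<le> \<kappa>")
    case True
    let ?W = "\<lambda>_::nat. complex_nbhd \<eta> complex_interval"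
    obtain c where c: "\<forall>z\<in>(\<Pi> j\<in>?I. complex_nbhd \<eta>1 complex_interval).
       cmod (F z - (\<Sum>\<nu>\<in>index_set \<xi> k \<epsilon>. of_real (c \<nu>) * (\<Prod>j=1..k. z j ^ \<nu> j))) \<le> K1 * \<epsilon>"
    proof -
      have "0 < \<epsilon>" using \<epsilon> by simp
      from appr[OF this] show ?thesis by (elim exE) (rule that)
    qed
    let ?q = "shifted_poly k (index_set \<xi> k \<epsilon>) c"
    have q: "cmod (R z - (?q z)\<^sup>2) \<le> K1 * \<epsilon> * (2 * B + 1)" if z: "z \<in> Pi ?I ?W" for z
    proof -
      have zV: "z \<in> Pi ?I ?V" using sub(1)[OF \<eta>(2)] z by blast
      have d: "cmod ((F z + 1) - ?q z) \<le> K1 * \<epsilon>"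
        using c sub(2)[OF \<eta>(2)] z by (auto simp: shifted_poly_def algebra_simps)
      have "cmod (?q z) \<le> cmod (F z + 1) + cmod ((F z + 1) - ?q z)"
        using norm_triangle_ineq4[of "F z + 1" "(F z + 1) - ?q z"] by simp
      then have "cmod (?q z) \<le> B + 1" using FB(2)[OF zV] d True \<kappa>(2) by linarith
      then have s: "cmod ((F z + 1) + ?q z) \<le> 2 * B + 1"
        using FB(2)[OF zV] norm_triangle_ineq[of "F z + 1" "?q z"] by linarith
      have "R z - (?q z)\<^sup>2 = ((F z + 1) - ?q z) * ((F z + 1) + ?q z)"
        unfolding Fsq[OF zV, symmetric] by (simp add: power2_eq_square algebra_simps)
      then show ?thesis using mult_mono[OF d s] K1 \<epsilon> by (simp add: norm_mult)
    qed
    have q': "cmod (R z - (?q z)\<^sup>2) \<le> 1 / (2 * C8)" if z: "z \<in> Pi ?I ?W" for z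
    proof -
      have "K1 * \<epsilon> * (2 * B + 1) \<le> \<kappa> * (2 * B + 1)" using True B1 by (intro mult_right_mono) auto
      then show ?thesis using q[OF z] \<kappa>(3) by linarith
    qed
    have W: "convex (?W k)" "-1 \<in> ?W k" "1 \<in> ?W k"
      using one_in_complex_nbhd[OF \<eta>(1)] convex_complex_nbhd[OF convex_complex_interval] by auto
    have cR: "continuous_on (Pi ?I ?W) R" using continuous_on_subset[OF hol_on_box_cont[OF hR] sub(1)[OF \<eta>(2)]] .
    have cq: "continuous_on (Pi ?I ?W) (\<lambda>z. (?q z)\<^sup>2)"
      by (rule hol_on_box_cont[OF hol_on_box_power[OF hol_shifted_poly]])
    have den: "c0 \<le> cmod (box_antideriv k (\<lambda>z. (?q z)\<^sup>2) (z(k := 1)))" if z: "z \<in> Pi ?I ?W" for z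
    proof -
      have z1: "z(k := 1) \<in> Pi ?I ?W" using z W(3) by auto
      have b: "1 / C8 \<le> Re (R z)" if "z \<in> Pi ?I ?W" for z using Rb sub(1)[OF \<eta>(2)] that by blast
      \<comment> \<open>Over the path of length 2 the integral of \<open>R\<close> is at least
        \<open>2 / C8\<close>, and replacing \<open>R\<close> by the square changes it by at most
        \<open>2 * (1 / (2 * C8))\<close>, so \<open>1 / C8\<close> remains.\<close>
      have "2 * (1 / C8) \<le> Re (box_antideriv k R (z(k := 1)))"
        by (rule Re_box_antideriv_one_ge[OF cR b W kI z])
      moreover have "cmod (box_antideriv k R (z(k := 1)) - box_antideriv k (\<lambda>z. (?q z)\<^sup>2) (z(k := 1)))
         \<le> cmod ((z(k := 1)) k + 1) * (1 / (2 * C8))"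
        by (rule norm_box_antideriv_diff_le[OF cR cq W(1,2) kI z1 q'])
      moreover have "cmod ((z(k := 1)) k + 1) * (1 / (2 * C8)) = 1 / C8" using C8 by simp
      moreover have "Re (box_antideriv k R (z(k := 1))) \<le> cmod (box_antideriv k R (z(k := 1)))" by (rule complex_Re_le_cmod)
      moreover have "cmod (box_antideriv k R (z(k := 1))) - cmod (box_antideriv k (\<lambda>z. (?q z)\<^sup>2) (z(k := 1)))
         \<le> cmod (box_antideriv k R (z(k := 1)) - box_antideriv k (\<lambda>z. (?q z)\<^sup>2) (z(k := 1)))"
        by (rule norm_triangle_ineq2)
      ultimately have "1 / C8 \<le> cmod (box_antideriv k (\<lambda>z. (?q z)\<^sup>2) (z(k := 1)))" by linarith
      moreover have "c0 \<le> 1 / C8" using C8 by (simp add: c0_def min_le_iff_disj field_simps)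
      ultimately show ?thesis by linarith
    qed
    have rl: "c0 \<le> Re ((?q (real_point x))\<^sup>2)" if x: "x \<in> ?I \<rightarrow> {-1..1}" for x
    proof -
      have z: "real_point x \<in> Pi ?I ?W" by (rule real_point_in_box[OF x \<eta>(1)])
      have "1 / C8 \<le> Re (R (real_point x))" using Rb sub(1)[OF \<eta>(2)] z by blast
      moreover have "\<bar>Re (R (real_point x) - (?q (real_point x))\<^sup>2)\<bar> \<le> 1 / (2 * C8)"
        using q'[OF z] abs_Re_le_cmod order_trans by blast
      moreover have "1 / C8 = 2 * (1 / (2 * C8))" by simp
      moreover have "c0 \<le> 1 / (2 * C8)" by (simp add: c0_def)
      ultimately show ?thesis unfolding minus_complex.sel by linarith
    qed
    have "K1 * \<epsilon> * (2 * B + 1) \<le> K * \<epsilon>"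
    proof -
      have "K1 * (2 * B + 1) * \<epsilon> \<le> K * \<epsilon>" using \<epsilon> by (intro mult_right_mono) (auto simp: K_def)
      then show ?thesis by (simp add: mult_ac)
    qed
    then show ?thesis using q den rl by (intro exI[of _ c]) (blast intro: order_trans)
  next
    case False
    let ?W = "\<lambda>_::nat. complex_nbhd \<eta> complex_interval"
    let ?q = "shifted_poly k (index_set \<xi> k \<epsilon>) (\<lambda>_. 0)"
    have q1: "?q = (\<lambda>z. 1)" by (simp add: shifted_poly_def fun_eq_iff)
    have "cmod (R z - 1) \<le> K * \<epsilon>" if z: "z \<in> Pi ?I ?W" for z
    proof -
      have "cmod (R z) \<le> 1 + C8" using Rb sub(1)[OF \<eta>(2)] z by blast
      then have "cmod (R z - 1) \<le> 2 + C8" using norm_triangle_ineq4[of "R z" 1] by simp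
      also have "\<dots> \<le> (2 + C8) * (K1 * \<epsilon> / \<kappa>)"
      proof -
        have "1 \<le> K1 * \<epsilon> / \<kappa>" using False \<kappa>(1) by (simp add: pos_le_divide_eq)
        then have "(2 + C8) * 1 \<le> (2 + C8) * (K1 * \<epsilon> / \<kappa>)" by (rule mult_left_mono) (use C8 in simp)
        then show ?thesis by simp
      qed
      also have "\<dots> = (2 + C8) * K1 / \<kappa> * \<epsilon>" by simp
      also have "\<dots> \<le> K * \<epsilon>" using \<epsilon> by (intro mult_right_mono) (auto simp: K_def)
      finally show ?thesis .
    qed
    moreover have "box_antideriv k (\<lambda>z. 1) (z(k := 1)) = 2" for z :: "nat \<Rightarrow> complex"
      by (simp add: box_antideriv_def)
    moreover have "c0 \<le> 1" by (simp add: c0_def)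
    ultimately show ?thesis by (intro exI[of _ "\<lambda>_. 0"]) (simp add: q1 del: One_nat_def)
  qed
  show ?thesis
  proof (intro exI[of _ R] conjI allI impI ballI)
    show "R z = R z'" if "\<forall>i\<in>?I. z i = z' i" for z z' using Rdep that by blast
    show "R (real_point x) = r (complexify k x)" if "x \<in> ?I \<rightarrow> {-1..1}" for x using Rreal[OF that] by blast
    show "\<exists>\<eta>0>0. \<forall>\<eta>. 0 < \<eta> \<longrightarrow> \<eta> \<le> \<eta>0 \<longrightarrow>
       hol_on_box ?I (\<lambda>_. complex_nbhd \<eta> complex_interval) R \<and>
       (\<forall>z\<in>Pi ?I (\<lambda>_. complex_nbhd \<eta> complex_interval). 1 / C8 \<le> Re (R z) \<and> cmod (R z) \<le> 1 + C8)"
    proof (intro exI[of _ \<eta>1] conjI allI impI ballI)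
      fix \<eta> assume \<eta>: "0 < \<eta>" "\<eta> \<le> \<eta>1"
      show "hol_on_box ?I (\<lambda>_. complex_nbhd \<eta> complex_interval) R"
      proof (rule hol_on_box_subset[OF hR])
        show "complex_nbhd \<eta> complex_interval \<subseteq> ?V i" if "i \<in> ?I" for i
          by (rule complex_nbhd_mono) (use \<eta>1(2)[OF that] \<eta> in auto)
      qed
      fix z assume "z \<in> Pi ?I (\<lambda>_. complex_nbhd \<eta> complex_interval)"
      then show "1 / C8 \<le> Re (R z)" "cmod (R z) \<le> 1 + C8" using Rb sub(1)[OF \<eta>(2)] by blast+
    qed (rule \<eta>1)
    show "\<exists>\<eta>0>0. \<exists>K\<ge>0. \<exists>c0>0. \<forall>\<eta>. 0 < \<eta> \<longrightarrow> \<eta> \<le> \<eta>0 \<longrightarrow> (\<forall>\<epsilon>\<in>{0<..<1}. \<exists>c.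
       (\<forall>z\<in>Pi {1..k} (\<lambda>_. complex_nbhd \<eta> complex_interval).
          cmod (R z - (shifted_poly k (index_set \<xi> k \<epsilon>) c z)\<^sup>2) \<le> K * \<epsilon> \<and>
          c0 \<le> cmod (box_antideriv k (\<lambda>z. (shifted_poly k (index_set \<xi> k \<epsilon>) c z)\<^sup>2) (z(k := 1)))) \<and>
       (\<forall>x\<in>{1..k} \<rightarrow> {-1..1}. c0 \<le> Re ((shifted_poly k (index_set \<xi> k \<epsilon>) c (real_point x))\<^sup>2)))"
      using \<eta>1(1) K0 c0 main by blast
  qed
qed

section \<open>Perturbation of triangular maps\<close>

text \<open>The third bound mirrors the first: the distance from 1 is at most
  \<open>(1 + e) ^ n - 1\<close> on both sides. The second one remains positive when
  \<open>e\<close> is not small.\<close>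

lemma prod_near_one:
  fixes u :: "'a \<Rightarrow> real"
  assumes "finite A" "\<And>k. k \<in> A \<Longrightarrow> \<bar>u k - 1\<bar> \<le> e" "\<And>k. k \<in> A \<Longrightarrow> b \<le> u k" "0 < b" "0 \<le> e"
  shows "(\<Prod>k\<in>A. u k) \<le> (1 + e) ^ card A \<and> b ^ card A \<le> (\<Prod>k\<in>A. u k) \<and> 2 - (1 + e) ^ card A \<le> (\<Prod>k\<in>A. u k)"
  using assms(1-3)
proof (induction A rule: finite_induct)
  case (insert k A)
  let ?p = "\<Prod>k\<in>A. u k" and ?P = "(1 + e) ^ card A"
  have IH: "?p \<le> ?P" "b ^ card A \<le> ?p" "2 - ?P \<le> ?p" using insert by auto
  have uk: "\<bar>u k - 1\<bar> \<le> e" "b \<le> u k" using insert.prems by auto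
  have p0: "0 \<le> ?p" using IH(2) assms(4) by (meson less_imp_le order_trans zero_le_power)
  have "u k * ?p \<le> (1 + e) * ?P" using uk IH(1) p0 assms(5) by (intro mult_mono) auto
  moreover have "b * b ^ card A \<le> u k * ?p" using uk IH(2) p0 assms(4) by (intro mult_mono) auto
  moreover have "2 - (1 + e) * ?P \<le> u k * ?p"
  proof -
    have "- (e * ?P) \<le> - (e * ?p)" using IH(1) assms(5) by (simp add: mult_left_mono)
    also have "- (e * ?p) \<le> (u k - 1) * ?p"
    proof -
      have "(- e) * ?p \<le> (u k - 1) * ?p" using uk p0 by (intro mult_right_mono) auto
      then show ?thesis by simp
    qed
    finally show ?thesis using IH(3) by (simp add: algebra_simps)
  qed
  ultimately show ?case using insert.hyps by simp
qed auto

text \<open>The chord bound for a convex function of \<epsilon> on the unit interval; it makes the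
  error of a product linear in \<epsilon>.\<close>

lemma power_one_plus_le:
  fixes C \<epsilon> :: real
  assumes "0 \<le> C" "0 \<le> \<epsilon>" "\<epsilon> \<le> 1"
  shows "(1 + C * \<epsilon>) ^ n \<le> 1 + \<epsilon> * ((1 + C) ^ n - 1)"
proof (induction n)
  case (Suc n)
  let ?X = "(1 + C) ^ n - 1"
  have X: "0 \<le> ?X" using assms(1) by (simp add: one_le_power)
  have "(1 + C * \<epsilon>) ^ Suc n \<le> (1 + C * \<epsilon>) * (1 + \<epsilon> * ?X)"
    unfolding power_Suc using Suc assms by (intro mult_left_mono) auto
  also have "\<dots> = 1 + \<epsilon> * (C + ?X + C * (\<epsilon> * ?X))" by (simp add: algebra_simps)
  also have "\<dots> \<le> 1 + \<epsilon> * (C + ?X + C * (1 * ?X))"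
    using assms X by (intro add_left_mono mult_left_mono mult_right_mono) auto
  also have "\<dots> = 1 + \<epsilon> * ((1 + C) ^ Suc n - 1)" by (simp add: algebra_simps)
  finally show ?case .
qed simp

lemma hol_on_box_extend:
  assumes F: "hol_on_box {1..k} V F" and k: "k \<le> d"
    and dep: "\<And>z z'. (\<And>i. i \<in> {1..k} \<Longrightarrow> z i = z' i) \<Longrightarrow> F z = F z'"
  shows "hol_on_box {1..d} V F"
  unfolding hol_on_box_def
proof (intro conjI ballI)
  have sub: "Pi {1..d} V \<subseteq> Pi {1..k} V" using k by auto
  show "continuous_on (Pi {1..d} V) F" using hol_on_box_cont[OF F] sub by (rule continuous_on_subset)
  fix z i assume z: "z \<in> Pi {1..d} V" and i: "i \<in> {1..d}"
  show "(\<lambda>u. F (z(i := u))) holomorphic_on V i"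
  proof (cases "i \<in> {1..k}")
    case True
    then show ?thesis using hol_on_box_hol[OF F] z sub by blast
  next
    case False
    have "F (z(i := u)) = F z" for u by (rule dep) (use False in auto)
    then show ?thesis by simp
  qed
qed

section \<open>Pushforwards under triangular maps\<close>

context smooth_triangular
begin

definition vec_map :: "(nat \<Rightarrow> real) \<Rightarrow> nat \<Rightarrow> real" where "vec_map = (\<lambda>x. \<lambda>k\<in>{1..n}. S x k)"

lemma measurable_map: "vec_map \<in> measurable (cube_measure {1..n}) (cube_measure {1..n})"
  unfolding vec_map_def using measurable_S[of n] by simp

lemma map_in_cube: "x \<in> cube n \<Longrightarrow> vec_map x \<in> cube n"
  using range'[of _ x n] by (auto simp: vec_map_def cube_def)

lemma emeasure_density_map:
  assumes f: "f \<in> borel_measurable (cube_measure {1..n})" and A: "A \<in> sets (cube_measure {1..n})"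
  shows "emeasure (density (cube_measure {1..n}) (\<lambda>x. ennreal (f x))) A
    = (\<integral>\<^sup>+x. ennreal (f (vec_map x)) * (\<Prod>k=1..n. ennreal (s k x)) * indicator A (vec_map x) \<partial>cube_measure {1..n})"
proof -
  have "(\<lambda>x. ennreal (f x) * indicator A x) \<in> borel_measurable (cube_measure {1..n})"
    using f A by measurable
  from substitution[OF order_refl this]
  show ?thesis using f A unfolding vec_map_def by (simp add: emeasure_density mult_ac)
qed

lemma emeasure_distr_map:
  assumes f: "f \<in> borel_measurable (cube_measure {1..n})" and A: "A \<in> sets (cube_measure {1..n})"
  shows "emeasure (distr (density (cube_measure {1..n}) (\<lambda>x. ennreal (f x))) (cube_measure {1..n}) vec_map) A
    = (\<integral>\<^sup>+x. ennreal (f x) * indicator A (vec_map x) \<partial>cube_measure {1..n})"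
proof -
  have pre: "vec_map -` A \<inter> space (cube_measure {1..n}) \<in> sets (cube_measure {1..n})"
    by (rule measurable_sets[OF measurable_map A])
  have "emeasure (distr (density (cube_measure {1..n}) (\<lambda>x. ennreal (f x))) (cube_measure {1..n}) vec_map) A
     = emeasure (density (cube_measure {1..n}) (\<lambda>x. ennreal (f x))) (vec_map -` A \<inter> space (cube_measure {1..n}))"
    using measurable_map A by (subst emeasure_distr) auto
  also have "\<dots> = (\<integral>\<^sup>+x. ennreal (f x) * indicator (vec_map -` A \<inter> space (cube_measure {1..n})) x \<partial>cube_measure {1..n})"
    using f pre by (subst emeasure_density) auto
  also have "\<dots> = (\<integral>\<^sup>+x. ennreal (f x) * indicator A (vec_map x) \<partial>cube_measure {1..n})"
    by (intro nn_integral_cong) (auto simp: indicator_def)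
  finally show ?thesis .
qed

text \<open>The substitution rule pulls the target measure back to the source cube. Both sides are
  then integrals against the same indicator of the image point, so a pointwise inequality of
  densities suffices and the inverse map never appears.\<close>

lemma pushforward_le:
  assumes f: "f \<in> borel_measurable (cube_measure {1..n})" and g: "g \<in> borel_measurable (cube_measure {1..n})"
    and A: "A \<in> sets (cube_measure {1..n})" and c: "0 \<le> c" and g0: "\<And>x. x \<in> cube n \<Longrightarrow> 0 \<le> g x"
  shows "(\<And>x. x \<in> cube n \<Longrightarrow> f x \<le> c * (g (vec_map x) * (\<Prod>k=1..n. s k x))) \<Longrightarrow>
      emeasure (distr (density (cube_measure {1..n}) (\<lambda>x. ennreal (f x))) (cube_measure {1..n}) vec_map) A
       \<le> ennreal c * emeasure (density (cube_measure {1..n}) (\<lambda>x. ennreal (g x))) A"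
    and "(\<And>x. x \<in> cube n \<Longrightarrow> c * (g (vec_map x) * (\<Prod>k=1..n. s k x)) \<le> f x) \<Longrightarrow>
      ennreal c * emeasure (density (cube_measure {1..n}) (\<lambda>x. ennreal (g x))) A
       \<le> emeasure (distr (density (cube_measure {1..n}) (\<lambda>x. ennreal (f x))) (cube_measure {1..n}) vec_map) A"
proof -
  let ?\<mu> = "cube_measure {1..n}"
  have pr: "(\<Prod>k=1..n. ennreal (s k x)) = ennreal (\<Prod>k=1..n. s k x)" and p0: "0 \<le> (\<Prod>k=1..n. s k x)"
    if x: "x \<in> cube n" for x
  proof -
    have "0 < s k x" if "k \<in> {1..n}" for k
    proof -
      have "restrict x {1..k} \<in> cube k" using restrict_cube[OF x] that by auto
      from pos[OF that this] show ?thesis using dep(2)[OF that, of "restrict x {1..k}" x] by simp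
    qed
    then show "(\<Prod>k=1..n. ennreal (s k x)) = ennreal (\<Prod>k=1..n. s k x)" "0 \<le> (\<Prod>k=1..n. s k x)"
      by (auto intro!: prod_ennreal prod_nonneg simp: less_imp_le)
  qed
  have ms: "(\<lambda>x. \<Prod>k=1..n. ennreal (s k x)) \<in> borel_measurable ?\<mu>"
    using measurable_s by (intro borel_measurable_prod_ennreal measurable_compose[OF _ measurable_ennreal]) auto
  have m1: "(\<lambda>x. ennreal (g (vec_map x)) * (\<Prod>k=1..n. ennreal (s k x)) * indicator A (vec_map x)) \<in> borel_measurable ?\<mu>"
  proof -
    have "(\<lambda>x. ennreal (g (vec_map x))) \<in> borel_measurable ?\<mu>"
      by (intro measurable_compose[OF _ measurable_ennreal] measurable_compose[OF measurable_map g])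
    moreover have "(\<lambda>x. indicator A (vec_map x) :: ennreal) \<in> borel_measurable ?\<mu>"
      by (intro measurable_compose[OF measurable_map] borel_measurable_indicator A)
    ultimately show ?thesis using ms by (intro borel_measurable_times_ennreal)
  qed
  have e: "ennreal c * emeasure (density ?\<mu> (\<lambda>x. ennreal (g x))) A
     = (\<integral>\<^sup>+x. ennreal (c * (g (vec_map x) * (\<Prod>k=1..n. s k x))) * indicator A (vec_map x) \<partial>?\<mu>)"
  proof -
    have "ennreal c * emeasure (density ?\<mu> (\<lambda>x. ennreal (g x))) A
      = (\<integral>\<^sup>+x. ennreal c * (ennreal (g (vec_map x)) * (\<Prod>k=1..n. ennreal (s k x)) * indicator A (vec_map x)) \<partial>?\<mu>)"
      unfolding emeasure_density_map[OF g A] by (rule nn_integral_cmult[OF m1, symmetric])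
    also have "\<dots> = (\<integral>\<^sup>+x. ennreal (c * (g (vec_map x) * (\<Prod>k=1..n. s k x))) * indicator A (vec_map x) \<partial>?\<mu>)"
    proof (rule nn_integral_cong)
      fix x assume "x \<in> space ?\<mu>"
      then have x: "x \<in> cube n" by (simp add: space_cube_measure)
      show "ennreal c * (ennreal (g (vec_map x)) * (\<Prod>k=1..n. ennreal (s k x)) * indicator A (vec_map x))
        = ennreal (c * (g (vec_map x) * (\<Prod>k=1..n. s k x))) * indicator A (vec_map x)"
        unfolding pr[OF x] using c g0[OF map_in_cube[OF x]] p0[OF x] by (simp add: ennreal_mult mult.assoc)
    qed
    finally show ?thesis .
  qed
  show "(\<And>x. x \<in> cube n \<Longrightarrow> f x \<le> c * (g (vec_map x) * (\<Prod>k=1..n. s k x))) \<Longrightarrow>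
      emeasure (distr (density ?\<mu> (\<lambda>x. ennreal (f x))) ?\<mu> vec_map) A
       \<le> ennreal c * emeasure (density ?\<mu> (\<lambda>x. ennreal (g x))) A"
    unfolding e emeasure_distr_map[OF f A]
    by (intro nn_integral_mono mult_right_mono ennreal_leI) (auto simp: space_cube_measure)
  show "(\<And>x. x \<in> cube n \<Longrightarrow> c * (g (vec_map x) * (\<Prod>k=1..n. s k x)) \<le> f x) \<Longrightarrow>
      ennreal c * emeasure (density ?\<mu> (\<lambda>x. ennreal (g x))) A
       \<le> emeasure (distr (density ?\<mu> (\<lambda>x. ennreal (f x))) ?\<mu> vec_map) A"
    unfolding e emeasure_distr_map[OF f A]
    by (intro nn_integral_mono mult_right_mono ennreal_leI) (auto simp: space_cube_measure)
qed

end

text \<open>\<open>R\<close> yields the exact map and \<open>G\<close> its approximation.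
  \<open>C8\<close>, \<open>K\<close> and \<open>c0\<close> are chosen before \<epsilon>, and every
  error bound derived here is a function of such constants times \<epsilon>.\<close>

locale approximation_pair =
  T: positive_box_family d \<eta> R + S: positive_box_family d \<eta> G
  for d :: nat and \<eta> :: real and R G :: "nat \<Rightarrow> (nat \<Rightarrow> complex) \<Rightarrow> complex" +
  fixes C8 K c0 \<epsilon> :: real
  assumes C8: "0 < C8" and K: "0 \<le> K" and c0: "0 < c0" and \<epsilon>: "0 < \<epsilon>" "\<epsilon> < 1"
    and R_bounds: "k \<in> {1..d} \<Longrightarrow> z \<in> Pi {1..k} (\<lambda>_. complex_nbhd \<eta> complex_interval) \<Longrightarrow> 1 / C8 \<le> Re (R k z) \<and> cmod (R k z) \<le> 1 + C8"
    and close: "k \<in> {1..d} \<Longrightarrow> z \<in> Pi {1..k} (\<lambda>_. complex_nbhd \<eta> complex_interval) \<Longrightarrow> cmod (R k z - G k z) \<le> K * \<epsilon>"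
    and mass_lower: "k \<in> {1..d} \<Longrightarrow> z \<in> Pi {1..k} (\<lambda>_. complex_nbhd \<eta> complex_interval) \<Longrightarrow> c0 \<le> cmod (box_antideriv k (G k) (z(k := 1)))"
    and G_lower: "k \<in> {1..d} \<Longrightarrow> x \<in> {1..k} \<rightarrow> {-1..1} \<Longrightarrow> c0 \<le> Re (G k (real_point x))"

text \<open>The bound of \<open>norm_quotient_diff_le\<close>, doubled and divided by \<epsilon>.
  The weight \<open>w\<close> is the bound \<open>2 + \<eta>\<close> for the length of the
  integration path in the case of flows, and 1 for derivatives; \<open>min (2 / C8) c0\<close> is a
  lower bound for both normalising integrals.\<close>

definition flow_const :: "real \<Rightarrow> real \<Rightarrow> real \<Rightarrow> real \<Rightarrow> real" where
  "flow_const w C8 K c0 = 2 * (w * K / min (2 / C8) c0 + w * (1 + C8) * (2 * K) / (min (2 / C8) c0)\<^sup>2)"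

lemma flow_const_nonneg: "0 \<le> w \<Longrightarrow> 0 < C8 \<Longrightarrow> 0 \<le> K \<Longrightarrow> 0 < c0 \<Longrightarrow> 0 \<le> flow_const w C8 K c0"
  unfolding flow_const_def by (intro mult_nonneg_nonneg add_nonneg_nonneg divide_nonneg_nonneg) auto

context approximation_pair
begin

lemma cont_RG:
  assumes k: "k \<in> {1..d}"
  shows "continuous_on (Pi {1..k} (\<lambda>_. T.nb)) (R k)" "continuous_on (Pi {1..k} (\<lambda>_. T.nb)) (G k)"
  using T.hol[OF k] S.hol[OF k] hol_on_box_cont by blast+

context
  fixes k :: nat
  assumes k: "k \<in> {1..d}"
begin

lemma kI: "k \<in> {1..k}" using k by auto

lemma up_one: "z \<in> Pi {1..k} (\<lambda>_. T.nb) \<Longrightarrow> z(k := 1) \<in> Pi {1..k} (\<lambda>_. T.nb)"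
  using T.nb(3) by auto

lemma T_mass_lower:
  assumes z: "z \<in> Pi {1..k} (\<lambda>_. T.nb)"
  shows "2 / C8 \<le> cmod (T.mass k z)"
proof -
  have "2 * (1 / C8) \<le> Re (box_antideriv k (R k) (z(k := 1)))"
    by (rule Re_box_antideriv_one_ge[OF cont_RG(1)[OF k] _ T.nb(1,4,3) kI z]) (use R_bounds[OF k] in blast)
  then show ?thesis unfolding T.mass_def using complex_Re_le_cmod[of "box_antideriv k (R k) (z(k := 1))"] by simp
qed

lemma mass_diff:
  assumes z: "z \<in> Pi {1..k} (\<lambda>_. T.nb)"
  shows "cmod (T.mass k z - S.mass k z) \<le> 2 * K * \<epsilon>"
proof -
  have "cmod (box_antideriv k (R k) (z(k := 1)) - box_antideriv k (G k) (z(k := 1))) \<le> cmod ((z(k := 1)) k + 1) * (K * \<epsilon>)"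
    by (rule norm_box_antideriv_diff_le[OF cont_RG[OF k] T.nb(1,4) kI up_one[OF z] close[OF k]])
  then show ?thesis unfolding T.mass_def S.mass_def by simp
qed

lemma coord_bound:
  assumes z: "z \<in> Pi {1..k} (\<lambda>_. T.nb)"
  shows "cmod (z k + 1) \<le> 2 + \<eta>"
proof -
  have "z k \<in> T.nb" using z kI by auto
  then obtain y :: real where y: "-1 \<le> y" "y \<le> 1" "cmod (z k - of_real y) < \<eta>"
    by (auto simp: complex_nbhd_def complex_interval_def)
  have "cmod (z k + 1) \<le> cmod (z k - of_real y) + cmod (of_real (y + 1))"
    using norm_triangle_ineq[of "z k - of_real y" "of_real (y + 1)"] by simp
  also have "cmod (of_real (y + 1)) \<le> 2" unfolding norm_of_real using y by auto
  finally show ?thesis using y by linarith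
qed

lemma flow_diff:
  assumes z: "z \<in> Pi {1..k} (\<lambda>_. T.nb)"
  shows "cmod (T.flow k z - S.flow k z) \<le> flow_const (2 + \<eta>) C8 K c0 * \<epsilon>"
proof -
  let ?\<beta> = "min (2 / C8) c0"
  let ?a = "box_antideriv k (R k) z" and ?a' = "box_antideriv k (G k) z"
  have "cmod (?a - ?a') \<le> cmod (z k + 1) * (K * \<epsilon>)"
    by (rule norm_box_antideriv_diff_le[OF cont_RG[OF k] T.nb(1,4) kI z close[OF k]])
  also have "\<dots> \<le> (2 + \<eta>) * (K * \<epsilon>)" using coord_bound[OF z] K \<epsilon> by (intro mult_right_mono) auto
  finally have 1: "cmod (?a - ?a') \<le> (2 + \<eta>) * (K * \<epsilon>)" .
  have "cmod ?a \<le> cmod (z k + 1) * (1 + C8)"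
    by (rule norm_box_antideriv_le[OF _ T.nb(1,4) kI z]) (use R_bounds[OF k] in blast)
  also have "\<dots> \<le> (2 + \<eta>) * (1 + C8)" using coord_bound[OF z] C8 by (intro mult_right_mono) auto
  finally have 2: "cmod ?a \<le> (2 + \<eta>) * (1 + C8)" .
  have 3: "cmod (?a / T.mass k z - ?a' / S.mass k z) \<le> (2 + \<eta>) * (K * \<epsilon>) / ?\<beta> + (2 + \<eta>) * (1 + C8) * (2 * K * \<epsilon>) / ?\<beta>\<^sup>2"
    by (rule norm_quotient_diff_le[OF 1 mass_diff[OF z] 2])
       (use T_mass_lower[OF z] mass_lower[OF k z] C8 c0 in \<open>auto simp: S.mass_def min_le_iff_disj\<close>)
  have 4: "cmod (T.flow k z - S.flow k z) = 2 * cmod (?a / T.mass k z - ?a' / S.mass k z)"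
  proof -
    have "T.flow k z - S.flow k z = 2 * (?a / T.mass k z - ?a' / S.mass k z)"
      by (simp add: T.flow_def S.flow_def algebra_simps)
    then show ?thesis by (simp only: norm_mult norm_numeral)
  qed
  have "cmod (T.flow k z - S.flow k z) \<le> 2 * ((2 + \<eta>) * (K * \<epsilon>) / ?\<beta> + (2 + \<eta>) * (1 + C8) * (2 * K * \<epsilon>) / ?\<beta>\<^sup>2)"
    unfolding 4 by (rule mult_left_mono[OF 3]) simp
  also have "\<dots> = flow_const (2 + \<eta>) C8 K c0 * \<epsilon>"
    by (simp add: flow_const_def divide_inverse algebra_simps)
  finally show ?thesis .
qed

lemma tri_diff:
  assumes x: "x \<in> {1..k} \<rightarrow> {-1..1}"
  shows "\<bar>T.tri x k - S.tri x k\<bar> \<le> flow_const (2 + \<eta>) C8 K c0 * \<epsilon>"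
  using flow_diff[OF real_point_in_box[OF x T.\<eta>]] abs_Re_le_cmod[of "T.flow k (real_point x) - S.flow k (real_point x)"]
  unfolding T.tri_def S.tri_def by simp

lemma tri_deriv_diff:
  assumes x: "x \<in> {1..k} \<rightarrow> {-1..1}"
  shows "\<bar>T.tri_deriv k x - S.tri_deriv k x\<bar> \<le> flow_const 1 C8 K c0 * \<epsilon>"
proof -
  let ?\<beta> = "min (2 / C8) c0" and ?z = "real_point x"
  have z: "?z \<in> Pi {1..k} (\<lambda>_. T.nb)" by (rule real_point_in_box[OF x T.\<eta>])
  have "cmod (R k ?z / T.mass k ?z - G k ?z / S.mass k ?z) \<le> K * \<epsilon> / ?\<beta> + (1 + C8) * (2 * K * \<epsilon>) / ?\<beta>\<^sup>2"
    by (rule norm_quotient_diff_le[OF close[OF k z] mass_diff[OF z]])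
       (use R_bounds[OF k z] T_mass_lower[OF z] mass_lower[OF k z] C8 c0 in \<open>auto simp: S.mass_def min_le_iff_disj\<close>)
  then have "2 * cmod (R k ?z / T.mass k ?z - G k ?z / S.mass k ?z) \<le> flow_const 1 C8 K c0 * \<epsilon>"
    by (simp add: flow_const_def divide_inverse algebra_simps)
  moreover have "\<bar>T.tri_deriv k x - S.tri_deriv k x\<bar> \<le> cmod (2 * (R k ?z / T.mass k ?z - G k ?z / S.mass k ?z))"
    using abs_Re_le_cmod[of "2 * (R k ?z / T.mass k ?z - G k ?z / S.mass k ?z)"]
    unfolding T.tri_deriv_def S.tri_deriv_def minus_complex.sel(1)[symmetric] by (simp add: right_diff_distrib)
  ultimately show ?thesis unfolding norm_mult norm_numeral by linarith
qed

lemma G_upper: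
  assumes z: "z \<in> Pi {1..k} (\<lambda>_. T.nb)"
  shows "cmod (G k z) \<le> 1 + C8 + K"
proof -
  have "cmod (G k z) \<le> cmod (R k z) + cmod (R k z - G k z)"
    using norm_triangle_ineq4[of "R k z" "R k z - G k z"] by simp
  moreover have "K * \<epsilon> \<le> K * 1" using K \<epsilon> by (intro mult_left_mono) auto
  ultimately show ?thesis using R_bounds[OF k z] close[OF k z] by linarith
qed

text \<open>The normalising integral lies between \<open>c0\<close> and
  \<open>2 * (1 + C8 + K)\<close>, the latter being the length of the interval times the bound for
  \<open>G\<close>.\<close>

lemma S_tri_deriv_bounds:
  assumes x: "x \<in> {1..k} \<rightarrow> {-1..1}"
  shows "c0 / (1 + C8 + K) \<le> S.tri_deriv k x" "S.tri_deriv k x \<le> 2 * (1 + C8 + K) / c0"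
proof -
  let ?z = "real_point x" and ?m = "LBINT t:{-1..1}. S.density k (x(k := t))"
  have z: "?z \<in> Pi {1..k} (\<lambda>_. T.nb)" by (rule real_point_in_box[OF x T.\<eta>])
  have m0: "0 < ?m" by (rule S.mass_pos[OF k x])
  have m: "cmod (S.mass k ?z) = ?m" unfolding S.mass_real[OF k x] using m0 by simp
  have "cmod (S.mass k ?z) \<le> cmod ((?z(k := 1)) k + 1) * (1 + C8 + K)"
    unfolding S.mass_def by (rule norm_box_antideriv_le[OF G_upper T.nb(1,4) kI up_one[OF z]])
  then have mu: "?m \<le> 2 * (1 + C8 + K)" unfolding m by simp
  have ml: "c0 \<le> ?m" using mass_lower[OF k z] m by (simp add: S.mass_def)
  have gl: "c0 \<le> S.density k x" using G_lower[OF k x] by (simp add: S.density_def)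
  have gu: "S.density k x \<le> 1 + C8 + K"
    using G_upper[OF z] complex_Re_le_cmod[of "G k ?z"] by (simp add: S.density_def)
  have "c0 / (1 + C8 + K) = 2 * c0 / (2 * (1 + C8 + K))" by (rule mult_divide_mult_cancel_left[symmetric]) simp
  also have "2 * c0 / (2 * (1 + C8 + K)) \<le> 2 * S.density k x / ?m"
    using gl mu m0 c0 by (intro frac_le) auto
  finally show "c0 / (1 + C8 + K) \<le> S.tri_deriv k x" unfolding S.tri_deriv_eq[OF k x] .
  show "S.tri_deriv k x \<le> 2 * (1 + C8 + K) / c0"
    unfolding S.tri_deriv_eq[OF k x] using gu ml c0 gl by (intro frac_le) auto
qed

end

end

section \<open>Maps known only on the cube, and the transport as a normalised antiderivative\<close>

lemma (in lipschitz_density) prob_space_density: "prob_space (density (cube_measure {1..d}) (\<lambda>x. ennreal (f x)))"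
proof
  let ?\<mu> = "cube_measure {1..d}"
  have i: "integrable ?\<mu> f" using total by (metis not_integrable_integral_eq zero_neq_one)
  have nn: "AE x in ?\<mu>. 0 \<le> f x"
  proof (rule AE_I2)
    fix x assume "x \<in> space ?\<mu>"
    then have "x \<in> cube d" by (simp add: space_cube_measure)
    from lower[OF this] m show "0 \<le> f x" by simp
  qed
  have "emeasure (density ?\<mu> (\<lambda>x. ennreal (f x))) (space ?\<mu>) = (\<integral>\<^sup>+x. ennreal (f x) * indicator (space ?\<mu>) x \<partial>?\<mu>)"
    using meas by (intro emeasure_density) auto
  also have "\<dots> = (\<integral>\<^sup>+x. ennreal (f x) \<partial>?\<mu>)" by (intro nn_integral_cong) simp
  also have "\<dots> = 1" unfolding nn_integral_eq_integral[OF i nn] total by simp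
  finally show "emeasure (density ?\<mu> (\<lambda>x. ennreal (f x))) (space (density ?\<mu> (\<lambda>x. ennreal (f x)))) = 1"
    unfolding space_density .
qed

context smooth_triangular
begin

context
  fixes F
  assumes F: "\<And>x. x \<in> cube n \<Longrightarrow> F x = vec_map x"
begin

text \<open>The approximating map is defined by real integrals and \<open>vec_map\<close> by complex
  ones; they are identified on the cube only, so the properties are transferred to any map that
  agrees there.\<close>

lemma bij_betw_representative: "bij_betw F (cube n) (cube n)"
  using bij_betw_cube F unfolding vec_map_def by (subst bij_betw_cong[of _ F]) auto

lemma triangular_representative: "triangular_map n F"
  unfolding triangular_map_def
proof (intro ballI impI)
  fix j x y assume j: "j \<in> {1..n}" and xy: "x \<in> cube n" "y \<in> cube n" and e: "\<forall>i\<in>{1..j}. x i = y i"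
  have "S x j = S y j" by (rule dep(1)[OF j]) (use e in blast)
  then show "F x j = F y j" unfolding F[OF xy(1)] F[OF xy(2)] using j by (simp add: vec_map_def)
qed

lemma monotone_representative: "monotone_in_last n F"
  unfolding monotone_in_last_def
proof (intro ballI mono_onI)
  fix j x and r s :: real
  assume j: "j \<in> {1..n}" and x: "x \<in> cube n" and rs: "r \<in> {-1..1}" "s \<in> {-1..1}" "r \<le> s"
  have c: "x(j := r) \<in> cube n" "x(j := s) \<in> cube n" using x j rs by (auto intro: cube_fun_upd simp del: fun_upd_apply)
  have "S (x(j := r)) j \<le> S (x(j := s)) j"
    using strict_increasing'[OF j x rs(1,2)] rs(3) by (cases "r = s") auto
  then show "F (x(j := r)) j \<le> F (x(j := s)) j"
    unfolding F[OF c(1)] F[OF c(2)] using j by (simp add: vec_map_def del: fun_upd_apply)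
qed

lemma distr_representative:
  "distr (density (cube_measure {1..n}) g) (cube_measure {1..n}) F = distr (density (cube_measure {1..n}) g) (cube_measure {1..n}) vec_map"
  by (rule distr_cong) (use F in \<open>auto simp: space_cube_measure\<close>)

end

end

text \<open>The derivative of the transport is one-sided at the end points, since nothing is known
  of its values off the cube; the map \<open>tri\<close> of the family \<open>R\<close> extends it
  smoothly beyond.\<close>

locale kr_family = kr: kr_pair d f\<^sub>\<rho> f\<^sub>\<pi> M L \<Lambda> + T: positive_box_family d \<eta> R
  for d f\<^sub>\<rho> f\<^sub>\<pi> M L \<Lambda> \<eta> R +
  assumes kr_deriv: "k \<in> {1..d} \<Longrightarrow> x \<in> cube k \<Longrightarrow>
    ((\<lambda>t. kr_comp d f\<^sub>\<rho> f\<^sub>\<pi> k (x(k := t))) has_real_derivative Re (R k (real_point x))) (at (x k) within {-1..1})"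
begin

context
  fixes k x
  assumes k: "k \<in> {1..d}" and x: "x \<in> cube d"
begin

lemma kr_deriv_upd:
  assumes t: "t \<in> {-1..1}"
  shows "((\<lambda>t. kr_comp d f\<^sub>\<rho> f\<^sub>\<pi> k (x(k := t))) has_real_derivative T.density k (x(k := t))) (at t within {-1..1})"
proof -
  let ?x = "(restrict x {1..k})(k := t)"
  have x': "?x \<in> cube k"
  proof (rule cube_fun_upd(2))
    show "restrict x {1..k} \<in> cube k" using restrict_cube[OF x] k by auto
  qed (use k t in auto)
  have e: "kr_comp d f\<^sub>\<rho> f\<^sub>\<pi> k (?x(k := s)) = kr_comp d f\<^sub>\<rho> f\<^sub>\<pi> k (x(k := s))" for s
    by (rule kr.T_dep[OF k]) auto
  have r: "R k (real_point ?x) = R k (real_point (x(k := t)))"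
    by (rule T.G_dep[OF k]) (auto simp: real_point_def)
  have tk: "?x k = t" by simp
  from kr_deriv[OF k x'] show ?thesis unfolding e r tk T.density_def .
qed

lemma kr_integral:
  assumes t: "t \<in> {-1..1}"
  shows "(LBINT s:{-1..t}. T.density k (x(k := s))) = kr_comp d f\<^sub>\<rho> f\<^sub>\<pi> k (x(k := t)) + 1"
proof -
  have xP: "x \<in> {1..k} \<rightarrow> {-1..1}" by (rule cube_Pi[OF x]) (use k in simp)
  have c: "continuous_on {-1..1} (\<lambda>s. T.density k (x(k := s)))"
    unfolding T.density_def by (rule continuous_on_real_section[OF hol_on_box_cont[OF T.hol[OF k]] T.\<eta> xP])
  have "(LBINT s:{-1..t}. T.density k (x(k := s))) = kr_comp d f\<^sub>\<rho> f\<^sub>\<pi> k (x(k := t)) - kr_comp d f\<^sub>\<rho> f\<^sub>\<pi> k (x(k := -1))"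
    unfolding set_lebesgue_integral_def
  proof (rule integral_FTC_atLeastAtMost)
    show "-1 \<le> t" using t by simp
    show "continuous_on {-1..t} (\<lambda>s. T.density k (x(k := s)))" by (rule continuous_on_subset[OF c]) (use t in auto)
    fix s assume s: "-1 \<le> s" "s \<le> t"
    have s': "s \<in> {-1..1}" using s t by simp
    have sub: "{-1..t} \<subseteq> {-1..1}" using t by auto
    show "((\<lambda>t. kr_comp d f\<^sub>\<rho> f\<^sub>\<pi> k (x(k := t))) has_vector_derivative T.density k (x(k := s))) (at s within {-1..t})"
      using has_field_derivative_subset[OF kr_deriv_upd[OF s'] sub]
      unfolding has_real_derivative_iff_has_vector_derivative .
  qed
  then show ?thesis unfolding kr.T_ends(1)[OF x k] by simp
qed

text \<open>The transport maps end points to end points, so \<open>R k\<close> integrates to 2 over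
  the interval and the normalisation of \<open>tri\<close> changes nothing.\<close>

lemma kr_eq_tri: "kr_comp d f\<^sub>\<rho> f\<^sub>\<pi> k x = T.tri x k"
  and tri_deriv_eq_density: "T.tri_deriv k x = T.density k x"
proof -
  have xP: "x \<in> {1..k} \<rightarrow> {-1..1}" by (rule cube_Pi[OF x]) (use k in simp)
  have m: "(LBINT s:{-1..1}. T.density k (x(k := s))) = 2"
    using kr_integral[of 1] unfolding kr.T_ends(2)[OF x k] by simp
  have "(LBINT s:{-1..x k}. T.density k (x(k := s))) = kr_comp d f\<^sub>\<rho> f\<^sub>\<pi> k x + 1"
    using kr_integral[OF cube_memD[OF x k]] unfolding fun_upd_triv .
  then show "kr_comp d f\<^sub>\<rho> f\<^sub>\<pi> k x = T.tri x k" unfolding T.tri_eq[OF k xP] m by simp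
  show "T.tri_deriv k x = T.density k x" unfolding T.tri_deriv_eq[OF k xP] m by simp
qed

end

lemma kr_eq_vec_map:
  assumes x: "x \<in> cube d"
  shows "kr_map d f\<^sub>\<rho> f\<^sub>\<pi> d x = T.vec_map x"
proof
  fix i
  show "kr_map d f\<^sub>\<rho> f\<^sub>\<pi> d x i = T.vec_map x i"
  proof (cases "i \<in> {1..d}")
    case True
    then show ?thesis using kr.kr_eq[OF True] kr_eq_tri[OF True x] by (simp add: T.vec_map_def)
  next
    case False
    then show ?thesis using kr.kr_undefined[OF False] unfolding T.vec_map_def restrict_def by (simp only: if_False)
  qed
qed

lemma density_relation:
  assumes x: "x \<in> cube d"
  shows "f\<^sub>\<rho> x = f\<^sub>\<pi> (T.vec_map x) * (\<Prod>k=1..d. T.tri_deriv k x)"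
proof -
  have "((\<lambda>t. kr_comp d f\<^sub>\<rho> f\<^sub>\<pi> k (x(k := t))) has_real_derivative T.tri_deriv k x) (at (x k) within {-1..1})"
    if k: "k \<in> {1..d}" for k
    using kr_deriv_upd[OF k x cube_memD[OF x k]] unfolding fun_upd_triv tri_deriv_eq_density[OF k x] .
  from kr.density_relation[OF x this] show ?thesis unfolding kr_eq_vec_map[OF x] .
qed

text \<open>The pointwise density relation, used as an inequality with constant 1 in both
  directions.\<close>

lemma pushforward_eq:
  "distr (density (cube_measure {1..d}) (\<lambda>x. ennreal (f\<^sub>\<rho> x))) (cube_measure {1..d}) T.vec_map
    = density (cube_measure {1..d}) (\<lambda>x. ennreal (f\<^sub>\<pi> x))" (is "?N = ?P")
proof (rule measure_eqI)
  fix A assume "A \<in> sets ?N"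
  then have A: "A \<in> sets (cube_measure {1..d})" by simp
  have p: "0 \<le> f\<^sub>\<pi> x" if "x \<in> cube d" for x using kr.\<pi>.lower[OF that] kr.\<pi>.m by simp
  have r: "f\<^sub>\<rho> x \<le> 1 * (f\<^sub>\<pi> (T.vec_map x) * (\<Prod>k=1..d. T.tri_deriv k x))"
    "1 * (f\<^sub>\<pi> (T.vec_map x) * (\<Prod>k=1..d. T.tri_deriv k x)) \<le> f\<^sub>\<rho> x" if "x \<in> cube d" for x
    unfolding density_relation[OF that] by simp_all
  note le = T.pushforward_le[OF kr.\<rho>.meas kr.\<pi>.meas A zero_le_one]
  have "emeasure ?N A \<le> ennreal 1 * emeasure ?P A"
    by (rule le(1)) (erule p r(1))+
  moreover have "ennreal 1 * emeasure ?P A \<le> emeasure ?N A"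
    by (rule le(2)) (erule p r(2))+
  ultimately show "emeasure ?N A = emeasure ?P A" by simp
qed simp

end

section \<open>Error bounds at a fixed level of the index sets\<close>

locale transport_approximation =
  approximation_pair d \<eta> R G C8 K c0 \<epsilon> + kr_family d f\<^sub>\<rho> f\<^sub>\<pi> M L \<Lambda> \<eta> R
  for d \<eta> R G C8 K c0 \<epsilon> f\<^sub>\<rho> f\<^sub>\<pi> M L \<Lambda>

text \<open>A common relative error, divided by \<epsilon>, for the two kinds of factors in the
  density ratio: quotients of last-variable derivatives, and the quotient of the target density at
  the two image points.\<close>

definition ratio_const :: "nat \<Rightarrow> real \<Rightarrow> real \<Rightarrow> real \<Rightarrow> real \<Rightarrow> real \<Rightarrow> real \<Rightarrow> real" where
  "ratio_const d \<eta> C8 K c0 M \<Lambda> =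
     max (flow_const 1 C8 K c0 / (c0 / (1 + C8 + K))) (\<Lambda> * (real d * flow_const (2 + \<eta>) C8 K c0) / M)"

context transport_approximation
begin

abbreviation "\<mu> \<equiv> cube_measure {1..d}"
abbreviation "\<rho> \<equiv> density \<mu> (\<lambda>x. ennreal (f\<^sub>\<rho> x))"
abbreviation "\<pi> \<equiv> density \<mu> (\<lambda>x. ennreal (f\<^sub>\<pi> x))"
abbreviation "flow_error \<equiv> flow_const (2 + \<eta>) C8 K c0"
abbreviation "ratio_error \<equiv> ratio_const d \<eta> C8 K c0 M \<Lambda>"

lemma sobolev_component_le:
  assumes B: "\<forall>F f (B::real). hol_on_box {1..d} (\<lambda>_. complex_nbhd \<eta> complex_interval) F \<longrightarrow>
    (\<forall>z\<in>Pi {1..d} (\<lambda>_. complex_nbhd \<eta> complex_interval). cmod (F z) \<le> B) \<longrightarrow>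
    (\<forall>x\<in>cube d. f x = Re (F (real_point x))) \<longrightarrow> sobolev_norm d m f \<le> ereal (K' * B)"
    and k: "k \<in> {1..d}" and f: "\<And>x. x \<in> cube d \<Longrightarrow> f x = kr_comp d f\<^sub>\<rho> f\<^sub>\<pi> k x - S.tri x k"
  shows "sobolev_norm d m f \<le> ereal (K' * (flow_error * \<epsilon>))"
proof (rule B[rule_format])
  let ?F = "\<lambda>z. T.flow k z - S.flow k z"
  have kd: "k \<le> d" using k by simp
  show "hol_on_box {1..d} (\<lambda>_. T.nb) ?F"
  proof (rule hol_on_box_extend[OF _ kd])
    show "hol_on_box {1..k} (\<lambda>_. T.nb) ?F" by (rule hol_on_box_diff[OF T.hol_flow[OF k] S.hol_flow[OF k]])
    show "?F z = ?F z'" if "\<And>i. i \<in> {1..k} \<Longrightarrow> z i = z' i" for z z'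
      using T.flow_dep(1)[OF k, of z z'] S.flow_dep(1)[OF k, of z z'] that by simp
  qed
  show "cmod (?F z) \<le> flow_error * \<epsilon>" if "z \<in> Pi {1..d} (\<lambda>_. T.nb)" for z
    by (rule flow_diff[OF k]) (use that kd in auto)
  show "f x = Re (?F (real_point x))" if "x \<in> cube d" for x
    unfolding f[OF that] kr_eq_tri[OF k that] by (simp add: T.tri_def S.tri_def)
qed

lemma sum_tri_diff:
  assumes x: "x \<in> cube d"
  shows "(\<Sum>i=1..d. \<bar>T.vec_map x i - S.vec_map x i\<bar>) \<le> real d * flow_error * \<epsilon>"
proof -
  have "\<bar>T.vec_map x i - S.vec_map x i\<bar> \<le> flow_error * \<epsilon>" if i: "i \<in> {1..d}" for i
    using tri_diff[OF i, of x] cube_Pi[OF x, of i] i by (simp add: T.vec_map_def S.vec_map_def)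
  from sum_bounded_above[of "{1..d}", OF this] show ?thesis by (simp add: mult.assoc)
qed

lemma wasserstein_bound:
  assumes "1 \<le> p"
  shows "wasserstein d p (distr \<rho> \<mu> S.vec_map) \<pi> \<le> real d * flow_error * \<epsilon>"
  unfolding pushforward_eq[symmetric]
proof (rule wasserstein_le[OF kr.\<rho>.prob_space_density _ _ _ _ assms])
  show "S.vec_map \<in> measurable \<rho> \<mu>" "T.vec_map \<in> measurable \<rho> \<mu>"
    using S.measurable_map T.measurable_map by simp_all
  show "(\<lambda>x. x i) \<in> borel_measurable \<mu>" if i: "i \<in> {1..d}" for i
  proof -
    have "(\<lambda>x. x i) \<in> measurable \<mu> half_lebesgue"
      unfolding cube_measure_def using i by (rule measurable_component_singleton)
    moreover have "(\<lambda>t::real. t) \<in> borel_measurable half_lebesgue"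
      unfolding measurable_cong_sets[OF sets_half_lebesgue refl] by (intro measurable_restrict_space1) simp
    ultimately show ?thesis by (rule measurable_compose)
  qed
  fix x assume "x \<in> space \<rho>"
  then have x: "x \<in> cube d" by (simp add: space_cube_measure)
  have "L2_set (\<lambda>i. S.vec_map x i - T.vec_map x i) {1..d} \<le> (\<Sum>i=1..d. \<bar>S.vec_map x i - T.vec_map x i\<bar>)"
    by (rule L2_set_le_sum_abs)
  also have "\<dots> = (\<Sum>i=1..d. \<bar>T.vec_map x i - S.vec_map x i\<bar>)" by (simp add: abs_minus_commute)
  finally show "L2_set (\<lambda>i. S.vec_map x i - T.vec_map x i) {1..d} \<le> real d * flow_error * \<epsilon>"
    using sum_tri_diff[OF x] by linarith
qed

lemma density_quotient:
  assumes x: "x \<in> cube d"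
  shows "\<bar>f\<^sub>\<pi> (T.vec_map x) / f\<^sub>\<pi> (S.vec_map x) - 1\<bar> \<le> ratio_error * \<epsilon>"
    and "M / L \<le> f\<^sub>\<pi> (T.vec_map x) / f\<^sub>\<pi> (S.vec_map x)"
proof -
  let ?t = "f\<^sub>\<pi> (T.vec_map x)" and ?s = "f\<^sub>\<pi> (S.vec_map x)"
  have c: "T.vec_map x \<in> cube d" "S.vec_map x \<in> cube d"
    using T.map_in_cube[OF x] S.map_in_cube[OF x] by auto
  have M: "0 < M" by (rule kr.\<pi>.m)
  have b: "M \<le> ?t" "M \<le> ?s" "?s \<le> L" using kr.\<pi>.lower[OF c(1)] kr.\<pi>.lower[OF c(2)] kr.\<pi>.upper[OF c(2)] by auto
  show "M / L \<le> ?t / ?s" using b M by (intro frac_le) auto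
  have "\<bar>?t - ?s\<bar> \<le> \<Lambda> * (\<Sum>i=1..d. \<bar>T.vec_map x i - S.vec_map x i\<bar>)" by (rule kr.\<pi>.lip[OF c])
  also have "\<dots> \<le> \<Lambda> * (real d * flow_error * \<epsilon>)" by (rule mult_left_mono[OF sum_tri_diff[OF x] kr.\<pi>.\<Lambda>])
  finally have "\<bar>?t - ?s\<bar> / ?s \<le> \<Lambda> * (real d * flow_error * \<epsilon>) / M" using b M by (intro frac_le) auto
  moreover have "\<bar>?t / ?s - 1\<bar> = \<bar>?t - ?s\<bar> / ?s"
  proof -
    have "?t / ?s - 1 = (?t - ?s) / ?s" using b M by (simp add: diff_divide_distrib)
    then show ?thesis using b M by simp
  qed
  moreover have "\<Lambda> * (real d * flow_error * \<epsilon>) / M = \<Lambda> * (real d * flow_error) / M * \<epsilon>" by simp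
  moreover have "\<Lambda> * (real d * flow_error) / M * \<epsilon> \<le> ratio_error * \<epsilon>"
    unfolding ratio_const_def using \<epsilon> by (intro mult_right_mono max.cobounded2) auto
  ultimately show "\<bar>?t / ?s - 1\<bar> \<le> ratio_error * \<epsilon>" by linarith
qed

lemma deriv_quotient:
  assumes k: "k \<in> {1..d}" and x: "x \<in> cube d"
  shows "\<bar>T.tri_deriv k x / S.tri_deriv k x - 1\<bar> \<le> ratio_error * \<epsilon>"
    and "1 / C8 / (2 * (1 + C8 + K) / c0) \<le> T.tri_deriv k x / S.tri_deriv k x"
proof -
  let ?t = "T.tri_deriv k x" and ?s = "S.tri_deriv k x" and ?l = "c0 / (1 + C8 + K)"
  have xP: "x \<in> {1..k} \<rightarrow> {-1..1}" by (rule cube_Pi[OF x]) (use k in simp)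
  have l: "0 < ?l" using c0 C8 K by simp
  note s = S_tri_deriv_bounds[OF k xP]
  have t: "1 / C8 \<le> ?t"
    using R_bounds[OF k real_point_in_box[OF xP T.\<eta>]] by (simp add: tri_deriv_eq_density[OF k x] T.density_def)
  show "1 / C8 / (2 * (1 + C8 + K) / c0) \<le> ?t / ?s"
    using t s l C8 order.trans[OF _ t, of 0] by (intro frac_le) auto
  have "\<bar>?t - ?s\<bar> / ?s \<le> flow_const 1 C8 K c0 * \<epsilon> / ?l"
    using tri_deriv_diff[OF k xP] s l by (intro frac_le) auto
  moreover have "\<bar>?t / ?s - 1\<bar> = \<bar>?t - ?s\<bar> / ?s"
  proof -
    have "?t / ?s - 1 = (?t - ?s) / ?s" using s l by (simp add: diff_divide_distrib)
    then show ?thesis using s l by simp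
  qed
  moreover have "flow_const 1 C8 K c0 * \<epsilon> / ?l = flow_const 1 C8 K c0 / ?l * \<epsilon>" by simp
  moreover have "flow_const 1 C8 K c0 / ?l * \<epsilon> \<le> ratio_error * \<epsilon>"
    unfolding ratio_const_def using \<epsilon> by (intro mult_right_mono max.cobounded1) auto
  ultimately show "\<bar>?t / ?s - 1\<bar> \<le> ratio_error * \<epsilon>" by linarith
qed

lemma ratio_error_nonneg: "0 \<le> ratio_error"
  unfolding ratio_const_def using flow_const_nonneg[of 1 C8 K c0] C8 K c0 by (intro max.coboundedI1 divide_nonneg_nonneg) auto

text \<open>A lower bound for every factor of the density ratio, independent of \<epsilon>. The
  minimum with 1 keeps its powers at most 1.\<close>

definition ratio_min :: real where "ratio_min = min 1 (min (M / L) (1 / C8 / (2 * (1 + C8 + K) / c0)))"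

abbreviation "comparison_error \<equiv> \<epsilon> * ((1 + ratio_error) ^ Suc d - 1)"

lemma ratio_min: "0 < ratio_min" "ratio_min \<le> 1"
proof -
  have "(\<lambda>i\<in>{1..d}. 0) \<in> cube d" by (auto simp: cube_def)
  then have "0 < L" using kr.\<pi>.lower kr.\<pi>.upper kr.\<pi>.m by fastforce
  then show "0 < ratio_min" "ratio_min \<le> 1" using kr.\<pi>.m C8 K c0 by (auto simp: ratio_min_def)
qed

lemma comparison_error_nonneg: "0 \<le> comparison_error"
  using ratio_error_nonneg \<epsilon> by (intro mult_nonneg_nonneg) (auto simp: one_le_power simp del: power_Suc)

lemma density_ratio:
  assumes x: "x \<in> cube d"
  shows "f\<^sub>\<rho> x \<le> (1 + comparison_error) * (f\<^sub>\<pi> (S.vec_map x) * (\<Prod>k=1..d. S.tri_deriv k x))"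
    and "max (ratio_min ^ Suc d) (1 - comparison_error) * (f\<^sub>\<pi> (S.vec_map x) * (\<Prod>k=1..d. S.tri_deriv k x)) \<le> f\<^sub>\<rho> x"
proof -
  \<comment> \<open>Index 0 carries the quotient of the target densities and the others the
    quotients of derivatives, so the density ratio is a product of \<open>Suc d\<close> factors near
    1.\<close>
  define w where "w k = (if k = 0 then f\<^sub>\<pi> (T.vec_map x) / f\<^sub>\<pi> (S.vec_map x) else T.tri_deriv k x / S.tri_deriv k x)" for k
  have "\<bar>w k - 1\<bar> \<le> ratio_error * \<epsilon> \<and> ratio_min \<le> w k" if k: "k \<in> insert 0 {1..d}" for k
  proof (cases "k = 0")
    case True
    have "ratio_min \<le> M / L" by (simp add: ratio_min_def)
    then show ?thesis using density_quotient[OF x] True by (simp add: w_def)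
  next
    case False
    then have k': "k \<in> {1..d}" using k by auto
    have "ratio_min \<le> 1 / C8 / (2 * (1 + C8 + K) / c0)" unfolding ratio_min_def by (intro min.coboundedI2 min.cobounded2)
    then have "ratio_min \<le> T.tri_deriv k x / S.tri_deriv k x" using deriv_quotient(2)[OF k' x] by (rule order.trans)
    then show ?thesis using deriv_quotient(1)[OF k' x] False by (simp add: w_def)
  qed
  then have w: "\<And>k. k \<in> insert 0 {1..d} \<Longrightarrow> \<bar>w k - 1\<bar> \<le> ratio_error * \<epsilon>" "\<And>k. k \<in> insert 0 {1..d} \<Longrightarrow> ratio_min \<le> w k"
    by blast+
  let ?W = "\<Prod>k\<in>insert 0 {1..d}. w k" and ?Q = "f\<^sub>\<pi> (S.vec_map x) * (\<Prod>k=1..d. S.tri_deriv k x)"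
  have "?W \<le> (1 + ratio_error * \<epsilon>) ^ card (insert 0 {1..d}) \<and> ratio_min ^ card (insert 0 {1..d}) \<le> ?W
      \<and> 2 - (1 + ratio_error * \<epsilon>) ^ card (insert 0 {1..d}) \<le> ?W"
    by (rule prod_near_one[OF _ w ratio_min(1)]) (use ratio_error_nonneg \<epsilon> in auto)
  moreover have "card (insert 0 {1..d}) = Suc d" by simp
  ultimately have W: "?W \<le> (1 + ratio_error * \<epsilon>) ^ Suc d" "ratio_min ^ Suc d \<le> ?W" "2 - (1 + ratio_error * \<epsilon>) ^ Suc d \<le> ?W"
    by simp_all
  have p: "(1 + ratio_error * \<epsilon>) ^ Suc d \<le> 1 + comparison_error"
    by (rule power_one_plus_le) (use ratio_error_nonneg \<epsilon> in auto)
  have s0: "0 < S.tri_deriv k x" if k: "k \<in> {1..d}" for k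
    by (rule S.tri_deriv_pos[OF k cube_Pi[OF x]]) (use k in simp)
  have f0: "0 < f\<^sub>\<pi> (S.vec_map x)" using kr.\<pi>.lower[OF S.map_in_cube[OF x]] kr.\<pi>.m by simp
  have Q0: "0 \<le> ?Q" using s0 f0 by (intro mult_nonneg_nonneg prod_nonneg) (auto simp: less_imp_le)
  have "?W = f\<^sub>\<pi> (T.vec_map x) / f\<^sub>\<pi> (S.vec_map x) * (\<Prod>k=1..d. w k)" by (subst prod.insert) (auto simp: w_def)
  also have "(\<Prod>k=1..d. w k) = (\<Prod>k=1..d. T.tri_deriv k x) / (\<Prod>k=1..d. S.tri_deriv k x)"
    unfolding prod_dividef[symmetric] by (rule prod.cong) (auto simp: w_def)
  finally have "?W * ?Q = f\<^sub>\<rho> x"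
  proof -
    assume e: "?W = f\<^sub>\<pi> (T.vec_map x) / f\<^sub>\<pi> (S.vec_map x) * ((\<Prod>k=1..d. T.tri_deriv k x) / (\<Prod>k=1..d. S.tri_deriv k x))"
    have "(\<Prod>k=1..d. S.tri_deriv k x) \<noteq> 0" using s0 by (simp add: less_imp_neq[symmetric])
    then show ?thesis unfolding e density_relation[OF x] using f0 by simp
  qed
  moreover have "?W * ?Q \<le> (1 + comparison_error) * ?Q" using W(1) p Q0 by (intro mult_right_mono) auto
  moreover have "max (ratio_min ^ Suc d) (1 - comparison_error) * ?Q \<le> ?W * ?Q"
    using W(2,3) p Q0 by (intro mult_right_mono max.boundedI) linarith+
  ultimately show "f\<^sub>\<rho> x \<le> (1 + comparison_error) * ?Q" "max (ratio_min ^ Suc d) (1 - comparison_error) * ?Q \<le> f\<^sub>\<rho> x"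
    by simp_all
qed

text \<open>
  The lower bound \<open>1 - comparison_error\<close> may be negative for large \<open>\<epsilon>\<close>, where \<open>ratio_min ^ Suc d\<close>
  keeps the density ratio away from 0.
\<close>

lemma comparison:
  "density_comparison \<mu> f\<^sub>\<pi> \<pi> (distr \<rho> \<mu> S.vec_map) comparison_error (max (ratio_min ^ Suc d) (1 - comparison_error))"
proof (rule density_comparison.intro)
  have p: "0 \<le> f\<^sub>\<pi> x" if "x \<in> cube d" for x using kr.\<pi>.lower[OF that] kr.\<pi>.m by simp
  show "sigma_finite_measure \<mu>" using prob_space_cube_measure[of "{1..d}"] by (rule prob_space_imp_sigma_finite)
  show "f\<^sub>\<pi> \<in> borel_measurable \<mu>" by (rule kr.\<pi>.meas)
  show "0 \<le> f\<^sub>\<pi> x" if "x \<in> space \<mu>" for x using p that by (simp add: space_cube_measure)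
  show "\<pi> = \<pi>" ..
  show "prob_space \<pi>" by (rule kr.\<pi>.prob_space_density)
  show "prob_space (distr \<rho> \<mu> S.vec_map)"
    by (rule prob_space.prob_space_distr[OF kr.\<rho>.prob_space_density]) (use S.measurable_map in simp)
  show "sets (distr \<rho> \<mu> S.vec_map) = sets \<mu>" by simp
  show "0 \<le> comparison_error" by (rule comparison_error_nonneg)
  have "0 < ratio_min ^ Suc d" "ratio_min ^ Suc d \<le> 1"
    using ratio_min by (auto intro!: zero_less_power power_le_one simp del: power_Suc)
  then show "0 < max (ratio_min ^ Suc d) (1 - comparison_error)"
    "1 - comparison_error \<le> max (ratio_min ^ Suc d) (1 - comparison_error)"
    "max (ratio_min ^ Suc d) (1 - comparison_error) \<le> 1 + comparison_error"
    using comparison_error_nonneg by (auto simp: less_max_iff_disj simp del: power_Suc)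
  have c: "0 \<le> 1 + comparison_error" "0 \<le> max (ratio_min ^ Suc d) (1 - comparison_error)"
    using comparison_error_nonneg \<open>0 < ratio_min ^ Suc d\<close> by (auto simp: le_max_iff_disj simp del: power_Suc)
  fix A assume A: "A \<in> sets \<mu>"
  show "emeasure (distr \<rho> \<mu> S.vec_map) A \<le> ennreal (1 + comparison_error) * emeasure \<pi> A"
    by (rule S.pushforward_le(1)[OF kr.\<rho>.meas kr.\<pi>.meas A c(1)]) (erule p density_ratio(1))+
  show "ennreal (max (ratio_min ^ Suc d) (1 - comparison_error)) * emeasure \<pi> A \<le> emeasure (distr \<rho> \<mu> S.vec_map) A"
    by (rule S.pushforward_le(2)[OF kr.\<rho>.meas kr.\<pi>.meas A c(2)]) (erule p density_ratio(2))+
qed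

end

section \<open>Main result\<close>

context transport_approximation
begin

lemma S_estimates:
  assumes F: "\<And>x. x \<in> cube d \<Longrightarrow> F x = S.vec_map x" and p: "1 \<le> p"
    and K': "\<forall>F f (B::real). hol_on_box {1..d} (\<lambda>_. complex_nbhd \<eta> complex_interval) F \<longrightarrow>
      (\<forall>z\<in>Pi {1..d} (\<lambda>_. complex_nbhd \<eta> complex_interval). cmod (F z) \<le> B) \<longrightarrow>
      (\<forall>x\<in>cube d. f x = Re (F (real_point x))) \<longrightarrow> sobolev_norm d m f \<le> ereal (K' * B)"
    and B: "real d * (K' * (flow_error * \<epsilon>)) \<le> B" "real d * flow_error * \<epsilon> \<le> B" "comparison_error \<le> B"
  shows "sobolev_norm_vec d m (\<lambda>x k. kr_comp d f\<^sub>\<rho> f\<^sub>\<pi> k x - F x k) \<le> ereal B"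
    and "absolutely_continuous \<mu> (distr \<rho> \<mu> F)" and "hellinger \<mu> (distr \<rho> \<mu> F) \<pi> \<le> B"
    and "total_variation (distr \<rho> \<mu> F) \<pi> \<le> B" and "kl_div (distr \<rho> \<mu> F) \<pi> \<le> ereal B"
    and "wasserstein d p (distr \<rho> \<mu> F) \<pi> \<le> B"
proof -
  have "sobolev_norm d m (\<lambda>x. kr_comp d f\<^sub>\<rho> f\<^sub>\<pi> k x - F x k) \<le> ereal (K' * (flow_error * \<epsilon>))" if k: "k \<in> {1..d}" for k
    by (rule sobolev_component_le[OF K' k]) (use k in \<open>simp add: F S.vec_map_def\<close>)
  then have "sobolev_norm_vec d m (\<lambda>x k. kr_comp d f\<^sub>\<rho> f\<^sub>\<pi> k x - F x k) \<le> (\<Sum>k=1..d. ereal (K' * (flow_error * \<epsilon>)))"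
    unfolding sobolev_norm_vec_def by (rule sum_mono)
  also have "\<dots> = ereal (real d * (K' * (flow_error * \<epsilon>)))" by simp
  also have "\<dots> \<le> ereal B" using B(1) by simp
  finally show "sobolev_norm_vec d m (\<lambda>x k. kr_comp d f\<^sub>\<rho> f\<^sub>\<pi> k x - F x k) \<le> ereal B" .
  interpret cmp: density_comparison \<mu> f\<^sub>\<pi> \<pi> "distr \<rho> \<mu> S.vec_map" comparison_error
    "max (ratio_min ^ Suc d) (1 - comparison_error)" by (rule comparison)
  have e: "distr \<rho> \<mu> F = distr \<rho> \<mu> S.vec_map" by (rule S.distr_representative) (rule F)
  show "absolutely_continuous \<mu> (distr \<rho> \<mu> F)" unfolding e by (rule cmp.ac_base)
  show "hellinger \<mu> (distr \<rho> \<mu> F) \<pi> \<le> B" unfolding e using cmp.hellinger_le B(3) by linarith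
  show "total_variation (distr \<rho> \<mu> F) \<pi> \<le> B" unfolding e using cmp.total_variation_le B(3) by linarith
  have "ereal comparison_error \<le> ereal B" using B(3) by simp
  then show "kl_div (distr \<rho> \<mu> F) \<pi> \<le> ereal B" unfolding e using cmp.kl_div_le by (rule order.trans[rotated])
  show "wasserstein d p (distr \<rho> \<mu> F) \<pi> \<le> B" unfolding e using wasserstein_bound[OF p] B(2) by linarith
qed

end

text \<open>Makes the choices for the single components uniform: the smallest radius and lower
  bound, the sum of the error constants, the larger Lipschitz constant. All of them precede
  \<epsilon>; only the polynomial coefficients depend on it.\<close>

theorem transport_approximation_exists:
  assumes d: "1 \<le> d" and M: "0 < M"
    and \<delta>: "\<forall>j\<in>{1..d}. 0 < \<delta> j"
    and reg: "regularity_constants M L C6 C7 C8"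
    and A: "assumption_A d M L \<delta> C6 f\<^sub>\<rho>" "assumption_A d M L \<delta> C6 f\<^sub>\<pi>"
    and \<xi>: "\<forall>j. \<xi> j = 1 + C7 * \<delta> j"
  shows "\<exists>\<eta> R K c0 \<Lambda>. 0 < \<eta> \<and> 0 \<le> K \<and> 0 < c0 \<and> 0 \<le> \<Lambda> \<and> (\<forall>\<epsilon>\<in>{0<..<1}. \<exists>c.
    transport_approximation d \<eta> R (\<lambda>k z. (shifted_poly k (index_set \<xi> k \<epsilon>) (c k) z)\<^sup>2) C8 K c0 \<epsilon> f\<^sub>\<rho> f\<^sub>\<pi> M L \<Lambda>)"
proof -
  let ?B = "\<lambda>\<eta> k::nat. Pi {1..k} (\<lambda>_. complex_nbhd \<eta> complex_interval)"
  let ?q = "\<lambda>k \<epsilon>. shifted_poly k (index_set \<xi> k \<epsilon>)"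
  define \<zeta> where "\<zeta> = (\<lambda>j. C7 * \<delta> j)"
  have C: "0 < C7" "0 < C8" using reg by (auto simp: regularity_constants_def)
  have \<zeta>0: "0 < \<zeta> j" if "j \<in> {1..d}" for j using \<delta> that C by (simp add: \<zeta>_def)
  note reg' = reg[unfolded regularity_constants_def Let_def, THEN conjunct2, THEN conjunct2, THEN conjunct2,
      THEN spec, THEN spec, THEN spec, THEN spec, THEN mp, THEN mp, THEN mp, THEN mp, OF d \<delta> A]
  \<comment> \<open>Packing all properties into one predicate lets a single use of choice over
    \<open>k\<close> produce all witnesses.\<close>
  define \<Phi> where "\<Phi> k R \<eta>1 \<eta>2 K c0 \<longleftrightarrow>
      (\<forall>z z'. (\<forall>i\<in>{1..k}. z i = z' i) \<longrightarrow> R z = R z') \<and>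
      (\<forall>x\<in>cube k. Im (R (real_point x)) = 0 \<and>
        ((\<lambda>t. kr_comp d f\<^sub>\<rho> f\<^sub>\<pi> k (x(k := t))) has_real_derivative Re (R (real_point x))) (at (x k) within {-1..1})) \<and>
      0 < \<eta>1 \<and> (\<forall>\<eta>. 0 < \<eta> \<longrightarrow> \<eta> \<le> \<eta>1 \<longrightarrow> hol_on_box {1..k} (\<lambda>_. complex_nbhd \<eta> complex_interval) R \<and>
         (\<forall>z\<in>?B \<eta> k. 1 / C8 \<le> Re (R z) \<and> cmod (R z) \<le> 1 + C8)) \<and>
      0 < \<eta>2 \<and> 0 \<le> K \<and> 0 < c0 \<and> (\<forall>\<eta>. 0 < \<eta> \<longrightarrow> \<eta> \<le> \<eta>2 \<longrightarrow> (\<forall>\<epsilon>\<in>{0<..<1}. \<exists>c.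
         (\<forall>z\<in>?B \<eta> k. cmod (R z - (?q k \<epsilon> c z)\<^sup>2) \<le> K * \<epsilon> \<and>
            c0 \<le> cmod (box_antideriv k (\<lambda>z. (?q k \<epsilon> c z)\<^sup>2) (z(k := 1)))) \<and>
         (\<forall>x\<in>{1..k} \<rightarrow> {-1..1}. c0 \<le> Re ((?q k \<epsilon> c (real_point x))\<^sup>2))))"
    for k :: nat and R :: "(nat \<Rightarrow> complex) \<Rightarrow> complex" and \<eta>1 \<eta>2 K c0 :: real
  have "\<exists>R \<eta>1 \<eta>2 K c0. \<Phi> k R \<eta>1 \<eta>2 K c0" if k: "k \<in> {1..d}" for k
  proof -
    from bspec[OF reg'[folded \<zeta>_def] k]
    obtain r where r0: "multi_holomorphic_on k r (poly_nbhd k \<zeta> complex_interval)"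
        "\<forall>x\<in>cube k. \<exists>D. ((\<lambda>t. kr_comp d f\<^sub>\<rho> f\<^sub>\<pi> k (x(k := t))) has_real_derivative D) (at (x k) within {-1..1}) \<and>
          r (complexify k x) = complex_of_real D"
        "r ` poly_nbhd k \<zeta> complex_interval \<subseteq> complex_nbhd C8 {1}"
        "\<forall>z\<in>poly_nbhd k \<zeta> complex_interval. 1 / C8 \<le> Re (r z)"
      by (elim exE conjE) (rule that)
    note r = r0(1) bspec[OF r0(2)] r0(3) bspec[OF r0(4)]
    have "\<exists>R. (\<forall>z z'. (\<forall>i\<in>{1..k}. z i = z' i) \<longrightarrow> R z = R z') \<and>
      (\<forall>x\<in>{1..k} \<rightarrow> {-1..1}. R (real_point x) = r (complexify k x)) \<and>
      (\<exists>\<eta>0>0. \<forall>\<eta>. 0 < \<eta> \<longrightarrow> \<eta> \<le> \<eta>0 \<longrightarrow>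
         hol_on_box {1..k} (\<lambda>_. complex_nbhd \<eta> complex_interval) R \<and>
         (\<forall>z\<in>?B \<eta> k. 1 / C8 \<le> Re (R z) \<and> cmod (R z) \<le> 1 + C8)) \<and>
      (\<exists>\<eta>0>0. \<exists>K\<ge>0. \<exists>c0>0. \<forall>\<eta>. 0 < \<eta> \<longrightarrow> \<eta> \<le> \<eta>0 \<longrightarrow> (\<forall>\<epsilon>\<in>{0<..<1}. \<exists>c.
         (\<forall>z\<in>?B \<eta> k.
            cmod (R z - (?q k \<epsilon> c z)\<^sup>2) \<le> K * \<epsilon> \<and>
            c0 \<le> cmod (box_antideriv k (\<lambda>z. (?q k \<epsilon> c z)\<^sup>2) (z(k := 1)))) \<and>
         (\<forall>x\<in>{1..k} \<rightarrow> {-1..1}. c0 \<le> Re ((?q k \<epsilon> c (real_point x))\<^sup>2))))"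
    proof (rule component_approximation)
      show "1 \<le> k" using k by simp
      show "0 < \<zeta> j" if "j \<in> {1..k}" for j by (rule \<zeta>0) (use that k in auto)
      show "\<xi> j = 1 + \<zeta> j" for j using \<xi> by (simp add: \<zeta>_def)
      show "Im (r (complexify k x)) = 0" if "x \<in> cube k" for x using r(2)[OF that] by auto
    qed (fact r C)+
    then obtain R \<eta>1 \<eta>2 K c0 where R: "\<forall>z z'. (\<forall>i\<in>{1..k}. z i = z' i) \<longrightarrow> R z = R z'"
      "\<forall>x\<in>{1..k} \<rightarrow> {-1..1}. R (real_point x) = r (complexify k x)"
      "0 < \<eta>1" "\<forall>\<eta>. 0 < \<eta> \<longrightarrow> \<eta> \<le> \<eta>1 \<longrightarrow> hol_on_box {1..k} (\<lambda>_. complex_nbhd \<eta> complex_interval) R \<and>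
         (\<forall>z\<in>?B \<eta> k. 1 / C8 \<le> Re (R z) \<and> cmod (R z) \<le> 1 + C8)"
      "0 < \<eta>2" "0 \<le> K" "0 < c0" "\<forall>\<eta>. 0 < \<eta> \<longrightarrow> \<eta> \<le> \<eta>2 \<longrightarrow> (\<forall>\<epsilon>\<in>{0<..<1}. \<exists>c.
         (\<forall>z\<in>?B \<eta> k. cmod (R z - (?q k \<epsilon> c z)\<^sup>2) \<le> K * \<epsilon> \<and>
            c0 \<le> cmod (box_antideriv k (\<lambda>z. (?q k \<epsilon> c z)\<^sup>2) (z(k := 1)))) \<and>
         (\<forall>x\<in>{1..k} \<rightarrow> {-1..1}. c0 \<le> Re ((?q k \<epsilon> c (real_point x))\<^sup>2)))"
      by (elim exE conjE) (rule that)
    have D: "Im (R (real_point x)) = 0 \<and>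
        ((\<lambda>t. kr_comp d f\<^sub>\<rho> f\<^sub>\<pi> k (x(k := t))) has_real_derivative Re (R (real_point x))) (at (x k) within {-1..1})"
      if x: "x \<in> cube k" for x
    proof -
      have "R (real_point x) = r (complexify k x)" using R(2) cube_Pi[OF x order_refl] by blast
      then show ?thesis using r(2)[OF x] by auto
    qed
    have "\<Phi> k R \<eta>1 \<eta>2 K c0" unfolding \<Phi>_def by (intro conjI R ballI D[THEN conjunct1] D[THEN conjunct2])
    then show ?thesis by blast
  qed
  then obtain R \<eta>1 \<eta>2 K c0 where \<Phi>: "\<And>k. k \<in> {1..d} \<Longrightarrow> \<Phi> k (R k) (\<eta>1 k) (\<eta>2 k) (K k) (c0 k)" by metis
  note P = \<Phi>[unfolded \<Phi>_def]
  have dep: "R k z = R k z'" if "k \<in> {1..d}" "\<And>i. i \<in> {1..k} \<Longrightarrow> z i = z' i" for k z z'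
    using P[OF that(1), THEN conjunct1] that(2) by blast
  have Rr: "Im (R k (real_point x)) = 0"
      "((\<lambda>t. kr_comp d f\<^sub>\<rho> f\<^sub>\<pi> k (x(k := t))) has_real_derivative Re (R k (real_point x))) (at (x k) within {-1..1})"
    if "k \<in> {1..d}" "x \<in> cube k" for k x
    using P[OF that(1), THEN conjunct2, THEN conjunct1] that(2) by blast+
  have pos: "0 < \<eta>1 k" "0 < \<eta>2 k" "0 \<le> K k" "0 < c0 k" if "k \<in> {1..d}" for k
    using P[OF that, THEN conjunct2, THEN conjunct2, THEN conjunct1] P[OF that, THEN conjunct2, THEN conjunct2, THEN conjunct2, THEN conjunct2, THEN conjunct1] P[OF that, THEN conjunct2, THEN conjunct2, THEN conjunct2, THEN conjunct2, THEN conjunct2, THEN conjunct1] P[OF that, THEN conjunct2, THEN conjunct2, THEN conjunct2, THEN conjunct2, THEN conjunct2, THEN conjunct2, THEN conjunct1]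
    by blast+
  have R1: "hol_on_box {1..k} (\<lambda>_. complex_nbhd \<eta> complex_interval) (R k)"
      "\<And>z. z \<in> ?B \<eta> k \<Longrightarrow> 1 / C8 \<le> Re (R k z) \<and> cmod (R k z) \<le> 1 + C8"
    if "k \<in> {1..d}" "0 < \<eta>" "\<eta> \<le> \<eta>1 k" for k \<eta>
    using P[OF that(1), THEN conjunct2, THEN conjunct2, THEN conjunct2, THEN conjunct1] that(2,3) by blast+
  have R2: "\<exists>c. (\<forall>z\<in>?B \<eta> k. cmod (R k z - (?q k \<epsilon> c z)\<^sup>2) \<le> K k * \<epsilon> \<and>
            c0 k \<le> cmod (box_antideriv k (\<lambda>z. (?q k \<epsilon> c z)\<^sup>2) (z(k := 1)))) \<and>
         (\<forall>x\<in>{1..k} \<rightarrow> {-1..1}. c0 k \<le> Re ((?q k \<epsilon> c (real_point x))\<^sup>2))"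
    if "k \<in> {1..d}" "0 < \<eta>" "\<eta> \<le> \<eta>2 k" "\<epsilon> \<in> {0<..<1}" for k \<eta> \<epsilon>
    by (rule P[OF that(1), THEN conjunct2, THEN conjunct2, THEN conjunct2, THEN conjunct2, THEN conjunct2, THEN conjunct2, THEN conjunct2, rule_format, OF that(2-4)])
  obtain \<eta> where \<eta>: "0 < \<eta>" "\<And>k. k \<in> {1..d} \<Longrightarrow> \<eta> \<le> min (\<eta>1 k) (\<eta>2 k)"
    using common_radius[of d "\<lambda>k. min (\<eta>1 k) (\<eta>2 k)"] pos by auto
  have \<eta>12: "\<eta> \<le> \<eta>1 k" "\<eta> \<le> \<eta>2 k" if "k \<in> {1..d}" for k using \<eta>(2)[OF that] by auto
  obtain c where c: "0 < c" "\<And>k. k \<in> {1..d} \<Longrightarrow> c \<le> c0 k" using common_radius[of d c0] pos by auto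
  define K' where "K' = (\<Sum>k=1..d. K k)"
  have K': "0 \<le> K'" "K k \<le> K'" if "k \<in> {1..d}" for k
    unfolding K'_def using pos that by (auto intro!: sum_nonneg member_le_sum)
  obtain \<Lambda>1 \<Lambda>2 where \<Lambda>: "0 \<le> \<Lambda>1" "\<And>\<Lambda>. \<Lambda>1 \<le> \<Lambda> \<Longrightarrow> lipschitz_density d f\<^sub>\<rho> M L \<Lambda>"
      "\<And>\<Lambda>. \<Lambda>2 \<le> \<Lambda> \<Longrightarrow> lipschitz_density d f\<^sub>\<pi> M L \<Lambda>"
    using assumption_A_lipschitz_density[OF A(1) M] assumption_A_lipschitz_density[OF A(2) M] \<delta> by blast
  define \<Lambda> where "\<Lambda> = max \<Lambda>1 \<Lambda>2"
  have T: "positive_box_family d \<eta> R"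
  proof (rule positive_box_family.intro)
    show "0 < \<eta>" by (rule \<eta>(1))
    fix k assume k: "k \<in> {1..d}"
    show h: "hol_on_box {1..k} (\<lambda>_. complex_nbhd \<eta> complex_interval) (R k)" by (rule R1(1)[OF k \<eta>(1) \<eta>12(1)[OF k]])
    show "R k z = R k z'" if "\<And>i. i \<in> {1..k} \<Longrightarrow> z i = z' i" for z z' by (rule dep[OF k that])
    show "Im (R k (real_point x)) = 0 \<and> 0 < Re (R k (real_point x))" if x: "x \<in> {1..k} \<rightarrow> {-1..1}" for x
    proof
      have "R k (real_point x) = R k (real_point (restrict x {1..k}))" by (rule dep[OF k]) (simp add: real_point_def)
      moreover have "restrict x {1..k} \<in> cube k" using x by (auto simp: cube_def)
      ultimately show "Im (R k (real_point x)) = 0" using Rr(1)[OF k] by simp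
      have "0 < 1 / C8" using C by simp
      then show "0 < Re (R k (real_point x))"
        using R1(2)[OF k \<eta>(1) \<eta>12(1)[OF k] real_point_in_box[OF x \<eta>(1)]] by linarith
    qed
    show "box_antideriv k (R k) (z(k := 1)) \<noteq> 0" if z: "z \<in> ?B \<eta> k" for z
    proof
      assume e: "box_antideriv k (R k) (z(k := 1)) = 0"
      have "2 * (1 / C8) \<le> Re (box_antideriv k (R k) (z(k := 1)))"
      proof (rule Re_box_antideriv_one_ge[OF hol_on_box_cont[OF h] _ convex_complex_nbhd[OF convex_complex_interval]
            one_in_complex_nbhd(2,1)[OF \<eta>(1)] _ z])
        show "1 / C8 \<le> Re (R k z)" if "z \<in> ?B \<eta> k" for z using R1(2)[OF k \<eta>(1) \<eta>12(1)[OF k] that] by blast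
      qed (use k in simp)
      then show False using e C by (simp add: field_simps)
    qed
  qed
  have kr: "kr_family d f\<^sub>\<rho> f\<^sub>\<pi> M L \<Lambda> \<eta> R"
  proof (intro kr_family.intro kr_pair.intro kr_family_axioms.intro T)
    show "lipschitz_density d f\<^sub>\<rho> M L \<Lambda>" "lipschitz_density d f\<^sub>\<pi> M L \<Lambda>"
      by (rule \<Lambda>(2), simp add: \<Lambda>_def) (rule \<Lambda>(3), simp add: \<Lambda>_def)
  qed (rule Rr(2))
  have "\<exists>a. transport_approximation d \<eta> R (\<lambda>k z. (?q k \<epsilon> (a k) z)\<^sup>2) C8 K' c \<epsilon> f\<^sub>\<rho> f\<^sub>\<pi> M L \<Lambda>"
    if \<epsilon>: "\<epsilon> \<in> {0<..<1}" for \<epsilon>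
  proof -
    have "\<forall>k\<in>{1..d}. \<exists>c. (\<forall>z\<in>?B \<eta> k. cmod (R k z - (?q k \<epsilon> c z)\<^sup>2) \<le> K k * \<epsilon> \<and>
            c0 k \<le> cmod (box_antideriv k (\<lambda>z. (?q k \<epsilon> c z)\<^sup>2) (z(k := 1)))) \<and>
         (\<forall>x\<in>{1..k} \<rightarrow> {-1..1}. c0 k \<le> Re ((?q k \<epsilon> c (real_point x))\<^sup>2))"
      by (intro ballI R2[OF _ \<eta>(1) \<eta>12(2) \<epsilon>])
    from bchoice[OF this] obtain a where a: "\<forall>k\<in>{1..d}. (\<forall>z\<in>?B \<eta> k. cmod (R k z - (?q k \<epsilon> (a k) z)\<^sup>2) \<le> K k * \<epsilon> \<and>
            c0 k \<le> cmod (box_antideriv k (\<lambda>z. (?q k \<epsilon> (a k) z)\<^sup>2) (z(k := 1)))) \<and>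
         (\<forall>x\<in>{1..k} \<rightarrow> {-1..1}. c0 k \<le> Re ((?q k \<epsilon> (a k) (real_point x))\<^sup>2))" ..
    have a1: "cmod (R k z - (?q k \<epsilon> (a k) z)\<^sup>2) \<le> K' * \<epsilon>" 
      and a2: "c \<le> cmod (box_antideriv k (\<lambda>z. (?q k \<epsilon> (a k) z)\<^sup>2) (z(k := 1)))"
      if k: "k \<in> {1..d}" and z: "z \<in> ?B \<eta> k" for k z
    proof -
      have b: "cmod (R k z - (?q k \<epsilon> (a k) z)\<^sup>2) \<le> K k * \<epsilon>"
        "c0 k \<le> cmod (box_antideriv k (\<lambda>z. (?q k \<epsilon> (a k) z)\<^sup>2) (z(k := 1)))" using a k z by blast+
      have "K k * \<epsilon> \<le> K' * \<epsilon>" using K'(2)[OF k] \<epsilon> by (intro mult_right_mono) auto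
      then show "cmod (R k z - (?q k \<epsilon> (a k) z)\<^sup>2) \<le> K' * \<epsilon>" using b(1) by linarith
      show "c \<le> cmod (box_antideriv k (\<lambda>z. (?q k \<epsilon> (a k) z)\<^sup>2) (z(k := 1)))" using b(2) c(2)[OF k] by linarith
    qed
    have a3: "c \<le> Re ((?q k \<epsilon> (a k) (real_point x))\<^sup>2)" if k: "k \<in> {1..d}" and x: "x \<in> {1..k} \<rightarrow> {-1..1}" for k x
    proof -
      have "c0 k \<le> Re ((?q k \<epsilon> (a k) (real_point x))\<^sup>2)" using a k x by blast
      then show ?thesis using c(2)[OF k] by linarith
    qed
    have "positive_box_family d \<eta> (\<lambda>k z. (?q k \<epsilon> (a k) z)\<^sup>2)"
    proof (rule positive_box_family.intro)
      show "0 < \<eta>" by (rule \<eta>(1))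
      fix k assume k: "k \<in> {1..d}"
      show "hol_on_box {1..k} (\<lambda>_. complex_nbhd \<eta> complex_interval) (\<lambda>z. (?q k \<epsilon> (a k) z)\<^sup>2)"
        by (intro hol_on_box_power hol_shifted_poly)
      show "(?q k \<epsilon> (a k) z)\<^sup>2 = (?q k \<epsilon> (a k) z')\<^sup>2" if e: "\<And>i. i \<in> {1..k} \<Longrightarrow> z i = z' i" for z z'
      proof -
        have "(\<lambda>\<nu>. \<Prod>j=1..k. z j ^ \<nu> j) = (\<lambda>\<nu>. \<Prod>j=1..k. z' j ^ \<nu> j)"
        proof (intro ext prod.cong refl)
          show "z j ^ \<nu> j = z' j ^ \<nu> j" if "j \<in> {1..k}" for \<nu> j
            by (rule arg_cong[OF e[OF that]])
        qed
        from arg_cong[OF this, of "\<lambda>g. (1 + (\<Sum>\<nu>\<in>index_set \<xi> k \<epsilon>. complex_of_real (a k \<nu>) * g \<nu>))\<^sup>2"]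
        show ?thesis unfolding shifted_poly_def .
      qed
      show "Im ((?q k \<epsilon> (a k) (real_point x))\<^sup>2) = 0 \<and> 0 < Re ((?q k \<epsilon> (a k) (real_point x))\<^sup>2)"
        if x: "x \<in> {1..k} \<rightarrow> {-1..1}" for x
      proof
        show "Im ((?q k \<epsilon> (a k) (real_point x))\<^sup>2) = 0"
          unfolding shifted_poly_real of_real_power[symmetric] by (rule Im_complex_of_real)
        show "0 < Re ((?q k \<epsilon> (a k) (real_point x))\<^sup>2)" using a3[OF k x] c(1) by linarith
      qed
      show "box_antideriv k (\<lambda>z. (?q k \<epsilon> (a k) z)\<^sup>2) (z(k := 1)) \<noteq> 0" if z: "z \<in> ?B \<eta> k" for z
        using a2[OF k z] c(1) by auto
    qed
    moreover have "approximation_pair_axioms d \<eta> R (\<lambda>k z. (?q k \<epsilon> (a k) z)\<^sup>2) C8 K' c \<epsilon>"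
    proof (rule approximation_pair_axioms.intro)
      show "0 \<le> K'" using K'(1)[of 1] d by simp
    qed (use C c(1) \<epsilon> a1 a2 a3 R1(2)[OF _ \<eta>(1) \<eta>12(1)] in auto)
    ultimately show ?thesis using T kr
      by (intro exI[of _ a] transport_approximation.intro approximation_pair.intro)
  qed
  moreover have "0 \<le> K'" using K'(1)[of 1] d by simp
  moreover have "0 \<le> \<Lambda>" using \<Lambda>(1) by (simp add: \<Lambda>_def)
  ultimately show ?thesis using \<eta>(1) c(1) by (intro exI[of _ \<eta>] exI[of _ R] exI[of _ K'] exI[of _ c] exI[of _ \<Lambda>]) auto
qed

theorem proposition6p4:
  fixes d m :: nat and p M L C6 C7 C8 :: real and \<delta> :: "nat \<Rightarrow> real"
    and \<rho> \<pi> :: "(nat \<Rightarrow> real) measure" and f\<^sub>\<rho> f\<^sub>\<pi> :: "(nat \<Rightarrow> real) \<Rightarrow> real"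
    and \<xi> :: "nat \<Rightarrow> real"
  assumes "1 \<le> d" and "1 \<le> p"
    and "0 < M" and "M \<le> L"
    and "\<forall>j\<in>{1..d}. 0 < \<delta> j"
    and "regularity_constants M L C6 C7 C8"
    and "assumption_A d M L \<delta> C6 f\<^sub>\<rho>" and "assumption_A d M L \<delta> C6 f\<^sub>\<pi>"
    and "\<rho> = density (cube_measure {1..d}) (\<lambda>x. ennreal (f\<^sub>\<rho> x))"
    and "\<pi> = density (cube_measure {1..d}) (\<lambda>x. ennreal (f\<^sub>\<pi> x))"
    and "\<forall>j. \<xi> j = 1 + C7 * \<delta> j"
  shows "\<forall>\<beta>'<rate \<xi> d. \<exists>C>0. \<forall>\<epsilon>\<in>{0<..<1}.
    \<exists>P :: nat \<Rightarrow> (nat \<Rightarrow> real) \<Rightarrow> real.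
      (\<forall>k\<in>{1..d}. P k \<in> poly_space k (index_set \<xi> k \<epsilon>)) \<and>
      (let S = approx_map d P;
           N2 = distr \<rho> (cube_measure {1..d}) S;
           bound = C * exp (- \<beta>' * real (index_count \<xi> d \<epsilon>) powr (1 / real d))
       in bij_betw S (cube d) (cube d) \<and> triangular_map d S \<and> monotone_in_last d S \<and>
          sobolev_norm_vec d m (\<lambda>x k. kr_comp d f\<^sub>\<rho> f\<^sub>\<pi> k x - S x k) \<le> ereal bound \<and>
          absolutely_continuous (cube_measure {1..d}) N2 \<and>
          hellinger (cube_measure {1..d}) N2 \<pi> \<le> bound \<and>
          total_variation N2 \<pi> \<le> bound \<and>
          kl_div N2 \<pi> \<le> ereal bound \<and>
          wasserstein d p N2 \<pi> \<le> bound)"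
proof (intro allI impI)
  fix \<beta>' assume \<beta>': "\<beta>' < rate \<xi> d"
  have C: "0 < C7" "0 < C8" using assms(6) by (auto simp: regularity_constants_def)
  have \<xi>1: "1 < \<xi> j" if "j \<in> {1..d}" for j using assms(5,11) that C by simp
  \<comment> \<open>Everything before this is measured in \<epsilon>; \<open>C0\<close> translates
    \<epsilon> into the number of degrees of freedom.\<close>
  obtain C0 where C0: "0 < C0"
    "\<And>\<epsilon>. \<epsilon> \<in> {0<..<1} \<Longrightarrow> \<epsilon> \<le> C0 * exp (- \<beta>' * real (index_count \<xi> d \<epsilon>) powr (1 / real d))"
    using index_count_exp_bound[OF assms(1) \<xi>1 less_imp_le[OF \<beta>']] by blast
  obtain \<eta> R K c0 \<Lambda> where \<eta>: "0 < \<eta>" and K: "0 \<le> K" "0 < c0" "0 \<le> \<Lambda>"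
    and exs: "\<forall>\<epsilon>\<in>{0<..<1}. \<exists>c.
      transport_approximation d \<eta> R (\<lambda>k z. (shifted_poly k (index_set \<xi> k \<epsilon>) (c k) z)\<^sup>2) C8 K c0 \<epsilon> f\<^sub>\<rho> f\<^sub>\<pi> M L \<Lambda>"
    using transport_approximation_exists[OF assms(1,3,5,6,7,8,11)] by (elim exE conjE) (rule that)
  obtain K' where K': "0 \<le> K'"
    "\<forall>F f (B::real). hol_on_box {1..d} (\<lambda>_. complex_nbhd \<eta> complex_interval) F \<longrightarrow>
      (\<forall>z\<in>Pi {1..d} (\<lambda>_. complex_nbhd \<eta> complex_interval). cmod (F z) \<le> B) \<longrightarrow>
      (\<forall>x\<in>cube d. f x = Re (F (real_point x))) \<longrightarrow> sobolev_norm d m f \<le> ereal (K' * B)"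
    using sobolev_norm_box_le[OF \<eta>, of d m] by (elim exE conjE) (rule that)
  define A where "A = flow_const (2 + \<eta>) C8 K c0"
  define E where "E = (1 + ratio_const d \<eta> C8 K c0 M \<Lambda>) ^ Suc d - 1"
  \<comment> \<open>Dominates the Sobolev, Wasserstein and density-ratio constants at once; absolute
    values and the summand 1 make it positive without an argument about signs.\<close>
  define C' where "C' = 1 + \<bar>real d * (K' * A)\<bar> + \<bar>real d * A\<bar> + \<bar>E\<bar>"
  have C': "1 \<le> C'" "real d * (K' * A) \<le> C'" "real d * A \<le> C'" "E \<le> C'" by (auto simp: C'_def)
  show "\<exists>C>0. \<forall>\<epsilon>\<in>{0<..<1}.
    \<exists>P :: nat \<Rightarrow> (nat \<Rightarrow> real) \<Rightarrow> real.
      (\<forall>k\<in>{1..d}. P k \<in> poly_space k (index_set \<xi> k \<epsilon>)) \<and>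
      (let S = approx_map d P;
           N2 = distr \<rho> (cube_measure {1..d}) S;
           bound = C * exp (- \<beta>' * real (index_count \<xi> d \<epsilon>) powr (1 / real d))
       in bij_betw S (cube d) (cube d) \<and> triangular_map d S \<and> monotone_in_last d S \<and>
          sobolev_norm_vec d m (\<lambda>x k. kr_comp d f\<^sub>\<rho> f\<^sub>\<pi> k x - S x k) \<le> ereal bound \<and>
          absolutely_continuous (cube_measure {1..d}) N2 \<and>
          hellinger (cube_measure {1..d}) N2 \<pi> \<le> bound \<and>
          total_variation N2 \<pi> \<le> bound \<and>
          kl_div N2 \<pi> \<le> ereal bound \<and>
          wasserstein d p N2 \<pi> \<le> bound)"
  proof (intro exI[of _ "C' * C0"] conjI ballI)
    show "0 < C' * C0" using C' C0 by simp
    fix \<epsilon> :: real assume \<epsilon>: "\<epsilon> \<in> {0<..<1}"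
    then have \<epsilon>0: "0 < \<epsilon>" by simp
    let ?\<Lambda> = "\<lambda>k. index_set \<xi> k \<epsilon>"
    obtain c where c: "transport_approximation d \<eta> R (\<lambda>k z. (shifted_poly k (?\<Lambda> k) (c k) z)\<^sup>2) C8 K c0 \<epsilon> f\<^sub>\<rho> f\<^sub>\<pi> M L \<Lambda>"
      using bspec[OF exs \<epsilon>] ..
    interpret approx: transport_approximation d \<eta> R "\<lambda>k z. (shifted_poly k (?\<Lambda> k) (c k) z)\<^sup>2" C8 K c0 \<epsilon> f\<^sub>\<rho> f\<^sub>\<pi> M L \<Lambda>
      by (rule c)
    define P where "P = (\<lambda>k x. \<Sum>\<nu>\<in>?\<Lambda> k. c k \<nu> * (\<Prod>j=1..k. x j ^ \<nu> j))"
    define B where "B = C' * C0 * exp (- \<beta>' * real (index_count \<xi> d \<epsilon>) powr (1 / real d))"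
    have P_space: "P k \<in> poly_space k (?\<Lambda> k)" if k: "k \<in> {1..d}" for k
    proof -
      have "finite (?\<Lambda> k)" by (rule finite_index_set[OF \<xi>1 _ \<epsilon>0]) (use k in auto)
      then show ?thesis unfolding poly_space_def P_def by blast
    qed
    have dens: "approx.S.density k x = (1 + P k x)\<^sup>2" for k x
      unfolding approx.S.density_def shifted_poly_real of_real_power[symmetric] Re_complex_of_real P_def ..
    have F: "approx_map d P x = approx.S.vec_map x" if x: "x \<in> cube d" for x
    proof
      fix k
      show "approx_map d P x k = approx.S.vec_map x k"
      proof (cases "k \<in> {1..d}")
        case True
        have "x \<in> {1..k} \<rightarrow> {-1..1}" by (rule cube_Pi[OF x]) (use True in simp)
        from approx.S.tri_eq[OF True this] show ?thesis
          using True unfolding approx_map_def approx.S.vec_map_def approx_comp_def dens by simp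
      next
        case False
        then show ?thesis unfolding approx_map_def approx.S.vec_map_def restrict_def by (simp only: if_False)
      qed
    qed
    have B: "a * \<epsilon> \<le> B" if "a \<le> C'" for a
    proof -
      have "a * \<epsilon> \<le> C' * \<epsilon>" using that \<epsilon>0 by (intro mult_right_mono) auto
      also have "\<dots> \<le> C' * (C0 * exp (- \<beta>' * real (index_count \<xi> d \<epsilon>) powr (1 / real d)))"
        using C0(2)[OF \<epsilon>] C'(1) by (intro mult_left_mono) auto
      finally show ?thesis by (simp only: B_def mult.assoc)
    qed
    have bounds: "real d * (K' * (A * \<epsilon>)) \<le> B" "real d * A * \<epsilon> \<le> B" "\<epsilon> * E \<le> B"
      using B[OF C'(2)] B[OF C'(3)] B[OF C'(4)] by (simp_all add: mult_ac)
    note estimates = approx.S_estimates[OF _ assms(2) K'(2) bounds[unfolded A_def E_def]]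
    show "\<exists>P :: nat \<Rightarrow> (nat \<Rightarrow> real) \<Rightarrow> real.
      (\<forall>k\<in>{1..d}. P k \<in> poly_space k (index_set \<xi> k \<epsilon>)) \<and>
      (let S = approx_map d P;
           N2 = distr \<rho> (cube_measure {1..d}) S;
           bound = C' * C0 * exp (- \<beta>' * real (index_count \<xi> d \<epsilon>) powr (1 / real d))
       in bij_betw S (cube d) (cube d) \<and> triangular_map d S \<and> monotone_in_last d S \<and>
          sobolev_norm_vec d m (\<lambda>x k. kr_comp d f\<^sub>\<rho> f\<^sub>\<pi> k x - S x k) \<le> ereal bound \<and>
          absolutely_continuous (cube_measure {1..d}) N2 \<and>
          hellinger (cube_measure {1..d}) N2 \<pi> \<le> bound \<and>
          total_variation N2 \<pi> \<le> bound \<and>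
          kl_div N2 \<pi> \<le> ereal bound \<and>
          wasserstein d p N2 \<pi> \<le> bound)"
      unfolding B_def[symmetric] Let_def assms(9,10)
    proof (intro exI[of _ P] conjI ballI P_space)
      show "bij_betw (approx_map d P) (cube d) (cube d)" by (rule approx.S.bij_betw_representative) (rule F)
      show "triangular_map d (approx_map d P)" by (rule approx.S.triangular_representative) (rule F)
      show "monotone_in_last d (approx_map d P)" by (rule approx.S.monotone_representative) (rule F)
    qed (assumption | rule estimates F)+
  qed
qed

end
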